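(* Let $\mathcal{A}$ be a toric arrangement of deletion-restriction type in the complex $l$-torus $(\mathbb{C}^* )^l$, with complement $M(\mathcal{A})$. Then the graded algebras $R(\mathcal{A})$ and $H^*(M(\mathcal{A}))$ are isomorphic.
   Context: A character of $(\mathbb{C}^* )^l$ is a homomorphism $\chi \colon (\mathbb{C}^* )^l \to \mathbb{C}^*$ given by a Laurent monomial $\chi(z_1,\dots,z_l) = z_1^{n_1}\cdots z_l^{n_l}$ with integer exponents. A toric arrangement in $(\mathbb{C}^* )^l$ is a finite collection $\mathcal{A} = \{K_1,\dots,K_n\}$ of toric hypersurfaces $K_i = \{z \in (\mathbb{C}^* )^l \mid \chi_i(z) = c_i\}$, where each $\chi_i$ is a character and $c_i \in \mathbb{C}^*$. Standing assumption: each $K_i$ is connected, i.e. each $\chi_i$ is primitive (its exponents are relatively prime). The complement is $M(\mathcal{A}) = (\mathbb{C}^* )^l \setminus \bigcup_{i=1}^n K_i$. $H^*(-)$ denotes de Rham cohomology with complex coefficients. Given an ordering $K_1,\dots,K_n$ of the hypersurfaces, put $M_i = (\mathbb{C}^* )^l \setminus (K_1\cup\cdots\cup K_i)$ for $0\le i\le n$ (so $M_0 = (\mathbb{C}^* )^l$). The arrangement $\mathcal{A}$ is of deletion-restriction type if there is an ordering of its hypersurfaces such that for every $1\le i\le n$ the map $j^*\colon H^*(M_{i-1}) \to H^*(M_{i-1}\cap K_i)$ induced by inclusion is surjective. The variety $M(\mathcal{A})$ is affine, with coordinate ring $S(\mathcal{A}) = \mathbb{C}[z_1^{\pm1},\dots,z_l^{\pm1}]\left[\frac{1}{\prod_{i=1}^n(\chi_i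 - c_i)}\right]$. Let $\Omega^\bullet$ be its algebraic de Rham complex, with $\Omega^p = \bigoplus_{1\le i_1<\cdots<i_p\le l} S(\mathcal{A})\, \frac{dz_{i_1}}{z_{i_1}}\wedge\cdots\wedge\frac{dz_{i_p}}{z_{i_p}}$. Put $\xi_i = d\log z_i = dz_i/z_i$ for $1\le i\le l$ and $\psi_j = d\log(\chi_j - c_j) = d\chi_j/(\chi_j - c_j)$ for $1\le j\le n$. Then $R(\mathcal{A})$ is the $\mathbb{C}$-subalgebra of $\Omega^\bullet$ generated by $1$ and the $1$-forms $\xi_1,\dots,\xi_l,\psi_1,\dots,\psi_n$, graded by $R_k(\mathcal{A}) = R(\mathcal{A})\cap\Omega^k$. *)

theory Defs
  imports "HOL-Analysis.Analysis" "HOL-Algebra.Module" "HOL-Algebra.QuotRing"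
begin

section \<open>Graded algebras over the complex numbers\<close>

record 'a graded_algebra = "(complex, 'a) module" +
  homog :: "nat \<Rightarrow> 'a set"

definition graded_algebra_isomorphic ::
    "('a, 'm) graded_algebra_scheme \<Rightarrow> ('b, 'n) graded_algebra_scheme \<Rightarrow> bool" where
  "graded_algebra_isomorphic R S \<longleftrightarrow>
     (\<exists>\<phi>\<in>ring_iso R S.
        (\<forall>c. \<forall>x\<in>carrier R. \<phi> (c \<odot>\<^bsub>R\<^esub> x) = c \<odot>\<^bsub>S\<^esub> \<phi> x) \<and>
        (\<forall>k. \<phi> ` homog R k = homog S k))"

text \<open>The unital subalgebra generated by a set of elements (zero and negatives are obtained
  from scalar multiplication).\<close>

inductive_set generated_subalgebra :: "('a, 'm) graded_algebra_scheme \<Rightarrow> 'a set \<Rightarrow> 'a set"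
  for R and G where
  one: "\<one>\<^bsub>R\<^esub> \<in> generated_subalgebra R G"
| gen: "x \<in> G \<Longrightarrow> x \<in> generated_subalgebra R G"
| add: "x \<in> generated_subalgebra R G \<Longrightarrow> y \<in> generated_subalgebra R G
    \<Longrightarrow> x \<oplus>\<^bsub>R\<^esub> y \<in> generated_subalgebra R G"
| mult: "x \<in> generated_subalgebra R G \<Longrightarrow> y \<in> generated_subalgebra R G
    \<Longrightarrow> x \<otimes>\<^bsub>R\<^esub> y \<in> generated_subalgebra R G"
| smult: "x \<in> generated_subalgebra R G \<Longrightarrow> c \<odot>\<^bsub>R\<^esub> x \<in> generated_subalgebra R G"


section \<open>Smooth maps and tangent spaces\<close>

text \<open>Both notions of smoothness are meant for open sets.\<close>

primrec Ck_on :: "nat \<Rightarrow> 'a::real_normed_vector set \<Rightarrow> ('a \<Rightarrow> 'b::real_normed_vector) \<Rightarrow> bool" where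
  "Ck_on 0 U f \<longleftrightarrow> continuous_on U f"
| "Ck_on (Suc k) U f \<longleftrightarrow> (\<forall>x\<in>U. f differentiable at x) \<and>
     (\<forall>v. Ck_on k U (\<lambda>x. frechet_derivative f (at x) v))"

definition smooth_on :: "'a::real_normed_vector set \<Rightarrow> ('a \<Rightarrow> 'b::real_normed_vector) \<Rightarrow> bool" where
  "smooth_on U f \<longleftrightarrow> (\<forall>k. Ck_on k U f)"

text \<open>Throughout, \<open>X\<close> is meant to be an embedded submanifold of a Euclidean space (for instance
  an open subset). Its tangent space at \<open>p\<close> consists of the velocities of smooth curves in \<open>X\<close>.\<close>

definition tangent_space :: "'a::euclidean_space set \<Rightarrow> 'a \<Rightarrow> 'a set" where
  "tangent_space X p = {v. \<exists>\<epsilon>>0. \<exists>\<gamma>. smooth_on {-\<epsilon><..<\<epsilon>} \<gamma> \<and> \<gamma> ` {-\<epsilon><..<\<epsilon>} \<subseteq> X \<and> \<gamma> 0 = p \<and>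
     (\<gamma> has_vector_derivative v) (at (0::real))}"


section \<open>Complex-valued differential forms\<close>

text \<open>A form \<open>\<omega>\<close>, possibly of mixed degree, is represented by its values \<open>\<omega> p vs\<close> on lists of
  tangent vectors at \<open>p\<close>; the component of degree \<open>k\<close> is its restriction to lists of length \<open>k\<close>.
  Forms on \<open>X\<close> are normalised to vanish away from \<open>X\<close> and on lists that are not tangent to \<open>X\<close>.\<close>

type_synonym 'a form = "'a \<Rightarrow> 'a list \<Rightarrow> complex"

definition alternating_multilinear :: "'a::real_vector set \<Rightarrow> ('a list \<Rightarrow> complex) \<Rightarrow> bool" where
  "alternating_multilinear T \<alpha> \<longleftrightarrow>
     (\<forall>us ws v w a b. set us \<subseteq> T \<and> set ws \<subseteq> T \<and> v \<in> T \<and> w \<in> T \<longrightarrow>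
        \<alpha> (us @ (a *\<^sub>R v + b *\<^sub>R w) # ws) = a *\<^sub>R \<alpha> (us @ v # ws) + b *\<^sub>R \<alpha> (us @ w # ws)) \<and>
     (\<forall>vs. set vs \<subseteq> T \<and> \<not> distinct vs \<longrightarrow> \<alpha> vs = 0)"

definition homogeneous :: "nat \<Rightarrow> 'a form \<Rightarrow> bool" where
  "homogeneous k \<omega> \<longleftrightarrow> (\<forall>p vs. length vs \<noteq> k \<longrightarrow> \<omega> p vs = 0)"

definition component :: "nat \<Rightarrow> 'a form \<Rightarrow> 'a form" where
  "component k \<omega> = (\<lambda>p vs. if length vs = k then \<omega> p vs else 0)"

definition restrict_form :: "'a::euclidean_space set \<Rightarrow> 'a form \<Rightarrow> 'a form" where
  "restrict_form X \<omega> = (\<lambda>p vs. if p \<in> X \<and> set vs \<subseteq> tangent_space X p then \<omega> p vs else 0)"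

definition function_form :: "('a \<Rightarrow> complex) \<Rightarrow> 'a form" where
  "function_form f = (\<lambda>p vs. if vs = [] then f p else 0)"

text \<open>The wedge product, as a sum over shuffles: \<open>I\<close> is the set of positions whose vectors are
  fed to \<open>\<alpha>\<close>, and the sign is that of the corresponding shuffle. In this normalisation
  \<open>(\<alpha> \<and> \<beta>)(u,v) = \<alpha>(u)\<beta>(v) - \<alpha>(v)\<beta>(u)\<close> for 1-forms.\<close>

definition wedge :: "'a form \<Rightarrow> 'a form \<Rightarrow> 'a form" where
  "wedge \<alpha> \<beta> = (\<lambda>p vs. \<Sum>I\<in>Pow {..<length vs}.
     (-1) ^ card {(i, j). i \<in> I \<and> j \<in> {..<length vs} - I \<and> j < i} *
     \<alpha> p (nths vs I) * \<beta> p (nths vs (- I)))"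

text \<open>Forms defined on an open subset \<open>U\<close> of the ambient space (values off \<open>U\<close> are ignored), and
  their exterior derivative, computed with constant vector fields.\<close>

definition ambient_form :: "'a::euclidean_space set \<Rightarrow> 'a form \<Rightarrow> bool" where
  "ambient_form U \<eta> \<longleftrightarrow>
     (\<forall>q\<in>U. alternating_multilinear UNIV (\<eta> q)) \<and> (\<forall>vs. smooth_on U (\<lambda>q. \<eta> q vs))"

definition ambient_deriv :: "'a::euclidean_space form \<Rightarrow> 'a form" where
  "ambient_deriv \<eta> = (\<lambda>p vs. \<Sum>i<length vs. (-1) ^ i *
     frechet_derivative (\<lambda>q. \<eta> q (take i vs @ drop (Suc i) vs)) (at p) (vs ! i))"

text \<open>A smooth form on a submanifold is one that is locally the restriction of a smooth form on an
  open subset of the ambient space; its exterior derivative is the restriction of the exterior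
  derivative of any such local extension.\<close>

definition local_extension ::
    "'a::euclidean_space set \<Rightarrow> 'a form \<Rightarrow> 'a set \<Rightarrow> 'a form \<Rightarrow> bool" where
  "local_extension X \<omega> U \<eta> \<longleftrightarrow> open U \<and> ambient_form U \<eta> \<and>
     (\<forall>q\<in>X \<inter> U. \<forall>vs. set vs \<subseteq> tangent_space X q \<longrightarrow> \<omega> q vs = \<eta> q vs)"

definition smooth_forms :: "'a::euclidean_space set \<Rightarrow> 'a form set" where
  "smooth_forms X = {\<omega>. restrict_form X \<omega> = \<omega> \<and>
     (\<forall>p\<in>X. alternating_multilinear (tangent_space X p) (\<omega> p)) \<and>
     (\<forall>p\<in>X. \<exists>U \<eta>. p \<in> U \<and> local_extension X \<omega> U \<eta>)}"

definition exterior_deriv :: "'a::euclidean_space set \<Rightarrow> 'a form \<Rightarrow> 'a form" where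
  "exterior_deriv X \<omega> = restrict_form X
     (\<lambda>p vs. THE y. \<exists>U \<eta>. p \<in> U \<and> local_extension X \<omega> U \<eta> \<and> y = ambient_deriv \<eta> p vs)"

text \<open>The algebra operations on a set \<open>C\<close> of forms on \<open>X\<close>.\<close>

definition form_algebra :: "'a::euclidean_space set \<Rightarrow> 'a form set \<Rightarrow> 'a form graded_algebra" where
  "form_algebra X C =
     \<lparr>carrier = C, mult = wedge, one = restrict_form X (function_form (\<lambda>_. 1)),
      zero = (\<lambda>_ _. 0), add = (\<lambda>\<alpha> \<beta> p vs. \<alpha> p vs + \<beta> p vs),
      smult = (\<lambda>c \<alpha> p vs. c * \<alpha> p vs), homog = (\<lambda>k. {\<omega>\<in>C. homogeneous k \<omega>})\<rparr>"


section \<open>De Rham cohomology with complex coefficients\<close>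

definition closed_forms :: "'a::euclidean_space set \<Rightarrow> 'a form set" where
  "closed_forms X = {\<omega>\<in>smooth_forms X. exterior_deriv X \<omega> = (\<lambda>_ _. 0)}"

definition exact_forms :: "'a::euclidean_space set \<Rightarrow> 'a form set" where
  "exact_forms X = exterior_deriv X ` smooth_forms X"

definition deRham_class :: "'a::euclidean_space set \<Rightarrow> 'a form \<Rightarrow> 'a form set" where
  "deRham_class X \<omega> = exact_forms X +>\<^bsub>form_algebra X (closed_forms X)\<^esub> \<omega>"

definition deRham_cohomology :: "'a::euclidean_space set \<Rightarrow> 'a form set graded_algebra" where
  "deRham_cohomology X =
     (let Z = form_algebra X (closed_forms X); H = Z Quot exact_forms X in
      \<lparr>carrier = carrier H, mult = mult H, one = one H, zero = zero H, add = add H,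
       smult = (\<lambda>c C. \<Union>\<omega>\<in>C. deRham_class X (c \<odot>\<^bsub>Z\<^esub> \<omega>)),
       homog = (\<lambda>k. deRham_class X ` homog Z k)\<rparr>)"

text \<open>The map \<open>H\<^sup>*(X) \<rightarrow> H\<^sup>*(Y)\<close> induced by the inclusion of a submanifold \<open>Y\<close> of \<open>X\<close>; it does
  not depend on \<open>X\<close> except through its domain.\<close>

definition inclusion_pullback :: "'a::euclidean_space set \<Rightarrow> 'a form set \<Rightarrow> 'a form set" where
  "inclusion_pullback Y C = (\<Union>\<omega>\<in>C. deRham_class Y (restrict_form Y \<omega>))"


section \<open>Toric arrangements\<close>

definition torus :: "(complex^'l) set" where
  "torus = {z. \<forall>i. z $ i \<noteq> 0}"

text \<open>The character with exponent vector \<open>n\<close>.\<close>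

definition character :: "int^'l \<Rightarrow> complex^'l \<Rightarrow> complex" where
  "character n z = (\<Prod>i\<in>UNIV. z $ i powi n $ i)"

text \<open>A hypersurface is given by the pair of its exponent vector and its value.\<close>

definition hypersurface :: "(int^'l) \<times> complex \<Rightarrow> (complex^'l) set" where
  "hypersurface = (\<lambda>(n, c). {z\<in>torus. character n z = c})"

definition primitive :: "int^'l \<Rightarrow> bool" where
  "primitive n \<longleftrightarrow> Gcd (range (\<lambda>i. n $ i)) = 1"

text \<open>Injectivity says that each hypersurface of the arrangement comes with exactly one chosen
  equation (\<open>(n, c)\<close> and \<open>(-n, 1/c)\<close> define the same hypersurface).\<close>

definition toric_arrangement :: "((int^'l) \<times> complex) set \<Rightarrow> bool" where
  "toric_arrangement \<A> \<longleftrightarrow> finite \<A> \<and> inj_on hypersurface \<A> \<and>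
     (\<forall>(n, c)\<in>\<A>. primitive n \<and> c \<noteq> 0)"

definition complement :: "((int^'l) \<times> complex) set \<Rightarrow> (complex^'l) set" where
  "complement \<A> = torus - (\<Union>K\<in>\<A>. hypersurface K)"

definition deletion_restriction_type :: "((int^'l) \<times> complex) set \<Rightarrow> bool" where
  "deletion_restriction_type \<A> \<longleftrightarrow>
     (\<exists>Ks. distinct Ks \<and> set Ks = \<A> \<and>
       (\<forall>i<length Ks.
         let M = complement (set (take i Ks)); N = M \<inter> hypersurface (Ks ! i) in
         inclusion_pullback N ` carrier (deRham_cohomology M) = carrier (deRham_cohomology N)))"


section \<open>The algebraic de Rham complex and the algebra of logarithmic forms\<close>

text \<open>The logarithmic differential \<open>df / f\<close> on an open set \<open>M\<close>.\<close>

definition dlog :: "'a::euclidean_space set \<Rightarrow> ('a \<Rightarrow> complex) \<Rightarrow> 'a form" where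
  "dlog M f = restrict_form M (\<lambda>p vs. ambient_deriv (function_form f) p vs / f p)"

definition xi :: "((int^'l) \<times> complex) set \<Rightarrow> 'l \<Rightarrow> (complex^'l) form" where
  "xi \<A> i = dlog (complement \<A>) (\<lambda>z. z $ i)"

definition psi :: "((int^'l) \<times> complex) set \<Rightarrow> (int^'l) \<times> complex \<Rightarrow> (complex^'l) form" where
  "psi \<A> = (\<lambda>(n, c). dlog (complement \<A>) (\<lambda>z. character n z - c))"

text \<open>The elements of the coordinate ring of the affine variety \<open>complement \<A>\<close> are identified with
  regular functions on it; only their values on the complement are relevant.\<close>

inductive_set coordinate_ring :: "((int^'l) \<times> complex) set \<Rightarrow> (complex^'l \<Rightarrow> complex) set"
  for \<A> where
  const: "(\<lambda>_. c) \<in> coordinate_ring \<A>"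
| coord: "(\<lambda>z. z $ i) \<in> coordinate_ring \<A>"
| coord_inverse: "(\<lambda>z. inverse (z $ i)) \<in> coordinate_ring \<A>"
| localise: "(\<lambda>z. 1 / (\<Prod>(n, c)\<in>\<A>. character n z - c)) \<in> coordinate_ring \<A>"
| add: "f \<in> coordinate_ring \<A> \<Longrightarrow> g \<in> coordinate_ring \<A> \<Longrightarrow> (\<lambda>z. f z + g z) \<in> coordinate_ring \<A>"
| mult: "f \<in> coordinate_ring \<A> \<Longrightarrow> g \<in> coordinate_ring \<A> \<Longrightarrow> (\<lambda>z. f z * g z) \<in> coordinate_ring \<A>"

text \<open>Algebraic \<open>p\<close>-forms: the coordinate-ring span of the products \<open>dz\<^sub>i/z\<^sub>i \<and> \<dots>\<close> of length
  \<open>p\<close>. All index sequences are allowed, since \<open>'l\<close> carries no order; by antisymmetry this is the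
  span of the products over increasing sequences.\<close>

definition algebraic_forms :: "((int^'l) \<times> complex) set \<Rightarrow> nat \<Rightarrow> (complex^'l) form set" where
  "algebraic_forms \<A> p =
     {\<lambda>z vs. \<Sum>s | length s = p. f s z *
        foldr wedge (map (xi \<A>) s) (restrict_form (complement \<A>) (function_form (\<lambda>_. 1))) z vs
      | f. \<forall>s. f s \<in> coordinate_ring \<A>}"

definition algebraic_deRham_complex ::
    "((int^'l) \<times> complex) set \<Rightarrow> (complex^'l) form graded_algebra" where
  "algebraic_deRham_complex \<A> =
     (form_algebra (complement \<A>) {\<omega>. \<forall>p. component p \<omega> \<in> algebraic_forms \<A> p})
       \<lparr>homog := algebraic_forms \<A>\<rparr>"

definition log_form_algebra ::
    "((int^'l) \<times> complex) set \<Rightarrow> (complex^'l) form graded_algebra" where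
  "log_form_algebra \<A> =
     (let \<Omega> = algebraic_deRham_complex \<A>;
          R = generated_subalgebra \<Omega> (range (xi \<A>) \<union> psi \<A> ` \<A>) in
      \<Omega>\<lparr>carrier := R, homog := (\<lambda>k. R \<inter> homog \<Omega> k)\<rparr>)"

end

theory Submission
  imports Defs
begin

text \<open>Every closed form on the complement is cohomologous to a logarithmic one, by induction on the
  arrangement. When a hypersurface \<open>K = {\<chi> = c}\<close> is added, averaging over the circles around \<open>K\<close> writes a
  closed form on a punctured tube as \<open>\<alpha> + \<psi> \<and> \<beta>\<close> up to exact forms, where \<open>\<psi> = d log (\<chi> - c)\<close> and \<open>\<alpha>\<close>, \<open>\<beta>\<close>
  are closed on the whole tube. The class of \<open>\<beta>\<close> on \<open>K\<close> lifts to the larger complement by the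
  deletion-restriction hypothesis, and after subtracting \<open>\<psi>\<close> times the lift the form extends over \<open>K\<close> up to an
  exact form. The torus itself is treated by averaging over its circles.

  Conversely, an exact logarithmic form vanishes, which is shown by
  eliminating the coordinates one at a time. After an isogeny all \<open>\<chi>\<^sub>i - c\<^sub>i\<close> split into factors
  \<open>z\<^sub>j - a\<close> with monomials \<open>a\<close> in the other coordinates, and Arnold's relations bring the form to
  \<open>B\<^sub>0 + \<Sum>\<^sub>a B\<^sub>a \<and> d log (z\<^sub>j - a)\<close> with logarithmic forms \<open>B\<^sub>0\<close>, \<open>B\<^sub>a\<close> in the other coordinates. Its
  residue along \<open>z\<^sub>j = a\<close> is a multiple of \<open>B\<^sub>a\<close> and is exact, so \<open>B\<^sub>a = 0\<close> by induction; then \<open>B\<^sub>0\<close> is exact by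
  restriction to a section, and vanishes as well.\<close>

section \<open>Calculus: smooth maps, parameter integrals, symmetry of second derivatives, a
  cutoff\<close>

section \<open>Smooth maps\<close>

text \<open>De Rham classes are given by concrete forms, so no long exact sequence is invoked: each
  connecting map is replaced by an explicit primitive, obtained by integrating a pulled-back form
  over an interval or a circle. The obstacle on the surjective side is that a residue lives only
  over the hypersurface, while a product of \<open>\<psi>\<close> with \<open>a\<close> needs
  \<open>a\<close> on the whole previous complement; exactly this extension, up to exact forms, is
  what the deletion-restriction condition supplies. A primitive exponent vector \<open>n\<close> has
  a dual vector \<open>m\<close> with pairing 1, and the orbits of the one-parameter subgroup
  \<open>m\<close> are transversal to all level sets of the character. They give the tube, the
  retraction and the circles by closed formulas. On the injective side the difficulty is that \<chi>
  - c has degree |n_j| in the coordinate z_j, so its zeros are multivalued functions of the other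
  coordinates; the isogeny makes them single-valued, and density brings the result back. Forms of
  mixed degree are treated throughout, with signs carried by the degree involution; the grading
  enters only in the final comparison.\<close>

lemma Ck_on_cong:
  assumes "open U" "\<And>x. x \<in> U \<Longrightarrow> f x = g x" "Ck_on k U f"
  shows "Ck_on k U g"
  using assms(2,3)
proof (induction k arbitrary: f g)
  case 0
  have "continuous_on U g"
    by (rule continuous_on_eq[OF _ 0(1)]) (use 0(2) in simp_all)
  then show ?case by simp
next
  case (Suc k)
  have diff: "\<forall>x\<in>U. f differentiable at x"
    and Ck: "\<And>v. Ck_on k U (\<lambda>x. frechet_derivative f (at x) v)"
    using Suc.prems(2) by simp_all
  have d: "(g has_derivative frechet_derivative f (at x)) (at x)" if "x \<in> U" for x
    using diff that
    by (intro has_derivative_transform_within_open[OF _ assms(1) that Suc.prems(1)])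
      (simp_all add: frechet_derivative_works[symmetric])
  have eq: "frechet_derivative f (at x) = frechet_derivative g (at x)" if "x \<in> U" for x
    by (rule frechet_derivative_at[OF d[OF that]])
  have "Ck_on k U (\<lambda>x. frechet_derivative g (at x) v)" for v
    by (rule Suc.IH[OF fun_cong[OF eq] Ck])
  moreover have "g differentiable at x" if "x \<in> U" for x
    using d[OF that] by (rule differentiableI)
  ultimately show ?case by simp
qed

lemma Ck_on_SucI:
  assumes "open U" "\<And>x. x \<in> U \<Longrightarrow> (f has_derivative F x) (at x)" "\<And>v. Ck_on k U (\<lambda>x. F x v)"
  shows "Ck_on (Suc k) U f"
proof -
  have eq: "F x = frechet_derivative f (at x)" if "x \<in> U" for x
    by (rule frechet_derivative_at[OF assms(2)[OF that]])
  have "Ck_on k U (\<lambda>x. frechet_derivative f (at x) v)" for v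
    by (rule Ck_on_cong[OF assms(1) fun_cong[OF eq] assms(3)])
  moreover have "f differentiable at x" if "x \<in> U" for x
    using assms(2)[OF that] by (rule differentiableI)
  ultimately show ?thesis by simp
qed

lemma Ck_on_SucD: "Ck_on (Suc k) U f \<Longrightarrow> Ck_on k U f"
proof (induction k arbitrary: f)
  case 0
  then have "f differentiable at x" if "x \<in> U" for x using that by simp
  then show ?case
    by (simp add: continuous_at_imp_continuous_on differentiable_imp_continuous_within)
next
  case (Suc k)
  have "Ck_on k U (\<lambda>x. frechet_derivative f (at x) v)" for v
  proof (rule Suc.IH)
    show "Ck_on (Suc k) U (\<lambda>x. frechet_derivative f (at x) v)"
      using Suc.prems by (subst (asm) Ck_on.simps(2)) blast
  qed
  moreover have "\<forall>x\<in>U. f differentiable at x"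
    using Suc.prems by (subst (asm) Ck_on.simps(2)) blast
  ultimately show ?case by simp
qed

lemma Ck_on_has_derivative:
  "Ck_on (Suc k) U f \<Longrightarrow> x \<in> U \<Longrightarrow> (f has_derivative frechet_derivative f (at x)) (at x)"
  by (simp add: frechet_derivative_works)

lemma Ck_on_frechet: "Ck_on (Suc k) U f \<Longrightarrow> Ck_on k U (\<lambda>x. frechet_derivative f (at x) v)"
  by simp

lemma Ck_on_subset: "Ck_on k U f \<Longrightarrow> V \<subseteq> U \<Longrightarrow> Ck_on k V f"
  by (induction k arbitrary: f) (auto intro: continuous_on_subset)

lemma Ck_on_local:
  assumes "\<And>x. x \<in> U \<Longrightarrow> \<exists>V. open V \<and> x \<in> V \<and> Ck_on k V f"
  shows "Ck_on k U f"
  using assms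
proof (induction k arbitrary: f)
  case 0
  have "isCont f x" if "x \<in> U" for x
    using 0[OF that] by (auto simp: continuous_on_eq_continuous_at)
  then show ?case by (simp add: continuous_at_imp_continuous_on)
next
  case (Suc k)
  have "f differentiable at x" if "x \<in> U" for x
    using Suc.prems[OF that] by auto
  moreover have "Ck_on k U (\<lambda>x. frechet_derivative f (at x) v)" for v
    
  proof (rule Suc.IH)
    fix x assume "x \<in> U"
    from Suc.prems[OF this] show "\<exists>V. open V \<and> x \<in> V \<and> Ck_on k V (\<lambda>x. frechet_derivative f (at x) v)"
      by auto
  qed
  ultimately show ?case by simp
qed

lemma Ck_on_const: "open U \<Longrightarrow> Ck_on k U (\<lambda>x. c)"
proof (induction k arbitrary: c)
  case (Suc k)
  then show ?case by (intro Ck_on_SucI[OF _ has_derivative_const])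
qed simp

lemma Ck_on_add:
  assumes "open U" "Ck_on k U f" "Ck_on k U g"
  shows "Ck_on k U (\<lambda>x. f x + g x)"
  using assms(2,3)
proof (induction k arbitrary: f g)
  case 0
  then show ?case by (auto intro: continuous_on_add)
next
  case (Suc k)
  show ?case
    by (rule Ck_on_SucI[OF assms(1) has_derivative_add[OF
        Ck_on_has_derivative[OF Suc.prems(1)] Ck_on_has_derivative[OF Suc.prems(2)]]
        Suc.IH[OF Suc.prems[THEN Ck_on_frechet]]])
qed

lemma Ck_on_linear:
  assumes "open U" "bounded_linear L" "Ck_on k U f"
  shows "Ck_on k U (\<lambda>x. L (f x))"
  using assms(3)
proof (induction k arbitrary: f)
  case 0
  then show ?case using assms(2) by (auto intro: bounded_linear.continuous_on)
next
  case (Suc k)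
  show ?case
    by (rule Ck_on_SucI[OF assms(1) bounded_linear.has_derivative[OF assms(2)
        Ck_on_has_derivative[OF Suc.prems]] Suc.IH[OF Suc.prems[THEN Ck_on_frechet]]])
qed

lemma Ck_on_bilinear:
  assumes "open U" "bounded_bilinear B" "Ck_on k U f" "Ck_on k U g"
  shows "Ck_on k U (\<lambda>x. B (f x) (g x))"
  using assms(3,4)
proof (induction k arbitrary: f g)
  case 0
  then show ?case using assms(2) by (auto intro: bounded_bilinear.continuous_on)
next
  case (Suc k)
  note D = Suc.prems[THEN Ck_on_SucD] and F = Suc.prems[THEN Ck_on_frechet]
  show ?case
    by (rule Ck_on_SucI[OF assms(1) bounded_bilinear.FDERIV[OF assms(2)
        Ck_on_has_derivative[OF Suc.prems(1)] Ck_on_has_derivative[OF Suc.prems(2)]]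
        Ck_on_add[OF assms(1) Suc.IH[OF D(1) F(2)] Suc.IH[OF F(1) D(2)]]])
qed

lemma Ck_on_sum:
  assumes "open U" "\<And>i. i \<in> I \<Longrightarrow> Ck_on k U (f i)"
  shows "Ck_on k U (\<lambda>x. \<Sum>i\<in>I. f i x)"
  using assms(2)
  by (induction I rule: infinite_finite_induct) (simp_all add: Ck_on_const Ck_on_add assms(1))

lemma Ck_on_ident:
  assumes "open U"
  shows "Ck_on k U (\<lambda>x. x)"
proof (cases k)
  case (Suc m)
  have "Ck_on (Suc m) U (\<lambda>x. x)"
    by (rule Ck_on_SucI[OF assms has_derivative_ident Ck_on_const[OF assms]])
  with Suc show ?thesis by simp
qed simp

text \<open>The chain rule gives the derivative of \<open>g\<close> in a direction that depends on
  the point, so the induction hypothesis does not apply to it. Expanding that direction in the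
  Euclidean basis yields a sum of products of functions with fixed directions.\<close>

lemma Ck_on_compose:
  fixes f :: "'a::real_normed_vector \<Rightarrow> 'b::euclidean_space"
  assumes "open U" "open V" "f ` U \<subseteq> V" "Ck_on k U f" "Ck_on k V g"
  shows "Ck_on k U (\<lambda>x. g (f x))"
  using assms(4,5)
proof (induction k arbitrary: g)
  case 0
  then show ?case
    using assms(3) by (simp add: continuous_on_compose2[of V g U f])
next
  case (Suc k)
  have lin: "linear (frechet_derivative g (at (f x)))" if "x \<in> U" for x
    using Ck_on_has_derivative[OF Suc.prems(2)] that assms(3) has_derivative_linear by blast
  have d: "((\<lambda>x. g (f x)) has_derivative
      (\<lambda>v. \<Sum>b\<in>Basis. (frechet_derivative f (at x) v \<bullet> b) *\<^sub>R frechet_derivative g (at (f x)) b)) (at x)"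
    (is "(_ has_derivative ?D x) _")
    if "x \<in> U" for x
  proof -
    have rep: "frechet_derivative g (at (f x)) w = (\<Sum>b\<in>Basis. (w \<bullet> b) *\<^sub>R frechet_derivative g (at (f x)) b)" for w
      by (subst (1) euclidean_representation[symmetric])
        (simp only: linear_sum[OF lin[OF that]] linear_scale[OF lin[OF that]])
    have "((\<lambda>x. g (f x)) has_derivative
      (\<lambda>v. frechet_derivative g (at (f x)) (frechet_derivative f (at x) v))) (at x)"
    proof (rule has_derivative_compose[OF Ck_on_has_derivative[OF Suc.prems(1) that]
        Ck_on_has_derivative[OF Suc.prems(2)]])
      show "f x \<in> V" using that assms(3) by blast
    qed
    then show ?thesis by (subst (asm) rep)
  qed
  show ?case
  proof (rule Ck_on_SucI[OF assms(1) d])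
    fix v
    have "Ck_on k U (\<lambda>x. frechet_derivative g (at (f x)) b)" for b
      by (rule Suc.IH[OF Ck_on_SucD[OF Suc.prems(1)] Ck_on_frechet[OF Suc.prems(2)]])
    then show "Ck_on k U (\<lambda>x. \<Sum>b\<in>Basis. (frechet_derivative f (at x) v \<bullet> b) *\<^sub>R frechet_derivative g (at (f x)) b)"
      by (intro Ck_on_sum Ck_on_bilinear[OF assms(1) bounded_bilinear_scaleR] assms(1)
          Ck_on_linear[OF assms(1) bounded_linear_inner_left] Ck_on_frechet[OF Suc.prems(1)])
  qed
qed

lemma smooth_on_cong:
  "open U \<Longrightarrow> (\<And>x. x \<in> U \<Longrightarrow> f x = g x) \<Longrightarrow> smooth_on U f \<Longrightarrow> smooth_on U g"
  unfolding smooth_on_def by (intro allI Ck_on_cong[of U f g]) auto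

lemma smooth_on_subset: "smooth_on U f \<Longrightarrow> V \<subseteq> U \<Longrightarrow> smooth_on V f"
  unfolding smooth_on_def by (intro allI Ck_on_subset[of _ U f V]) auto

lemma smooth_on_local:
  assumes "\<And>x. x \<in> U \<Longrightarrow> \<exists>V. open V \<and> x \<in> V \<and> smooth_on V f"
  shows "smooth_on U f"
  unfolding smooth_on_def
proof (intro allI Ck_on_local)
  fix k x
  assume "x \<in> U"
  from assms[OF this] show "\<exists>V. open V \<and> x \<in> V \<and> Ck_on k V f"
    unfolding smooth_on_def by auto
qed

lemma smooth_on_has_derivative:
  "smooth_on U f \<Longrightarrow> x \<in> U \<Longrightarrow> (f has_derivative frechet_derivative f (at x)) (at x)"
  unfolding smooth_on_def by (erule allE[where x = "Suc 0"], rule Ck_on_has_derivative)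

lemma smooth_on_imp_differentiable: "smooth_on U f \<Longrightarrow> x \<in> U \<Longrightarrow> f differentiable at x"
  by (rule differentiableI[OF smooth_on_has_derivative])

lemma smooth_on_frechet_linear: "smooth_on U f \<Longrightarrow> x \<in> U \<Longrightarrow> linear (frechet_derivative f (at x))"
  by (rule linear_frechet_derivative[OF smooth_on_imp_differentiable])

lemma smooth_on_imp_continuous_on: "smooth_on U f \<Longrightarrow> continuous_on U f"
  unfolding smooth_on_def by (erule allE[where x = 0]) simp

lemma smooth_on_frechet:
  assumes "smooth_on U f"
  shows "smooth_on U (\<lambda>x. frechet_derivative f (at x) v)"
  unfolding smooth_on_def
proof
  fix k
  have "Ck_on (Suc k) U f" using assms by (simp only: smooth_on_def)
  then show "Ck_on k U (\<lambda>x. frechet_derivative f (at x) v)" by simp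
qed

lemma smooth_onI:
  assumes "open U" "\<And>x. x \<in> U \<Longrightarrow> (f has_derivative F x) (at x)" "\<And>v. smooth_on U (\<lambda>x. F x v)"
  shows "smooth_on U f"
  unfolding smooth_on_def
proof
  fix k
  have "Ck_on k U (\<lambda>x. F x v)" for v using assms(3) by (simp only: smooth_on_def)
  from Ck_on_SucD[OF Ck_on_SucI[OF assms(1,2) this]] show "Ck_on k U f" by simp
qed

named_theorems smooth_intros

lemma smooth_on_const [smooth_intros]: "open U \<Longrightarrow> smooth_on U (\<lambda>x. c)"
  by (simp add: smooth_on_def Ck_on_const)

lemma smooth_on_ident [smooth_intros]: "open U \<Longrightarrow> smooth_on U (\<lambda>x. x)"
  by (simp add: smooth_on_def Ck_on_ident)

lemma smooth_on_add [smooth_intros]: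
  "open U \<Longrightarrow> smooth_on U f \<Longrightarrow> smooth_on U g \<Longrightarrow> smooth_on U (\<lambda>x. f x + g x)"
  unfolding smooth_on_def by (intro allI, rule Ck_on_add) simp_all

lemma smooth_on_sum [smooth_intros]:
  "open U \<Longrightarrow> (\<And>i. i \<in> I \<Longrightarrow> smooth_on U (f i)) \<Longrightarrow> smooth_on U (\<lambda>x. \<Sum>i\<in>I. f i x)"
  unfolding smooth_on_def by (intro allI, rule Ck_on_sum) simp_all

lemma smooth_on_linear:
  "open U \<Longrightarrow> bounded_linear L \<Longrightarrow> smooth_on U f \<Longrightarrow> smooth_on U (\<lambda>x. L (f x))"
  unfolding smooth_on_def by (intro allI, rule Ck_on_linear) simp_all

lemma smooth_on_bilinear:
  "open U \<Longrightarrow> bounded_bilinear B \<Longrightarrow> smooth_on U f \<Longrightarrow> smooth_on U g \<Longrightarrow> smooth_on U (\<lambda>x. B (f x) (g x))"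
  unfolding smooth_on_def by (intro allI, rule Ck_on_bilinear) simp_all

lemma smooth_on_compose:
  fixes f :: "'a::real_normed_vector \<Rightarrow> 'b::euclidean_space"
  shows "open U \<Longrightarrow> open V \<Longrightarrow> smooth_on V g \<Longrightarrow> f ` U \<subseteq> V \<Longrightarrow> smooth_on U f
    \<Longrightarrow> smooth_on U (\<lambda>x. g (f x))"
  unfolding smooth_on_def by (intro allI, rule Ck_on_compose[of U V]) simp_all

lemmas smooth_on_mult [smooth_intros] = smooth_on_bilinear[OF _ bounded_bilinear_mult]
lemmas smooth_on_scaleR [smooth_intros] = smooth_on_bilinear[OF _ bounded_bilinear_scaleR]
lemmas smooth_on_Re [smooth_intros] = smooth_on_linear[OF _ bounded_linear_Re]
lemmas smooth_on_cnj [smooth_intros] = smooth_on_linear[OF _ bounded_linear_cnj]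
lemmas smooth_on_of_real [smooth_intros] = smooth_on_linear[OF _ bounded_linear_of_real]
lemmas smooth_on_fst [smooth_intros] = smooth_on_linear[OF _ bounded_linear_fst]
lemmas smooth_on_snd [smooth_intros] = smooth_on_linear[OF _ bounded_linear_snd]
lemmas smooth_on_vec_nth [smooth_intros] = smooth_on_linear[OF _ bounded_linear_vec_nth]

lemma smooth_on_minus [smooth_intros]:
  "open U \<Longrightarrow> smooth_on U f \<Longrightarrow> smooth_on U (\<lambda>x. - f x)"
  by (rule smooth_on_linear[OF _ bounded_linear_minus[OF bounded_linear_ident]])

lemma smooth_on_diff [smooth_intros]:
  "open U \<Longrightarrow> smooth_on U f \<Longrightarrow> smooth_on U g \<Longrightarrow> smooth_on U (\<lambda>x. f x - g x)"
  unfolding diff_conv_add_uminus by (intro smooth_intros)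

lemma smooth_on_prod [smooth_intros]:
  fixes f :: "'i \<Rightarrow> 'a::real_normed_vector \<Rightarrow> 'b::real_normed_field"
  assumes "open U" "\<And>i. i \<in> I \<Longrightarrow> smooth_on U (f i)"
  shows "smooth_on U (\<lambda>x. \<Prod>i\<in>I. f i x)"
  using assms(2)
  by (induction I rule: infinite_finite_induct) (simp_all add: smooth_on_const smooth_on_mult assms(1))

lemma smooth_on_power [smooth_intros]:
  fixes f :: "'a::real_normed_vector \<Rightarrow> 'b::real_normed_algebra_1"
  assumes "open U" "smooth_on U f"
  shows "smooth_on U (\<lambda>x. f x ^ n)"
  by (induction n) (simp_all add: smooth_on_const smooth_on_mult assms)

lemma smooth_on_Pair [smooth_intros]:
  assumes "open U" "smooth_on U f" "smooth_on U g"
  shows "smooth_on U (\<lambda>x. (f x, g x))"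
proof -
  have "smooth_on U (\<lambda>x. (f x, 0) + (0, g x))"
    using assms by (intro smooth_on_add smooth_on_linear[OF assms(1) bounded_linear_Pair[OF bounded_linear_ident bounded_linear_zero]]
       smooth_on_linear[OF assms(1) bounded_linear_Pair[OF bounded_linear_zero bounded_linear_ident]])
  then show ?thesis by simp
qed

lemma smooth_on_vec_lambda [smooth_intros]:
  fixes f :: "'i::finite \<Rightarrow> 'a::real_normed_vector \<Rightarrow> 'b::euclidean_space"
  assumes "open U" "\<And>i. smooth_on U (f i)"
  shows "smooth_on U (\<lambda>x. \<chi> i. f i x)"
proof -
  have "bounded_linear (axis i :: 'b \<Rightarrow> 'b^'i)" for i
    unfolding linear_conv_bounded_linear[symmetric] by (intro linearI) (auto simp: axis_def vec_eq_iff)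
  then have "smooth_on U (\<lambda>x. \<Sum>i\<in>UNIV. axis i (f i x))"
    using assms by (intro smooth_on_sum smooth_on_linear[of U "axis _"])
  moreover have "(\<Sum>i\<in>UNIV. axis i (f i x)) = (\<chi> i. f i x)" for x
    by (auto simp: vec_eq_iff axis_def if_distrib cong: if_cong)
  ultimately show ?thesis by simp
qed

text \<open>The derivative of \<open>inverse f\<close> is a polynomial in \<open>inverse f\<close>
  and the derivative of \<open>f\<close>, so order \<open>k\<close> of the inverse itself feeds
  order \<open>k + 1\<close>.\<close>

lemma smooth_on_inverse [smooth_intros]:
  fixes f :: "'a::real_normed_vector \<Rightarrow> 'b::real_normed_div_algebra"
  assumes "open U" "smooth_on U f" "\<And>x. x \<in> U \<Longrightarrow> f x \<noteq> 0"
  shows "smooth_on U (\<lambda>x. inverse (f x))"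
proof -
  have "Ck_on k U (\<lambda>x. inverse (f x))" for k
  proof (induction k)
    case 0
    show ?case using continuous_on_inverse[OF smooth_on_imp_continuous_on[OF assms(2)]] assms(3) by simp
  next
    case (Suc k)
    have *: "Ck_on k U (\<lambda>x. frechet_derivative f (at x) v)" for v
      using smooth_on_frechet[OF assms(2)] by (auto simp: smooth_on_def)
    show ?case
    proof (rule Ck_on_SucI[OF assms(1)])
      show "((\<lambda>x. inverse (f x)) has_derivative
          (\<lambda>h. - (inverse (f x) * frechet_derivative f (at x) h * inverse (f x)))) (at x)" if "x \<in> U" for x
        by (rule Deriv.has_derivative_inverse[OF assms(3)[OF that] smooth_on_has_derivative[OF assms(2) that]])
      show "Ck_on k U (\<lambda>x. - (inverse (f x) * frechet_derivative f (at x) v * inverse (f x)))" for v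
        by (intro Ck_on_linear[OF assms(1) bounded_linear_minus[OF bounded_linear_ident]]
          Ck_on_bilinear[OF assms(1) bounded_bilinear_mult] Suc *)
    qed
  qed
  then show ?thesis by (simp add: smooth_on_def)
qed

lemma smooth_on_divide [smooth_intros]:
  fixes f g :: "'a::real_normed_vector \<Rightarrow> 'b::real_normed_field"
  assumes "open U" "smooth_on U f" "smooth_on U g" "\<And>x. x \<in> U \<Longrightarrow> g x \<noteq> 0"
  shows "smooth_on U (\<lambda>x. f x / g x)"
  unfolding divide_inverse by (intro smooth_intros assms)

lemma smooth_on_powi [smooth_intros]:
  fixes f :: "'a::real_normed_vector \<Rightarrow> 'b::real_normed_field"
  assumes "open U" "smooth_on U f" "\<And>x. x \<in> U \<Longrightarrow> f x \<noteq> 0"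
  shows "smooth_on U (\<lambda>x. f x powi n)"
  by (cases "n \<ge> 0") (simp_all add: power_int_def smooth_on_power smooth_on_inverse assms)

lemma smooth_on_exp [smooth_intros]:
  fixes f :: "'a::real_normed_vector \<Rightarrow> 'b::{real_normed_field, banach}"
  assumes "open U" "smooth_on U f"
  shows "smooth_on U (\<lambda>x. exp (f x))"
proof -
  have "Ck_on k U (\<lambda>x. exp (f x))" for k
  proof (induction k)
    case 0
    show ?case using continuous_on_exp[OF smooth_on_imp_continuous_on[OF assms(2)]] by simp
  next
    case (Suc k)
    have *: "Ck_on k U (\<lambda>x. frechet_derivative f (at x) v)" for v
      using smooth_on_frechet[OF assms(2)] by (auto simp: smooth_on_def)
    have "((\<lambda>x. exp (f x)) has_derivative (\<lambda>v. exp (f x) * frechet_derivative f (at x) v)) (at x)"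
      if "x \<in> U" for x
      using has_derivative_compose[OF smooth_on_has_derivative[OF assms(2) that]
          DERIV_exp[unfolded has_field_derivative_def]] by simp
    from Ck_on_SucI[OF assms(1) this Ck_on_bilinear[OF assms(1) bounded_bilinear_mult Suc *]]
    show ?case .
  qed
  then show ?thesis by (simp add: smooth_on_def)
qed

lemma smooth_on_ln [smooth_intros]:
  fixes f :: "'a::real_normed_vector \<Rightarrow> real"
  assumes "open U" "smooth_on U f" "\<And>x. x \<in> U \<Longrightarrow> f x > 0"
  shows "smooth_on U (\<lambda>x. ln (f x))"
proof (rule smooth_onI[OF assms(1)])
  show "((\<lambda>x. ln (f x)) has_derivative (\<lambda>v. frechet_derivative f (at x) v * inverse (f x))) (at x)"
    if "x \<in> U" for x
    using has_derivative_compose[OF smooth_on_has_derivative[OF assms(2) that]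
        DERIV_ln[OF assms(3)[OF that], unfolded has_field_derivative_def]] by (simp add: mult.commute)
  show "smooth_on U (\<lambda>x. frechet_derivative f (at x) v * inverse (f x))" for v
    by (intro smooth_intros smooth_on_frechet assms) (use assms(3) in force)
qed

text \<open>Away from the zeros of \<open>f\<close> the modulus is the exponential of half the
  logarithm of the squared modulus, and the latter is polynomial in \<open>f\<close> and its
  conjugate.\<close>

lemma smooth_on_norm [smooth_intros]:
  fixes f :: "'a::real_normed_vector \<Rightarrow> complex"
  assumes "open U" "smooth_on U f" "\<And>x. x \<in> U \<Longrightarrow> f x \<noteq> 0"
  shows "smooth_on U (\<lambda>x. norm (f x))"
proof (rule smooth_on_cong[OF assms(1)])
  have pos: "Re (f x * cnj (f x)) > 0" if "x \<in> U" for x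
    using assms(3)[OF that] by (simp add: complex_mult_cnj cmod_power2[symmetric])
  show "smooth_on U (\<lambda>x. exp (1/2 * ln (Re (f x * cnj (f x)))))"
    by (intro smooth_intros assms pos)
  show "exp (1/2 * ln (Re (f x * cnj (f x)))) = norm (f x)" if "x \<in> U" for x
    using assms(3)[OF that] pos[OF that]
    by (simp add: ln_sqrt[symmetric] cmod_def flip: power2_eq_square)
qed

lemma smooth_on_cis [smooth_intros]:
  assumes "open U" "smooth_on U f"
  shows "smooth_on U (\<lambda>x. cis (f x))"
  unfolding cis_conv_exp by (intro smooth_intros assms)

subsection \<open>Parameter integrals and second derivatives\<close>

lemma smooth_on_joint_continuous_frechet:
  "smooth_on U f \<Longrightarrow> continuous_on U (\<lambda>x. frechet_derivative f (at x) v)"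
  by (rule smooth_on_imp_continuous_on[OF smooth_on_frechet])

lemma slice_continuous:
  fixes g :: "real \<times> 'a::real_normed_vector \<Rightarrow> 'b::euclidean_space"
  assumes "continuous_on \<Omega> g" "{a..b} \<times> U \<subseteq> \<Omega>" "p \<in> U"
  shows "continuous_on {a..b} (\<lambda>x. g (x, p))"
  using assms by (intro continuous_on_compose2[OF assms(1)] continuous_intros) auto

text \<open>Differentiation under the integral sign. The Leibniz rule asks for the derivative as a
  bounded linear map depending jointly continuously on parameter and variable; in finite dimension
  this can be checked on basis vectors.\<close>

lemma has_derivative_param_integral:
  fixes g :: "real \<times> 'a::euclidean_space \<Rightarrow> 'b::euclidean_space"
  assumes \<Omega>: "smooth_on \<Omega> g" "{a..b} \<times> U \<subseteq> \<Omega>" and U: "open U" "p \<in> U"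
  shows "((\<lambda>p. integral {a..b} (\<lambda>x. g (x, p))) has_derivative
     (\<lambda>v. integral {a..b} (\<lambda>x. frechet_derivative g (at (x, p)) (0, v)))) (at p)"
proof -
  obtain e where e: "e > 0" "ball p e \<subseteq> U" using U openE by blast
  define D where "D q x = Blinfun (\<lambda>v. frechet_derivative g (at (x, q)) (0, v))" for q x
  have bl: "bounded_linear (\<lambda>v. frechet_derivative g (at (x, q)) (0, v))" if "x \<in> {a..b}" "q \<in> U" for x q
  proof -
    have "bounded_linear (frechet_derivative g (at (x, q)))"
      using smooth_on_has_derivative[OF \<Omega>(1)] that \<Omega>(2) has_derivative_bounded_linear by blast
    from bounded_linear_compose[OF this bounded_linear_Pair[OF bounded_linear_zero bounded_linear_ident]]
    show ?thesis .
  qed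
  have D: "blinfun_apply (D q x) v = frechet_derivative g (at (x, q)) (0, v)"
    if "x \<in> {a..b}" "q \<in> U" for x q v
    unfolding D_def using bounded_linear_Blinfun_apply[OF bl[OF that]] by simp
  have contD: "continuous_on (ball p e \<times> {a..b}) (\<lambda>(q, x). D q x)"
  proof (rule continuous_on_blinfun_componentwise)
    fix i :: 'a
    have "continuous_on (ball p e \<times> {a..b}) (\<lambda>z. frechet_derivative g (at (snd z, fst z)) (0, i))"
      using subsetD[OF e(2)] subsetD[OF \<Omega>(2)]
      by (intro continuous_on_compose2[OF smooth_on_joint_continuous_frechet[OF \<Omega>(1)]]
          continuous_intros) (auto simp del: mem_ball)
    then show "continuous_on (ball p e \<times> {a..b}) (\<lambda>z. blinfun_apply (case z of (q, x) \<Rightarrow> D q x) i)"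
      by (rule continuous_on_eq) (use D subsetD[OF e(2)] in \<open>auto simp del: mem_ball\<close>)
  qed
  have int: "(\<lambda>x. g (x, q)) integrable_on cbox a b" if "q \<in> ball p e" for q
    using slice_continuous[OF smooth_on_imp_continuous_on[OF \<Omega>(1)] \<Omega>(2)] that e(2)
    by (auto intro!: integrable_continuous_interval)
  have *: "((\<lambda>q. integral (cbox a b) (\<lambda>x. g (x, q))) has_derivative
      blinfun_apply (integral (cbox a b) (D p))) (at p within ball p e)"
  proof (rule leibniz_rule[OF _ int])
    fix q x assume q: "q \<in> ball p e" and x: "x \<in> cbox a b"
    then have "(x, q) \<in> \<Omega>" using subsetD[OF e(2)] \<Omega>(2) by auto
    from smooth_on_has_derivative[OF \<Omega>(1) this]
    have "((\<lambda>q. g (x, q)) has_derivative (\<lambda>v. frechet_derivative g (at (x, q)) (0, v))) (at q within ball p e)"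
      by (intro has_derivative_compose[where f = "\<lambda>q. (x, q)" and g = g])
        (auto intro!: derivative_eq_intros)
    moreover have "blinfun_apply (D q x) = (\<lambda>v. frechet_derivative g (at (x, q)) (0, v))"
      using D[of x q] x subsetD[OF e(2) q] by (intro ext) simp
    ultimately show "((\<lambda>q. g (x, q)) has_derivative blinfun_apply (D q x)) (at q within ball p e)"
      by simp
  qed (use e contD in auto)
  have "continuous_on {a..b} (\<lambda>x. D p x)"
    using continuous_on_compose2[OF contD, of "{a..b}" "\<lambda>x. (p, x)"] e(1)
    by (simp add: continuous_on_Pair continuous_on_const continuous_on_id image_subset_iff)
  then have intD: "D p integrable_on cbox a b" by (simp add: integrable_continuous_interval)
  have "blinfun_apply (integral (cbox a b) (D p)) v =
    integral {a..b} (\<lambda>x. frechet_derivative g (at (x, p)) (0, v))" for v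
  proof -
    have "integral {a..b} (\<lambda>x. blinfun_apply (D p x) v)
        = integral {a..b} (\<lambda>x. frechet_derivative g (at (x, p)) (0, v))"
      by (rule integral_cong) (rule D[OF _ U(2)])
    then show ?thesis using blinfun_apply_integral[OF intD, of v] by (simp only: box_real)
  qed
  then have "blinfun_apply (integral (cbox a b) (D p)) =
    (\<lambda>v. integral {a..b} (\<lambda>x. frechet_derivative g (at (x, p)) (0, v)))"
    by (rule ext)
  moreover have "at p within ball p e = at p"
    using e(1) by (intro at_within_open) simp_all
  ultimately show ?thesis using * by (simp only: box_real)
qed

text \<open>The derivative in a fixed direction \<open>v\<close> is again a parameter integral, of
  the derivative of \<open>g\<close> in direction \<open>(0, v)\<close>, so the order is raised by
  induction over all \<open>g\<close>.\<close>

lemma smooth_on_param_integral: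
  fixes g :: "real \<times> 'a::euclidean_space \<Rightarrow> 'b::euclidean_space"
  assumes "smooth_on \<Omega> g" "{a..b} \<times> U \<subseteq> \<Omega>" "open U"
  shows "smooth_on U (\<lambda>p. integral {a..b} (\<lambda>x. g (x, p)))"
proof -
  have "Ck_on k U (\<lambda>p. integral {a..b} (\<lambda>x. g (x, p)))" if "smooth_on \<Omega> g" for k and g :: "real \<times> 'a \<Rightarrow> 'b"
    using that
  proof (induction k arbitrary: g)
    case 0
    have "continuous (at p) (\<lambda>p. integral {a..b} (\<lambda>x. g (x, p)))" if "p \<in> U" for p
      using has_derivative_continuous[OF has_derivative_param_integral[OF 0 assms(2,3) that]] .
    then show ?case by (simp add: continuous_at_imp_continuous_on)
  next
    case (Suc k)
    show ?case
      by (rule Ck_on_SucI[OF assms(3) has_derivative_param_integral[OF Suc.prems assms(2,3)]])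
        (assumption, rule Suc.IH[OF smooth_on_frechet[OF Suc.prems]])
  qed
  with assms(1) show ?thesis by (simp add: smooth_on_def)
qed

lemma frechet_derivative_eqI:
  "(f has_derivative f') (at x) \<Longrightarrow> frechet_derivative f (at x) = f'"
  by (rule frechet_derivative_at[symmetric])

text \<open>Write \<open>f (q + t w) - f q\<close> as the integral over \<open>r\<close> from
  \<open>0\<close> to \<open>t\<close> of the derivative of \<open>f\<close> in direction
  \<open>w\<close> at \<open>q + r w\<close>. Differentiate under the integral in direction
  \<open>v\<close> and compare the one-sided derivatives of both sides at
  \<open>t = 0\<close>.\<close>

lemma smooth_on_symmetric:
  fixes f :: "'a::euclidean_space \<Rightarrow> 'b::euclidean_space"
  assumes f: "smooth_on U f" and U: "open U" "p \<in> U"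
  shows "frechet_derivative (\<lambda>q. frechet_derivative f (at q) v) (at p) w
       = frechet_derivative (\<lambda>q. frechet_derivative f (at q) w) (at p) v"
proof -
  obtain e where e: "e > 0" "ball p e \<subseteq> U" using U openE by blast
  \<comment> \<open>Small enough that \<open>q + r w\<close> stays in the ball of radius
    \<open>e\<close> for \<open>q\<close> within \<open>e / 2\<close> of \<open>p\<close> and
    \<open>r \<le> d\<close>; the \<open>1 +\<close> avoids a zero denominator when
    \<open>w = 0\<close>.\<close>
  define d where "d = e / (2 * (1 + norm w))"
  have d: "d > 0" unfolding d_def using e(1) by (intro divide_pos_pos mult_pos_pos add_pos_nonneg) auto
  define \<Omega> where "\<Omega> = {(r::real, q). q + r *\<^sub>R w \<in> U}"
  have "open \<Omega>"
  proof -
    have "\<Omega> = (\<lambda>z. snd z + fst z *\<^sub>R w) -` U" by (auto simp: \<Omega>_def)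
    then show ?thesis using U(1) by (auto intro!: open_vimage continuous_intros)
  qed
  define V where "V = ball p (e / 2)"
  have sub: "{0..t} \<times> V \<subseteq> \<Omega>" if "t \<le> d" for t
  proof -
    have "q + r *\<^sub>R w \<in> U" if "r \<in> {0..t}" "q \<in> V" for r q
    proof -
      have "norm (r *\<^sub>R w) \<le> d * norm w" using that \<open>t \<le> d\<close> by (simp add: mult_right_mono)
      also have "\<dots> < d * (1 + norm w)" using d by simp
      also have "\<dots> = e / 2" 
      proof -
        have "e / (2 * c) * c = e / 2" if "c \<noteq> 0" for c using that by simp
        from this[of "1 + norm w"] show ?thesis
          unfolding d_def using add_pos_nonneg[OF zero_less_one norm_ge_zero, of w] by linarith
      qed
      finally have "norm (p - (q + r *\<^sub>R w)) < e"
        using that(2) norm_triangle_ineq4[of "p - q" "r *\<^sub>R w"] by (simp add: V_def dist_norm algebra_simps)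
      then show ?thesis using e(2) by (auto simp: dist_norm)
    qed
    then show ?thesis by (auto simp: \<Omega>_def)
  qed
  define g where "g = (\<lambda>z::real \<times> 'a. frechet_derivative f (at (snd z + fst z *\<^sub>R w)) w)"
  have smg: "smooth_on \<Omega> g"
    unfolding g_def
    by (rule smooth_on_compose[OF \<open>open \<Omega>\<close> U(1) smooth_on_frechet[OF f]])
      (auto simp: \<Omega>_def intro!: smooth_intros \<open>open \<Omega>\<close>[unfolded \<Omega>_def])
  have smv: "smooth_on U (\<lambda>q. frechet_derivative f (at q) v)" for v
    by (rule smooth_on_frechet[OF f])
  have dg: "frechet_derivative g (at (r, p)) (0, v) =
      frechet_derivative (\<lambda>q. frechet_derivative f (at q) w) (at (p + r *\<^sub>R w)) v"
    if "p + r *\<^sub>R w \<in> U" for r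
  proof -
    have "(g has_derivative (\<lambda>z. frechet_derivative (\<lambda>q. frechet_derivative f (at q) w) (at (p + r *\<^sub>R w))
        (snd z + fst z *\<^sub>R w))) (at (r, p))"
      unfolding g_def
      by (rule has_derivative_compose[where f = "\<lambda>z. snd z + fst z *\<^sub>R w" and g = "\<lambda>q. frechet_derivative f (at q) w"])
        (use smooth_on_has_derivative[OF smv[of w] that] in \<open>auto intro!: derivative_eq_intros\<close>)
    from frechet_derivative_eqI[OF this] show ?thesis by simp
  qed
  have ftc: "integral {0..t} (\<lambda>r. g (r, q)) = f (q + t *\<^sub>R w) - f q"
    if "q \<in> V" "0 \<le> t" "t \<le> d" for q t
  proof -
    have "((\<lambda>r. f (q + r *\<^sub>R w)) has_vector_derivative g (r, q)) (at r within {0..t})"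
      if r: "r \<in> {0..t}" for r
    proof -
      have mem: "q + r *\<^sub>R w \<in> U" using subsetD[OF sub[OF \<open>t \<le> d\<close>], of "(r, q)"] r \<open>q \<in> V\<close> by (auto simp: \<Omega>_def)
      have "((\<lambda>r. q + r *\<^sub>R w) has_derivative (\<lambda>h. h *\<^sub>R w)) (at r within {0..t})"
        by (auto intro!: derivative_eq_intros)
      from has_derivative_compose[OF this smooth_on_has_derivative[OF f mem]]
      show ?thesis
        unfolding has_vector_derivative_def g_def
        by (simp add: linear_scale[OF smooth_on_frechet_linear[OF f mem]])
    qed
    from integral_unique[OF fundamental_theorem_of_calculus[OF that(2) this]]
    show ?thesis by simp
  qed
  define h where "h r = frechet_derivative g (at (r, p)) (0, v)" for r
  have p: "p \<in> V" using e by (simp add: V_def)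
  have eq: "integral {0..t} h = frechet_derivative f (at (p + t *\<^sub>R w)) v - frechet_derivative f (at p) v"
    if t: "0 \<le> t" "t \<le> d" for t
  proof -
    have mem: "p + t *\<^sub>R w \<in> U" using subsetD[OF sub[OF t(2)], of "(t, p)"] t(1) p by (auto simp: \<Omega>_def)
    have "((\<lambda>q. integral {0..t} (\<lambda>r. g (r, q))) has_derivative (\<lambda>v. integral {0..t} (\<lambda>r. frechet_derivative g (at (r, p)) (0, v)))) (at p)"
      by (rule has_derivative_param_integral[OF smg sub[OF t(2)] _ p]) (simp add: V_def)
    then have 1: "((\<lambda>q. f (q + t *\<^sub>R w) - f q) has_derivative (\<lambda>v. integral {0..t} (\<lambda>r. frechet_derivative g (at (r, p)) (0, v)))) (at p)"
      by (rule has_derivative_transform_within_open[OF _ _ p ftc[OF _ t]]) (simp add: V_def)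
    have "((\<lambda>q. q + t *\<^sub>R w) has_derivative (\<lambda>v. v)) (at p)"
      by (auto intro!: derivative_eq_intros)
    from has_derivative_unique[OF 1 has_derivative_diff[OF has_derivative_compose[OF this
            smooth_on_has_derivative[OF f mem]] smooth_on_has_derivative[OF f U(2)]]]
    show ?thesis unfolding h_def by (rule fun_cong)
  qed
  have conth: "continuous_on {0..d} h"
    unfolding h_def using sub[of d] p
    by (intro slice_continuous[OF smooth_on_joint_continuous_frechet[OF smg]]) auto
  have "((\<lambda>t. integral {0..t} h) has_vector_derivative h 0) (at 0 within {0..d})"
    by (rule integral_has_vector_derivative[OF conth]) (use d in auto)
  then have "((\<lambda>t. frechet_derivative f (at (p + t *\<^sub>R w)) v - frechet_derivative f (at p) v)
      has_vector_derivative h 0) (at 0 within {0..d})"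
    by (rule has_vector_derivative_transform[rotated 2]) (use d eq in simp_all)
  moreover have "((\<lambda>t. frechet_derivative f (at (p + t *\<^sub>R w)) v - frechet_derivative f (at p) v)
      has_vector_derivative frechet_derivative (\<lambda>q. frechet_derivative f (at q) v) (at p) w) (at 0 within {0..d})"
  proof -
    have "((\<lambda>t. p + t *\<^sub>R w) has_derivative (\<lambda>h. h *\<^sub>R w)) (at 0 within {0..d})"
      by (auto intro!: derivative_eq_intros)
    moreover have "((\<lambda>q. frechet_derivative f (at q) v) has_derivative
        frechet_derivative (\<lambda>q. frechet_derivative f (at q) v) (at p)) (at (p + 0 *\<^sub>R w))"
      using smooth_on_has_derivative[OF smv U(2)] by simp
    ultimately have "((\<lambda>t. frechet_derivative f (at (p + t *\<^sub>R w)) v) has_derivative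
       (\<lambda>h. frechet_derivative (\<lambda>q. frechet_derivative f (at q) v) (at p) (h *\<^sub>R w))) (at 0 within {0..d})"
      by (rule has_derivative_compose)
    from has_derivative_diff[OF this has_derivative_const[of "frechet_derivative f (at p) v"]] show ?thesis
      unfolding has_vector_derivative_def
      by (simp add: linear_scale[OF smooth_on_frechet_linear[OF smv U(2)]])
  qed
  ultimately have "h 0 = frechet_derivative (\<lambda>q. frechet_derivative f (at q) v) (at p) w"
    using d by (intro vector_derivative_unique_within[of 0 "{0..d}"]) (auto simp: trivial_limit_within islimpt_Icc)
  moreover have "h 0 = frechet_derivative (\<lambda>q. frechet_derivative f (at q) w) (at p) v"
    using dg[of 0] U(2) by (simp add: h_def)
  ultimately show ?thesis by simp
qed

subsection \<open>A smooth cutoff function\<close>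

text \<open>The powers of \<open>inverse x\<close> make the family closed under differentiation up
  to linear combinations, so the smoothness of the classical flat function \<open>flat 0\<close>
  follows by induction over the whole family.\<close>

definition flat :: "nat \<Rightarrow> real \<Rightarrow> real" where
  "flat k x = (if x > 0 then exp (- inverse x) * inverse x ^ k else 0)"

lemma flat_tendsto_0: "(flat k \<longlongrightarrow> 0) (at 0)"
proof -
  have "((\<lambda>x. (inverse x) ^ k / exp (inverse x)) \<longlongrightarrow> 0) (at_right (0::real))"
    by (rule filterlim_compose[OF tendsto_power_div_exp_0 filterlim_inverse_at_top_right])
  then have "(flat k \<longlongrightarrow> 0) (at_right 0)"
    by (rule Lim_transform_eventually)
      (auto simp: flat_def exp_minus field_simps eventually_at_right_less
        intro!: eventually_mono[OF eventually_at_right_less[of 0]])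
  moreover have "(flat k \<longlongrightarrow> 0) (at_left 0)"
    by (rule Lim_transform_eventually[OF tendsto_const])
      (auto simp: flat_def eventually_at_filter)
  ultimately show ?thesis by (simp add: filterlim_split_at_real)
qed

lemma flat_has_derivative:
  "(flat k has_real_derivative (flat (k + 2) x - real k * flat (k + 1) x)) (at x)"
proof -
  consider "x > 0" | "x < 0" | "x = 0" by linarith
  then show ?thesis
  proof cases
    case 1
    have "((\<lambda>x. exp (- inverse x) * inverse x ^ k) has_real_derivative
      (flat (k + 2) x - real k * flat (k + 1) x)) (at x)"
      using 1 by (auto intro!: derivative_eq_intros simp: flat_def)
         (cases k; simp add: field_simps power2_eq_square)
    then show ?thesis
      by (rule has_field_derivative_transform_within_open[of _ _ _ "{0<..}"]) (use 1 in \<open>auto simp: flat_def\<close>)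
  next
    case 2
    have "((\<lambda>x. 0) has_real_derivative (flat (k + 2) x - real k * flat (k + 1) x)) (at x)"
      using 2 by (simp add: flat_def)
    then show ?thesis
      by (rule has_field_derivative_transform_within_open[of _ _ _ "{..<0}"]) (use 2 in \<open>auto simp: flat_def\<close>)
  next
    case 3
    \<comment> \<open>At \<open>0\<close> the difference quotient of \<open>flat k\<close> is
      \<open>flat (Suc k)\<close>, which tends to \<open>0\<close>.\<close>
    have "((\<lambda>h. (flat k (0 + h) - flat k 0) / h) \<longlongrightarrow> 0) (at 0)"
      by (rule Lim_transform_eventually[OF flat_tendsto_0[of "Suc k"]])
        (auto simp: flat_def eventually_at_filter divide_inverse)
    then show ?thesis using 3 by (simp add: DERIV_def flat_def)
  qed
qed

lemma smooth_on_flat: "smooth_on UNIV (flat k)"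
proof -
  have "Ck_on n UNIV (flat k)" for n
  proof (induction n arbitrary: k)
    case 0
    have "isCont (flat k) x" for x
      using DERIV_isCont[OF flat_has_derivative] .
    then show ?case by (simp add: continuous_at_imp_continuous_on)
  next
    case (Suc n)
    have *: "Ck_on n UNIV (\<lambda>x. (flat (k + 2) x + (- real k) * flat (k + 1) x) * v)" for v
      by (intro Ck_on_bilinear[OF open_UNIV bounded_bilinear_mult] Ck_on_add[OF open_UNIV]
          Ck_on_const[OF open_UNIV] Suc)
    have "(flat k has_derivative (\<lambda>v. (flat (k + 2) x + (- real k) * flat (k + 1) x) * v)) (at x)" for x
      using flat_has_derivative[of k x] by (simp add: has_field_derivative_def)
    from Ck_on_SucI[OF open_UNIV this *] show ?case .
  qed
  then show ?thesis by (simp add: smooth_on_def)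
qed

text \<open>A quotient of translated and reflected flat functions; the denominator is positive
  because \<open>1/2 - x\<close> and \<open>x - 1/4\<close> cannot both be nonpositive. The argument
  will be a squared relative distance to a hypersurface, so the cutoff is \<open>1\<close> up to
  half the radius of the tube.\<close>

lemma smooth_cutoff:
  obtains \<phi> :: "real \<Rightarrow> real" where "smooth_on UNIV \<phi>" "\<And>x. x \<le> 1/4 \<Longrightarrow> \<phi> x = 1" "\<And>x. x \<ge> 1/2 \<Longrightarrow> \<phi> x = 0"
proof
  define f where "f = flat 0"
  define \<phi> where "\<phi> x = f (1/2 - x) / (f (1/2 - x) + f (x - 1/4))" for x
  have pos: "f (1/2 - x) + f (x - 1/4) > 0" for x
    by (auto simp: f_def flat_def intro: add_pos_pos)
  have "smooth_on UNIV (\<lambda>x. f (1/2 - x))" "smooth_on UNIV (\<lambda>x. f (x - 1/4))"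
    unfolding f_def
    by (rule smooth_on_compose[OF open_UNIV open_UNIV smooth_on_flat]; auto intro!: smooth_intros)+
  then show "smooth_on UNIV \<phi>"
    unfolding \<phi>_def using pos by (intro smooth_intros open_UNIV) (auto simp: less_imp_neq[symmetric])
  show "\<phi> x = 1" if "x \<le> 1/4" for x
    using pos[of x] that by (simp add: \<phi>_def f_def flat_def)
  show "\<phi> x = 0" if "x \<ge> 1/2" for x
    using that by (simp add: \<phi>_def f_def flat_def)
qed

section \<open>Exterior algebra at a single point\<close>

section \<open>The wedge product as a recursion\<close>

text \<open>Splitting off the first vector turns the sum over shuffles into the antiderivation rule
  for contractions; every identity below is then an induction on the list of vectors.\<close>

fun wdg :: "('a list \<Rightarrow> complex) \<Rightarrow> ('a list \<Rightarrow> complex) \<Rightarrow> 'a list \<Rightarrow> complex" where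
  "wdg a b [] = a [] * b []"
| "wdg a b (v # vs) = wdg (\<lambda>us. a (v # us)) b vs
     + wdg (\<lambda>us. (-1) ^ length us * a us) (\<lambda>us. b (v # us)) vs"

definition inversions :: "nat \<Rightarrow> nat set \<Rightarrow> (nat \<times> nat) set" where
  "inversions n I = {(i, j). i \<in> I \<and> j \<in> {..<n} - I \<and> j < i}"

lemma finite_inversions: "I \<subseteq> {..<n} \<Longrightarrow> finite (inversions n I)"
  unfolding inversions_def by (rule finite_subset[of _ "{..<n} \<times> {..<n}"]) auto

lemma card_inversions_insert:
  "card (inversions (Suc n) (insert 0 (Suc ` J))) = card (inversions n J)"
proof -
  have "inversions (Suc n) (insert 0 (Suc ` J)) = map_prod Suc Suc ` inversions n J"
  proof (rule Set.set_eqI)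
    fix x :: "nat \<times> nat"
    obtain i j where x: "x = (i, j)" by (cases x)
    show "x \<in> inversions (Suc n) (insert 0 (Suc ` J)) \<longleftrightarrow> x \<in> map_prod Suc Suc ` inversions n J"
      unfolding x by (cases i; cases j) (auto simp: inversions_def)
  qed
  then show ?thesis by (simp add: card_image inj_on_def map_prod_def split: prod.splits)
qed

text \<open>Position \<open>0\<close> now goes to the second factor and is passed by every element
  of \<open>J\<close>, which adds \<open>card J\<close> inversions. This is the source of the sign
  \<open>(-1) ^ length us\<close> in the recursion.\<close>

lemma card_inversions_Suc:
  assumes "J \<subseteq> {..<n}"
  shows "card (inversions (Suc n) (Suc ` J)) = card (inversions n J) + card J"
proof -
  have "inversions (Suc n) (Suc ` J) = map_prod Suc Suc ` inversions n J \<union> (\<lambda>i. (Suc i, 0)) ` J"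
  proof (rule Set.set_eqI)
    fix x :: "nat \<times> nat"
    obtain i j where x: "x = (i, j)" by (cases x)
    show "x \<in> inversions (Suc n) (Suc ` J)
        \<longleftrightarrow> x \<in> map_prod Suc Suc ` inversions n J \<union> (\<lambda>i. (Suc i, 0)) ` J"
      unfolding x by (cases i; cases j) (auto simp: inversions_def)
  qed
  moreover have "card (map_prod Suc Suc ` inversions n J) = card (inversions n J)"
    by (simp add: card_image inj_on_def map_prod_def split: prod.splits)
  moreover have "card ((\<lambda>i. (Suc i, 0::nat)) ` J) = card J"
    by (simp add: card_image inj_on_def)
  moreover have "finite J" using assms finite_subset by blast
  moreover have "map_prod Suc Suc ` inversions n J \<inter> (\<lambda>i. (Suc i, 0)) ` J = {}" by auto
  ultimately show ?thesis
    using finite_inversions[OF assms] by (simp add: card_Un_disjoint)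
qed

lemma sum_Pow_lessThan_Suc:
  "(\<Sum>I\<in>Pow {..<Suc n}. f I) = (\<Sum>J\<in>Pow {..<n}. f (insert 0 (Suc ` J))) + (\<Sum>J\<in>Pow {..<n}. f (Suc ` J))"
proof -
  have "Pow (Suc ` {..<n}) = (`) Suc ` Pow {..<n}" by (simp add: image_Pow_surj)
  then have P: "Pow {..<Suc n} = (`) Suc ` Pow {..<n} \<union> (\<lambda>J. insert 0 (Suc ` J)) ` Pow {..<n}"
    by (simp add: lessThan_Suc_eq_insert_0 Pow_insert image_image)
  have inj: "inj_on ((`) Suc) (Pow {..<n})" "inj_on (\<lambda>J. insert 0 (Suc ` J)) (Pow {..<n})"
    by (auto simp: inj_on_def)
  have disj: "(`) Suc ` Pow {..<n} \<inter> (\<lambda>J. insert 0 (Suc ` J)) ` Pow {..<n} = {}" by auto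
  show ?thesis
    unfolding P by (subst sum.union_disjoint) (use disj inj in \<open>auto simp: sum.reindex add.commute\<close>)
qed

lemma wedge_Cons:
  "wedge \<alpha> \<beta> p (v # vs) = wedge (\<lambda>p us. \<alpha> p (v # us)) \<beta> p vs
     + wedge (\<lambda>p us. (-1) ^ length us * \<alpha> p us) (\<lambda>p us. \<beta> p (v # us)) p vs"
proof -
  let ?n = "length vs"
  let ?f = "\<lambda>I. (-1) ^ card (inversions (Suc ?n) I) * \<alpha> p (nths (v # vs) I) * \<beta> p (nths (v # vs) (- I))"
  have 1: "?f (insert 0 (Suc ` J)) = (-1) ^ card (inversions ?n J) * \<alpha> p (v # nths vs J) * \<beta> p (nths vs (- J))" for J
  proof -
    have "{j. Suc j \<in> insert 0 (Suc ` J)} = J" "{j. Suc j \<in> - insert 0 (Suc ` J)} = - J" by auto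
    then show ?thesis by (simp add: nths_Cons card_inversions_insert)
  qed
  have 2: "?f (Suc ` J) = (-1) ^ card (inversions ?n J) * ((-1) ^ length (nths vs J) * \<alpha> p (nths vs J))
      * \<beta> p (v # nths vs (- J))" if "J \<in> Pow {..<?n}" for J
  proof -
    have "{j. Suc j \<in> Suc ` J} = J" "{j. Suc j \<in> - (Suc ` J)} = - J" by auto
    moreover have "length (nths vs J) = card J"
      using that unfolding length_nths by (intro arg_cong[where f = card]) auto
    ultimately show ?thesis
      using that by (simp add: nths_Cons card_inversions_Suc power_add)
  qed
  have "wedge \<alpha> \<beta> p (v # vs) = (\<Sum>I\<in>Pow {..<Suc ?n}. ?f I)"
    unfolding wedge_def inversions_def by simp
  also have "\<dots> = (\<Sum>J\<in>Pow {..<?n}. (-1) ^ card (inversions ?n J) * \<alpha> p (v # nths vs J) * \<beta> p (nths vs (- J)))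
     + (\<Sum>J\<in>Pow {..<?n}. (-1) ^ card (inversions ?n J) * ((-1) ^ length (nths vs J) * \<alpha> p (nths vs J))
      * \<beta> p (v # nths vs (- J)))"
    unfolding sum_Pow_lessThan_Suc 1 by (intro arg_cong2[where f = "(+)"] refl sum.cong 2)
  finally show ?thesis unfolding wedge_def inversions_def by simp
qed

lemma wedge_eq_wdg: "wedge \<alpha> \<beta> p vs = wdg (\<alpha> p) (\<beta> p) vs"
proof (induction vs arbitrary: \<alpha> \<beta>)
  case Nil
  show ?case by (simp add: wedge_def)
next
  case (Cons v vs)
  show ?case unfolding wedge_Cons Cons.IH by simp
qed

lemma wedge_fun: "wedge \<alpha> \<beta> = (\<lambda>p. wdg (\<alpha> p) (\<beta> p))"
  by (intro ext wedge_eq_wdg)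

lemma wdg_add_left: "wdg (\<lambda>us. a us + a' us) b vs = wdg a b vs + wdg a' b vs"
proof (induction vs arbitrary: a a' b)
  case (Cons v vs)
  show ?case by (simp only: wdg.simps distrib_left Cons.IH) simp
qed (simp add: algebra_simps)

lemma wdg_add_right: "wdg a (\<lambda>us. b us + b' us) vs = wdg a b vs + wdg a b' vs"
proof (induction vs arbitrary: a b b')
  case (Cons v vs)
  show ?case by (simp only: wdg.simps Cons.IH) simp
qed (simp add: algebra_simps)

lemma wdg_cmult_left: "wdg (\<lambda>us. c * a us) b vs = c * wdg a b vs"
proof (induction vs arbitrary: a b)
  case (Cons v vs)
  have "(\<lambda>us. (-1) ^ length us * (c * a us)) = (\<lambda>us. c * ((-1) ^ length us * a us))" by (simp add: ac_simps)
  then show ?case by (simp only: wdg.simps Cons.IH) (simp add: algebra_simps)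
qed simp

lemma wdg_cmult_right: "wdg a (\<lambda>us. c * b us) vs = c * wdg a b vs"
proof (induction vs arbitrary: a b)
  case (Cons v vs)
  show ?case by (simp only: wdg.simps Cons.IH) (simp add: algebra_simps)
qed simp

lemma wdg_minus_left: "wdg (\<lambda>us. - a us) b vs = - wdg a b vs"
  using wdg_cmult_left[of "-1" a b vs] by simp

lemma wdg_minus_right: "wdg a (\<lambda>us. - b us) vs = - wdg a b vs"
  using wdg_cmult_right[of a "-1" b vs] by simp

lemma wdg_diff_left: "wdg (\<lambda>us. a us - a' us) b vs = wdg a b vs - wdg a' b vs"
  using wdg_add_left[of a "\<lambda>us. - a' us" b vs] by (simp add: wdg_minus_left)

lemma wdg_diff_right: "wdg a (\<lambda>us. b us - b' us) vs = wdg a b vs - wdg a b' vs"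
  using wdg_add_right[of a b "\<lambda>us. - b' us" vs] by (simp add: wdg_minus_right)

lemma wdg_zero_left: "wdg (\<lambda>us. 0) b vs = 0"
  using wdg_cmult_left[of 0 "\<lambda>us. 0" b vs] by simp

lemma wdg_zero_right: "wdg a (\<lambda>us. 0) vs = 0"
  using wdg_cmult_right[of a 0 "\<lambda>us. 0" vs] by simp

lemma sign_sign: "(-1) ^ n * ((-1) ^ n * c) = (c::complex)"
  by (simp add: mult.assoc[symmetric] power_mult_distrib[symmetric])

text \<open>The degree involution, which multiplies the part of degree \<open>k\<close> by
  \<open>(-1) ^ k\<close>, is multiplicative. It is how forms of mixed degree carry the signs of the
  antiderivation rules.\<close>

lemma wdg_sign: "wdg (\<lambda>us. (-1) ^ length us * a us) (\<lambda>us. (-1) ^ length us * b us) vs = (-1) ^ length vs * wdg a b vs"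
proof (induction vs arbitrary: a b)
  case (Cons v vs)
  have 1: "(\<lambda>us. (-1) ^ length (v # us) * a (v # us)) = (\<lambda>us. - ((-1) ^ length us * a (v # us)))"
    "(\<lambda>us. (-1) ^ length (v # us) * b (v # us)) = (\<lambda>us. - ((-1) ^ length us * b (v # us)))"
    by simp_all
  show ?case
    unfolding wdg.simps 1 wdg_minus_left wdg_minus_right Cons.IH by (simp add: algebra_simps)
qed simp

text \<open>Contract both sides with the leading vector. Three terms arise, according to the factor
  that receives it, and they match because the degree involution is multiplicative.\<close>

lemma wdg_assoc: "wdg (wdg a b) c vs = wdg a (wdg b c) vs"
proof (induction vs arbitrary: a b c)
  case (Cons v vs)
  show ?case
    unfolding wdg.simps wdg_add_left wdg_add_right Cons.IH wdg_sign[symmetric] by simp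
qed simp

text \<open>A scalar as a form at one point; \<open>const0 1\<close> is the unit of the wedge
  product.\<close>

definition const0 :: "complex \<Rightarrow> 'a list \<Rightarrow> complex" where
  "const0 c vs = (if vs = [] then c else 0)"

lemma wdg_const_left:
  fixes b :: "'a list \<Rightarrow> complex"
  shows "wdg (const0 c) b vs = c * b vs"
proof (induction vs arbitrary: b)
  case (Cons v vs)
  have "(\<lambda>us. const0 c (v # us)) = (\<lambda>us. 0)" by (simp add: const0_def)
  moreover have "(\<lambda>us::'a list. (-1) ^ length us * const0 c us) = const0 c" by (auto simp: const0_def)
  ultimately show ?case unfolding wdg.simps by (simp only: Cons.IH wdg_zero_left add_0)
qed (simp add: const0_def)

lemma wdg_const_right: "wdg a (const0 c) vs = c * a vs"
proof (induction vs arbitrary: a)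
  case (Cons v vs)
  have "(\<lambda>us. const0 c (v # us)) = (\<lambda>us. 0)" by (simp add: const0_def)
  then show ?case by (simp add: Cons.IH wdg_zero_right del: mult_minus1)
qed (simp add: const0_def)

lemma function_form_eq: "function_form f p = const0 (f p)"
  by (rule ext) (simp add: function_form_def const0_def)

lemma wdg_map: "wdg a b (map L vs) = wdg (\<lambda>us. a (map L us)) (\<lambda>us. b (map L us)) vs"
proof (induction vs arbitrary: a b)
  case (Cons v vs)
  show ?case by (simp add: Cons.IH)
qed simp

lemma wdg_homogeneous:
  assumes "\<And>us. length us \<noteq> k \<Longrightarrow> a us = 0" "\<And>us. length us \<noteq> m \<Longrightarrow> b us = 0" "length vs \<noteq> k + m"
  shows "wdg a b vs = 0"
  using assms
proof (induction vs arbitrary: a b k m)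
  case (Cons v vs)
  have "wdg (\<lambda>us. a (v # us)) b vs = 0"
  proof (cases k)
    case 0
    then have "(\<lambda>us. a (v # us)) = (\<lambda>us. 0)" using Cons.prems(1) by auto
    then show ?thesis by (simp add: wdg_zero_left)
  next
    case (Suc k')
    show ?thesis by (rule Cons.IH[of k' _ m]) (use Cons.prems Suc in auto)
  qed
  moreover have "wdg (\<lambda>us. (-1) ^ length us * a us) (\<lambda>us. b (v # us)) vs = 0"
  proof (cases m)
    case 0
    then have "(\<lambda>us. b (v # us)) = (\<lambda>us. 0)" using Cons.prems(2) by auto
    then show ?thesis by (simp add: wdg_zero_right)
  next
    case (Suc m')
    show ?thesis by (rule Cons.IH[of k _ m']) (use Cons.prems Suc in auto)
  qed
  ultimately show ?case by simp
qed auto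

lemma wdg_sum_left: "wdg (\<lambda>us. \<Sum>i\<in>I. a i us) b vs = (\<Sum>i\<in>I. wdg (a i) b vs)"
  by (induction I rule: infinite_finite_induct) (simp_all add: wdg_zero_left wdg_add_left)

lemma wdg_sum_right: "wdg a (\<lambda>us. \<Sum>i\<in>I. b i us) vs = (\<Sum>i\<in>I. wdg a (b i) vs)"
  by (induction I rule: infinite_finite_induct) (simp_all add: wdg_zero_right wdg_add_right)

section \<open>Alternating multilinear forms\<close>

definition multilinear :: "('a::real_vector list \<Rightarrow> complex) \<Rightarrow> bool" where
  "multilinear a \<longleftrightarrow> (\<forall>us ws v w x y.
     a (us @ (x *\<^sub>R v + y *\<^sub>R w) # ws) = x *\<^sub>R a (us @ v # ws) + y *\<^sub>R a (us @ w # ws))"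

abbreviation alternating :: "('a::real_vector list \<Rightarrow> complex) \<Rightarrow> bool" where
  "alternating \<equiv> alternating_multilinear UNIV"

lemma alternating_iff: "alternating a \<longleftrightarrow> multilinear a \<and> (\<forall>vs. \<not> distinct vs \<longrightarrow> a vs = 0)"
  by (simp add: alternating_multilinear_def multilinear_def)

lemma multilinearD: "multilinear a \<Longrightarrow>
    a (us @ (x *\<^sub>R v + y *\<^sub>R w) # ws) = x *\<^sub>R a (us @ v # ws) + y *\<^sub>R a (us @ w # ws)"
  by (simp add: multilinear_def)

lemma multilinear_add: "multilinear a \<Longrightarrow> a (us @ (v + w) # ws) = a (us @ v # ws) + a (us @ w # ws)"
  using multilinearD[of a us 1 v 1 w ws] by simp

lemma multilinear_scale: "multilinear a \<Longrightarrow> a (us @ (x *\<^sub>R v) # ws) = x *\<^sub>R a (us @ v # ws)"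
  using multilinearD[of a us x v 0 v ws] by simp

lemma multilinear_zero: "multilinear a \<Longrightarrow> a (us @ 0 # ws) = 0"
  using multilinear_scale[of a us 0 0 ws] by simp

lemma multilinear_sum:
  "multilinear a \<Longrightarrow> a (us @ (\<Sum>b\<in>S. c b *\<^sub>R g b) # ws) = (\<Sum>b\<in>S. c b *\<^sub>R a (us @ g b # ws))"
  by (induction S rule: infinite_finite_induct)
    (simp_all add: multilinear_zero multilinear_add multilinear_scale)

lemma multilinear_basis:
  fixes v :: "'a::euclidean_space"
  shows "multilinear a \<Longrightarrow> a (us @ v # ws) = (\<Sum>b\<in>Basis. (v \<bullet> b) *\<^sub>R a (us @ b # ws))"
  using multilinear_sum[of a us "\<lambda>b. v \<bullet> b" "\<lambda>b. b" Basis ws] by (simp add: euclidean_representation)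

lemma alternating_multilin: "alternating a \<Longrightarrow> multilinear a"
  by (simp add: alternating_iff)

lemma adjacent_swap:
  assumes "multilinear a" "\<And>us v ws. a (us @ v # v # ws) = 0"
  shows "a (us @ v # w # ws) = - a (us @ w # v # ws)"
proof -
  have "0 = a (us @ (v + w) # (v + w) # ws)" using assms(2) by simp
  also have "\<dots> = a (us @ v # (v + w) # ws) + a (us @ w # (v + w) # ws)"
    by (rule multilinear_add[OF assms(1)])
  also have "a (us @ v # (v + w) # ws) = a (us @ v # w # ws)"
    using multilinear_add[OF assms(1), of "us @ [v]" v w ws] assms(2) by simp
  also have "a (us @ w # (v + w) # ws) = a (us @ w # v # ws)"
    using multilinear_add[OF assms(1), of "us @ [w]" v w ws] assms(2) by simp
  finally show ?thesis by (simp add: eq_neg_iff_add_eq_0)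
qed

text \<open>Transposing neighbours brings two equal vectors together, so only adjacent repetitions
  have to be excluded. Inductions along the prefix \<open>us\<close> can deliver the condition in
  this form.\<close>

lemma alternatingI:
  assumes "multilinear a" "\<And>us v ws. a (us @ v # v # ws) = 0"
  shows "alternating a"
proof -
  have *: "a (xs @ y # ys @ y # zs) = 0" for xs y ys zs
  proof (induction ys arbitrary: xs)
    case Nil
    show ?case using assms(2)[of xs y zs] by simp
  next
    case (Cons u ys)
    show ?case
      using Cons.IH[of "xs @ [u]"] adjacent_swap[OF assms, of xs y u "ys @ y # zs"] by simp
  qed
  have "a vs = 0" if nd: "\<not> distinct vs" for vs
  proof -
    obtain xs y ys zs where "vs = xs @ [y] @ ys @ [y] @ zs" using not_distinct_decomp[OF nd] by blast
    then show ?thesis using * by simp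
  qed
  with assms(1) show ?thesis by (simp add: alternating_iff)
qed

lemma alternating_adjacent: "alternating a \<Longrightarrow> a (us @ v # v # ws) = 0"
  by (simp add: alternating_iff)

lemma alternating_swap: "alternating a \<Longrightarrow> a (v # w # ws) = - a (w # v # ws)"
  using adjacent_swap[of a "[]" v w ws] by (simp add: alternating_iff)

lemma multilinear_ins: "multilinear a \<Longrightarrow> multilinear (\<lambda>us. a (v # us))"
  unfolding multilinear_def by (metis append_Cons)

lemma alternating_ins: "alternating a \<Longrightarrow> alternating (\<lambda>us. a (v # us))"
  by (auto simp: alternating_iff multilinear_ins)

lemma alternating_move: "alternating a \<Longrightarrow> a (us @ w # ws) = (-1) ^ length us * a (w # us @ ws)"
proof (induction us arbitrary: a)
  case (Cons u us)
  from Cons.IH[OF alternating_ins[OF Cons.prems, of u]] alternating_swap[OF Cons.prems, of u w "us @ ws"]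
  show ?case by simp
qed simp

lemma multilinear_sign: "multilinear a \<Longrightarrow> multilinear (\<lambda>us. (-1) ^ length us * a us)"
  unfolding multilinear_def by (simp add: algebra_simps)

lemma alternating_sign: "alternating a \<Longrightarrow> alternating (\<lambda>us. (-1) ^ length us * a us)"
  by (simp add: alternating_iff multilinear_sign)

lemma alternating_zero: "alternating (\<lambda>us. 0)"
  by (simp add: alternating_iff multilinear_def)

lemma alternating_add: "alternating a \<Longrightarrow> alternating b \<Longrightarrow> alternating (\<lambda>us. a us + b us)"
  by (simp add: alternating_iff multilinear_def algebra_simps)

lemma alternating_cmult: "alternating a \<Longrightarrow> alternating (\<lambda>us. c * a us)"
  by (simp add: alternating_iff multilinear_def algebra_simps)

lemma multilinear_wdg: "multilinear a \<Longrightarrow> multilinear b \<Longrightarrow> multilinear (wdg a b)"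
proof -
  have "wdg a b (us @ (x *\<^sub>R v + y *\<^sub>R w) # ws) = x *\<^sub>R wdg a b (us @ v # ws) + y *\<^sub>R wdg a b (us @ w # ws)"
    if "multilinear a" "multilinear b" for us ws v w x y
    using that
  proof (induction us arbitrary: a b)
    case Nil
    have 1: "(\<lambda>us. a ((x *\<^sub>R v + y *\<^sub>R w) # us)) = (\<lambda>us. of_real x * a (v # us) + of_real y * a (w # us))"
      "(\<lambda>us. b ((x *\<^sub>R v + y *\<^sub>R w) # us)) = (\<lambda>us. of_real x * b (v # us) + of_real y * b (w # us))"
      using multilinearD[OF Nil(1), of "[]"] multilinearD[OF Nil(2), of "[]"]
      by (auto simp: scaleR_conv_of_real)
    show ?case
      unfolding append_Nil wdg.simps 1 wdg_add_left wdg_add_right wdg_cmult_left wdg_cmult_right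
      by (simp add: scaleR_conv_of_real algebra_simps)
  next
    case (Cons u us)
    show ?case
      unfolding append_Cons wdg.simps Cons.IH[OF multilinear_ins[OF Cons.prems(1)] Cons.prems(2)]
        Cons.IH[OF multilinear_sign[OF Cons.prems(1)] multilinear_ins[OF Cons.prems(2)]]
      by (simp add: algebra_simps)
  qed
  then show "multilinear a \<Longrightarrow> multilinear b \<Longrightarrow> ?thesis" unfolding multilinear_def[of "wdg a b"] by blast
qed

text \<open>When the repeated vector stands at the head, the terms with both copies in one factor
  vanish and the two mixed terms cancel: the degree sign flips once a copy has entered the left
  factor.\<close>

lemma alternating_wdg:
  assumes "alternating a" "alternating b"
  shows "alternating (wdg a b)"
proof (rule alternatingI)
  show "multilinear (wdg a b)" using assms by (intro multilinear_wdg alternating_multilin)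
  show "wdg a b (us @ v # v # ws) = 0" for us v ws
    using assms
  proof (induction us arbitrary: a b)
    case Nil
    have 1: "(\<lambda>us. a (v # v # us)) = (\<lambda>us. 0)" "(\<lambda>us. b (v # v # us)) = (\<lambda>us. 0)"
      using alternating_adjacent[OF Nil(1), of "[]"] alternating_adjacent[OF Nil(2), of "[]"] by auto
    have 2: "(\<lambda>us. (-1) ^ length (v # us) * a (v # us)) = (\<lambda>us. - ((-1) ^ length us * a (v # us)))" by simp
    show ?case unfolding append_Nil wdg.simps 1 2 by (simp add: wdg_zero_left wdg_zero_right wdg_minus_left)
  next
    case (Cons u us)
    show ?case
      unfolding append_Cons wdg.simps Cons.IH[OF alternating_ins[OF Cons.prems(1)] Cons.prems(2)]
        Cons.IH[OF alternating_sign[OF Cons.prems(1)] alternating_ins[OF Cons.prems(2)]]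
      by simp
  qed
qed

lemma alternating_const0: "alternating (const0 c)"
  by (rule alternatingI) (auto simp: multilinear_def const0_def)

section \<open>Exterior calculus on open sets: derivative, pullback, fibre integration,
  homotopies\<close>

section \<open>The exterior derivative\<close>

text \<open>Smoothness separated from alternation: inductions over the list of vectors pass to
  contractions and to sign twists, and this condition is stable under both.\<close>

definition smooth_coeffs :: "'a::euclidean_space set \<Rightarrow> 'a form \<Rightarrow> bool" where
  "smooth_coeffs U \<alpha> \<longleftrightarrow> (\<forall>vs. smooth_on U (\<lambda>q. \<alpha> q vs))"

lemma ambient_form_iff:
  "ambient_form U \<alpha> \<longleftrightarrow> (\<forall>q\<in>U. alternating (\<alpha> q)) \<and> smooth_coeffs U \<alpha>"
  by (simp add: ambient_form_def smooth_coeffs_def)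

lemma ambient_form_alternating: "ambient_form U \<alpha> \<Longrightarrow> q \<in> U \<Longrightarrow> alternating (\<alpha> q)"
  by (simp add: ambient_form_def)

lemma ambient_form_smooth: "ambient_form U \<alpha> \<Longrightarrow> smooth_coeffs U \<alpha>"
  by (simp add: ambient_form_iff)

lemma smooth_coeffsD: "smooth_coeffs U \<alpha> \<Longrightarrow> smooth_on U (\<lambda>q. \<alpha> q vs)"
  by (simp add: smooth_coeffs_def)

lemma smooth_coeffs_ins: "smooth_coeffs U \<alpha> \<Longrightarrow> smooth_coeffs U (\<lambda>q us. \<alpha> q (v # us))"
  by (simp add: smooth_coeffs_def)

lemma smooth_coeffs_sign:
  "open U \<Longrightarrow> smooth_coeffs U \<alpha> \<Longrightarrow> smooth_coeffs U (\<lambda>q us. (-1) ^ length us * \<alpha> q us)"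
  unfolding smooth_coeffs_def by (intro allI smooth_on_mult smooth_on_const) blast+

lemma smooth_coeffs_add:
  "open U \<Longrightarrow> smooth_coeffs U \<alpha> \<Longrightarrow> smooth_coeffs U \<beta> \<Longrightarrow> smooth_coeffs U (\<lambda>q us. \<alpha> q us + \<beta> q us)"
  unfolding smooth_coeffs_def by (intro allI smooth_on_add) blast+

lemma smooth_coeffs_cmult:
  "open U \<Longrightarrow> smooth_coeffs U \<alpha> \<Longrightarrow> smooth_coeffs U (\<lambda>q us. c * \<alpha> q us)"
  unfolding smooth_coeffs_def by (intro allI smooth_on_mult smooth_on_const) blast+

lemma smooth_coeffs_fmult:
  "open U \<Longrightarrow> smooth_on U f \<Longrightarrow> smooth_coeffs U \<alpha> \<Longrightarrow> smooth_coeffs U (\<lambda>q us. f q * \<alpha> q us)"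
  unfolding smooth_coeffs_def by (intro allI smooth_on_mult) blast+

lemma frechet_cong:
  assumes "open U" "p \<in> U" "\<And>q. q \<in> U \<Longrightarrow> f q = g q"
  shows "frechet_derivative f (at p) = frechet_derivative g (at p)"
proof -
  have "(f has_derivative f') (at p) \<longleftrightarrow> (g has_derivative f') (at p)" for f'
    using has_derivative_transform_within_open[OF _ assms(1,2), of f f' UNIV g]
      has_derivative_transform_within_open[OF _ assms(1,2), of g f' UNIV f] assms(3) by auto
  then show ?thesis by (simp add: frechet_derivative_def)
qed

lemma frechet_add:
  assumes "smooth_on U f" "smooth_on U g" "p \<in> U"
  shows "frechet_derivative (\<lambda>q. f q + g q) (at p) v
    = frechet_derivative f (at p) v + frechet_derivative g (at p) v"
  by (simp add: frechet_derivative_eqI[OF has_derivative_add[OF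
    smooth_on_has_derivative[OF assms(1,3)] smooth_on_has_derivative[OF assms(2,3)]]])

lemma frechet_mult:
  fixes f g :: "'a::real_normed_vector \<Rightarrow> complex"
  assumes "smooth_on U f" "smooth_on U g" "p \<in> U"
  shows "frechet_derivative (\<lambda>q. f q * g q) (at p) v
    = f p * frechet_derivative g (at p) v + frechet_derivative f (at p) v * g p"
  by (simp add: frechet_derivative_eqI[OF has_derivative_mult[OF
    smooth_on_has_derivative[OF assms(1,3)] smooth_on_has_derivative[OF assms(2,3)]]])

lemma frechet_cmult:
  fixes f :: "'a::real_normed_vector \<Rightarrow> complex"
  assumes "smooth_on U f" "p \<in> U"
  shows "frechet_derivative (\<lambda>q. c * f q) (at p) v = c * frechet_derivative f (at p) v"
  by (simp add: frechet_derivative_eqI[OF has_derivative_mult_right[OF smooth_on_has_derivative[OF assms]]])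

lemma frechet_sum:
  assumes "\<And>i. i \<in> I \<Longrightarrow> smooth_on U (f i)" "p \<in> U"
  shows "frechet_derivative (\<lambda>q. \<Sum>i\<in>I. f i q) (at p) v = (\<Sum>i\<in>I. frechet_derivative (f i) (at p) v)"
  by (simp add: frechet_derivative_eqI[OF has_derivative_sum[OF smooth_on_has_derivative[OF assms]]])

lemma ambient_deriv_Nil [simp]: "ambient_deriv \<eta> p [] = 0"
  by (simp add: ambient_deriv_def)

text \<open>Cartan's formula for a constant vector field.\<close>

lemma ambient_deriv_Cons:
  "ambient_deriv \<eta> p (v # vs) = frechet_derivative (\<lambda>q. \<eta> q vs) (at p) v
     - ambient_deriv (\<lambda>q us. \<eta> q (v # us)) p vs"
  by (simp add: ambient_deriv_def sum.lessThan_Suc_shift sum_negf del: sum.lessThan_Suc)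

lemma ambient_deriv_cong:
  assumes "open U" "p \<in> U" "\<And>q vs. q \<in> U \<Longrightarrow> \<alpha> q vs = \<beta> q vs"
  shows "ambient_deriv \<alpha> p vs = ambient_deriv \<beta> p vs"
  unfolding ambient_deriv_def
  by (intro sum.cong refl arg_cong2[where f = "(*)"] fun_cong[OF frechet_cong[OF assms(1,2)]] assms(3))

lemma ambient_deriv_add:
  assumes "smooth_coeffs U \<alpha>" "smooth_coeffs U \<beta>" "p \<in> U"
  shows "ambient_deriv (\<lambda>q us. \<alpha> q us + \<beta> q us) p vs = ambient_deriv \<alpha> p vs + ambient_deriv \<beta> p vs"
  unfolding ambient_deriv_def
  by (simp add: frechet_add[OF smooth_coeffsD[OF assms(1)] smooth_coeffsD[OF assms(2)] assms(3)]
      distrib_left sum.distrib)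

lemma ambient_deriv_cmult:
  assumes "smooth_coeffs U \<alpha>" "p \<in> U"
  shows "ambient_deriv (\<lambda>q us. c * \<alpha> q us) p vs = c * ambient_deriv \<alpha> p vs"
  unfolding ambient_deriv_def
  by (simp add: frechet_cmult[OF smooth_coeffsD[OF assms(1)] assms(2)] sum_distrib_left ac_simps)

lemma ambient_deriv_zero [simp]: "ambient_deriv (\<lambda>q us. 0) p vs = 0"
  by (simp add: ambient_deriv_def)

lemma ambient_deriv_minus:
  assumes "smooth_coeffs U \<alpha>" "p \<in> U"
  shows "ambient_deriv (\<lambda>q us. - \<alpha> q us) p vs = - ambient_deriv \<alpha> p vs"
  using ambient_deriv_cmult[OF assms, of "-1"] by simp

lemma ambient_deriv_diff:
  assumes "open U" "smooth_coeffs U \<alpha>" "smooth_coeffs U \<beta>" "p \<in> U"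
  shows "ambient_deriv (\<lambda>q us. \<alpha> q us - \<beta> q us) p vs = ambient_deriv \<alpha> p vs - ambient_deriv \<beta> p vs"
  using ambient_deriv_add[OF assms(2) smooth_coeffs_cmult[OF assms(1,3), of "-1"] assms(4)]
    ambient_deriv_minus[OF assms(3,4)] by simp

text \<open>On a list of length \<open>n\<close> the derivative evaluates the form on lists of
  length \<open>n - 1\<close>, hence the extra sign: \<open>d\<close> anticommutes with the degree
  involution.\<close>

lemma ambient_deriv_sign:
  assumes "smooth_coeffs U \<alpha>" "p \<in> U"
  shows "ambient_deriv (\<lambda>q us. (-1) ^ length us * \<alpha> q us) p vs = - ((-1) ^ length vs * ambient_deriv \<alpha> p vs)"
proof -
  have "(-1) ^ i * frechet_derivative (\<lambda>q. (-1) ^ length (take i vs @ drop (Suc i) vs) * \<alpha> q (take i vs @ drop (Suc i) vs)) (at p) (vs ! i)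
     = - ((-1) ^ length vs * ((-1) ^ i * frechet_derivative (\<lambda>q. \<alpha> q (take i vs @ drop (Suc i) vs)) (at p) (vs ! i)))"
    if "i < length vs" for i
  proof -
    have "(-1) ^ length (take i vs @ drop (Suc i) vs) = - ((-1::complex) ^ length vs)"
      using that by (cases "length vs") (auto simp: min_absorb2)
    then show ?thesis
      using frechet_cmult[OF smooth_coeffsD[OF assms(1)] assms(2), of "- ((-1) ^ length vs)"] by (simp only:) simp
  qed
  then show ?thesis
    unfolding ambient_deriv_def sum_distrib_left sum_negf[symmetric] by (intro sum.cong) auto
qed

lemma smooth_coeffs_wdg:
  assumes "open U" "smooth_coeffs U \<alpha>" "smooth_coeffs U \<beta>"
  shows "smooth_coeffs U (\<lambda>q. wdg (\<alpha> q) (\<beta> q))"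
proof -
  have "smooth_on U (\<lambda>q. wdg (\<alpha> q) (\<beta> q) vs)" for vs
    using assms(2,3)
  proof (induction vs arbitrary: \<alpha> \<beta>)
    case Nil
    show ?case unfolding wdg.simps
      by (intro smooth_on_mult[OF assms(1)] smooth_coeffsD Nil)
  next
    case (Cons v vs)
    show ?case unfolding wdg.simps
      by (intro smooth_on_add[OF assms(1)] Cons.IH[OF smooth_coeffs_ins[OF Cons.prems(1)] Cons.prems(2)]
          Cons.IH[OF smooth_coeffs_sign[OF assms(1) Cons.prems(1)] smooth_coeffs_ins[OF Cons.prems(2)]])
  qed
  then show ?thesis by (simp add: smooth_coeffs_def)
qed

lemma frechet_wdg:
  assumes "open U" "smooth_coeffs U \<alpha>" "smooth_coeffs U \<beta>" "p \<in> U"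
  shows "frechet_derivative (\<lambda>q. wdg (\<alpha> q) (\<beta> q) vs) (at p) v
     = wdg (\<lambda>us. frechet_derivative (\<lambda>q. \<alpha> q us) (at p) v) (\<beta> p) vs
     + wdg (\<alpha> p) (\<lambda>us. frechet_derivative (\<lambda>q. \<beta> q us) (at p) v) vs"
  using assms(2,3)
proof (induction vs arbitrary: \<alpha> \<beta>)
  case Nil
  show ?case unfolding wdg.simps
    by (subst frechet_mult[OF smooth_coeffsD[OF Nil(1)] smooth_coeffsD[OF Nil(2)] assms(4)]) simp
next
  case (Cons w vs)
  note s1 = smooth_coeffs_ins[OF Cons.prems(1)] smooth_coeffs_ins[OF Cons.prems(2)]
    smooth_coeffs_sign[OF assms(1) Cons.prems(1)]
  show ?case unfolding wdg.simps
    by (subst frechet_add[OF smooth_coeffsD[OF smooth_coeffs_wdg[OF assms(1) s1(1) Cons.prems(2)]]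
          smooth_coeffsD[OF smooth_coeffs_wdg[OF assms(1) s1(3) s1(2)]] assms(4)])
      (simp add: Cons.IH[OF s1(1) Cons.prems(2)] Cons.IH[OF s1(3) s1(2)]
        frechet_cmult[OF smooth_coeffsD[OF Cons.prems(1)] assms(4)])
qed

text \<open>Graded Leibniz rule, with the sign expressed by the degree involution. After contraction
  with the leading vector, Cartan's formula on the left and the antiderivation rule on the right
  leave the same statement for contracted factors.\<close>

lemma ambient_deriv_wdg:
  assumes "open U" "smooth_coeffs U \<alpha>" "smooth_coeffs U \<beta>" "p \<in> U"
  shows "ambient_deriv (\<lambda>q. wdg (\<alpha> q) (\<beta> q)) p vs
    = wdg (ambient_deriv \<alpha> p) (\<beta> p) vs + wdg (\<lambda>us. (-1) ^ length us * \<alpha> p us) (ambient_deriv \<beta> p) vs"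
  using assms(2,3)
proof (induction vs arbitrary: \<alpha> \<beta>)
  case (Cons v vs)
  note s = smooth_coeffs_ins[OF Cons.prems(1), of v] smooth_coeffs_ins[OF Cons.prems(2), of v]
    smooth_coeffs_sign[OF assms(1) Cons.prems(1)]
  have sgn: "ambient_deriv (\<lambda>q us. (-1) ^ length us * \<alpha> q us) p = (\<lambda>vs. - ((-1) ^ length vs * ambient_deriv \<alpha> p vs))"
    by (rule ext) (rule ambient_deriv_sign[OF Cons.prems(1) assms(4)])
  have ins: "ambient_deriv (\<lambda>q us. wdg (\<lambda>us. \<alpha> q (v # us)) (\<beta> q) us
       + wdg (\<lambda>us. (-1) ^ length us * \<alpha> q us) (\<lambda>us. \<beta> q (v # us)) us) p vs
     = ambient_deriv (\<lambda>q. wdg (\<lambda>us. \<alpha> q (v # us)) (\<beta> q)) p vs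
     + ambient_deriv (\<lambda>q. wdg (\<lambda>us. (-1) ^ length us * \<alpha> q us) (\<lambda>us. \<beta> q (v # us))) p vs"
    by (rule ambient_deriv_add[OF smooth_coeffs_wdg[OF assms(1) s(1) Cons.prems(2)]
          smooth_coeffs_wdg[OF assms(1) s(3) s(2)] assms(4)])
  have l: "(\<lambda>us. (-1) ^ length (v # us) * \<alpha> p (v # us)) = (\<lambda>us. - ((-1) ^ length us * \<alpha> p (v # us)))" by simp
  show ?case
    unfolding ambient_deriv_Cons[of _ p v] frechet_wdg[OF assms(1) Cons.prems assms(4)] ins
      Cons.IH[OF s(1) Cons.prems(2)] Cons.IH[OF s(3) s(2)] sgn wdg.simps
      wdg_diff_left wdg_diff_right l wdg_minus_left sign_sign
    by simp
qed simp

lemma smooth_coeffs_deriv: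
  assumes "open U" "smooth_coeffs U \<alpha>"
  shows "smooth_coeffs U (ambient_deriv \<alpha>)"
  unfolding smooth_coeffs_def ambient_deriv_def
  by (intro allI smooth_on_sum[OF assms(1)] smooth_on_mult[OF assms(1)] smooth_on_const[OF assms(1)]
      smooth_on_frechet smooth_coeffsD[OF assms(2)])

lemma smooth_coeffs_frechet:
  "smooth_coeffs U \<alpha> \<Longrightarrow> smooth_coeffs U (\<lambda>q us. frechet_derivative (\<lambda>r. \<alpha> r us) (at q) v)"
  by (simp add: smooth_coeffs_def smooth_on_frechet)

text \<open>The derivative along a constant field is its Lie derivative; it commutes with
  \<open>d\<close> by symmetry of second derivatives.\<close>

lemma frechet_ambient_deriv:
  assumes "open U" "smooth_coeffs U \<alpha>" "p \<in> U"
  shows "frechet_derivative (\<lambda>q. ambient_deriv \<alpha> q vs) (at p) v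
    = ambient_deriv (\<lambda>q us. frechet_derivative (\<lambda>r. \<alpha> r us) (at q) v) p vs"
proof -
  have "frechet_derivative (\<lambda>q. ambient_deriv \<alpha> q vs) (at p) v
    = (\<Sum>i<length vs. frechet_derivative (\<lambda>q. (-1) ^ i *
     frechet_derivative (\<lambda>q. \<alpha> q (take i vs @ drop (Suc i) vs)) (at q) (vs ! i)) (at p) v)"
    unfolding ambient_deriv_def
    by (rule frechet_sum[OF _ assms(3)])
      (intro smooth_on_mult[OF assms(1)] smooth_on_const[OF assms(1)] smooth_on_frechet smooth_coeffsD[OF assms(2)])
  also have "\<dots> = (\<Sum>i<length vs. (-1) ^ i * frechet_derivative
     (\<lambda>q. frechet_derivative (\<lambda>q. \<alpha> q (take i vs @ drop (Suc i) vs)) (at q) v) (at p) (vs ! i))"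
  proof (rule sum.cong[OF refl])
    fix i
    let ?vs = "take i vs @ drop (Suc i) vs"
    show "frechet_derivative (\<lambda>q. (-1) ^ i * frechet_derivative (\<lambda>q. \<alpha> q ?vs) (at q) (vs ! i)) (at p) v
      = (-1) ^ i * frechet_derivative (\<lambda>q. frechet_derivative (\<lambda>q. \<alpha> q ?vs) (at q) v) (at p) (vs ! i)"
      unfolding frechet_cmult[OF smooth_on_frechet[OF smooth_coeffsD[OF assms(2)]] assms(3)]
      by (subst smooth_on_symmetric[OF smooth_coeffsD[OF assms(2)] assms(1,3)]) (rule refl)
  qed
  finally show ?thesis by (simp add: ambient_deriv_def)
qed

text \<open>With \<open>L\<close> the Lie derivative along \<open>v\<close> and \<open>i\<close> the
  contraction, Cartan's formula gives \<open>i d d = L d - d i d = L d - d L + d d i\<close>. The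
  terms with \<open>L\<close> cancel, and the induction continues with the contracted form.\<close>

lemma ambient_deriv_deriv:
  assumes "open U" "smooth_coeffs U \<alpha>" "p \<in> U"
  shows "ambient_deriv (ambient_deriv \<alpha>) p vs = 0"
  using assms(2)
proof (induction vs arbitrary: \<alpha>)
  case (Cons v vs)
  have "ambient_deriv (ambient_deriv \<alpha>) p (v # vs)
      = ambient_deriv (\<lambda>q us. frechet_derivative (\<lambda>r. \<alpha> r us) (at q) v) p vs
      - (ambient_deriv (\<lambda>q us. frechet_derivative (\<lambda>r. \<alpha> r us) (at q) v) p vs
         - ambient_deriv (ambient_deriv (\<lambda>q us. \<alpha> q (v # us))) p vs)"
    unfolding ambient_deriv_Cons[of _ _ v] frechet_ambient_deriv[OF assms(1) Cons.prems assms(3)]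
    by (subst ambient_deriv_diff[OF assms(1) smooth_coeffs_frechet[OF Cons.prems]
        smooth_coeffs_deriv[OF assms(1) smooth_coeffs_ins[OF Cons.prems]] assms(3)]) simp
  with Cons.IH[OF smooth_coeffs_ins[OF Cons.prems]] show ?case by simp
qed simp

lemma multilinear_deriv:
  assumes "open U" "smooth_coeffs U \<alpha>" "\<And>q. q \<in> U \<Longrightarrow> multilinear (\<alpha> q)" "p \<in> U"
  shows "multilinear (ambient_deriv \<alpha> p)"
proof -
  have "ambient_deriv \<alpha> p (us @ (x *\<^sub>R v + y *\<^sub>R w) # ws)
    = of_real x * ambient_deriv \<alpha> p (us @ v # ws) + of_real y * ambient_deriv \<alpha> p (us @ w # ws)" for us ws v w x y
    using assms(2,3)
  proof (induction us arbitrary: \<alpha>)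
    case Nil
    have lin: "linear (frechet_derivative (\<lambda>q. \<alpha> q ws) (at p))"
      by (rule smooth_on_frechet_linear[OF smooth_coeffsD[OF Nil(1)] assms(4)])
    have "ambient_deriv (\<lambda>q us. \<alpha> q ((x *\<^sub>R v + y *\<^sub>R w) # us)) p ws
      = ambient_deriv (\<lambda>q us. of_real x * \<alpha> q (v # us) + of_real y * \<alpha> q (w # us)) p ws"
      using multilinearD[OF Nil(2), of _ "[]"]
      by (intro ambient_deriv_cong[OF assms(1,4)]) (simp add: scaleR_conv_of_real)
    also have "\<dots> = of_real x * ambient_deriv (\<lambda>q us. \<alpha> q (v # us)) p ws
        + of_real y * ambient_deriv (\<lambda>q us. \<alpha> q (w # us)) p ws"
      by (subst ambient_deriv_add[OF smooth_coeffs_cmult[OF assms(1) smooth_coeffs_ins[OF Nil(1)]]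
            smooth_coeffs_cmult[OF assms(1) smooth_coeffs_ins[OF Nil(1)]] assms(4)])
        (simp add: ambient_deriv_cmult[OF smooth_coeffs_ins[OF Nil(1)] assms(4)])
    finally show ?case
      by (simp add: ambient_deriv_Cons linear_add[OF lin] linear_scale[OF lin] scaleR_conv_of_real algebra_simps)
  next
    case (Cons u us)
    have "frechet_derivative (\<lambda>q. \<alpha> q (us @ (x *\<^sub>R v + y *\<^sub>R w) # ws)) (at p)
        = frechet_derivative (\<lambda>q. of_real x * \<alpha> q (us @ v # ws) + of_real y * \<alpha> q (us @ w # ws)) (at p)"
      using multilinearD[OF Cons.prems(2)]
      by (intro frechet_cong[OF assms(1,4)]) (simp add: scaleR_conv_of_real)
    then have "frechet_derivative (\<lambda>q. \<alpha> q (us @ (x *\<^sub>R v + y *\<^sub>R w) # ws)) (at p) u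
       = of_real x * frechet_derivative (\<lambda>q. \<alpha> q (us @ v # ws)) (at p) u
       + of_real y * frechet_derivative (\<lambda>q. \<alpha> q (us @ w # ws)) (at p) u"
      using frechet_add[OF smooth_coeffsD[OF smooth_coeffs_cmult[OF assms(1) Cons.prems(1)]]
            smooth_coeffsD[OF smooth_coeffs_cmult[OF assms(1) Cons.prems(1)]] assms(4)]
      by (simp add: frechet_cmult[OF smooth_coeffsD[OF Cons.prems(1)] assms(4)])
    moreover note Cons.IH[OF smooth_coeffs_ins[OF Cons.prems(1)] multilinear_ins[OF Cons.prems(2)], of u]
    ultimately show ?case
      by (simp add: ambient_deriv_Cons algebra_simps)
  qed
  then show ?thesis by (simp add: multilinear_def scaleR_conv_of_real)
qed

lemma ambient_form_deriv:
  assumes "open U" "ambient_form U \<alpha>"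
  shows "ambient_form U (ambient_deriv \<alpha>)"
  unfolding ambient_form_iff
proof (intro conjI ballI smooth_coeffs_deriv assms ambient_form_smooth)
  fix p assume p: "p \<in> U"
  show "alternating (ambient_deriv \<alpha> p)"
  proof (rule alternatingI)
    show "multilinear (ambient_deriv \<alpha> p)"
      by (rule multilinear_deriv[OF assms(1) ambient_form_smooth[OF assms(2)]
        alternating_multilin[OF ambient_form_alternating[OF assms(2)]] p])
    show "ambient_deriv \<alpha> p (us @ v # v # ws) = 0" for us v ws
      using assms(2)
    proof (induction us arbitrary: \<alpha>)
      case Nil
      have "ambient_deriv (\<lambda>q us. \<alpha> q (v # v # us)) p ws = ambient_deriv (\<lambda>q us. 0) p ws"
        by (rule ambient_deriv_cong[OF assms(1) p])
          (rule alternating_adjacent[OF ambient_form_alternating[OF Nil], of _ "[]", simplified])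
      then show ?case by (simp add: ambient_deriv_Cons)
    next
      case (Cons u us)
      have "ambient_form U (\<lambda>q us. \<alpha> q (u # us))"
        using Cons.prems by (simp add: ambient_form_iff smooth_coeffs_ins alternating_ins)
      moreover have "frechet_derivative (\<lambda>q. \<alpha> q (us @ v # v # ws)) (at p) = frechet_derivative (\<lambda>q. 0) (at p)"
        by (rule frechet_cong[OF assms(1) p])
          (rule alternating_adjacent[OF ambient_form_alternating[OF Cons.prems]])
      ultimately show ?case using Cons.IH by (simp add: ambient_deriv_Cons)
    qed
  qed
qed

lemma ambient_form_add:
  "open U \<Longrightarrow> ambient_form U \<alpha> \<Longrightarrow> ambient_form U \<beta> \<Longrightarrow> ambient_form U (\<lambda>q vs. \<alpha> q vs + \<beta> q vs)"
  unfolding ambient_form_iff by (intro conjI ballI alternating_add smooth_coeffs_add) blast+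

lemma ambient_form_cmult:
  "open U \<Longrightarrow> ambient_form U \<alpha> \<Longrightarrow> ambient_form U (\<lambda>q vs. c * \<alpha> q vs)"
  unfolding ambient_form_iff by (intro conjI ballI alternating_cmult smooth_coeffs_cmult) blast+

lemma ambient_form_fmult:
  "open U \<Longrightarrow> smooth_on U f \<Longrightarrow> ambient_form U \<alpha> \<Longrightarrow> ambient_form U (\<lambda>q vs. f q * \<alpha> q vs)"
  unfolding ambient_form_iff by (intro conjI ballI alternating_cmult smooth_coeffs_fmult) blast+

lemma ambient_form_minus:
  "open U \<Longrightarrow> ambient_form U \<alpha> \<Longrightarrow> ambient_form U (\<lambda>q vs. - \<alpha> q vs)"
  using ambient_form_cmult[of U \<alpha> "-1"] by simp

lemma ambient_form_zero: "open U \<Longrightarrow> ambient_form U (\<lambda>q vs. 0)"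
  by (simp add: ambient_form_def alternating_zero smooth_on_const)

lemma ambient_form_wdg:
  "open U \<Longrightarrow> ambient_form U \<alpha> \<Longrightarrow> ambient_form U \<beta> \<Longrightarrow> ambient_form U (\<lambda>q. wdg (\<alpha> q) (\<beta> q))"
  unfolding ambient_form_iff by (intro conjI ballI alternating_wdg smooth_coeffs_wdg) blast+

lemma ambient_form_sign:
  "open U \<Longrightarrow> ambient_form U \<alpha> \<Longrightarrow> ambient_form U (\<lambda>q vs. (-1) ^ length vs * \<alpha> q vs)"
  unfolding ambient_form_iff by (intro conjI ballI alternating_sign smooth_coeffs_sign) blast+

lemma ambient_form_subset: "ambient_form U \<alpha> \<Longrightarrow> V \<subseteq> U \<Longrightarrow> ambient_form V \<alpha>"
  unfolding ambient_form_def using smooth_on_subset by blast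

lemma ambient_form_cong:
  assumes "open U" "\<And>q vs. q \<in> U \<Longrightarrow> \<alpha> q vs = \<beta> q vs" "ambient_form U \<alpha>"
  shows "ambient_form U \<beta>"
proof -
  have "\<alpha> q = \<beta> q" if "q \<in> U" for q using assms(2)[OF that] by blast
  moreover have "smooth_on U (\<lambda>q. \<beta> q vs)" for vs
    by (rule smooth_on_cong[OF assms(1) assms(2)]) (use assms(3) in \<open>auto simp: ambient_form_def\<close>)
  ultimately show ?thesis using assms(3) by (simp add: ambient_form_def)
qed

lemma ambient_form_const0:
  "open U \<Longrightarrow> smooth_on U f \<Longrightarrow> ambient_form U (\<lambda>q. const0 (f q))"
  unfolding ambient_form_def
proof (intro conjI ballI allI alternating_const0)
  fix vs :: "'a list"
  assume "open U" "smooth_on U f"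
  then show "smooth_on U (\<lambda>q. const0 (f q) vs)"
    by (cases vs) (simp_all add: const0_def smooth_on_const)
qed

section \<open>Pullback\<close>

definition pullback :: "('a::euclidean_space \<Rightarrow> 'b::euclidean_space) \<Rightarrow> 'b form \<Rightarrow> 'a form" where
  "pullback f \<omega> = (\<lambda>p vs. \<omega> (f p) (map (frechet_derivative f (at p)) vs))"

text \<open>Product rule for \<open>\<omega>\<close> evaluated at the moving point
  \<open>f p\<close> on moving vectors \<open>gs\<close>, with the vectors \<open>us\<close> held
  fixed. The leading moving vector is expanded in the basis, which turns it into coefficient
  functions and a fixed vector appended to \<open>us\<close>.\<close>

lemma has_derivative_form_eval:
  fixes f :: "'a::euclidean_space \<Rightarrow> 'b::euclidean_space"
  assumes U: "open U" and V: "open V" and f: "smooth_on U f" "f ` U \<subseteq> V" and \<omega>: "ambient_form V \<omega>"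
    and gs: "\<And>g. g \<in> set gs \<Longrightarrow> smooth_on U g" and p: "p \<in> U"
  shows "((\<lambda>p. \<omega> (f p) (us @ map (\<lambda>g. g p) gs)) has_derivative
     (\<lambda>v. frechet_derivative (\<lambda>q. \<omega> q (us @ map (\<lambda>g. g p) gs)) (at (f p)) (frechet_derivative f (at p) v)
       + (\<Sum>i<length gs. \<omega> (f p) (us @ (map (\<lambda>g. g p) gs)[i := frechet_derivative (gs ! i) (at p) v])))) (at p)"
  using gs
proof (induction gs arbitrary: us)
  case Nil
  have "f p \<in> V" using f(2) p by blast
  from has_derivative_compose[OF smooth_on_has_derivative[OF f(1) p]
      smooth_on_has_derivative[OF smooth_coeffsD[OF ambient_form_smooth[OF \<omega>]] this, of us]]
  show ?case by simp
next
  case (Cons g gs)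
  let ?r = "\<lambda>p. map (\<lambda>g. g p) gs"
  have fp: "f p \<in> V" using f(2) p by blast
  note ml = alternating_multilin[OF ambient_form_alternating[OF \<omega>]]
  note sm = smooth_coeffsD[OF ambient_form_smooth[OF \<omega>]]
  have g: "smooth_on U g" using Cons.prems by simp
  note dg = smooth_on_has_derivative[OF g p]
  have IH: "((\<lambda>p. \<omega> (f p) ((us @ [b]) @ ?r p)) has_derivative
     (\<lambda>v. frechet_derivative (\<lambda>q. \<omega> q ((us @ [b]) @ ?r p)) (at (f p)) (frechet_derivative f (at p) v)
       + (\<Sum>i<length gs. \<omega> (f p) ((us @ [b]) @ (?r p)[i := frechet_derivative (gs ! i) (at p) v])))) (at p)" for b
    by (rule Cons.IH) (use Cons.prems in simp)
  have "((\<lambda>p. \<Sum>b\<in>Basis. (g p \<bullet> b) *\<^sub>R \<omega> (f p) ((us @ [b]) @ ?r p)) has_derivative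
     (\<lambda>v. \<Sum>b\<in>Basis. (g p \<bullet> b) *\<^sub>R (frechet_derivative (\<lambda>q. \<omega> q ((us @ [b]) @ ?r p)) (at (f p)) (frechet_derivative f (at p) v)
       + (\<Sum>i<length gs. \<omega> (f p) ((us @ [b]) @ (?r p)[i := frechet_derivative (gs ! i) (at p) v])))
       + (frechet_derivative g (at p) v \<bullet> b) *\<^sub>R \<omega> (f p) ((us @ [b]) @ ?r p))) (at p)"
    by (intro has_derivative_sum has_derivative_scaleR has_derivative_inner_left dg IH)
  moreover have "(\<Sum>b\<in>Basis. (g p \<bullet> b) *\<^sub>R (frechet_derivative (\<lambda>q. \<omega> q ((us @ [b]) @ ?r p)) (at (f p)) (frechet_derivative f (at p) v)
       + (\<Sum>i<length gs. \<omega> (f p) ((us @ [b]) @ (?r p)[i := frechet_derivative (gs ! i) (at p) v])))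
       + (frechet_derivative g (at p) v \<bullet> b) *\<^sub>R \<omega> (f p) ((us @ [b]) @ ?r p))
     = frechet_derivative (\<lambda>q. \<omega> q (us @ map (\<lambda>g. g p) (g # gs))) (at (f p)) (frechet_derivative f (at p) v)
       + (\<Sum>i<length (g # gs). \<omega> (f p) (us @ (map (\<lambda>g. g p) (g # gs))[i := frechet_derivative ((g # gs) ! i) (at p) v]))" for v
  proof -
    have "frechet_derivative (\<lambda>q. \<omega> q (us @ g p # ?r p)) (at (f p))
        = frechet_derivative (\<lambda>q. \<Sum>b\<in>Basis. of_real (g p \<bullet> b) * \<omega> q (us @ b # ?r p)) (at (f p))"
      by (rule frechet_cong[OF V fp]) (simp add: multilinear_basis[OF ml, of _ us "g p"] scaleR_conv_of_real)
    also have "\<dots> = (\<lambda>w. \<Sum>b\<in>Basis. of_real (g p \<bullet> b) * frechet_derivative (\<lambda>q. \<omega> q (us @ b # ?r p)) (at (f p)) w)"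
      by (rule ext, subst frechet_sum[OF smooth_on_mult[OF V smooth_on_const[OF V] sm] fp])
        (simp add: frechet_cmult[OF sm fp])
    finally have 1: "frechet_derivative (\<lambda>q. \<omega> q (us @ g p # ?r p)) (at (f p)) w
       = (\<Sum>b\<in>Basis. (g p \<bullet> b) *\<^sub>R frechet_derivative (\<lambda>q. \<omega> q (us @ b # ?r p)) (at (f p)) w)" for w
      by (simp add: scaleR_conv_of_real)
    have 2: "\<omega> (f p) (us @ frechet_derivative g (at p) v # ?r p)
       = (\<Sum>b\<in>Basis. (frechet_derivative g (at p) v \<bullet> b) *\<^sub>R \<omega> (f p) (us @ b # ?r p))"
      by (rule multilinear_basis[OF ml[OF fp]])
    have 3: "(\<Sum>i<length gs. \<omega> (f p) (us @ g p # (?r p)[i := frechet_derivative (gs ! i) (at p) v]))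
      = (\<Sum>b\<in>Basis. (g p \<bullet> b) *\<^sub>R (\<Sum>i<length gs. \<omega> (f p) (us @ b # (?r p)[i := frechet_derivative (gs ! i) (at p) v])))"
      by (simp add: multilinear_basis[OF ml[OF fp], of us "g p"] scaleR_sum_right sum.swap[of _ "{..<length gs}"])
    show ?thesis
      by (simp add: sum.lessThan_Suc_shift 1 2 3 scaleR_add_right sum.distrib del: sum.lessThan_Suc)
  qed
  ultimately have *: "((\<lambda>p. \<Sum>b\<in>Basis. (g p \<bullet> b) *\<^sub>R \<omega> (f p) ((us @ [b]) @ ?r p)) has_derivative
     (\<lambda>v. frechet_derivative (\<lambda>q. \<omega> q (us @ map (\<lambda>g. g p) (g # gs))) (at (f p)) (frechet_derivative f (at p) v)
       + (\<Sum>i<length (g # gs). \<omega> (f p) (us @ (map (\<lambda>g. g p) (g # gs))[i := frechet_derivative ((g # gs) ! i) (at p) v])))) (at p)"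
    by (simp only:)
  show ?case
  proof (rule has_derivative_transform_within_open[OF * U p])
    fix x assume "x \<in> U"
    then have "f x \<in> V" using f(2) by blast
    from multilinear_basis[OF ml[OF this], of us "g x" "?r x"]
    show "(\<Sum>b\<in>Basis. (g x \<bullet> b) *\<^sub>R \<omega> (f x) ((us @ [b]) @ ?r x)) = \<omega> (f x) (us @ map (\<lambda>g. g x) (g # gs))"
      by simp
  qed
qed

lemma smooth_on_form_eval:
  fixes f :: "'a::euclidean_space \<Rightarrow> 'b::euclidean_space"
  assumes U: "open U" and V: "open V" and f: "smooth_on U f" "f ` U \<subseteq> V" and \<omega>: "ambient_form V \<omega>"
    and gs: "\<And>g. g \<in> set gs \<Longrightarrow> smooth_on U g"
  shows "smooth_on U (\<lambda>p. \<omega> (f p) (us @ map (\<lambda>g. g p) gs))"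
  using gs
proof (induction gs arbitrary: us)
  case Nil
  show ?case
    using smooth_on_compose[OF U V smooth_coeffsD[OF ambient_form_smooth[OF \<omega>]] f(2,1), of us] by simp
next
  case (Cons g gs)
  have IH: "smooth_on U (\<lambda>p. \<omega> (f p) ((us @ [b]) @ map (\<lambda>g. g p) gs))" for b
    by (rule Cons.IH) (use Cons.prems in simp)
  have g: "smooth_on U g" using Cons.prems by simp
  show ?case
  proof (rule smooth_on_cong[OF U])
    show "smooth_on U (\<lambda>p. \<Sum>b\<in>Basis. (g p \<bullet> b) *\<^sub>R \<omega> (f p) ((us @ [b]) @ map (\<lambda>g. g p) gs))"
      by (intro smooth_on_sum[OF U] smooth_on_scaleR[OF U] IH smooth_on_linear[OF U bounded_linear_inner_left g])
    fix x assume "x \<in> U"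
    then have "f x \<in> V" using f(2) by blast
    from multilinear_basis[OF alternating_multilin[OF ambient_form_alternating[OF \<omega> this]], of us "g x" "map (\<lambda>g. g x) gs"]
    show "(\<Sum>b\<in>Basis. (g x \<bullet> b) *\<^sub>R \<omega> (f x) ((us @ [b]) @ map (\<lambda>g. g x) gs)) = \<omega> (f x) (us @ map (\<lambda>g. g x) (g # gs))"
      by simp
  qed
qed

lemma multilinear_map: "linear L \<Longrightarrow> multilinear a \<Longrightarrow> multilinear (\<lambda>us. a (map L us))"
  unfolding multilinear_def by (simp add: linear_add linear_scale)

lemma alternating_map: "linear L \<Longrightarrow> alternating a \<Longrightarrow> alternating (\<lambda>us. a (map L us))"
  by (rule alternatingI) (simp_all add: multilinear_map alternating_multilin alternating_adjacent)

lemma ambient_form_pullback: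
  fixes f :: "'a::euclidean_space \<Rightarrow> 'b::euclidean_space"
  assumes U: "open U" and V: "open V" and f: "smooth_on U f" "f ` U \<subseteq> V" and \<omega>: "ambient_form V \<omega>"
  shows "ambient_form U (pullback f \<omega>)"
  unfolding ambient_form_def
proof (intro conjI ballI allI)
  fix p assume "p \<in> U"
  with f(2) have "f p \<in> V" by blast
  then show "alternating (pullback f \<omega> p)"
    unfolding pullback_def
    by (intro alternating_map smooth_on_frechet_linear[OF f(1) \<open>p \<in> U\<close>] ambient_form_alternating[OF \<omega>])
next
  fix vs :: "'a list"
  have "smooth_on U (\<lambda>p. \<omega> (f p) ([] @ map (\<lambda>g. g p) (map (\<lambda>v p. frechet_derivative f (at p) v) vs)))"
    by (rule smooth_on_form_eval[OF assms]) (auto intro: smooth_on_frechet[OF f(1)])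
  then show "smooth_on U (\<lambda>p. pullback f \<omega> p vs)" by (simp add: pullback_def comp_def)
qed

text \<open>The terms of \<open>d (f\<^sup>* \<omega>)\<close> containing second derivatives of \<open>f\<close> cancel.\<close>

lemma second_derivative_terms_cancel:
  assumes "alternating \<alpha>" "\<And>v w. B v w = B w v"
  shows "(\<Sum>i<length vs. (-1) ^ i * (\<Sum>j<length vs - 1.
     \<alpha> ((map L (take i vs @ drop (Suc i) vs))[j := B ((take i vs @ drop (Suc i) vs) ! j) (vs ! i)]))) = 0"
  using assms(1)
proof (induction vs arbitrary: \<alpha>)
  case (Cons v vs)
  let ?n = "length vs"
  let ?d = "\<lambda>i. take i vs @ drop (Suc i) vs"
  have split: "(\<Sum>j<?n. \<alpha> ((L v # map L (?d i))[j := B ((v # ?d i) ! j) (vs ! i)]))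
     = \<alpha> (B v (vs ! i) # map L (?d i))
     + (\<Sum>j<?n - 1. \<alpha> (L v # (map L (?d i))[j := B (?d i ! j) (vs ! i)]))" if "i < ?n" for i
    using that by (cases ?n) (simp_all add: sum.lessThan_Suc_shift del: sum.lessThan_Suc)
  have first: "(\<Sum>j<?n. \<alpha> ((map L vs)[j := B (vs ! j) v])) = (\<Sum>j<?n. (-1) ^ j * \<alpha> (B v (vs ! j) # map L (?d j)))"
  proof (rule sum.cong[OF refl])
    fix j assume "j \<in> {..<?n}"
    then have j: "j < ?n" by simp
    have "(map L vs)[j := B (vs ! j) v] = map L (take j vs) @ B v (vs ! j) # map L (drop (Suc j) vs)"
      using j by (simp add: upd_conv_take_nth_drop take_map drop_map assms(2)[of v])
    then show "\<alpha> ((map L vs)[j := B (vs ! j) v]) = (-1) ^ j * \<alpha> (B v (vs ! j) # map L (?d j))"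
      using j alternating_move[OF Cons.prems, of "map L (take j vs)" "B v (vs ! j)"] by (simp add: min_absorb2)
  qed
  have "(\<Sum>i<length (v # vs). (-1) ^ i * (\<Sum>j<length (v # vs) - 1.
     \<alpha> ((map L (take i (v # vs) @ drop (Suc i) (v # vs)))[j := B ((take i (v # vs) @ drop (Suc i) (v # vs)) ! j) ((v # vs) ! i)])))
    = (\<Sum>j<?n. \<alpha> ((map L vs)[j := B (vs ! j) v]))
     + (\<Sum>i<?n. - ((-1) ^ i * (\<Sum>j<?n. \<alpha> ((L v # map L (?d i))[j := B ((v # ?d i) ! j) (vs ! i)]))))"
    by (simp add: sum.lessThan_Suc_shift del: sum.lessThan_Suc)
  also have "(\<Sum>i<?n. - ((-1) ^ i * (\<Sum>j<?n. \<alpha> ((L v # map L (?d i))[j := B ((v # ?d i) ! j) (vs ! i)]))))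
    = (\<Sum>i<?n. - ((-1) ^ i * \<alpha> (B v (vs ! i) # map L (?d i)))
       - (-1) ^ i * (\<Sum>j<?n - 1. \<alpha> (L v # (map L (?d i))[j := B (?d i ! j) (vs ! i)])))"
    by (rule sum.cong[OF refl]) (subst split; simp add: algebra_simps)
  also have "\<dots> = - (\<Sum>i<?n. (-1) ^ i * \<alpha> (B v (vs ! i) # map L (?d i)))"
    using Cons.IH[OF alternating_ins[OF Cons.prems, of "L v"]] by (simp add: sum_subtractf sum_negf)
  finally show ?case unfolding first by simp
qed simp

lemma ambient_deriv_pullback:
  fixes f :: "'a::euclidean_space \<Rightarrow> 'b::euclidean_space"
  assumes U: "open U" and V: "open V" and f: "smooth_on U f" "f ` U \<subseteq> V" and \<omega>: "ambient_form V \<omega>"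
    and p: "p \<in> U"
  shows "ambient_deriv (pullback f \<omega>) p vs = pullback f (ambient_deriv \<omega>) p vs"
proof -
  let ?L = "frechet_derivative f (at p)"
  let ?d = "\<lambda>i. take i vs @ drop (Suc i) vs"
  let ?B = "\<lambda>v w. frechet_derivative (\<lambda>q. frechet_derivative f (at q) v) (at p) w"
  have fp: "f p \<in> V" using f(2) p by blast
  have fd: "frechet_derivative (\<lambda>q. pullback f \<omega> q us) (at p) v
     = frechet_derivative (\<lambda>q. \<omega> q (map ?L us)) (at (f p)) (?L v)
       + (\<Sum>j<length us. \<omega> (f p) ((map ?L us)[j := ?B (us ! j) v]))" for us v
  proof -
    have "((\<lambda>p. \<omega> (f p) ([] @ map (\<lambda>g. g p) (map (\<lambda>v p. frechet_derivative f (at p) v) us))) has_derivative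
     (\<lambda>v. frechet_derivative (\<lambda>q. \<omega> q ([] @ map (\<lambda>g. g p) (map (\<lambda>v p. frechet_derivative f (at p) v) us))) (at (f p)) (?L v)
       + (\<Sum>i<length (map (\<lambda>v p. frechet_derivative f (at p) v) us). \<omega> (f p) ([] @ (map (\<lambda>g. g p) (map (\<lambda>v p. frechet_derivative f (at p) v) us))
          [i := frechet_derivative (map (\<lambda>v p. frechet_derivative f (at p) v) us ! i) (at p) v])))) (at p)"
      by (rule has_derivative_form_eval[OF U V f \<omega> _ p]) (auto intro: smooth_on_frechet[OF f(1)])
    from frechet_derivative_eqI[OF this] show ?thesis
      by (simp add: pullback_def comp_def)
  qed
  have len: "length (?d i) = length vs - 1" if "i < length vs" for i
    using that by (simp add: min_absorb2)
  have "ambient_deriv (pullback f \<omega>) p vs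
    = (\<Sum>i<length vs. (-1) ^ i * frechet_derivative (\<lambda>q. \<omega> q (map ?L (?d i))) (at (f p)) (?L (vs ! i))
       + (-1) ^ i * (\<Sum>j<length vs - 1. \<omega> (f p) ((map ?L (?d i))[j := ?B (?d i ! j) (vs ! i)])))"
    unfolding ambient_deriv_def fd distrib_left
    by (intro sum.cong refl) (simp only: len lessThan_iff)
  also have "\<dots> = (\<Sum>i<length vs. (-1) ^ i * frechet_derivative (\<lambda>q. \<omega> q (map ?L (?d i))) (at (f p)) (?L (vs ! i)))"
    unfolding sum.distrib
    using second_derivative_terms_cancel[OF ambient_form_alternating[OF \<omega> fp], of ?B ?L vs]
      smooth_on_symmetric[OF f(1) U p] by simp
  also have "\<dots> = pullback f (ambient_deriv \<omega>) p vs"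
    unfolding pullback_def ambient_deriv_def by (simp add: take_map drop_map)
  finally show ?thesis .
qed

lemma pullback_compose:
  assumes "f differentiable at p" "g differentiable at (f p)"
  shows "pullback f (pullback g \<omega>) p = pullback (\<lambda>x. g (f x)) \<omega> p"
proof -
  have "frechet_derivative (\<lambda>x. g (f x)) (at p) = (\<lambda>v. frechet_derivative g (at (f p)) (frechet_derivative f (at p) v))"
    using assms unfolding frechet_derivative_works
    by (intro frechet_derivative_eqI has_derivative_compose[of f _ p UNIV g])
  then show ?thesis by (simp add: pullback_def comp_def)
qed

lemma pullback_wdg: "pullback f (\<lambda>q. wdg (\<alpha> q) (\<beta> q)) p = wdg (pullback f \<alpha> p) (pullback f \<beta> p)"
  by (rule ext) (simp add: pullback_def wdg_map)

lemma pullback_id: "(\<And>q. q \<in> U \<Longrightarrow> f q = q) \<Longrightarrow> open U \<Longrightarrow> p \<in> U \<Longrightarrow> pullback f \<omega> p = \<omega> p"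
proof -
  assume a: "\<And>q. q \<in> U \<Longrightarrow> f q = q" "open U" "p \<in> U"
  have "frechet_derivative f (at p) = frechet_derivative (\<lambda>q. q) (at p)"
    by (rule frechet_cong[OF a(2,3) a(1)])
  then have "frechet_derivative f (at p) = (\<lambda>v. v)" by (simp add: frechet_derivative_eqI[OF has_derivative_ident])
  then show ?thesis using a by (simp add: pullback_def)
qed

lemma pullback_cong:
  assumes "open U" "p \<in> U" "\<And>q. q \<in> U \<Longrightarrow> f q = g q"
  shows "pullback f \<omega> p = pullback g \<omega> p"
  using frechet_cong[OF assms] assms(2,3) by (simp add: pullback_def)

section \<open>Integration over an interval\<close>

text \<open>Integrates the part of the form without \<open>dx\<close> over the interval;
  \<open>fibre_integral\<close> integrates the part with \<open>dx\<close> and lowers the degree by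
  one.\<close>

definition interval_integral_form :: "real \<Rightarrow> real \<Rightarrow> (real \<times> 'a::euclidean_space) form \<Rightarrow> 'a form" where
  "interval_integral_form a b \<Theta> = (\<lambda>p vs. integral {a..b} (\<lambda>x. \<Theta> (x, p) (map (Pair 0) vs)))"

definition fibre_integral :: "real \<Rightarrow> real \<Rightarrow> (real \<times> 'a::euclidean_space) form \<Rightarrow> 'a form" where
  "fibre_integral a b \<Theta> = interval_integral_form a b (\<lambda>z us. \<Theta> z ((1, 0) # us))"

lemma slice_integrable:
  fixes \<Theta> :: "(real \<times> 'a::euclidean_space) form"
  assumes "smooth_coeffs \<Omega> \<Theta>" "{a..b} \<times> U \<subseteq> \<Omega>" "p \<in> U"
  shows "(\<lambda>x. \<Theta> (x, p) us) integrable_on {a..b}"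
  by (rule integrable_continuous_interval[OF slice_continuous[OF
      smooth_on_imp_continuous_on[OF smooth_coeffsD[OF assms(1)]] assms(2,3)]])

lemma ambient_form_interval_integral:
  fixes \<Theta> :: "(real \<times> 'a::euclidean_space) form"
  assumes U: "open U" and \<Omega>: "open \<Omega>" "{a..b} \<times> U \<subseteq> \<Omega>" and \<Theta>: "ambient_form \<Omega> \<Theta>"
  shows "ambient_form U (interval_integral_form a b \<Theta>)"
  unfolding ambient_form_def
proof (intro conjI ballI allI)
  note sm = ambient_form_smooth[OF \<Theta>]
  show "smooth_on U (\<lambda>p. interval_integral_form a b \<Theta> p vs)" for vs
    unfolding interval_integral_form_def
    by (rule smooth_on_param_integral[OF smooth_coeffsD[OF sm] \<Omega>(2) U])
  fix p assume p: "p \<in> U"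
  have alt: "alternating (\<Theta> (x, p))" if "x \<in> {a..b}" for x
    using ambient_form_alternating[OF \<Theta>] \<Omega>(2) that p by blast
  show "alternating (interval_integral_form a b \<Theta> p)"
  proof (rule alternatingI)
    have "interval_integral_form a b \<Theta> p (us @ (x *\<^sub>R v + y *\<^sub>R w) # ws)
      = x *\<^sub>R interval_integral_form a b \<Theta> p (us @ v # ws) + y *\<^sub>R interval_integral_form a b \<Theta> p (us @ w # ws)"
      for us ws v w x y
    proof -
      let ?us = "map (Pair 0) us :: (real \<times> 'a) list" and ?ws = "map (Pair 0) ws :: (real \<times> 'a) list"
      have "interval_integral_form a b \<Theta> p (us @ (x *\<^sub>R v + y *\<^sub>R w) # ws)
        = integral {a..b} (\<lambda>t. x *\<^sub>R \<Theta> (t, p) (?us @ (0, v) # ?ws) + y *\<^sub>R \<Theta> (t, p) (?us @ (0, w) # ?ws))"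
        unfolding interval_integral_form_def
      proof (rule integral_cong)
        fix t assume "t \<in> {a..b}"
        from multilinearD[OF alternating_multilin[OF alt[OF this]], of ?us x "(0, v)" y "(0, w)" ?ws]
        show "\<Theta> (t, p) (map (Pair 0) (us @ (x *\<^sub>R v + y *\<^sub>R w) # ws))
          = x *\<^sub>R \<Theta> (t, p) (?us @ (0, v) # ?ws) + y *\<^sub>R \<Theta> (t, p) (?us @ (0, w) # ?ws)" by simp
      qed
      also have "\<dots> = x *\<^sub>R interval_integral_form a b \<Theta> p (us @ v # ws) + y *\<^sub>R interval_integral_form a b \<Theta> p (us @ w # ws)"
        unfolding interval_integral_form_def
        by (simp add: integral_add slice_integrable[OF sm \<Omega>(2) p] integrable_cmul)
      finally show ?thesis .
    qed
    then show "multilinear (interval_integral_form a b \<Theta> p)" by (simp add: multilinear_def)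
    show "interval_integral_form a b \<Theta> p (us @ v # v # ws) = 0" for us v ws
    proof -
      have "interval_integral_form a b \<Theta> p (us @ v # v # ws) = integral {a..b} (\<lambda>t. 0)"
        unfolding interval_integral_form_def
        by (rule integral_cong) (simp add: alternating_adjacent[OF alt])
      then show ?thesis by simp
    qed
  qed
qed

lemma ambient_form_ins:
  assumes "ambient_form U \<alpha>"
  shows "ambient_form U (\<lambda>q us. \<alpha> q (v # us))"
  unfolding ambient_form_iff
  by (intro conjI ballI smooth_coeffs_ins[OF ambient_form_smooth[OF assms]]
      alternating_ins[OF ambient_form_alternating[OF assms]])

lemma ambient_form_fibre_integral:
  assumes "open U" "open \<Omega>" "{a..b} \<times> U \<subseteq> \<Omega>" "ambient_form \<Omega> \<Theta>"
  shows "ambient_form U (fibre_integral a b \<Theta>)"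
  unfolding fibre_integral_def
  by (rule ambient_form_interval_integral[OF assms(1-3) ambient_form_ins[OF assms(4)]])

lemma ambient_deriv_interval_integral:
  fixes \<Theta> :: "(real \<times> 'a::euclidean_space) form"
  assumes U: "open U" "p \<in> U" and \<Omega>: "{a..b} \<times> U \<subseteq> \<Omega>" and sm: "smooth_coeffs \<Omega> \<Theta>"
  shows "ambient_deriv (interval_integral_form a b \<Theta>) p vs = interval_integral_form a b (ambient_deriv \<Theta>) p vs"
proof -
  let ?d = "\<lambda>i. take i vs @ drop (Suc i) vs"
  have fd: "frechet_derivative (\<lambda>p. interval_integral_form a b \<Theta> p us) (at p) v
    = integral {a..b} (\<lambda>x. frechet_derivative (\<lambda>z. \<Theta> z (map (Pair 0) us)) (at (x, p)) (0, v))" for us v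
    unfolding interval_integral_form_def
    by (simp add: frechet_derivative_eqI[OF has_derivative_param_integral[OF smooth_coeffsD[OF sm] \<Omega> U]])
  have int: "(\<lambda>x. frechet_derivative (\<lambda>z. \<Theta> z us) (at (x, p)) w) integrable_on {a..b}" for us w
    by (rule slice_integrable[OF smooth_coeffs_frechet[OF sm] \<Omega> U(2)])
  have "ambient_deriv (interval_integral_form a b \<Theta>) p vs = (\<Sum>i<length vs. integral {a..b} (\<lambda>x. (-1) ^ i *
      frechet_derivative (\<lambda>z. \<Theta> z (map (Pair 0) (?d i))) (at (x, p)) (0, vs ! i)))"
    unfolding ambient_deriv_def fd by (simp add: integral_mult_right)
  also have "\<dots> = integral {a..b} (\<lambda>x. \<Sum>i<length vs. (-1) ^ i *
      frechet_derivative (\<lambda>z. \<Theta> z (map (Pair 0) (?d i))) (at (x, p)) (0, vs ! i))"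
    by (rule integral_sum[symmetric]) (simp_all add: integrable_on_mult_right int)
  finally show ?thesis
    by (simp add: interval_integral_form_def ambient_deriv_def take_map drop_map)
qed

lemma integral_frechet_fst:
  assumes "smooth_on \<Omega> (h :: real \<times> 'a::euclidean_space \<Rightarrow> complex)" "{a..b} \<times> U \<subseteq> \<Omega>" "p \<in> U" "a \<le> b"
  shows "integral {a..b} (\<lambda>x. frechet_derivative h (at (x, p)) (1, 0)) = h (b, p) - h (a, p)"
proof (rule integral_unique[OF fundamental_theorem_of_calculus[where f = "\<lambda>x. h (x, p)", OF assms(4)]])
  fix x assume "x \<in> {a..b}"
  then have mem: "(x, p) \<in> \<Omega>" using subsetD[OF assms(2), of "(x, p)"] assms(3) by simp
  have "((\<lambda>x. (x, p)) has_derivative (\<lambda>h. (h, 0))) (at x within {a..b})"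
    by (rule has_derivative_Pair[OF has_derivative_ident has_derivative_const])
  from has_derivative_compose[OF this smooth_on_has_derivative[OF assms(1) mem]]
  have 1: "((\<lambda>x. h (x, p)) has_derivative (\<lambda>v. frechet_derivative h (at (x, p)) (v, 0))) (at x within {a..b})" .
  have 2: "(\<lambda>v. frechet_derivative h (at (x, p)) (v, 0)) = (\<lambda>v. v *\<^sub>R frechet_derivative h (at (x, p)) (1, 0))"
  proof
    fix v :: real
    show "frechet_derivative h (at (x, p)) (v, 0) = v *\<^sub>R frechet_derivative h (at (x, p)) (1, 0)"
      using linear_scale[OF smooth_on_frechet_linear[OF assms(1) mem], of v "(1, 0)"] by simp
  qed
  show "((\<lambda>x. h (x, p)) has_vector_derivative frechet_derivative h (at (x, p)) (1, 0)) (at x within {a..b})"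
    unfolding has_vector_derivative_def by (rule has_derivative_eq_rhs[OF 1 2])
qed

text \<open>Cartan's formula for the unit field along the interval, integrated over it: the Lie
  derivative contributes the two boundary values by the fundamental theorem of calculus.\<close>

lemma cartan_fibre_integral:
  fixes \<Theta> :: "(real \<times> 'a::euclidean_space) form"
  assumes U: "open U" "p \<in> U" and \<Omega>: "{a..b} \<times> U \<subseteq> \<Omega>" "open \<Omega>" and sm: "smooth_coeffs \<Omega> \<Theta>" and ab: "a \<le> b"
  shows "ambient_deriv (fibre_integral a b \<Theta>) p vs
     = \<Theta> (b, p) (map (Pair 0) vs) - \<Theta> (a, p) (map (Pair 0) vs) - fibre_integral a b (ambient_deriv \<Theta>) p vs"
proof -
  let ?vs = "map (Pair 0) vs :: (real \<times> 'a) list"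
  have "ambient_deriv (fibre_integral a b \<Theta>) p vs
    = integral {a..b} (\<lambda>x. ambient_deriv (\<lambda>z us. \<Theta> z ((1, 0) # us)) (x, p) ?vs)"
    unfolding fibre_integral_def
    by (subst ambient_deriv_interval_integral[OF U \<Omega>(1) smooth_coeffs_ins[OF sm]])
      (simp add: interval_integral_form_def)
  also have "\<dots> = integral {a..b} (\<lambda>x. frechet_derivative (\<lambda>z. \<Theta> z ?vs) (at (x, p)) (1, 0)
       - ambient_deriv \<Theta> (x, p) ((1, 0) # ?vs))"
    by (simp add: ambient_deriv_Cons)
  also have "\<dots> = integral {a..b} (\<lambda>x. frechet_derivative (\<lambda>z. \<Theta> z ?vs) (at (x, p)) (1, 0))
       - integral {a..b} (\<lambda>x. ambient_deriv \<Theta> (x, p) ((1, 0) # ?vs))"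
    by (rule integral_diff slice_integrable[OF smooth_coeffs_frechet[OF sm] \<Omega>(1) U(2)]
        slice_integrable[OF smooth_coeffs_deriv[OF \<Omega>(2) sm] \<Omega>(1) U(2)])+
  also have "integral {a..b} (\<lambda>x. frechet_derivative (\<lambda>z. \<Theta> z ?vs) (at (x, p)) (1, 0))
      = \<Theta> (b, p) ?vs - \<Theta> (a, p) ?vs"
    by (rule integral_frechet_fst[OF smooth_coeffsD[OF sm] \<Omega>(1) U(2) ab])
  finally show ?thesis by (simp add: fibre_integral_def interval_integral_form_def)
qed

section \<open>Closed forms and homotopies\<close>

text \<open>Values off \<open>X\<close> are left arbitrary, so that restriction to smaller open
  sets, gluing and pullback require no renormalisation. The elements of
  \<open>closed_forms X\<close> are those that vanish off \<open>X\<close> in addition.\<close>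

definition closed_on :: "'a::euclidean_space set \<Rightarrow> 'a form \<Rightarrow> bool" where
  "closed_on X \<omega> \<longleftrightarrow> ambient_form X \<omega> \<and> (\<forall>p\<in>X. \<forall>vs. ambient_deriv \<omega> p vs = 0)"

definition cohomologous :: "'a::euclidean_space set \<Rightarrow> 'a form \<Rightarrow> 'a form \<Rightarrow> bool" where
  "cohomologous X \<omega> \<omega>' \<longleftrightarrow>
     (\<exists>\<eta>. ambient_form X \<eta> \<and> (\<forall>p\<in>X. \<forall>vs. \<omega> p vs = \<omega>' p vs + ambient_deriv \<eta> p vs))"

lemma closed_onD: "closed_on X \<omega> \<Longrightarrow> ambient_form X \<omega>" "closed_on X \<omega> \<Longrightarrow> p \<in> X \<Longrightarrow> ambient_deriv \<omega> p vs = 0"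
  by (simp_all add: closed_on_def)

lemma closed_on_cong:
  assumes "open X" "\<And>p vs. p \<in> X \<Longrightarrow> \<omega> p vs = \<omega>' p vs" "closed_on X \<omega>"
  shows "closed_on X \<omega>'"
  unfolding closed_on_def
proof (intro conjI ballI allI)
  show "ambient_form X \<omega>'" by (rule ambient_form_cong[OF assms(1,2) closed_onD(1)[OF assms(3)]])
  show "ambient_deriv \<omega>' p vs = 0" if "p \<in> X" for p vs
    using ambient_deriv_cong[where \<alpha> = \<omega> and \<beta> = \<omega>' and vs = vs, OF assms(1) that assms(2)] closed_onD(2)[OF assms(3) that] by simp
qed

lemma closed_on_subset: "closed_on X \<omega> \<Longrightarrow> Y \<subseteq> X \<Longrightarrow> closed_on Y \<omega>"
  by (auto simp: closed_on_def intro: ambient_form_subset)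

lemma closed_on_add:
  assumes "open X" "closed_on X \<omega>" "closed_on X \<omega>'"
  shows "closed_on X (\<lambda>p vs. \<omega> p vs + \<omega>' p vs)"
  unfolding closed_on_def
  by (intro conjI ballI allI ambient_form_add assms(1) closed_onD(1)[OF assms(2)] closed_onD(1)[OF assms(3)])
    (simp add: ambient_deriv_add[OF ambient_form_smooth[OF closed_onD(1)[OF assms(2)]]
      ambient_form_smooth[OF closed_onD(1)[OF assms(3)]]] closed_onD(2)[OF assms(2)] closed_onD(2)[OF assms(3)])

lemma closed_on_cmult:
  assumes "open X" "closed_on X \<omega>"
  shows "closed_on X (\<lambda>p vs. c * \<omega> p vs)"
  unfolding closed_on_def
  by (intro conjI ballI allI ambient_form_cmult assms(1) closed_onD(1)[OF assms(2)])
    (simp add: ambient_deriv_cmult[OF ambient_form_smooth[OF closed_onD(1)[OF assms(2)]]] closed_onD(2)[OF assms(2)])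

lemma closed_on_deriv:
  assumes "open X" "ambient_form X \<eta>"
  shows "closed_on X (ambient_deriv \<eta>)"
  unfolding closed_on_def
  using ambient_form_deriv[OF assms] ambient_deriv_deriv[OF assms(1) ambient_form_smooth[OF assms(2)]] by blast

lemma closed_on_wdg:
  assumes "open X" "closed_on X \<omega>" "closed_on X \<omega>'"
  shows "closed_on X (\<lambda>p. wdg (\<omega> p) (\<omega>' p))"
  unfolding closed_on_def
proof (intro conjI ballI allI ambient_form_wdg assms closed_onD(1))
  fix p vs assume p: "p \<in> X"
  have "ambient_deriv \<omega> p = (\<lambda>us. 0)" "ambient_deriv \<omega>' p = (\<lambda>us. 0)"
    using closed_onD(2)[OF assms(2) p] closed_onD(2)[OF assms(3) p] by auto
  then show "ambient_deriv (\<lambda>p. wdg (\<omega> p) (\<omega>' p)) p vs = 0"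
    by (simp add: ambient_deriv_wdg[OF assms(1) ambient_form_smooth[OF closed_onD(1)[OF assms(2)]]
        ambient_form_smooth[OF closed_onD(1)[OF assms(3)]] p] wdg_zero_left wdg_zero_right)
qed

lemma closed_on_pullback:
  fixes f :: "'a::euclidean_space \<Rightarrow> 'b::euclidean_space"
  assumes "open U" "open V" "smooth_on U f" "f ` U \<subseteq> V" "closed_on V \<omega>"
  shows "closed_on U (pullback f \<omega>)"
  unfolding closed_on_def
proof (intro conjI ballI allI)
  show "ambient_form U (pullback f \<omega>)" by (rule ambient_form_pullback[OF assms(1-4) closed_onD(1)[OF assms(5)]])
  show "ambient_deriv (pullback f \<omega>) p vs = 0" if "p \<in> U" for p vs
  proof -
    have "f p \<in> V" using assms(4) that by blast
    then show ?thesis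
      unfolding ambient_deriv_pullback[OF assms(1-4) closed_onD(1)[OF assms(5)] that]
      by (simp add: pullback_def closed_onD(2)[OF assms(5)])
  qed
qed

lemma cohomologousI:
  "ambient_form X \<eta> \<Longrightarrow> (\<And>p vs. p \<in> X \<Longrightarrow> \<omega> p vs = \<omega>' p vs + ambient_deriv \<eta> p vs) \<Longrightarrow> cohomologous X \<omega> \<omega>'"
  by (auto simp: cohomologous_def)

lemma cohomologousE:
  assumes "cohomologous X \<omega> \<omega>'"
  obtains \<eta> where "ambient_form X \<eta>" "\<And>p vs. p \<in> X \<Longrightarrow> \<omega> p vs = \<omega>' p vs + ambient_deriv \<eta> p vs"
  using assms by (auto simp: cohomologous_def)

lemma cohomologous_cong:
  assumes "\<And>p vs. p \<in> X \<Longrightarrow> \<omega> p vs = \<omega>1 p vs" "\<And>p vs. p \<in> X \<Longrightarrow> \<omega>' p vs = \<omega>1' p vs" "cohomologous X \<omega> \<omega>'"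
  shows "cohomologous X \<omega>1 \<omega>1'"
  using assms(1,2) cohomologousE[OF assms(3)] by (metis cohomologousI)

lemma cohomologous_refl: "open X \<Longrightarrow> (\<And>p vs. p \<in> X \<Longrightarrow> \<omega> p vs = \<omega>' p vs) \<Longrightarrow> cohomologous X \<omega> \<omega>'"
  by (rule cohomologousI[OF ambient_form_zero]) auto

lemma cohomologous_sym:
  assumes "open X" "cohomologous X \<omega> \<omega>'"
  shows "cohomologous X \<omega>' \<omega>"
proof -
  obtain \<eta> where \<eta>: "ambient_form X \<eta>" "\<And>p vs. p \<in> X \<Longrightarrow> \<omega> p vs = \<omega>' p vs + ambient_deriv \<eta> p vs"
    using cohomologousE[OF assms(2)] by blast
  show ?thesis
    by (rule cohomologousI[OF ambient_form_minus[OF assms(1) \<eta>(1)]])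
      (simp add: ambient_deriv_minus[OF ambient_form_smooth[OF \<eta>(1)]] \<eta>(2))
qed

lemma cohomologous_add:
  assumes "open X" "cohomologous X \<omega> \<omega>'" "cohomologous X \<tau> \<tau>'"
  shows "cohomologous X (\<lambda>p vs. \<omega> p vs + \<tau> p vs) (\<lambda>p vs. \<omega>' p vs + \<tau>' p vs)"
proof -
  obtain \<eta> where \<eta>: "ambient_form X \<eta>" "\<And>p vs. p \<in> X \<Longrightarrow> \<omega> p vs = \<omega>' p vs + ambient_deriv \<eta> p vs"
    using cohomologousE[OF assms(2)] by blast
  obtain \<theta> where \<theta>: "ambient_form X \<theta>" "\<And>p vs. p \<in> X \<Longrightarrow> \<tau> p vs = \<tau>' p vs + ambient_deriv \<theta> p vs"
    using cohomologousE[OF assms(3)] by blast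
  show ?thesis
    by (rule cohomologousI[OF ambient_form_add[OF assms(1) \<eta>(1) \<theta>(1)]])
      (simp add: ambient_deriv_add[OF ambient_form_smooth[OF \<eta>(1)] ambient_form_smooth[OF \<theta>(1)]] \<eta>(2) \<theta>(2))
qed

lemma cohomologous_trans:
  assumes "open X" "cohomologous X \<omega> \<omega>'" "cohomologous X \<omega>' \<omega>''"
  shows "cohomologous X \<omega> \<omega>''"
proof -
  obtain \<eta> where \<eta>: "ambient_form X \<eta>" "\<And>p vs. p \<in> X \<Longrightarrow> \<omega> p vs = \<omega>' p vs + ambient_deriv \<eta> p vs"
    using cohomologousE[OF assms(2)] by blast
  obtain \<theta> where \<theta>: "ambient_form X \<theta>" "\<And>p vs. p \<in> X \<Longrightarrow> \<omega>' p vs = \<omega>'' p vs + ambient_deriv \<theta> p vs"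
    using cohomologousE[OF assms(3)] by blast
  show ?thesis
    by (rule cohomologousI[OF ambient_form_add[OF assms(1) \<eta>(1) \<theta>(1)]])
      (simp add: ambient_deriv_add[OF ambient_form_smooth[OF \<eta>(1)] ambient_form_smooth[OF \<theta>(1)]] \<eta>(2) \<theta>(2))
qed

lemma cohomologous_cmult:
  assumes "open X" "cohomologous X \<omega> \<omega>'"
  shows "cohomologous X (\<lambda>p vs. c * \<omega> p vs) (\<lambda>p vs. c * \<omega>' p vs)"
proof -
  obtain \<eta> where \<eta>: "ambient_form X \<eta>" "\<And>p vs. p \<in> X \<Longrightarrow> \<omega> p vs = \<omega>' p vs + ambient_deriv \<eta> p vs"
    using cohomologousE[OF assms(2)] by blast
  show ?thesis
    by (rule cohomologousI[OF ambient_form_cmult[OF assms(1) \<eta>(1), of c]])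
      (simp add: ambient_deriv_cmult[OF ambient_form_smooth[OF \<eta>(1)]] \<eta>(2) distrib_left)
qed

lemma cohomologous_subset: "cohomologous X \<omega> \<omega>' \<Longrightarrow> Y \<subseteq> X \<Longrightarrow> cohomologous Y \<omega> \<omega>'"
  unfolding cohomologous_def by (meson ambient_form_subset subsetD)

lemma cohomologous_pullback:
  fixes f :: "'a::euclidean_space \<Rightarrow> 'b::euclidean_space"
  assumes "open U" "open V" "smooth_on U f" "f ` U \<subseteq> V" "cohomologous V \<omega> \<omega>'"
  shows "cohomologous U (pullback f \<omega>) (pullback f \<omega>')"
proof -
  obtain \<eta> where \<eta>: "ambient_form V \<eta>" "\<And>p vs. p \<in> V \<Longrightarrow> \<omega> p vs = \<omega>' p vs + ambient_deriv \<eta> p vs"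
    using cohomologousE[OF assms(5)] by blast
  show ?thesis
  proof (rule cohomologousI[OF ambient_form_pullback[OF assms(1-4) \<eta>(1)]])
    fix p vs assume p: "p \<in> U"
    then have "f p \<in> V" using assms(4) by blast
    then show "pullback f \<omega> p vs = pullback f \<omega>' p vs + ambient_deriv (pullback f \<eta>) p vs"
      unfolding ambient_deriv_pullback[OF assms(1-4) \<eta>(1) p] by (simp add: pullback_def \<eta>(2))
  qed
qed

text \<open>Since \<open>\<gamma>\<close> is closed, its product with \<open>d \<eta>\<close> is the
  derivative of the product of the degree involution of \<open>\<gamma>\<close> with
  \<open>\<eta>\<close>; the twist absorbs the Leibniz sign for forms of mixed degree.\<close>

lemma cohomologous_wdg:
  assumes "open X" "closed_on X \<gamma>" "cohomologous X \<omega> \<omega>'"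
  shows "cohomologous X (\<lambda>p. wdg (\<gamma> p) (\<omega> p)) (\<lambda>p. wdg (\<gamma> p) (\<omega>' p))"
proof -
  obtain \<eta> where \<eta>: "ambient_form X \<eta>" "\<And>p vs. p \<in> X \<Longrightarrow> \<omega> p vs = \<omega>' p vs + ambient_deriv \<eta> p vs"
    using cohomologousE[OF assms(3)] by blast
  let ?g = "\<lambda>p vs. (-1) ^ length vs * \<gamma> p vs"
  have g: "ambient_form X ?g" by (rule ambient_form_sign[OF assms(1) closed_onD(1)[OF assms(2)]])
  show ?thesis
  proof (rule cohomologousI[OF ambient_form_wdg[OF assms(1) g \<eta>(1)]])
    fix p vs assume p: "p \<in> X"
    have "ambient_deriv ?g p = (\<lambda>us. 0)"
      by (rule ext) (simp add: ambient_deriv_sign[OF ambient_form_smooth[OF closed_onD(1)[OF assms(2)]] p]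
          closed_onD(2)[OF assms(2) p])
    moreover have "\<omega> p = (\<lambda>us. \<omega>' p us + ambient_deriv \<eta> p us)" using \<eta>(2)[OF p] by blast
    ultimately show "wdg (\<gamma> p) (\<omega> p) vs = wdg (\<gamma> p) (\<omega>' p) vs + ambient_deriv (\<lambda>p. wdg (?g p) (\<eta> p)) p vs"
      unfolding ambient_deriv_wdg[OF assms(1) ambient_form_smooth[OF g] ambient_form_smooth[OF \<eta>(1)] p] sign_sign
      by (simp add: wdg_add_right wdg_zero_left)
  qed
qed

lemma slice_pullback:
  fixes \<Phi> :: "real \<times> 'a::euclidean_space \<Rightarrow> 'b::euclidean_space"
  assumes "smooth_on \<Omega> \<Phi>" "(x, p) \<in> \<Omega>"
  shows "pullback \<Phi> \<omega> (x, p) (map (Pair 0) vs) = pullback (\<lambda>p. \<Phi> (x, p)) \<omega> p vs"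
proof -
  have "((\<lambda>p. (x, p)) has_derivative Pair 0) (at p)"
    using has_derivative_Pair[OF has_derivative_const has_derivative_ident, of x p UNIV] by simp
  from frechet_derivative_eqI[OF has_derivative_compose[OF this smooth_on_has_derivative[OF assms]]]
  show ?thesis by (simp add: pullback_def comp_def)
qed

lemma closed_fibre_integral_zero:
  assumes "closed_on \<Omega> \<Theta>" "{a..b} \<times> U \<subseteq> \<Omega>" "p \<in> U"
  shows "fibre_integral a b (ambient_deriv \<Theta>) p vs = 0" "interval_integral_form a b (ambient_deriv \<Theta>) p vs = 0"
proof -
  have mem: "(x, p) \<in> \<Omega>" if "x \<in> {a..b}" for x
    using assms(2,3) that by blast
  have "fibre_integral a b (ambient_deriv \<Theta>) p vs = integral {a..b} (\<lambda>x. 0)"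
    unfolding fibre_integral_def interval_integral_form_def
    by (rule integral_cong) (rule closed_onD(2)[OF assms(1) mem])
  then show "fibre_integral a b (ambient_deriv \<Theta>) p vs = 0" by simp
  have "interval_integral_form a b (ambient_deriv \<Theta>) p vs = integral {a..b} (\<lambda>x. 0)"
    unfolding interval_integral_form_def
    by (rule integral_cong) (rule closed_onD(2)[OF assms(1) mem])
  then show "interval_integral_form a b (ambient_deriv \<Theta>) p vs = 0" by simp
qed

text \<open>The primitive is the fibre integral over the unit interval of the form pulled back along
  \<open>\<Phi>\<close>. The open set \<open>\<Omega>\<close> around the cylinder makes
  \<open>\<Phi>\<close> smooth at the ends of the interval as well.\<close>

lemma homotopy_cohomologous:
  fixes \<Phi> :: "real \<times> 'a::euclidean_space \<Rightarrow> 'b::euclidean_space"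
  assumes U: "open U" and V: "open V" and \<Omega>: "open \<Omega>" "{0..1} \<times> U \<subseteq> \<Omega>"
    and \<Phi>: "smooth_on \<Omega> \<Phi>" "\<Phi> ` \<Omega> \<subseteq> V" and \<omega>: "closed_on V \<omega>"
  shows "cohomologous U (pullback (\<lambda>p. \<Phi> (1, p)) \<omega>) (pullback (\<lambda>p. \<Phi> (0, p)) \<omega>)"
proof -
  note \<Theta> = closed_on_pullback[OF \<Omega>(1) V \<Phi> \<omega>]
  show ?thesis
  proof (rule cohomologousI[OF ambient_form_fibre_integral[OF U \<Omega> closed_onD(1)[OF \<Theta>]]])
    fix p vs assume p: "p \<in> U"
    have mem: "(1, p) \<in> \<Omega>" "(0, p) \<in> \<Omega>" using \<Omega>(2) p by auto
    show "pullback (\<lambda>p. \<Phi> (1, p)) \<omega> p vs = pullback (\<lambda>p. \<Phi> (0, p)) \<omega> p vs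
        + ambient_deriv (fibre_integral 0 1 (pullback \<Phi> \<omega>)) p vs"
      unfolding cartan_fibre_integral[OF U p \<Omega>(2,1) ambient_form_smooth[OF closed_onD(1)[OF \<Theta>]] zero_le_one]
        closed_fibre_integral_zero(1)[OF \<Theta> \<Omega>(2) p] slice_pullback[OF \<Phi>(1) mem(1)] slice_pullback[OF \<Phi>(1) mem(2)]
      by simp
  qed
qed

text \<open>The weight \<open>x\<close> on the fibre coordinate turns the fibre integral into a primitive of the
  difference between the average and the endpoint.\<close>

lemma average_cohomologous:
  fixes \<Theta> :: "(real \<times> 'a::euclidean_space) form"
  assumes U: "open U" and \<Omega>: "open \<Omega>" "{0..T} \<times> U \<subseteq> \<Omega>" and \<Theta>: "closed_on \<Omega> \<Theta>" and T: "0 \<le> T"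
  shows "cohomologous U (interval_integral_form 0 T \<Theta>) (\<lambda>p vs. of_real T * \<Theta> (T, p) (map (Pair 0) vs))"
proof -
  let ?W = "\<lambda>z vs. of_real (fst z) * \<Theta> z vs"
  note sm = ambient_form_smooth[OF closed_onD(1)[OF \<Theta>]]
  have smf: "smooth_on \<Omega> (\<lambda>z. complex_of_real (fst z))"
    by (intro smooth_on_of_real smooth_on_fst smooth_on_ident \<Omega>(1))
  have W: "ambient_form \<Omega> ?W" by (rule ambient_form_fmult[OF \<Omega>(1) smf closed_onD(1)[OF \<Theta>]])
  have dfst: "frechet_derivative (\<lambda>z::real \<times> 'a. complex_of_real (fst z)) (at z) w = of_real (fst w)" for z w
  proof -
    have "((\<lambda>z::real \<times> 'a. complex_of_real (fst z)) has_derivative (\<lambda>w. of_real (fst w))) (at z)"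
      by (intro has_derivative_of_real has_derivative_fst has_derivative_ident)
    from frechet_derivative_eqI[OF this] show ?thesis by simp
  qed
  have fd: "frechet_derivative (\<lambda>z. of_real (fst z) * A z us) (at z) w
     = of_real (fst z) * frechet_derivative (\<lambda>z. A z us) (at z) w + of_real (fst w) * A z us"
    if "smooth_coeffs \<Omega> A" "z \<in> \<Omega>" for A :: "(real \<times> 'a) form" and us z w
    using frechet_mult[OF smf smooth_coeffsD[OF that(1)] that(2)] dfst by simp
  have W': "ambient_deriv ?W (x, p) ((1, 0) # map (Pair 0) vs) = \<Theta> (x, p) (map (Pair 0) vs)"
    if mem: "(x, p) \<in> \<Omega>" for x p vs
  proof -
    have "ambient_deriv (\<lambda>z us. of_real (fst z) * \<Theta> z ((1, 0) # us)) (x, p) (map (Pair 0) vs)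
      = of_real x * ambient_deriv (\<lambda>z us. \<Theta> z ((1, 0) # us)) (x, p) (map (Pair 0) vs)"
      unfolding ambient_deriv_def
      by (simp add: fd[OF smooth_coeffs_ins[OF sm] mem] sum_distrib_left mult.left_commute)
    then have "ambient_deriv ?W (x, p) ((1, 0) # map (Pair 0) vs)
       = of_real x * ambient_deriv \<Theta> (x, p) ((1, 0) # map (Pair 0) vs) + \<Theta> (x, p) (map (Pair 0) vs)"
      by (simp add: ambient_deriv_Cons fd[OF sm mem] algebra_simps)
    then show ?thesis by (simp add: closed_onD(2)[OF \<Theta> mem])
  qed
  have "cohomologous U (\<lambda>p vs. of_real T * \<Theta> (T, p) (map (Pair 0) vs)) (interval_integral_form 0 T \<Theta>)"
  proof (rule cohomologousI[OF ambient_form_fibre_integral[OF U \<Omega> W]])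
    fix p vs assume p: "p \<in> U"
    have "fibre_integral 0 T (ambient_deriv ?W) p vs = interval_integral_form 0 T \<Theta> p vs"
      unfolding fibre_integral_def interval_integral_form_def
      by (rule integral_cong, rule W', rule subsetD[OF \<Omega>(2)]) (use p in simp)
    then show "of_real T * \<Theta> (T, p) (map (Pair 0) vs) = interval_integral_form 0 T \<Theta> p vs
        + ambient_deriv (fibre_integral 0 T ?W) p vs"
      unfolding cartan_fibre_integral[OF U p \<Omega>(2,1) ambient_form_smooth[OF W] T] by simp
  qed
  then show ?thesis by (rule cohomologous_sym[OF U])
qed

section \<open>Logarithmic one-forms and averaging over circles\<close>

section \<open>Logarithmic one-forms\<close>

definition one_form :: "('a \<Rightarrow> 'a \<Rightarrow> complex) \<Rightarrow> 'a form" where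
  "one_form L p vs = (if length vs = 1 then L p (hd vs) else 0)"

definition log_deriv :: "('a::euclidean_space \<Rightarrow> complex) \<Rightarrow> 'a form" where
  "log_deriv f = one_form (\<lambda>p v. frechet_derivative f (at p) v / f p)"

lemma wdg_one_form_Cons:
  "wdg (one_form L p) b (v # vs) = L p v * b vs - wdg (one_form L p) (\<lambda>us. b (v # us)) vs"
proof -
  have "(\<lambda>us. one_form L p (v # us)) = const0 (L p v)" by (auto simp: one_form_def const0_def)
  moreover have "(\<lambda>us. (-1) ^ length us * one_form L p us) = (\<lambda>us. - one_form L p us)"
    by (auto simp: one_form_def)
  ultimately show ?thesis by (simp add: wdg_const_left wdg_minus_left)
qed

lemma one_form_Nil [simp]: "one_form L p [] = 0"
  by (simp add: one_form_def)

lemma wdg_one_one_proportional: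
  assumes "\<And>v. L p v = c * M p v"
  shows "wdg (one_form L p) (one_form M p) vs = 0"
proof -
  consider "vs = []" | v where "vs = [v]" | v w us where "vs = v # w # us" by (metis list.exhaust)
  then show ?thesis
    by cases (auto simp: wdg_one_form_Cons one_form_def wdg_zero_right assms simp del: wdg.simps(2))
qed

text \<open>By alternation at most one argument can contribute its multiple of \<open>X\<close>.
  This evaluates pullbacks along maps that shear in a single direction.\<close>

lemma multilinear_shift_expand:
  assumes "alternating a"
  shows "a (map (\<lambda>v. L v + c v *\<^sub>R X) vs)
    = a (map L vs) + wdg (one_form (\<lambda>_ v. of_real (c v)) p) (\<lambda>us. a (X # map L us)) vs"
  using assms
proof (induction vs arbitrary: a)
  case (Cons v vs)
  let ?s = "map (\<lambda>v. L v + c v *\<^sub>R X) vs"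
  note ml = alternating_multilin[OF Cons.prems]
  have X: "a (X # X # us) = 0" for us using alternating_adjacent[OF Cons.prems, of "[]"] by simp
  have "a (map (\<lambda>v. L v + c v *\<^sub>R X) (v # vs)) = a (L v # ?s) + of_real (c v) * a (X # ?s)"
    using multilinear_add[OF ml, of "[]" "L v" "c v *\<^sub>R X" ?s] multilinear_scale[OF ml, of "[]" "c v" X ?s]
    by (simp add: scaleR_conv_of_real)
  also have "a (X # ?s) = a (X # map L vs)"
    using Cons.IH[OF alternating_ins[OF Cons.prems], of X] by (simp add: X wdg_zero_right)
  also have "a (L v # ?s) = a (L v # map L vs) + wdg (one_form (\<lambda>_ v. of_real (c v)) p) (\<lambda>us. a (L v # X # map L us)) vs"
    by (rule Cons.IH[OF alternating_ins[OF Cons.prems]])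
  also have "(\<lambda>us. a (L v # X # map L us)) = (\<lambda>us. - a (X # L v # map L us))"
    by (intro ext alternating_swap[OF Cons.prems])
  finally show ?case by (simp add: wdg_one_form_Cons wdg_minus_right del: wdg.simps(2))
qed simp

lemma ambient_deriv_const0:
  "ambient_deriv (\<lambda>q. const0 (f q)) p = one_form (\<lambda>p v. frechet_derivative f (at p) v) p"
proof
  fix vs :: "'a list"
  consider "vs = []" | v where "vs = [v]" | v w us where "vs = v # w # us" by (metis list.exhaust)
  then show "ambient_deriv (\<lambda>q. const0 (f q)) p vs = one_form (\<lambda>p v. frechet_derivative f (at p) v) p vs"
    by cases (auto simp: ambient_deriv_Cons const0_def one_form_def)
qed

lemma log_deriv_wdg:
  "log_deriv f p = wdg (const0 (inverse (f p))) (ambient_deriv (\<lambda>q. const0 (f q)) p)"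
  by (rule ext) (simp add: wdg_const_left ambient_deriv_const0 log_deriv_def one_form_def divide_inverse)

text \<open>The form is \<open>inverse f\<close> times \<open>df\<close>, and the derivative of the
  coefficient is itself a multiple of \<open>df\<close>, so the product of these two one-forms
  vanishes.\<close>

lemma closed_log_deriv:
  fixes f :: "'a::euclidean_space \<Rightarrow> complex"
  assumes U: "open U" and f: "smooth_on U f" "\<And>p. p \<in> U \<Longrightarrow> f p \<noteq> 0"
  shows "closed_on U (log_deriv f)"
proof -
  have inv: "smooth_on U (\<lambda>q. inverse (f q))" by (rule smooth_on_inverse[OF U f])
  note c1 = ambient_form_const0[OF U inv] and c2 = ambient_form_const0[OF U f(1)]
  note d2 = ambient_form_deriv[OF U c2]
  have l: "log_deriv f = (\<lambda>p. wdg (const0 (inverse (f p))) (ambient_deriv (\<lambda>q. const0 (f q)) p))"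
    by (rule ext) (rule log_deriv_wdg)
  show ?thesis
    unfolding closed_on_def l
  proof (intro conjI ballI allI ambient_form_wdg U c1 d2)
    fix p vs assume p: "p \<in> U"
    have "frechet_derivative (\<lambda>q. inverse (f q)) (at p) v = - (inverse (f p) * inverse (f p)) * frechet_derivative f (at p) v" for v
      using frechet_derivative_eqI[OF Deriv.has_derivative_inverse[OF f(2)[OF p] smooth_on_has_derivative[OF f(1) p]]]
      by simp
    then have "wdg (ambient_deriv (\<lambda>q. const0 (inverse (f q))) p) (ambient_deriv (\<lambda>q. const0 (f q)) p) vs = 0"
      unfolding ambient_deriv_const0 by (rule wdg_one_one_proportional)
    moreover have "ambient_deriv (ambient_deriv (\<lambda>q. const0 (f q))) p = (\<lambda>us. 0)"
      by (intro ext ambient_deriv_deriv[OF U ambient_form_smooth[OF c2] p])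
    ultimately show "ambient_deriv (\<lambda>p. wdg (const0 (inverse (f p))) (ambient_deriv (\<lambda>q. const0 (f q)) p)) p vs = 0"
      unfolding ambient_deriv_wdg[OF U ambient_form_smooth[OF c1] ambient_form_smooth[OF d2] p]
      by (simp add: wdg_zero_right)
  qed
qed

lemma function_times_closed:
  assumes U: "open U" and f: "smooth_on U f" and b: "closed_on U b" and p: "p \<in> U"
  shows "ambient_deriv (\<lambda>q vs. f q * b q vs) p vs = wdg (one_form (\<lambda>p v. frechet_derivative f (at p) v) p) (b p) vs"
proof -
  have "(\<lambda>q vs. f q * b q vs) = (\<lambda>q. wdg (const0 (f q)) (b q))" by (intro ext) (simp add: wdg_const_left)
  moreover have "ambient_deriv b p = (\<lambda>us. 0)" using closed_onD(2)[OF b p] by blast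
  ultimately show ?thesis
    by (simp add: ambient_deriv_wdg[OF U ambient_form_smooth[OF ambient_form_const0[OF U f]]
        ambient_form_smooth[OF closed_onD(1)[OF b]] p] wdg_zero_right ambient_deriv_const0)
qed

section \<open>Integration over circles\<close>

lemma periodic_integral_shift:
  fixes f :: "real \<Rightarrow> complex"
  assumes f: "continuous_on UNIV f" "\<And>x. f (x + T) = f x" and a: "0 \<le> a" "a \<le> T"
  shows "integral {0..T} (\<lambda>x. f (x + a)) = integral {0..T} f"
proof -
  have int: "f integrable_on {c..d}" for c d
    by (rule integrable_continuous_interval[OF continuous_on_subset[OF f(1)]]) simp
  have cont: "continuous_on {c..d} f" for c d by (rule continuous_on_subset[OF f(1)]) simp
  have "integral {0..T} (\<lambda>x. f (x + a)) = integral {a..T + a} f"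
    using integral_shift_real_ivl[of a a "T + a" f] by simp
  also have "\<dots> = integral {a..T} f + integral {T..T + a} f"
    using Henstock_Kurzweil_Integration.integral_combine[of a T "T + a" f] a int by simp
  also have "integral {T..T + a} f = integral {0..a} f"
    using integral_shift_real_ivl[of T T "T + a" f] f(2) by simp
  also have "integral {a..T} f + integral {0..a} f = integral {0..T} f"
    using Henstock_Kurzweil_Integration.integral_combine[of 0 a T f] a int by (simp add: add.commute)
  finally show ?thesis .
qed

lemma integral_wdg_right:
  fixes G :: "real \<Rightarrow> 'a list \<Rightarrow> complex"
  assumes "\<And>us. (\<lambda>x. G x us) integrable_on S"
  shows "(\<lambda>x. wdg a (G x) vs) integrable_on S
    \<and> integral S (\<lambda>x. wdg a (G x) vs) = wdg a (\<lambda>us. integral S (\<lambda>x. G x us)) vs"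
  using assms
proof (induction vs arbitrary: a G)
  case Nil
  then show ?case by (simp add: integrable_on_mult_right)
next
  case (Cons v vs)
  note 1 = Cons.IH[OF Cons.prems, of "\<lambda>us. a (v # us)"]
  note 2 = Cons.IH[OF Cons.prems, of "\<lambda>us. (-1) ^ length us * a us" "\<lambda>us. v # us"]
  show ?case unfolding wdg.simps using 1 2 by (simp add: integrable_add integral_add)
qed

text \<open>The two parts of d log t: the real part governs the modulus of \<open>t\<close>, the
  imaginary part its direction.\<close>

lemma has_derivative_polar:
  fixes t :: "'a::euclidean_space \<Rightarrow> complex"
  assumes "(t has_derivative t') (at p)" "t p \<noteq> 0"
  shows "((\<lambda>z. norm (t z)) has_derivative (\<lambda>w. norm (t p) * Re (t' w / t p))) (at p)"
    and "((\<lambda>z. t z / of_real (norm (t z))) has_derivative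
      (\<lambda>w. \<i> * of_real (Im (t' w / t p)) * (t p / of_real (norm (t p))))) (at p)"
proof -
  have inner: "sgn (t p) \<bullet> t' w = norm (t p) * Re (t' w / t p)" for w
  proof -
    define q where "q = t' w / t p"
    have "t' w = t p * q" using assms(2) by (simp add: q_def)
    then have "sgn (t p) \<bullet> t' w = Re (cnj (sgn (t p)) * t p * q)"
      by (simp add: inner_complex_def algebra_simps)
    also have "cnj (sgn (t p)) * t p = of_real (norm (t p))"
      using assms(2) by (simp add: sgn_eq complex_norm_square[symmetric] field_simps power2_eq_square)
    finally show ?thesis by (simp add: q_def[symmetric])
  qed
  show 1: "((\<lambda>z. norm (t z)) has_derivative (\<lambda>w. norm (t p) * Re (t' w / t p))) (at p)"
    using has_derivative_compose[OF assms(1) has_derivative_norm[OF assms(2)]]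
    unfolding inner_commute[of _ "sgn (t p)"] inner .
  have "((\<lambda>z. t z / of_real (norm (t z))) has_derivative
     (\<lambda>w. - t p * (inverse (of_real (norm (t p))) * of_real (norm (t p) * Re (t' w / t p)) * inverse (of_real (norm (t p))))
       + t' w / of_real (norm (t p)))) (at p)"
    by (rule has_derivative_divide[OF assms(1) has_derivative_of_real[OF 1]]) (use assms(2) in simp)
  moreover have "- t p * (inverse (of_real (norm (t p))) * of_real (norm (t p) * Re (t' w / t p)) * inverse (of_real (norm (t p))))
       + t' w / of_real (norm (t p)) = \<i> * of_real (Im (t' w / t p)) * (t p / of_real (norm (t p)))" for w
  proof -
    define q where "q = t' w / t p"
    have "t' w = t p * q" using assms(2) by (simp add: q_def)
    moreover have "q = of_real (Re q) + \<i> * of_real (Im q)" by (simp add: complex_eq)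
    ultimately have "t' w = t p * of_real (Re q) + t p * \<i> * of_real (Im q)" by (metis distrib_left mult.assoc)
    then show ?thesis
      using assms(2) unfolding q_def[symmetric] by (simp add: field_simps)
  qed
  ultimately show "((\<lambda>z. t z / of_real (norm (t z))) has_derivative
      (\<lambda>w. \<i> * of_real (Im (t' w / t p)) * (t p / of_real (norm (t p))))) (at p)"
    by simp
qed

text \<open>\<open>J (u, z)\<close> is the point with coordinate \<open>t = u\<close> on the fibre through \<open>z\<close>; a closed form on the
  punctured tube \<open>U\<close> is, up to exact forms, determined by its restriction to the circles \<open>\<bar>t\<bar> = r\<close>.
  \<open>\<beta>\<close> is the residue and \<open>\<alpha>\<close> the circle average.\<close>

lemma circle_decomposition:
  fixes J :: "complex \<times> 'a::euclidean_space \<Rightarrow> 'a" and t :: "'a \<Rightarrow> complex" and r :: "'a \<Rightarrow> real"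
  assumes D: "open D" and P: "open P" and U: "open U" "U \<subseteq> P"
    and J: "smooth_on D J" "J ` D \<subseteq> U" and \<omega>: "closed_on U \<omega>"
    and t: "smooth_on U t" "\<And>z. z \<in> U \<Longrightarrow> t z \<noteq> 0" and r: "smooth_on P r" "\<And>z. z \<in> P \<Longrightarrow> r z > 0"
    and circle: "\<And>z u. z \<in> P \<Longrightarrow> norm u = r z \<Longrightarrow> (u, z) \<in> D"
    and segment: "\<And>z x. z \<in> U \<Longrightarrow> 0 \<le> x \<Longrightarrow> x \<le> 1 \<Longrightarrow>
        (of_real (1 - x + x * (r z / norm (t z))) * t z, z) \<in> D"
    and Jt: "\<And>z. z \<in> U \<Longrightarrow> J (t z, z) = z"
  obtains \<alpha> \<beta> where "closed_on P \<alpha>" "closed_on P \<beta>"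
    "cohomologous U \<omega> (\<lambda>p vs. \<alpha> p vs + wdg (\<lambda>us. - \<i> * log_deriv t p us) (\<beta> p) vs)"
    "\<And>\<pi> \<theta>. smooth_on P \<pi> \<Longrightarrow> \<pi> ` P \<subseteq> P \<Longrightarrow> smooth_on U \<theta> \<Longrightarrow> \<theta> ` U \<subseteq> U \<Longrightarrow>
       (\<And>z. z \<in> P \<Longrightarrow> r (\<pi> z) = r z) \<Longrightarrow>
       (\<And>z u. z \<in> P \<Longrightarrow> norm u = r z \<Longrightarrow> J (u, \<pi> z) = \<theta> (J (u, z))) \<Longrightarrow>
       (\<And>p. p \<in> U \<Longrightarrow> pullback \<theta> \<omega> p = \<omega> p) \<Longrightarrow>
       \<forall>p\<in>P. pullback \<pi> \<alpha> p = \<alpha> p \<and> pullback \<pi> \<beta> p = \<beta> p"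
proof -
  define T where "T = 2 * pi"
  have T: "0 \<le> T" "T \<noteq> 0" by (simp_all add: T_def)
  define \<Omega>P :: "(real \<times> 'a) set" where "\<Omega>P = UNIV \<times> P"
  define \<Omega>U :: "(real \<times> 'a) set" where "\<Omega>U = UNIV \<times> U"
  have \<Omega>: "open \<Omega>P" "open \<Omega>U" "\<And>a b. {a..b} \<times> P \<subseteq> \<Omega>P" "\<And>a b. {a..b} \<times> U \<subseteq> \<Omega>U"
    using P U by (auto simp: \<Omega>P_def \<Omega>U_def intro: open_Times)
  \<comment> \<open>\<open>k\<close> runs through the circle of radius \<open>r z\<close> by its
    angle. Pulling \<open>\<omega>\<close> back along \<open>F\<close> makes the angle a coordinate
    over the whole of \<open>P\<close>, although \<open>\<omega>\<close> lives on
    \<open>U\<close>.\<close>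
  define k where "k = (\<lambda>z::real \<times> 'a. (of_real (r (snd z)) * cis (fst z), snd z))"
  define F where "F = (\<lambda>z. J (k z))"
  define \<Theta> where "\<Theta> = pullback F \<omega>"
  have r_snd: "smooth_on \<Omega>P (\<lambda>z. r (snd z))"
    by (rule smooth_on_compose[OF \<Omega>(1) P r(1)])
      (auto simp: \<Omega>P_def intro: smooth_on_snd[OF \<Omega>(1)[unfolded \<Omega>P_def] smooth_on_ident[OF \<Omega>(1)[unfolded \<Omega>P_def]]])
  have k: "smooth_on \<Omega>P k" "k ` \<Omega>P \<subseteq> D"
  proof -
    show "smooth_on \<Omega>P k"
      unfolding k_def
      by (intro smooth_on_Pair smooth_on_mult smooth_on_of_real smooth_on_cis smooth_on_fst smooth_on_snd
          smooth_on_ident \<Omega>(1) r_snd)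
    show "k ` \<Omega>P \<subseteq> D"
      using r(2) by (auto simp: k_def \<Omega>P_def norm_mult abs_of_pos intro!: circle)
  qed
  have F: "smooth_on \<Omega>P F" "F ` \<Omega>P \<subseteq> U"
  proof -
    show "smooth_on \<Omega>P F" unfolding F_def by (rule smooth_on_compose[OF \<Omega>(1) D J(1) k(2,1)])
    show "F ` \<Omega>P \<subseteq> U" using k(2) J(2) by (auto simp: F_def)
  qed
  have \<Theta>: "closed_on \<Omega>P \<Theta>"
    unfolding \<Theta>_def by (rule closed_on_pullback[OF \<Omega>(1) U(1) F \<omega>])
  note sm\<Theta> = ambient_form_smooth[OF closed_onD(1)[OF \<Theta>]]
  have periodic: "\<Theta> (x + T, p) us = \<Theta> (x, p) us" if p: "p \<in> P" for x p us
  proof -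
    have mem: "(x + T, p) \<in> \<Omega>P" using p by (simp add: \<Omega>P_def)
    have "((\<lambda>z::real \<times> 'a. z + (T, 0)) has_derivative (\<lambda>w. w)) (at (x, p))"
      by (rule has_derivative_eq_rhs[OF has_derivative_add[OF has_derivative_ident has_derivative_const]]) simp
    moreover have "(F has_derivative frechet_derivative F (at (x + T, p))) (at ((x, p) + (T, 0)))"
      using smooth_on_has_derivative[OF F(1) mem] by simp
    ultimately have "((\<lambda>z. F (z + (T, 0))) has_derivative (\<lambda>w. frechet_derivative F (at (x + T, p)) w)) (at (x, p))"
      by (rule has_derivative_compose)
    moreover have Fper: "F (z + (T, 0)) = F z" for z
      by (cases z) (simp add: F_def k_def T_def cis.ctr)
    ultimately have "frechet_derivative F (at (x, p)) = frechet_derivative F (at (x + T, p))"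
      by (simp add: frechet_derivative_eqI)
    then show ?thesis using Fper[of "(x, p)"] by (simp add: \<Theta>_def pullback_def)
  qed
  define \<alpha> where "\<alpha> = (\<lambda>p vs. of_real (inverse T) * interval_integral_form 0 T \<Theta> p vs)"
  define \<beta> where "\<beta> = (\<lambda>p vs. of_real (inverse T) * fibre_integral 0 T \<Theta> p vs)"
  have \<alpha>: "closed_on P \<alpha>"
    unfolding \<alpha>_def
  proof (rule closed_on_cmult[OF P])
    show "closed_on P (interval_integral_form 0 T \<Theta>)"
      unfolding closed_on_def
      using ambient_form_interval_integral[OF P \<Omega>(1,3) closed_onD(1)[OF \<Theta>]]
        ambient_deriv_interval_integral[OF P _ \<Omega>(3) sm\<Theta>] closed_fibre_integral_zero(2)[OF \<Theta> \<Omega>(3)]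
      by simp
  qed
  have \<beta>: "closed_on P \<beta>"
    unfolding \<beta>_def
  proof (rule closed_on_cmult[OF P])
    have "ambient_deriv (fibre_integral 0 T \<Theta>) p vs = 0" if "p \<in> P" for p vs
      using cartan_fibre_integral[OF P that \<Omega>(3,1) sm\<Theta> T(1)] closed_fibre_integral_zero(1)[OF \<Theta> \<Omega>(3) that]
        periodic[OF that, of 0] by simp
    then show "closed_on P (fibre_integral 0 T \<Theta>)"
      unfolding closed_on_def
      using ambient_form_fibre_integral[OF P \<Omega>(1,3) closed_onD(1)[OF \<Theta>]] by simp
  qed
  have coh: "cohomologous U \<omega> (\<lambda>p vs. \<alpha> p vs + wdg (\<lambda>us. - \<i> * log_deriv t p us) (\<beta> p) vs)"
  proof -
    \<comment> \<open>\<open>\<tau>\<close> is d arg t, \<open>m z\<close> is the point of the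
      circle in the direction of \<open>t z\<close>, and \<open>Q\<close> rotates away from it.
      Since arg t may have no smooth branch on \<open>U\<close>, the rotation starts at
      \<open>m z\<close> and not at angle \<open>0\<close>.\<close>
    define \<tau> where "\<tau> p v = Im (frechet_derivative t (at p) v / t p)" for p v
    define m where "m z = of_real (r z) * (t z / of_real (norm (t z)))" for z
    define Q where "Q = (\<lambda>z::real \<times> 'a. J (cis (fst z) * m (snd z), snd z))"
    have rU: "smooth_on U r" by (rule smooth_on_subset[OF r(1) U(2)])
    have m: "smooth_on U m"
      unfolding m_def
      by (intro smooth_on_mult smooth_on_of_real smooth_on_divide smooth_on_norm U(1) rU t) (use t(2) in simp_all)
    have norm_m: "norm (m z) = r z" if "z \<in> U" for z
      using t(2)[OF that] r(2)[of z] U(2) that by (auto simp: m_def norm_mult norm_divide abs_of_pos)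
    have m_snd: "smooth_on \<Omega>U (\<lambda>z. m (snd z))"
      by (rule smooth_on_compose[OF \<Omega>(2) U(1) m _ smooth_on_snd[OF \<Omega>(2) smooth_on_ident[OF \<Omega>(2)]]])
        (auto simp: \<Omega>U_def)
    have kQ: "(\<lambda>z. (cis (fst z) * m (snd z), snd z)) ` \<Omega>U \<subseteq> D"
      using norm_m U(2) by (auto simp: \<Omega>U_def norm_mult intro!: circle)
    have smQ: "smooth_on \<Omega>U (\<lambda>z. (cis (fst z) * m (snd z), snd z))"
      by (intro smooth_on_Pair smooth_on_mult smooth_on_cis smooth_on_fst smooth_on_snd
          smooth_on_ident \<Omega>(2) m_snd)
    have Q: "smooth_on \<Omega>U Q" "Q ` \<Omega>U \<subseteq> U"
    proof -
      show "smooth_on \<Omega>U Q" unfolding Q_def by (rule smooth_on_compose[OF \<Omega>(2) D J(1) kQ smQ])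
      show "Q ` \<Omega>U \<subseteq> U" using kQ J(2) by (auto simp: Q_def)
    qed
    note \<Theta>Q = closed_on_pullback[OF \<Omega>(2) U(1) Q \<omega>]
    have 1: "cohomologous U (interval_integral_form 0 T (pullback Q \<omega>))
        (\<lambda>p vs. of_real T * pullback Q \<omega> (T, p) (map (Pair 0) vs))"
      by (rule average_cohomologous[OF U(1) \<Omega>(2,4) \<Theta>Q T(1)])
    \<comment> \<open>A full turn returns to \<open>m z\<close>, and the straight segment from
      \<open>t z\<close> to \<open>m z\<close> deforms the resulting map to the identity.\<close>
    have 2: "cohomologous U (pullback (\<lambda>p. Q (T, p)) \<omega>) \<omega>"
    proof -
      define k\<Phi> where "k\<Phi> = (\<lambda>z::real \<times> 'a. (of_real (1 - fst z + fst z * (r (snd z) / norm (t (snd z)))) * t (snd z), snd z))"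
      define \<Phi> where "\<Phi> = (\<lambda>z. J (k\<Phi> z))"
      define \<Omega> where "\<Omega> = \<Omega>U \<inter> k\<Phi> -` D"
      have snd: "smooth_on \<Omega>U snd"
        by (rule smooth_on_snd[OF \<open>open \<Omega>U\<close> smooth_on_ident[OF \<open>open \<Omega>U\<close>]])
      have snd': "snd ` \<Omega>U \<subseteq> U" by (auto simp: \<Omega>U_def)
      have rn: "smooth_on \<Omega>U (\<lambda>z. r (snd z) / norm (t (snd z)))"
        by (rule smooth_on_compose[OF \<open>open \<Omega>U\<close> U(1) _ snd' snd])
          (intro smooth_on_divide smooth_on_norm U(1) rU t, use t(2) in simp_all)
      have k\<Phi>: "smooth_on \<Omega>U k\<Phi>"
        unfolding k\<Phi>_def
        by (intro smooth_on_Pair smooth_on_mult smooth_on_of_real smooth_on_add smooth_on_diff smooth_on_const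
            smooth_on_fst smooth_on_ident snd \<open>open \<Omega>U\<close> rn smooth_on_compose[OF \<open>open \<Omega>U\<close> U(1) t(1) snd' snd])
      have op: "open \<Omega>"
        unfolding \<Omega>_def
        by (rule continuous_open_preimage[OF smooth_on_imp_continuous_on[OF k\<Phi>] \<open>open \<Omega>U\<close> D])
      have sub: "{0..1} \<times> U \<subseteq> \<Omega>"
        using segment by (auto simp: \<Omega>_def \<Omega>U_def k\<Phi>_def)
      have im: "k\<Phi> ` \<Omega> \<subseteq> D" by (auto simp: \<Omega>_def)
      have \<Phi>: "smooth_on \<Omega> \<Phi>" "\<Phi> ` \<Omega> \<subseteq> U"
      proof -
        show "smooth_on \<Omega> \<Phi>"
          unfolding \<Phi>_def
          by (rule smooth_on_compose[OF op D J(1) im smooth_on_subset[OF k\<Phi>]]) (auto simp: \<Omega>_def)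
        show "\<Phi> ` \<Omega> \<subseteq> U" using im J(2) by (auto simp: \<Phi>_def)
      qed
      have "\<Phi> (1, p) = Q (T, p)" for p
        by (simp add: \<Phi>_def k\<Phi>_def Q_def m_def T_def)
      moreover have "pullback (\<lambda>p. \<Phi> (0, p)) \<omega> p = \<omega> p" if "p \<in> U" for p
        by (rule pullback_id[OF _ U(1) that]) (simp add: \<Phi>_def k\<Phi>_def Jt)
      ultimately show ?thesis
        using homotopy_cohomologous[OF U(1) U(1) op sub \<Phi> \<omega>]
        by (intro cohomologous_cong[OF _ _ homotopy_cohomologous[OF U(1) U(1) op sub \<Phi> \<omega>]]) simp_all
    qed
    \<comment> \<open>At \<open>p\<close>, rotation by \<open>v\<close> from \<open>m p\<close> is
      \<open>F\<close> at angle \<open>v\<close> plus the argument. The derivative in the base picks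
      up \<open>\<tau>\<close> times the angular derivative, so expanding the shear gives
      \<open>\<alpha>\<close> plus the product of \<open>\<tau>\<close> and \<open>\<beta>\<close>,
      once the integrals are shifted back by periodicity.\<close>
    have 3: "interval_integral_form 0 T (pullback Q \<omega>) p vs
       = of_real T * (\<alpha> p vs + wdg (one_form (\<lambda>p v. of_real (\<tau> p v)) p) (\<beta> p) vs)" if p: "p \<in> U" for p vs
    proof -
      have pP: "p \<in> P" using p U(2) by blast
      have t0: "t p \<noteq> 0" using t(2)[OF p] .
      \<comment> \<open>The argument is chosen at the single point \<open>p\<close>; no branch near
        \<open>p\<close> is differentiated, because the derivative of \<open>m\<close> is computed
        from \<open>t\<close> itself.\<close>
      define a where "a = Arg2pi (t p)"
      have a: "0 \<le> a" "a \<le> T" using Arg2pi[of "t p"] by (auto simp: a_def T_def)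
      have cis_a: "t p / of_real (norm (t p)) = cis a"
        using Arg2pi[of "t p"] t0 by (simp add: a_def cis_conv_exp is_Arg_def field_simps)
      have mp: "m p = of_real (r p) * cis a" by (simp add: m_def cis_a)
      have dm: "(m has_derivative (\<lambda>w. of_real (r p) * (\<i> * of_real (\<tau> p w) * cis a) + of_real (frechet_derivative r (at p) w) * cis a)) (at p)"
        using has_derivative_mult[OF has_derivative_of_real[OF smooth_on_has_derivative[OF rU p]]
            has_derivative_polar(2)[OF smooth_on_has_derivative[OF t(1) p] t0]]
        unfolding cis_a m_def[abs_def] \<tau>_def .
      have slice: "frechet_derivative (\<lambda>z. Q (v, z)) (at p) w
          = frechet_derivative F (at (v + a, p)) (0, w) + \<tau> p w *\<^sub>R frechet_derivative F (at (v + a, p)) (1, 0)" for v w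
      proof -
        have memP: "(v + a, p) \<in> \<Omega>P" using pP by (simp add: \<Omega>P_def)
        have kmem: "k (v + a, p) \<in> D" using k(2) memP by blast
        have kk: "k (v + a, p) = (cis v * m p, p)" by (simp add: k_def mp cis_mult[symmetric] mult.left_commute)
        note dJ = smooth_on_has_derivative[OF J(1) kmem]
        have dk: "(k has_derivative (\<lambda>w. (of_real (r p) * (of_real (fst w) * (\<i> * cis (v + a)))
            + of_real (frechet_derivative r (at p) (snd w)) * cis (v + a), snd w))) (at (v + a, p))"
        proof -
          have "((\<lambda>z::real \<times> 'a. r (snd z)) has_derivative (\<lambda>w. frechet_derivative r (at p) (snd w))) (at (v + a, p))"
            using has_derivative_compose[OF has_derivative_snd[OF has_derivative_ident], of r _ "(v + a, p)"]
              smooth_on_has_derivative[OF r(1) pP] by simp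
          moreover have "((\<lambda>z::real \<times> 'a. cis (fst z)) has_derivative (\<lambda>w. of_real (fst w) * (\<i> * cis (v + a)))) (at (v + a, p))"
            using has_derivative_cis[OF has_derivative_fst[OF has_derivative_ident], of "(v + a, p)" UNIV]
            by (simp add: scaleR_conv_of_real)
          ultimately show ?thesis
            unfolding k_def
            by (intro has_derivative_Pair has_derivative_snd has_derivative_ident
                has_derivative_eq_rhs[OF has_derivative_mult[OF has_derivative_of_real]]) auto
        qed
        have "((\<lambda>z. (cis v * m z, z)) has_derivative (\<lambda>w. (cis v * (of_real (r p) * (\<i> * of_real (\<tau> p w) * cis a)
           + of_real (frechet_derivative r (at p) w) * cis a), w))) (at p)"
          by (intro has_derivative_Pair has_derivative_mult_right dm has_derivative_ident)
        from has_derivative_compose[OF this dJ[unfolded kk]]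
        have "frechet_derivative (\<lambda>z. Q (v, z)) (at p) w = frechet_derivative J (at (cis v * m p, p))
           (cis v * (of_real (r p) * (\<i> * of_real (\<tau> p w) * cis a) + of_real (frechet_derivative r (at p) w) * cis a), w)"
          by (simp add: Q_def frechet_derivative_eqI)
        also have "\<dots> = frechet_derivative F (at (v + a, p)) (\<tau> p w, w)"
          using has_derivative_compose[OF dk dJ] unfolding kk
          by (simp add: F_def[symmetric] frechet_derivative_eqI cis_mult[symmetric] algebra_simps)
        also have "(\<tau> p w, w) = (0, w) + \<tau> p w *\<^sub>R (1, 0)" by simp
        also have "frechet_derivative F (at (v + a, p)) \<dots> = frechet_derivative F (at (v + a, p)) (0, w)
           + \<tau> p w *\<^sub>R frechet_derivative F (at (v + a, p)) (1, 0)"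
          using smooth_on_frechet_linear[OF F(1) memP] by (simp only: linear_add linear_scale)
        finally show ?thesis .
      qed
      have pointwise: "pullback Q \<omega> (v, p) (map (Pair 0) vs) = \<Theta> (v + a, p) (map (Pair 0) vs)
         + wdg (one_form (\<lambda>p v. of_real (\<tau> p v)) p) (\<lambda>us. \<Theta> (v + a, p) ((1, 0) # map (Pair 0) us)) vs" for v vs
      proof -
        have memU: "(v, p) \<in> \<Omega>U" using p by (simp add: \<Omega>U_def)
        have memP: "(v + a, p) \<in> \<Omega>P" using pP by (simp add: \<Omega>P_def)
        have FQ: "Q (v, p) = F (v + a, p)" by (simp add: Q_def F_def k_def mp cis_mult[symmetric] mult.left_commute)
        have alt: "alternating (\<omega> (F (v + a, p)))"
          using ambient_form_alternating[OF closed_onD(1)[OF \<omega>]] F(2) memP by blast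
        have "pullback Q \<omega> (v, p) (map (Pair 0) vs) = \<omega> (F (v + a, p)) (map (\<lambda>w. frechet_derivative F (at (v + a, p)) (0, w)
            + \<tau> p w *\<^sub>R frechet_derivative F (at (v + a, p)) (1, 0)) vs)"
          unfolding slice_pullback[OF Q(1) memU] unfolding pullback_def FQ by (simp only: slice cong: map_cong)
        also have "\<dots> = \<omega> (F (v + a, p)) (map (\<lambda>w. frechet_derivative F (at (v + a, p)) (0, w)) vs)
           + wdg (one_form (\<lambda>_ v. of_real (\<tau> p v)) p) (\<lambda>us. \<omega> (F (v + a, p)) (frechet_derivative F (at (v + a, p)) (1, 0)
             # map (\<lambda>w. frechet_derivative F (at (v + a, p)) (0, w)) us)) vs"
          by (rule multilinear_shift_expand[OF alt])
        also have "one_form (\<lambda>_ v. of_real (\<tau> p v)) p = one_form (\<lambda>p v. of_real (\<tau> p v)) p"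
          by (rule ext) (simp add: one_form_def)
        finally show ?thesis by (simp add: \<Theta>_def pullback_def comp_def)
      qed
      have contP: "continuous_on UNIV (\<lambda>x. \<Theta> (x, p) us)" for us
        using slice_continuous[OF smooth_on_imp_continuous_on[OF smooth_coeffsD[OF sm\<Theta>]] _ pP] \<Omega>P_def
        by (intro continuous_on_compose2[OF smooth_on_imp_continuous_on[OF smooth_coeffsD[OF sm\<Theta>]]] continuous_intros)
          (use pP in \<open>auto simp: \<Omega>P_def\<close>)
      have per: "integral {0..T} (\<lambda>x. \<Theta> (x + a, p) us) = integral {0..T} (\<lambda>x. \<Theta> (x, p) us)" for us
        by (rule periodic_integral_shift[OF contP periodic[OF pP] a])
      have int: "(\<lambda>x. \<Theta> (x + a, p) us) integrable_on {0..T}" for us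
        by (rule integrable_continuous_interval) (intro continuous_on_compose2[OF contP] continuous_intros; simp)
      have "interval_integral_form 0 T (pullback Q \<omega>) p vs
        = interval_integral_form 0 T \<Theta> p vs + wdg (one_form (\<lambda>p v. of_real (\<tau> p v)) p) (fibre_integral 0 T \<Theta> p) vs"
        unfolding interval_integral_form_def fibre_integral_def pointwise
        by (subst integral_add) (use int integral_wdg_right[of "\<lambda>v us. \<Theta> (v + a, p) ((1, 0) # map (Pair 0) us)" "{0..T}"] in \<open>simp_all add: per\<close>)
      moreover have "complex_of_real T * (of_real (inverse T) * c) = c" for c using T(2) by simp
      ultimately show ?thesis
        by (simp only: \<alpha>_def \<beta>_def wdg_cmult_right distrib_left)
    qed
    have 4: "cohomologous U \<omega> (\<lambda>p vs. \<alpha> p vs + wdg (one_form (\<lambda>p v. of_real (\<tau> p v)) p) (\<beta> p) vs)"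
    proof (rule cohomologous_sym[OF U(1)], rule cohomologous_trans[OF U(1) _ 2])
      show "cohomologous U (\<lambda>p vs. \<alpha> p vs + wdg (one_form (\<lambda>p v. of_real (\<tau> p v)) p) (\<beta> p) vs) (pullback (\<lambda>p. Q (T, p)) \<omega>)"
      proof (rule cohomologous_cong[OF _ _ cohomologous_cmult[OF U(1) 1, of "of_real (inverse T)"]])
        fix p vs assume p: "p \<in> U"
        show "of_real (inverse T) * interval_integral_form 0 T (pullback Q \<omega>) p vs
          = \<alpha> p vs + wdg (one_form (\<lambda>p v. of_real (\<tau> p v)) p) (\<beta> p) vs"
          unfolding 3[OF p] using T(2) by simp
        have "(T, p) \<in> \<Omega>U" using p by (simp add: \<Omega>U_def)
        then show "of_real (inverse T) * (of_real T * pullback Q \<omega> (T, p) (map (Pair 0) vs)) = pullback (\<lambda>p. Q (T, p)) \<omega> p vs"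
          unfolding slice_pullback[OF Q(1) \<open>(T, p) \<in> \<Omega>U\<close>] using T(2) by simp
      qed
    qed
    \<comment> \<open>d arg t equals -i d log t plus i d ln |t|; multiplied by the closed form
      \<open>\<beta>\<close>, the second summand has the primitive \<open>ell\<close> times
      \<open>\<beta>\<close>.\<close>
    have 5: "cohomologous U (\<lambda>p vs. \<alpha> p vs + wdg (one_form (\<lambda>p v. of_real (\<tau> p v)) p) (\<beta> p) vs)
       (\<lambda>p vs. \<alpha> p vs + wdg (\<lambda>us. - \<i> * log_deriv t p us) (\<beta> p) vs)"
    proof -
      define ell where "ell q = \<i> * of_real (ln (norm (t q)))" for q
      have sm: "smooth_on U ell"
        unfolding ell_def
        by (intro smooth_on_mult smooth_on_const smooth_on_of_real smooth_on_ln smooth_on_norm U(1) t) (use t(2) in simp_all)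
      have \<beta>U: "closed_on U \<beta>" by (rule closed_on_subset[OF \<beta> U(2)])
      show ?thesis
      proof (rule cohomologousI[OF ambient_form_fmult[OF U(1) sm closed_onD(1)[OF \<beta>U]]])
        fix p vs assume p: "p \<in> U"
        have t0: "norm (t p) > 0" using t(2)[OF p] by simp
        have "(ell has_derivative (\<lambda>w. \<i> * of_real (Re (frechet_derivative t (at p) w / t p)))) (at p)"
          unfolding ell_def
          using has_derivative_compose[OF has_derivative_polar(1)[OF smooth_on_has_derivative[OF t(1) p] t(2)[OF p]]
              DERIV_ln[OF t0, unfolded has_field_derivative_def]] t0
          by (intro has_derivative_mult_right has_derivative_of_real) (simp add: mult.assoc[symmetric])
        then have fd: "frechet_derivative ell (at p) w = \<i> * of_real (Re (frechet_derivative t (at p) w / t p))" for w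
          by (simp add: frechet_derivative_eqI)
        have "of_real (\<tau> p w) = - \<i> * (frechet_derivative t (at p) w / t p) + frechet_derivative ell (at p) w" for w
          unfolding fd \<tau>_def by (simp add: complex_eq_iff del: times_divide_eq_right)
        then have "one_form (\<lambda>p v. of_real (\<tau> p v)) p
            = (\<lambda>us. - \<i> * log_deriv t p us + one_form (\<lambda>p v. frechet_derivative ell (at p) v) p us)"
          by (intro ext) (simp add: one_form_def log_deriv_def)
        then show "\<alpha> p vs + wdg (one_form (\<lambda>p v. of_real (\<tau> p v)) p) (\<beta> p) vs
          = \<alpha> p vs + wdg (\<lambda>us. - \<i> * log_deriv t p us) (\<beta> p) vs + ambient_deriv (\<lambda>q vs. ell q * \<beta> q vs) p vs"
          unfolding function_times_closed[OF U(1) sm \<beta>U p] by (simp only: wdg_add_left add.assoc)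
      qed
    qed
    show ?thesis by (rule cohomologous_trans[OF U(1) 4 5])
  qed
  \<comment> \<open>If \<open>\<pi>\<close> and \<open>\<theta>\<close> intertwine the circles,
    \<open>\<Theta>\<close> is invariant under \<open>\<pi>\<close> acting on the base, and so are
    its integrals over the angle.\<close>
  have basic: "\<forall>p\<in>P. pullback \<pi> \<alpha> p = \<alpha> p \<and> pullback \<pi> \<beta> p = \<beta> p"
    if \<pi>: "smooth_on P \<pi>" "\<pi> ` P \<subseteq> P" and \<theta>: "smooth_on U \<theta>" "\<theta> ` U \<subseteq> U"
      and r\<pi>: "\<And>z. z \<in> P \<Longrightarrow> r (\<pi> z) = r z"
      and J\<pi>: "\<And>z u. z \<in> P \<Longrightarrow> norm u = r z \<Longrightarrow> J (u, \<pi> z) = \<theta> (J (u, z))"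
      and \<theta>\<omega>: "\<And>p. p \<in> U \<Longrightarrow> pullback \<theta> \<omega> p = \<omega> p" for \<pi> \<theta>
  proof
    fix p assume p: "p \<in> P"
    define S where "S = (\<lambda>z::real \<times> 'a. (fst z, \<pi> (snd z)))"
    have mem: "(x, p) \<in> \<Omega>P" "(x, \<pi> p) \<in> \<Omega>P" for x using p \<pi>(2) by (auto simp: \<Omega>P_def)
    have dS: "(S has_derivative (\<lambda>w. (fst w, frechet_derivative \<pi> (at p) (snd w)))) (at (x, p))" for x
      unfolding S_def
      by (intro has_derivative_Pair has_derivative_fst has_derivative_ident
          has_derivative_compose[of snd snd "(x, p)" UNIV \<pi>, simplified] smooth_on_has_derivative[OF \<pi>(1)])
        (use p in \<open>simp_all add: has_derivative_snd[OF has_derivative_ident] smooth_on_has_derivative[OF \<pi>(1)]\<close>)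
    have FS: "F (S z) = \<theta> (F z)" if "z \<in> \<Omega>P" for z
      using that r(2)[of "snd z"] r\<pi>[of "snd z"] J\<pi>[of "snd z" "of_real (r (snd z)) * cis (fst z)"]
      by (auto simp: F_def k_def S_def \<Omega>P_def norm_mult)
    have key: "\<Theta> (x, \<pi> p) (map (\<lambda>w. (fst w, frechet_derivative \<pi> (at p) (snd w))) ws) = \<Theta> (x, p) ws" for x ws
    proof -
      have diff: "S differentiable at (x, p)" "F differentiable at (S (x, p))" "F differentiable at (x, p)"
        using dS smooth_on_imp_differentiable[OF F(1) mem(1)] smooth_on_imp_differentiable[OF F(1) mem(2)]
        by (auto simp: differentiable_def S_def)
      have Fx: "F (x, p) \<in> U" using F(2) mem(1) by blast
      have "\<Theta> (x, \<pi> p) (map (\<lambda>w. (fst w, frechet_derivative \<pi> (at p) (snd w))) ws) = pullback S (pullback F \<omega>) (x, p) ws"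
        by (simp add: pullback_def[of S] \<Theta>_def frechet_derivative_eqI[OF dS]) (simp add: S_def)
      also have "\<dots> = pullback (\<lambda>z. F (S z)) \<omega> (x, p) ws"
        by (simp add: pullback_compose[OF diff(1,2)])
      also have "\<dots> = pullback (\<lambda>z. \<theta> (F z)) \<omega> (x, p) ws"
        by (rule fun_cong[OF pullback_cong[OF \<Omega>(1) mem(1) FS]])
      also have "\<dots> = pullback F (pullback \<theta> \<omega>) (x, p) ws"
        by (simp add: pullback_compose[OF diff(3) smooth_on_imp_differentiable[OF \<theta>(1) Fx]])
      also have "\<dots> = \<Theta> (x, p) ws"
        by (simp add: pullback_def[of F] \<Theta>_def \<theta>\<omega>[OF Fx])
      finally show ?thesis .
    qed
    have "\<Theta> (x, \<pi> p) (map (Pair 0) (map (frechet_derivative \<pi> (at p)) vs)) = \<Theta> (x, p) (map (Pair 0) vs)" for x vs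
      using key[of x "map (Pair 0) vs"] by (simp add: comp_def)
    then have 1: "pullback \<pi> \<alpha> p = \<alpha> p"
      by (intro ext) (simp add: pullback_def \<alpha>_def interval_integral_form_def)
    have "\<Theta> (x, \<pi> p) ((1, 0) # map (Pair 0) (map (frechet_derivative \<pi> (at p)) vs)) = \<Theta> (x, p) ((1, 0) # map (Pair 0) vs)" for x vs
      using key[of x "(1, 0) # map (Pair 0) vs"] linear_0[OF smooth_on_frechet_linear[OF \<pi>(1) p]] by (simp add: comp_def)
    then have 2: "pullback \<pi> \<beta> p = \<beta> p"
      by (intro ext) (simp add: pullback_def \<beta>_def fibre_integral_def interval_integral_form_def)
    show "pullback \<pi> \<alpha> p = \<alpha> p \<and> pullback \<pi> \<beta> p = \<beta> p" using 1 2 by simp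
  qed
  show thesis by (rule that[OF \<alpha> \<beta> coh basic])
qed

section \<open>De Rham cohomology of open sets and of their smooth retracts\<close>

section \<open>The de Rham algebra of an open set\<close>

lemma tangent_space_open:
  assumes "open X" "p \<in> X"
  shows "tangent_space X p = UNIV"
proof -
  have "v \<in> tangent_space X p" for v
  proof -
    have "open ((\<lambda>s::real. p + s *\<^sub>R v) -` X)"
      by (rule open_vimage[OF assms(1)]) (intro continuous_intros)
    moreover have "0 \<in> (\<lambda>s::real. p + s *\<^sub>R v) -` X" using assms(2) by simp
    ultimately obtain e where e: "e > 0" "ball 0 e \<subseteq> (\<lambda>s::real. p + s *\<^sub>R v) -` X"
      using openE by blast
    have "smooth_on {-e<..<e} (\<lambda>s. p + s *\<^sub>R v)"
      by (intro smooth_on_add smooth_on_const smooth_on_scaleR smooth_on_ident open_greaterThanLessThan)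
    moreover have "(\<lambda>s. p + s *\<^sub>R v) ` {-e<..<e} \<subseteq> X"
      using e(2) by (auto simp: ball_def dist_norm subset_iff)
    moreover have "((\<lambda>s. p + s *\<^sub>R v) has_vector_derivative v) (at (0::real))"
      by (auto intro!: derivative_eq_intros simp: has_vector_derivative_def)
    ultimately show ?thesis
      unfolding tangent_space_def using e(1)
      by (intro CollectI exI[of _ e] conjI exI[of _ "\<lambda>s. p + s *\<^sub>R v"]) simp_all
  qed
  then show ?thesis by blast
qed

lemma restrict_form_open: "open X \<Longrightarrow> restrict_form X \<omega> = (\<lambda>p vs. if p \<in> X then \<omega> p vs else 0)"
  by (intro ext) (simp add: restrict_form_def tangent_space_open)

lemma ambient_form_restrict:
  "open X \<Longrightarrow> ambient_form X \<omega> \<Longrightarrow> ambient_form X (restrict_form X \<omega>)"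
  by (rule ambient_form_cong[of X \<omega>]) (simp_all add: restrict_form_open)

lemma smooth_forms_open:
  assumes X: "open X"
  shows "smooth_forms X = {\<omega>. ambient_form X \<omega> \<and> (\<forall>p vs. p \<notin> X \<longrightarrow> \<omega> p vs = 0)}"
proof (intro Set.set_eqI iffI)
  fix \<omega> assume \<omega>: "\<omega> \<in> smooth_forms X"
  have r: "restrict_form X \<omega> = \<omega>" and alt: "\<And>p. p \<in> X \<Longrightarrow> alternating (\<omega> p)"
    and loc: "\<And>p. p \<in> X \<Longrightarrow> \<exists>U \<eta>. p \<in> U \<and> local_extension X \<omega> U \<eta>"
    using \<omega> unfolding smooth_forms_def by (simp_all add: tangent_space_open[OF X])
  have "smooth_on X (\<lambda>q. \<omega> q vs)" for vs
  proof (rule smooth_on_local)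
    fix p assume p: "p \<in> X"
    obtain U \<eta> where U0: "p \<in> U" "local_extension X \<omega> U \<eta>" using loc[OF p] by blast
    then have U: "p \<in> U" "open U" "ambient_form U \<eta>" and eq: "\<And>q vs. q \<in> X \<inter> U \<Longrightarrow> \<eta> q vs = \<omega> q vs"
      unfolding local_extension_def by (simp_all add: tangent_space_open[OF X])
    have "smooth_on (X \<inter> U) (\<lambda>q. \<eta> q vs)"
      by (rule smooth_on_subset[OF smooth_coeffsD[OF ambient_form_smooth[OF U(3)]]]) simp
    then have "smooth_on (X \<inter> U) (\<lambda>q. \<omega> q vs)"
      by (rule smooth_on_cong[OF open_Int[OF X U(2)], rotated]) (rule eq)
    then show "\<exists>V. open V \<and> p \<in> V \<and> smooth_on V (\<lambda>q. \<omega> q vs)"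
      using p U(1) open_Int[OF X U(2)] by (intro exI[of _ "X \<inter> U"] conjI) simp_all
  qed
  with alt have "ambient_form X \<omega>" by (simp add: ambient_form_def)
  moreover have "\<omega> p vs = 0" if "p \<notin> X" for p vs
    using fun_cong[OF fun_cong[OF r, of p], of vs] that by (simp add: restrict_form_open[OF X])
  ultimately show "\<omega> \<in> {\<omega>. ambient_form X \<omega> \<and> (\<forall>p vs. p \<notin> X \<longrightarrow> \<omega> p vs = 0)}" by simp
next
  fix \<omega> assume \<omega>: "\<omega> \<in> {\<omega>. ambient_form X \<omega> \<and> (\<forall>p vs. p \<notin> X \<longrightarrow> \<omega> p vs = 0)}"
  have "restrict_form X \<omega> = \<omega>" using \<omega> by (intro ext) (auto simp: restrict_form_open[OF X])
  moreover have "local_extension X \<omega> X \<omega>" using \<omega> X by (simp add: local_extension_def)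
  ultimately show "\<omega> \<in> smooth_forms X"
    using \<omega> unfolding smooth_forms_def by (auto simp: tangent_space_open[OF X] ambient_form_alternating)
qed

lemma exterior_deriv_open:
  assumes X: "open X" and \<omega>: "\<omega> \<in> smooth_forms X"
  shows "exterior_deriv X \<omega> = restrict_form X (ambient_deriv \<omega>)"
proof -
  have amb: "ambient_form X \<omega>" using \<omega> by (simp add: smooth_forms_open[OF X])
  have "(THE y. \<exists>U \<eta>. p \<in> U \<and> local_extension X \<omega> U \<eta> \<and> y = ambient_deriv \<eta> p vs) = ambient_deriv \<omega> p vs"
    if p: "p \<in> X" for p vs
  proof (rule the_equality)
    have "local_extension X \<omega> X \<omega>" using amb X by (simp add: local_extension_def)
    then show "\<exists>U \<eta>. p \<in> U \<and> local_extension X \<omega> U \<eta> \<and> ambient_deriv \<omega> p vs = ambient_deriv \<eta> p vs"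
      using p by blast
    fix y assume "\<exists>U \<eta>. p \<in> U \<and> local_extension X \<omega> U \<eta> \<and> y = ambient_deriv \<eta> p vs"
    then obtain U \<eta> where U0: "p \<in> U" "local_extension X \<omega> U \<eta>" "y = ambient_deriv \<eta> p vs" by blast
    have U: "open U" and eq: "\<And>q vs. q \<in> X \<inter> U \<Longrightarrow> \<eta> q vs = \<omega> q vs"
      using U0(2) unfolding local_extension_def by (simp_all add: tangent_space_open[OF X])
    show "y = ambient_deriv \<omega> p vs"
      unfolding U0(3) by (rule ambient_deriv_cong[OF open_Int[OF X U] _ eq]) (use U0(1) p in simp)
  qed
  then show ?thesis
    unfolding exterior_deriv_def by (intro ext) (simp add: restrict_form_open[OF X])
qed

lemma closed_forms_open:
  assumes X: "open X"
  shows "closed_forms X = {\<omega>. closed_on X \<omega> \<and> (\<forall>p vs. p \<notin> X \<longrightarrow> \<omega> p vs = 0)}"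
proof -
  have "exterior_deriv X \<omega> = (\<lambda>_ _. 0) \<longleftrightarrow> (\<forall>p\<in>X. \<forall>vs. ambient_deriv \<omega> p vs = 0)" if "\<omega> \<in> smooth_forms X" for \<omega>
    unfolding exterior_deriv_open[OF X that] by (simp add: restrict_form_open[OF X] fun_eq_iff Ball_def)
  then show ?thesis
    unfolding closed_forms_def closed_on_def using smooth_forms_open[OF X] by auto
qed

lemma exact_forms_open:
  assumes X: "open X"
  shows "exact_forms X = {restrict_form X (ambient_deriv \<eta>) | \<eta>. ambient_form X \<eta>}"
proof (intro Set.set_eqI iffI)
  fix \<omega> assume "\<omega> \<in> exact_forms X"
  then show "\<omega> \<in> {restrict_form X (ambient_deriv \<eta>) | \<eta>. ambient_form X \<eta>}"
    unfolding exact_forms_def using exterior_deriv_open[OF X] smooth_forms_open[OF X] by auto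
next
  fix \<omega> assume "\<omega> \<in> {restrict_form X (ambient_deriv \<eta>) | \<eta>. ambient_form X \<eta>}"
  then obtain \<eta> where \<eta>: "ambient_form X \<eta>" "\<omega> = restrict_form X (ambient_deriv \<eta>)" by blast
  let ?\<eta> = "restrict_form X \<eta>"
  have mem: "?\<eta> \<in> smooth_forms X"
    using ambient_form_restrict[OF X \<eta>(1)] by (simp add: smooth_forms_open[OF X] restrict_form_open[OF X])
  have "ambient_deriv ?\<eta> p vs = ambient_deriv \<eta> p vs" if "p \<in> X" for p vs
    by (rule ambient_deriv_cong[OF X that]) (simp add: restrict_form_open[OF X])
  then have "exterior_deriv X ?\<eta> = \<omega>"
    unfolding exterior_deriv_open[OF X mem] \<eta>(2) by (intro ext) (simp add: restrict_form_open[OF X])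
  with mem show "\<omega> \<in> exact_forms X" unfolding exact_forms_def by blast
qed

lemma exact_forms_iff:
  assumes X: "open X"
  shows "\<omega> \<in> exact_forms X \<longleftrightarrow> cohomologous X \<omega> (\<lambda>p vs. 0) \<and> (\<forall>p vs. p \<notin> X \<longrightarrow> \<omega> p vs = 0)"
proof
  assume "\<omega> \<in> exact_forms X"
  then obtain \<eta> where \<eta>: "ambient_form X \<eta>" "\<omega> = restrict_form X (ambient_deriv \<eta>)"
    by (auto simp: exact_forms_open[OF X])
  then show "cohomologous X \<omega> (\<lambda>p vs. 0) \<and> (\<forall>p vs. p \<notin> X \<longrightarrow> \<omega> p vs = 0)"
    by (auto simp: restrict_form_open[OF X] intro!: cohomologousI[OF \<eta>(1)])
next
  assume a: "cohomologous X \<omega> (\<lambda>p vs. 0) \<and> (\<forall>p vs. p \<notin> X \<longrightarrow> \<omega> p vs = 0)"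
  then obtain \<eta> where \<eta>: "ambient_form X \<eta>" "\<And>p vs. p \<in> X \<Longrightarrow> \<omega> p vs = 0 + ambient_deriv \<eta> p vs"
    using cohomologousE[of X \<omega> "\<lambda>p vs. 0"] by blast
  have "\<omega> = restrict_form X (ambient_deriv \<eta>)"
    using a \<eta>(2) by (intro ext) (simp add: restrict_form_open[OF X])
  with \<eta>(1) show "\<omega> \<in> exact_forms X" by (auto simp: exact_forms_open[OF X])
qed

locale open_set =
  fixes X :: "'a::euclidean_space set"
  assumes open_X: "open X"
begin

definition Z :: "'a form graded_algebra" where
  "Z = form_algebra X (closed_forms X)"

lemma Z_simps [simp]:
  "carrier Z = closed_forms X" "mult Z = wedge" "add Z = (\<lambda>\<alpha> \<beta> p vs. \<alpha> p vs + \<beta> p vs)"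
  "zero Z = (\<lambda>_ _. 0)" "one Z = restrict_form X (function_form (\<lambda>_. 1))"
  "smult Z = (\<lambda>c \<alpha> p vs. c * \<alpha> p vs)" "homog Z = (\<lambda>k. {\<omega>\<in>closed_forms X. homogeneous k \<omega>})"
  by (simp_all add: Z_def form_algebra_def)

lemma closed_iff: "\<omega> \<in> closed_forms X \<longleftrightarrow> closed_on X \<omega> \<and> (\<forall>p vs. p \<notin> X \<longrightarrow> \<omega> p vs = 0)"
  by (simp add: closed_forms_open[OF open_X])

lemma closed_add: "\<alpha> \<in> closed_forms X \<Longrightarrow> \<beta> \<in> closed_forms X \<Longrightarrow> (\<lambda>p vs. \<alpha> p vs + \<beta> p vs) \<in> closed_forms X"
  using closed_on_add[OF open_X] by (simp add: closed_iff)

lemma closed_cmult: "\<alpha> \<in> closed_forms X \<Longrightarrow> (\<lambda>p vs. c * \<alpha> p vs) \<in> closed_forms X"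
  using closed_on_cmult[OF open_X] by (simp add: closed_iff)

lemma closed_zero: "(\<lambda>_ _. 0) \<in> closed_forms X"
  using ambient_form_zero[OF open_X] by (simp add: closed_iff closed_on_def)

lemma closed_wedge: "\<alpha> \<in> closed_forms X \<Longrightarrow> \<beta> \<in> closed_forms X \<Longrightarrow> wedge \<alpha> \<beta> \<in> closed_forms X"
proof -
  assume a: "\<alpha> \<in> closed_forms X" "\<beta> \<in> closed_forms X"
  have "wdg (\<alpha> p) (\<beta> p) vs = 0" if "p \<notin> X" for p vs
  proof -
    have "\<alpha> p = (\<lambda>us. 0)" using a that by (auto simp: closed_iff)
    then show ?thesis by (simp add: wdg_zero_left)
  qed
  then show ?thesis using a closed_on_wdg[OF open_X] unfolding wedge_fun by (simp add: closed_iff)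
qed

definition unit_form :: "'a form" where
  "unit_form = restrict_form X (function_form (\<lambda>_. 1))"

lemma unit_form_at: "unit_form p = (if p \<in> X then const0 1 else (\<lambda>us. 0))"
  by (rule ext) (simp add: unit_form_def restrict_form_open[OF open_X] function_form_eq)

lemma closed_unit: "unit_form \<in> closed_forms X"
proof -
  have "closed_on X (\<lambda>p. const0 1 :: 'a list \<Rightarrow> complex)"
    unfolding closed_on_def
    using ambient_form_const0[OF open_X smooth_on_const[OF open_X]]
    by (auto simp: ambient_deriv_const0[of "\<lambda>_. 1"] one_form_def)
  then have "closed_on X unit_form"
    by (rule closed_on_cong[OF open_X, rotated]) (simp add: unit_form_at)
  then show ?thesis by (simp add: closed_iff unit_form_at)
qed

lemma ring_Z: "ring Z"
proof (rule ringI)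
  show "abelian_group Z"
  proof (rule abelian_groupI)
    fix x assume "x \<in> carrier Z"
    then show "\<exists>y\<in>carrier Z. y \<oplus>\<^bsub>Z\<^esub> x = \<zero>\<^bsub>Z\<^esub>"
      using closed_cmult[of x "-1"] by (intro bexI[of _ "\<lambda>p vs. -1 * x p vs"]) simp_all
  qed (use closed_add closed_zero in \<open>simp_all add: ac_simps\<close>)
  show "monoid Z"
  proof (rule monoidI)
    show "x \<otimes>\<^bsub>Z\<^esub> y \<otimes>\<^bsub>Z\<^esub> z = x \<otimes>\<^bsub>Z\<^esub> (y \<otimes>\<^bsub>Z\<^esub> z)" for x y z
    proof -
      have "(\<lambda>p. wdg (wdg (x p) (y p)) (z p)) = (\<lambda>p. wdg (x p) (wdg (y p) (z p)))"
        by (intro ext wdg_assoc)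
      then show ?thesis by (simp add: wedge_fun)
    qed
    have u: "one Z = unit_form" by (simp add: unit_form_def)
    show "\<one>\<^bsub>Z\<^esub> \<in> carrier Z" unfolding u using closed_unit by simp
    fix x assume "x \<in> carrier Z"
    then have 0: "x p = (\<lambda>us. 0)" if "p \<notin> X" for p using that by (auto simp: closed_iff)
    show "\<one>\<^bsub>Z\<^esub> \<otimes>\<^bsub>Z\<^esub> x = x" "x \<otimes>\<^bsub>Z\<^esub> \<one>\<^bsub>Z\<^esub> = x"
      unfolding u Z_simps wedge_fun
      by (intro ext; simp add: unit_form_at wdg_const_left wdg_const_right wdg_zero_left wdg_zero_right 0)+
  qed (use closed_wedge in simp)
qed (simp_all add: wedge_fun fun_eq_iff wdg_add_left wdg_add_right)

lemma exact_iff: "\<omega> \<in> exact_forms X \<longleftrightarrow> cohomologous X \<omega> (\<lambda>p vs. 0) \<and> (\<forall>p vs. p \<notin> X \<longrightarrow> \<omega> p vs = 0)"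
  by (rule exact_forms_iff[OF open_X])

lemma exact_closed: "exact_forms X \<subseteq> closed_forms X"
proof
  fix \<omega> assume "\<omega> \<in> exact_forms X"
  then obtain \<eta> where \<eta>: "ambient_form X \<eta>" "\<omega> = restrict_form X (ambient_deriv \<eta>)"
    by (auto simp: exact_forms_open[OF open_X])
  have "closed_on X \<omega>"
    by (rule closed_on_cong[OF open_X _ closed_on_deriv[OF open_X \<eta>(1)]])
      (simp add: \<eta>(2) restrict_form_open[OF open_X])
  then show "\<omega> \<in> closed_forms X" by (simp add: closed_iff \<eta>(2) restrict_form_open[OF open_X])
qed

lemma minus_Z: "x \<in> closed_forms X \<Longrightarrow> \<ominus>\<^bsub>Z\<^esub> x = (\<lambda>p vs. - x p vs)"
proof -
  interpret ring Z by (rule ring_Z)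
  assume x: "x \<in> closed_forms X"
  then have "(\<lambda>p vs. - x p vs) \<in> closed_forms X" using closed_cmult[OF x, of "-1"] by simp
  with x show ?thesis by (intro minus_equality) simp_all
qed

lemma wedge_exact_left:
  assumes "a \<in> exact_forms X" "x \<in> closed_forms X"
  shows "wedge x a \<in> exact_forms X"
proof -
  have "cohomologous X (\<lambda>p. wdg (x p) (a p)) (\<lambda>p. wdg (x p) (\<lambda>vs. 0))"
    by (rule cohomologous_wdg[OF open_X]) (use assms in \<open>simp_all add: closed_iff exact_iff\<close>)
  moreover have "wdg (x p) (a p) vs = 0" if "p \<notin> X" for p vs
  proof -
    have "x p = (\<lambda>us. 0)" using assms(2) that by (auto simp: closed_iff)
    then show ?thesis by (simp add: wdg_zero_left)
  qed
  moreover have "(\<lambda>p. wdg (x p) (\<lambda>vs. 0)) = (\<lambda>p vs. 0)" by (intro ext wdg_zero_right)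
  ultimately show ?thesis by (simp add: exact_iff wedge_fun)
qed

lemma wedge_exact_right:
  assumes "a \<in> exact_forms X" "x \<in> closed_forms X"
  shows "wedge a x \<in> exact_forms X"
proof -
  obtain \<eta> where \<eta>: "ambient_form X \<eta>" "\<And>p vs. p \<in> X \<Longrightarrow> a p vs = 0 + ambient_deriv \<eta> p vs"
    using assms(1) cohomologousE[of X a "\<lambda>p vs. 0"] unfolding exact_iff by blast
  have x: "closed_on X x" using assms(2) by (simp add: closed_iff)
  have "cohomologous X (\<lambda>p. wdg (a p) (x p)) (\<lambda>p vs. 0)"
  proof (rule cohomologousI[OF ambient_form_wdg[OF open_X \<eta>(1) closed_onD(1)[OF x]]])
    fix p vs assume p: "p \<in> X"
    have "a p = ambient_deriv \<eta> p" using \<eta>(2)[OF p] by auto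
    moreover have "ambient_deriv x p = (\<lambda>us. 0)" using closed_onD(2)[OF x p] by blast
    ultimately show "wdg (a p) (x p) vs = 0 + ambient_deriv (\<lambda>p. wdg (\<eta> p) (x p)) p vs"
      unfolding ambient_deriv_wdg[OF open_X ambient_form_smooth[OF \<eta>(1)] ambient_form_smooth[OF closed_onD(1)[OF x]] p]
      by (simp add: wdg_zero_right)
  qed
  moreover have "wdg (a p) (x p) vs = 0" if "p \<notin> X" for p vs
  proof -
    have "x p = (\<lambda>us. 0)" using assms(2) that by (auto simp: closed_iff)
    then show ?thesis by (simp add: wdg_zero_right)
  qed
  ultimately show ?thesis by (simp add: exact_iff wedge_fun)
qed

lemma ideal_exact: "ideal (exact_forms X) Z"
proof (rule idealI[OF ring_Z])
  show "subgroup (exact_forms X) (add_monoid Z)"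
  proof (rule subgroup.intro)
    show "exact_forms X \<subseteq> carrier (add_monoid Z)" using exact_closed by simp
    show "x \<otimes>\<^bsub>add_monoid Z\<^esub> y \<in> exact_forms X" if "x \<in> exact_forms X" "y \<in> exact_forms X" for x y
      using that cohomologous_add[OF open_X, of x "\<lambda>p vs. 0" y "\<lambda>p vs. 0"] by (simp add: exact_iff)
    show "\<one>\<^bsub>add_monoid Z\<^esub> \<in> exact_forms X"
      using cohomologous_refl[OF open_X] by (simp add: exact_iff)
    show "inv\<^bsub>add_monoid Z\<^esub> x \<in> exact_forms X" if "x \<in> exact_forms X" for x
    proof -
      have "inv\<^bsub>add_monoid Z\<^esub> x = (\<lambda>p vs. - x p vs)"
        using minus_Z[of x] exact_closed that by (auto simp: a_inv_def)
      then show ?thesis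
        using that cohomologous_cmult[OF open_X, of x "\<lambda>p vs. 0" "-1"] by (simp add: exact_iff)
    qed
  qed
qed (use wedge_exact_left wedge_exact_right in simp_all)

lemma deRham_class_eq: "deRham_class X \<omega> = exact_forms X +>\<^bsub>Z\<^esub> \<omega>"
  by (simp add: deRham_class_def Z_def)

lemma deRham_class_iff:
  assumes "x \<in> closed_forms X" "y \<in> closed_forms X"
  shows "deRham_class X x = deRham_class X y \<longleftrightarrow> cohomologous X x y"
proof -
  interpret ideal "exact_forms X" Z by (rule ideal_exact)
  have "deRham_class X x = deRham_class X y \<longleftrightarrow> x \<ominus>\<^bsub>Z\<^esub> y \<in> exact_forms X"
    unfolding deRham_class_eq by (rule quotient_eq_iff_same_a_r_cos[OF ideal_exact, symmetric]) (use assms in simp_all)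
  also have "x \<ominus>\<^bsub>Z\<^esub> y = (\<lambda>p vs. x p vs - y p vs)"
    using minus_Z[OF assms(2)] by (simp add: a_minus_def)
  also have "\<dots> \<in> exact_forms X \<longleftrightarrow> cohomologous X (\<lambda>p vs. x p vs - y p vs) (\<lambda>p vs. 0)"
    using assms by (simp add: exact_iff closed_iff)
  also have "\<dots> \<longleftrightarrow> cohomologous X x y"
    unfolding cohomologous_def by (simp add: algebra_simps)
  finally show ?thesis .
qed

text \<open>The isomorphism sends a form in \<open>R\<close> to its class: exact elements of
  \<open>R\<close> vanish and every class is represented. The grading is recovered by cutting a
  representative and a primitive to the appropriate degrees.\<close>

lemma graded_iso_criterion:
  fixes R :: "'a form set" and \<Omega> :: "nat \<Rightarrow> 'a form set" and G :: "'a form graded_algebra"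
  assumes G: "carrier G = R" "mult G = wedge" "add G = (\<lambda>\<alpha> \<beta> p vs. \<alpha> p vs + \<beta> p vs)"
      "one G = restrict_form X (function_form (\<lambda>_. 1))" "smult G = (\<lambda>c \<alpha> p vs. c * \<alpha> p vs)"
      "homog G = (\<lambda>k. R \<inter> \<Omega> k)"
    and R: "R \<subseteq> closed_forms X" "\<And>c x. x \<in> R \<Longrightarrow> (\<lambda>p vs. c * x p vs) \<in> R"
      "\<And>x y. x \<in> R \<Longrightarrow> y \<in> R \<Longrightarrow> (\<lambda>p vs. x p vs + y p vs) \<in> R"
    and inj: "\<And>x. x \<in> R \<Longrightarrow> cohomologous X x (\<lambda>p vs. 0) \<Longrightarrow> x = (\<lambda>p vs. 0)"
    and surj: "\<And>\<omega>. \<omega> \<in> closed_forms X \<Longrightarrow> \<exists>x\<in>R. cohomologous X \<omega> x"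
    and homog: "\<And>k x. x \<in> R \<Longrightarrow> x \<in> \<Omega> k \<Longrightarrow> homogeneous k x"
    and comp: "\<And>k x. x \<in> R \<Longrightarrow> component k x \<in> R \<inter> \<Omega> k"
  shows "graded_algebra_isomorphic G (deRham_cohomology X)"
proof -
  interpret ideal "exact_forms X" Z by (rule ideal_exact)
  let ?\<phi> = "deRham_class X"
  let ?H = "deRham_cohomology X"
  have H: "carrier ?H = carrier (Z Quot exact_forms X)" "mult ?H = mult (Z Quot exact_forms X)"
    "add ?H = add (Z Quot exact_forms X)" "one ?H = one (Z Quot exact_forms X)"
    "smult ?H = (\<lambda>c C. \<Union>\<omega>\<in>C. deRham_class X (\<lambda>p vs. c * \<omega> p vs))"
    "homog ?H = (\<lambda>k. deRham_class X ` {\<omega>\<in>closed_forms X. homogeneous k \<omega>})"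
    unfolding deRham_cohomology_def Let_def Z_def[symmetric] by simp_all
  have carrier_H: "carrier ?H = ?\<phi> ` closed_forms X"
    unfolding H(1) by (auto simp: FactRing_def A_RCOSETS_def' deRham_class_eq)
  have hom: "(+>\<^bsub>Z\<^esub>) (exact_forms X) \<in> ring_hom Z (Z Quot exact_forms X)" by (rule rcos_ring_hom)
  have \<phi>: "?\<phi> \<in> ring_hom G ?H"
  proof (rule ring_hom_memI)
    fix x y assume "x \<in> carrier G" "y \<in> carrier G"
    then have x: "x \<in> carrier Z" "y \<in> carrier Z" using R(1) G(1) by auto
    show "?\<phi> x \<in> carrier ?H" using x carrier_H by simp
    show "?\<phi> (x \<otimes>\<^bsub>G\<^esub> y) = ?\<phi> x \<otimes>\<^bsub>?H\<^esub> ?\<phi> y"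
      using ring_hom_mult[OF hom x] by (simp add: deRham_class_eq H G)
    show "?\<phi> (x \<oplus>\<^bsub>G\<^esub> y) = ?\<phi> x \<oplus>\<^bsub>?H\<^esub> ?\<phi> y"
      using ring_hom_add[OF hom x] by (simp add: deRham_class_eq H G)
  next
    show "?\<phi> \<one>\<^bsub>G\<^esub> = \<one>\<^bsub>?H\<^esub>" using ring_hom_one[OF hom] by (simp add: deRham_class_eq H G)
  qed
  have "inj_on ?\<phi> R"
  proof (rule inj_onI)
    fix x y assume x: "x \<in> R" "y \<in> R" and eq: "?\<phi> x = ?\<phi> y"
    have "cohomologous X x y" using eq deRham_class_iff x R(1) by blast
    then have "cohomologous X (\<lambda>p vs. x p vs + -1 * y p vs) (\<lambda>p vs. 0)"
      unfolding cohomologous_def by (simp add: algebra_simps)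
    then have "(\<lambda>p vs. x p vs + -1 * y p vs) = (\<lambda>p vs. 0)"
      by (intro inj R(3) R(2) x)
    then show "x = y" by (simp add: fun_eq_iff)
  qed
  moreover have "?\<phi> ` R = carrier ?H"
  proof -
    have "?\<phi> \<omega> \<in> ?\<phi> ` R" if \<omega>: "\<omega> \<in> closed_forms X" for \<omega>
    proof -
      obtain x where "x \<in> R" "cohomologous X \<omega> x" using surj[OF \<omega>] by blast
      then show ?thesis using deRham_class_iff[OF \<omega>] R(1) by blast
    qed
    then show ?thesis using R(1) carrier_H by auto
  qed
  ultimately have "?\<phi> \<in> ring_iso G ?H"
    using \<phi> G(1) by (simp add: ring_iso_def bij_betw_def)
  moreover have "?\<phi> (c \<odot>\<^bsub>G\<^esub> x) = c \<odot>\<^bsub>?H\<^esub> ?\<phi> x" if "x \<in> carrier G" for c x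
  proof -
    have x: "x \<in> closed_forms X" using that G(1) R(1) by auto
    \<comment> \<open>Scalar multiplication on cohomology is a union over all representatives; it is
      a single class only because the result is independent of the representative.\<close>
    have "?\<phi> (\<lambda>p vs. c * \<omega> p vs) = ?\<phi> (\<lambda>p vs. c * x p vs)" if \<omega>: "\<omega> \<in> ?\<phi> x" for \<omega>
    proof -
      have \<omega>c: "\<omega> \<in> closed_forms X" using \<omega> x a_r_coset_subset_G[of "exact_forms X" x] exact_closed
        by (auto simp: deRham_class_eq)
      have "?\<phi> x = ?\<phi> \<omega>"
        unfolding deRham_class_eq
        by (rule a_repr_independence'[OF _ _]) (use \<omega> x in \<open>simp_all add: deRham_class_eq\<close>)
      then have "cohomologous X x \<omega>" using deRham_class_iff[OF x \<omega>c] by simp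
      then have "cohomologous X (\<lambda>p vs. c * x p vs) (\<lambda>p vs. c * \<omega> p vs)" by (rule cohomologous_cmult[OF open_X])
      then show ?thesis using deRham_class_iff[OF closed_cmult[OF x, of c] closed_cmult[OF \<omega>c, of c]] by simp
    qed
    moreover have "x \<in> ?\<phi> x" unfolding deRham_class_eq by (rule a_rcos_self) (use x in simp)
    ultimately show ?thesis unfolding H G by blast
  qed
  moreover have "?\<phi> ` homog G k = homog ?H k" for k
  proof -
    have "?\<phi> \<omega> \<in> ?\<phi> ` (R \<inter> \<Omega> k)" if \<omega>: "\<omega> \<in> closed_forms X" "homogeneous k \<omega>" for \<omega>
    proof -
      obtain x where x: "x \<in> R" "cohomologous X \<omega> x" using surj[OF \<omega>(1)] by blast
      obtain \<eta> where \<eta>: "ambient_form X \<eta>" "\<And>p vs. p \<in> X \<Longrightarrow> \<omega> p vs = x p vs + ambient_deriv \<eta> p vs"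
        using cohomologousE[OF x(2)] by blast
      \<comment> \<open>The part of degree \<open>k - 1\<close> of the primitive, phrased with
        \<open>Suc\<close> so that it is zero for \<open>k = 0\<close>.\<close>
      define \<eta>' where "\<eta>' p vs = (if Suc (length vs) = k then \<eta> p vs else 0)" for p vs
      have amb: "ambient_form X \<eta>'"
        unfolding ambient_form_def \<eta>'_def[abs_def]
      proof (intro conjI ballI allI)
        fix q assume "q \<in> X"
        then have a: "alternating (\<eta> q)" by (rule ambient_form_alternating[OF \<eta>(1)])
        show "alternating (\<lambda>vs. if Suc (length vs) = k then \<eta> q vs else 0)"
          by (rule alternatingI)
            (auto simp: multilinear_def multilinearD[OF alternating_multilin[OF a]] alternating_adjacent[OF a])
      next
        show "smooth_on X (\<lambda>q. if Suc (length vs) = k then \<eta> q vs else 0)" for vs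
          using smooth_coeffsD[OF ambient_form_smooth[OF \<eta>(1)], of vs]
          by (cases "Suc (length vs) = k") (simp_all add: smooth_on_const[OF open_X])
      qed
      have d: "ambient_deriv \<eta>' p vs = component k (ambient_deriv \<eta>) p vs" if p: "p \<in> X" for p vs
      proof -
        have len: "Suc (length (take i vs @ drop (Suc i) vs)) = length vs" if "i < length vs" for i
          using that by (simp add: min_absorb2)
        have "ambient_deriv \<eta>' p vs = (\<Sum>i<length vs. (-1) ^ i * frechet_derivative
            (\<lambda>q. if length vs = k then \<eta> q (take i vs @ drop (Suc i) vs) else 0) (at p) (vs ! i))"
          unfolding ambient_deriv_def \<eta>'_def by (intro sum.cong refl) (simp only: len lessThan_iff)
        then show ?thesis
          by (cases "length vs = k") (simp_all add: component_def ambient_deriv_def)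
      qed
      have "cohomologous X \<omega> (component k x)"
      proof (rule cohomologousI[OF amb])
        fix p vs assume p: "p \<in> X"
        show "\<omega> p vs = component k x p vs + ambient_deriv \<eta>' p vs"
          unfolding d[OF p] component_def using \<eta>(2)[OF p, of vs] \<omega>(2)
          by (cases "length vs = k") (auto simp: homogeneous_def)
      qed
      then have "?\<phi> \<omega> = ?\<phi> (component k x)"
        using deRham_class_iff[OF \<omega>(1)] comp[OF x(1), of k] R(1) by blast
      then show ?thesis using comp[OF x(1), of k] by blast
    qed
    moreover have "\<omega> \<in> closed_forms X \<and> homogeneous k \<omega>" if "\<omega> \<in> R \<inter> \<Omega> k" for \<omega>
      using that R(1) homog by blast
    ultimately show ?thesis unfolding H G by blast
  qed
  ultimately show ?thesis unfolding graded_algebra_isomorphic_def by blast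
qed

end

section \<open>Submanifolds with a smooth retraction\<close>

text \<open>A submanifold presented as the image of a smooth retraction of an open set: forms on
  \<open>N\<close> are studied through their pullbacks to \<open>P\<close>, where the calculus of
  open sets applies, and no charts occur.\<close>

locale retraction =
  fixes P N :: "'a::euclidean_space set" and r :: "'a \<Rightarrow> 'a"
  assumes open_P: "open P" and N_P: "N \<subseteq> P" and smooth_r: "smooth_on P r" and r_P: "r ` P \<subseteq> N"
    and r_N: "\<And>z. z \<in> N \<Longrightarrow> r z = z"
begin

abbreviation "Dr z \<equiv> frechet_derivative r (at z)"

lemma tangent_Dr:
  assumes z: "z \<in> P"
  shows "Dr z w \<in> tangent_space N (r z)"
proof -
  have op: "open ((\<lambda>s::real. z + s *\<^sub>R w) -` P)"
    by (rule open_vimage[OF open_P]) (intro continuous_intros)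
  moreover have "0 \<in> (\<lambda>s::real. z + s *\<^sub>R w) -` P" using z by simp
  ultimately obtain e where e: "e > 0" "ball 0 e \<subseteq> (\<lambda>s::real. z + s *\<^sub>R w) -` P"
    using openE by blast
  have im: "(\<lambda>s. z + s *\<^sub>R w) ` {-e<..<e} \<subseteq> P"
    using e(2) by (auto simp: ball_def dist_norm subset_iff)
  have "smooth_on {-e<..<e} (\<lambda>s. z + s *\<^sub>R w)"
    by (intro smooth_on_add smooth_on_const smooth_on_scaleR smooth_on_ident open_greaterThanLessThan)
  then have "smooth_on {-e<..<e} (\<lambda>s. r (z + s *\<^sub>R w))"
    by (rule smooth_on_compose[OF open_greaterThanLessThan open_P smooth_r im])
  moreover have "(\<lambda>s. r (z + s *\<^sub>R w)) ` {-e<..<e} \<subseteq> N"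
    using im r_P by blast
  moreover have "((\<lambda>s. r (z + s *\<^sub>R w)) has_vector_derivative Dr z w) (at (0::real))"
  proof -
    have "((\<lambda>s. z + s *\<^sub>R w) has_derivative (\<lambda>s. s *\<^sub>R w)) (at (0::real))"
      by (auto intro!: derivative_eq_intros)
    moreover have "(r has_derivative Dr z) (at (z + 0 *\<^sub>R w))"
      using smooth_on_has_derivative[OF smooth_r z] by simp
    ultimately have "((\<lambda>s. r (z + s *\<^sub>R w)) has_derivative (\<lambda>s. Dr z (s *\<^sub>R w))) (at (0::real))"
      by (rule has_derivative_compose)
    then show ?thesis
      by (simp add: has_vector_derivative_def linear_scale[OF smooth_on_frechet_linear[OF smooth_r z]])
  qed
  ultimately show ?thesis
    unfolding tangent_space_def using e(1)
    by (intro CollectI exI[of _ e] conjI exI[of _ "\<lambda>s. r (z + s *\<^sub>R w)"]) simp_all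
qed

text \<open>Differentiate \<open>r (\<gamma> s) = \<gamma> s\<close> along a curve in
  \<open>N\<close>.\<close>

lemma Dr_tangent:
  assumes p: "p \<in> N" and v: "v \<in> tangent_space N p"
  shows "Dr p v = v"
proof -
  obtain e \<gamma> where e: "e > 0" "\<gamma> ` {-e<..<e} \<subseteq> N" "\<gamma> 0 = p" "(\<gamma> has_vector_derivative v) (at (0::real))"
    using v unfolding tangent_space_def by blast
  have pP: "p \<in> P" using p N_P by blast
  have "(r has_derivative Dr p) (at (\<gamma> 0))" using smooth_on_has_derivative[OF smooth_r pP] e(3) by simp
  from has_derivative_compose[OF e(4)[unfolded has_vector_derivative_def] this]
  have 1: "((\<lambda>s. r (\<gamma> s)) has_derivative (\<lambda>s. Dr p (s *\<^sub>R v))) (at 0)" .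
  have "(\<gamma> has_derivative (\<lambda>s. Dr p (s *\<^sub>R v))) (at 0)"
  proof (rule has_derivative_transform_within_open[OF 1 open_greaterThanLessThan])
    show "0 \<in> {-e<..<e}" using e(1) by simp
    show "r (\<gamma> s) = \<gamma> s" if "s \<in> {-e<..<e}" for s using e(2) that by (intro r_N) blast
  qed
  then have "(\<lambda>s. Dr p (s *\<^sub>R v)) = (\<lambda>s. s *\<^sub>R v)"
    using e(4) unfolding has_vector_derivative_def by (rule has_derivative_unique)
  from fun_cong[OF this, of 1] show ?thesis by simp
qed

lemma map_Dr_tangent: "p \<in> N \<Longrightarrow> set vs \<subseteq> tangent_space N p \<Longrightarrow> map (Dr p) vs = vs"
  by (induction vs) (auto simp: Dr_tangent)

text \<open>A set of velocities of curves carries no visible linear structure, but here it is the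
  fixed space of the linear map \<open>Dr p\<close>.\<close>

lemma tangent_combination:
  assumes "p \<in> N" "v \<in> tangent_space N p" "w \<in> tangent_space N p"
  shows "a *\<^sub>R v + b *\<^sub>R w \<in> tangent_space N p"
proof -
  have pP: "p \<in> P" using assms(1) N_P by blast
  have "Dr p (a *\<^sub>R v + b *\<^sub>R w) = a *\<^sub>R v + b *\<^sub>R w"
    using linear_add[OF smooth_on_frechet_linear[OF smooth_r pP]] linear_scale[OF smooth_on_frechet_linear[OF smooth_r pP]]
      Dr_tangent[OF assms(1,2)] Dr_tangent[OF assms(1,3)] by simp
  then show ?thesis using tangent_Dr[OF pP, of "a *\<^sub>R v + b *\<^sub>R w"] r_N[OF assms(1)] by simp
qed

lemma set_map_Dr: "z \<in> P \<Longrightarrow> set (map (Dr z) vs) \<subseteq> tangent_space N (r z)"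
  using tangent_Dr by auto

lemma pullback_extension:
  assumes "local_extension N \<beta> U \<eta>" "z \<in> P" "r z \<in> U"
  shows "pullback r \<beta> z vs = pullback r \<eta> z vs"
  unfolding pullback_def
  using assms r_P set_map_Dr[OF assms(2)] unfolding local_extension_def by blast

lemma open_preimage:
  assumes "open U"
  shows "open (P \<inter> r -` U)"
  by (rule continuous_open_preimage[OF smooth_on_imp_continuous_on[OF smooth_r] open_P assms])

lemma ambient_deriv_pullback_extension:
  assumes ext: "local_extension N \<beta> U \<eta>" and z: "z \<in> P" "r z \<in> U"
  shows "ambient_deriv (pullback r \<beta>) z vs = ambient_deriv \<eta> (r z) (map (Dr z) vs)"
proof -
  have U: "open U" "ambient_form U \<eta>" using ext unfolding local_extension_def by blast+
  let ?V = "P \<inter> r -` U"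
  note V = open_preimage[OF U(1)]
  have mem: "z \<in> ?V" using z by simp
  have "ambient_deriv (pullback r \<beta>) z vs = ambient_deriv (pullback r \<eta>) z vs"
    by (rule ambient_deriv_cong[OF V mem]) (rule pullback_extension[OF ext]; simp)
  also have "\<dots> = pullback r (ambient_deriv \<eta>) z vs"
  proof (rule ambient_deriv_pullback[OF V U(1) _ _ U(2) mem])
    show "smooth_on ?V r" by (rule smooth_on_subset[OF smooth_r]) simp
  qed auto
  finally show ?thesis by (simp add: pullback_def)
qed

text \<open>The definite description is well posed because the derivative of any local extension, on
  tangent vectors, equals that of \<open>pullback r \<beta>\<close>, which does not mention the
  extension.\<close>

lemma exterior_deriv_extension:
  assumes ext: "local_extension N \<beta> U \<eta>" and p: "p \<in> N" "p \<in> U" and vs: "set vs \<subseteq> tangent_space N p"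
  shows "exterior_deriv N \<beta> p vs = ambient_deriv \<eta> p vs"
proof -
  have pP: "p \<in> P" using p(1) N_P by blast
  have *: "ambient_deriv \<theta> p vs = ambient_deriv (pullback r \<beta>) p vs" if "p \<in> V" "local_extension N \<beta> V \<theta>" for V \<theta>
    using ambient_deriv_pullback_extension[OF that(2) pP, of vs] that(1)
    by (simp add: r_N[OF p(1)] map_Dr_tangent[OF p(1) vs])
  have "(THE y. \<exists>U \<eta>. p \<in> U \<and> local_extension N \<beta> U \<eta> \<and> y = ambient_deriv \<eta> p vs) = ambient_deriv \<eta> p vs"
  proof (rule the_equality)
    show "\<exists>U \<eta>'. p \<in> U \<and> local_extension N \<beta> U \<eta>' \<and> ambient_deriv \<eta> p vs = ambient_deriv \<eta>' p vs"
      using ext p(2) by blast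
    fix y assume "\<exists>U \<eta>. p \<in> U \<and> local_extension N \<beta> U \<eta> \<and> y = ambient_deriv \<eta> p vs"
    then obtain V \<theta> where V: "p \<in> V" "local_extension N \<beta> V \<theta>" "y = ambient_deriv \<theta> p vs" by blast
    show "y = ambient_deriv \<eta> p vs" unfolding V(3) using *[OF p(2) ext] *[OF V(1,2)] by (rule trans[OF _ sym, rotated])
  qed
  then show ?thesis using p(1) vs by (simp add: exterior_deriv_def restrict_form_def)
qed

lemma ambient_form_pullback_smooth:
  assumes "\<beta> \<in> smooth_forms N"
  shows "ambient_form P (pullback r \<beta>)"
proof -
  have loc: "\<exists>U \<eta>. r z \<in> U \<and> local_extension N \<beta> U \<eta>" if "z \<in> P" for z
    using assms r_P that unfolding smooth_forms_def by blast
  have *: "ambient_form (P \<inter> r -` U) (pullback r \<beta>)" if ext: "local_extension N \<beta> U \<eta>" for U \<eta>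
  proof -
    have U: "open U" "ambient_form U \<eta>" using ext unfolding local_extension_def by blast+
    note V = open_preimage[OF U(1)]
    have sm: "smooth_on (P \<inter> r -` U) r" by (rule smooth_on_subset[OF smooth_r]) simp
    have im: "r ` (P \<inter> r -` U) \<subseteq> U" by auto
    show ?thesis
      by (rule ambient_form_cong[OF V _ ambient_form_pullback[OF V U(1) sm im U(2)]])
        (rule pullback_extension[OF ext, symmetric]; simp)
  qed
  show ?thesis
    unfolding ambient_form_def
  proof (intro conjI ballI allI)
    fix z assume z: "z \<in> P"
    obtain U \<eta> where U: "r z \<in> U" "local_extension N \<beta> U \<eta>" using loc[OF z] by blast
    show "alternating (pullback r \<beta> z)"
      by (rule ambient_form_alternating[OF *[OF U(2)]]) (use z U in simp)
  next
    fix vs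
    show "smooth_on P (\<lambda>q. pullback r \<beta> q vs)"
    proof (rule smooth_on_local)
      fix z assume z: "z \<in> P"
      obtain U \<eta> where U: "r z \<in> U" "local_extension N \<beta> U \<eta>" using loc[OF z] by blast
      have "open U" using U(2) by (simp add: local_extension_def)
      then show "\<exists>V. open V \<and> z \<in> V \<and> smooth_on V (\<lambda>q. pullback r \<beta> q vs)"
        using open_preimage smooth_coeffsD[OF ambient_form_smooth[OF *[OF U(2)]]] z U(1)
        by (intro exI[of _ "P \<inter> r -` U"] conjI) simp_all
    qed
  qed
qed

lemma ambient_deriv_pullback_smooth:
  assumes "\<beta> \<in> smooth_forms N" "z \<in> P"
  shows "ambient_deriv (pullback r \<beta>) z vs = pullback r (exterior_deriv N \<beta>) z vs"
proof -
  have rz: "r z \<in> N" using assms(2) r_P by blast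
  obtain U \<eta> where U: "r z \<in> U" "local_extension N \<beta> U \<eta>"
    using assms(1) rz unfolding smooth_forms_def by blast
  show ?thesis
    using ambient_deriv_pullback_extension[OF U(2) assms(2) U(1)]
      exterior_deriv_extension[OF U(2) rz U(1) set_map_Dr[OF assms(2)]]
    by (simp add: pullback_def)
qed

lemma restrict_smooth:
  assumes "ambient_form P b"
  shows "restrict_form N b \<in> smooth_forms N"
  unfolding smooth_forms_def
proof (intro CollectI conjI ballI)
  show "restrict_form N (restrict_form N b) = restrict_form N b"
    by (intro ext) (simp add: restrict_form_def)
  fix p assume p: "p \<in> N"
  have alt: "alternating (b p)" using ambient_form_alternating[OF assms] p N_P by blast
  show "alternating_multilinear (tangent_space N p) (restrict_form N b p)"
    unfolding alternating_multilinear_def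
  proof (intro conjI allI impI)
    fix us ws v w x y
    assume "set us \<subseteq> tangent_space N p \<and> set ws \<subseteq> tangent_space N p \<and> v \<in> tangent_space N p \<and> w \<in> tangent_space N p"
    then show "restrict_form N b p (us @ (x *\<^sub>R v + y *\<^sub>R w) # ws)
       = x *\<^sub>R restrict_form N b p (us @ v # ws) + y *\<^sub>R restrict_form N b p (us @ w # ws)"
      using p tangent_combination[OF p] multilinearD[OF alternating_multilin[OF alt]]
      by (simp add: restrict_form_def)
  next
    fix vs assume "set vs \<subseteq> tangent_space N p \<and> \<not> distinct vs"
    then show "restrict_form N b p vs = 0" using alt by (simp add: restrict_form_def alternating_iff)
  qed
  have "local_extension N (restrict_form N b) P b"
    using assms open_P by (simp add: local_extension_def restrict_form_def)
  then show "\<exists>U \<eta>. p \<in> U \<and> local_extension N (restrict_form N b) U \<eta>" using p N_P by blast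
qed

lemma restrict_closed:
  assumes "closed_on P b"
  shows "restrict_form N b \<in> closed_forms N"
proof -
  have ext: "local_extension N (restrict_form N b) P b"
    using closed_onD(1)[OF assms] open_P by (simp add: local_extension_def restrict_form_def)
  have "exterior_deriv N (restrict_form N b) p vs = 0" for p vs
  proof (cases "p \<in> N \<and> set vs \<subseteq> tangent_space N p")
    case True
    then have pP: "p \<in> P" using N_P by blast
    show ?thesis
      using exterior_deriv_extension[OF ext _ pP, of vs] closed_onD(2)[OF assms pP] True by simp
  next
    case False
    then show ?thesis by (auto simp: exterior_deriv_def restrict_form_def)
  qed
  with restrict_smooth[OF closed_onD(1)[OF assms]] show ?thesis by (simp add: closed_forms_def fun_eq_iff)
qed

lemma zero_exact: "(\<lambda>_ _. 0) \<in> exact_forms N"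
proof -
  have *: "restrict_form N (\<lambda>_ _. 0) = (\<lambda>_ _. 0)" by (intro ext) (simp add: restrict_form_def)
  have "closed_on P (\<lambda>_ _. 0)" using ambient_form_zero[OF open_P] by (simp add: closed_on_def)
  from restrict_closed[OF this] have "(\<lambda>_ _. 0) \<in> closed_forms N" unfolding * .
  then have "(\<lambda>_ _. 0) \<in> smooth_forms N" "(\<lambda>_ _. 0) = exterior_deriv N (\<lambda>_ _. 0)"
    unfolding closed_forms_def by simp_all
  then show ?thesis unfolding exact_forms_def by (rule image_eqI[where f = "exterior_deriv N", rotated])
qed

lemma pullback_restrict: "z \<in> P \<Longrightarrow> pullback r (restrict_form N b) z vs = pullback r b z vs"
  using set_map_Dr[of z vs] r_P by (auto simp: pullback_def restrict_form_def)

text \<open>Translates surjectivity on cohomology into forms. The restriction of \<open>b\<close> to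
  \<open>N\<close> differs from that of a closed form on \<open>M\<close> by an exact form on
  \<open>N\<close>; pulling this equation back along the retraction gives a relation on all of
  \<open>P\<close>, since \<open>b\<close> is its own pullback.\<close>

lemma surjective_restriction_lift:
  assumes M: "open M"
    and surj: "inclusion_pullback N ` carrier (deRham_cohomology M) = carrier (deRham_cohomology N)"
    and b: "closed_on P b" "\<And>z. z \<in> P \<Longrightarrow> pullback r b z = b z"
  obtains a where "closed_on M a" "cohomologous P b (pullback r a)"
proof -
  interpret M: open_set M by standard (rule M)
  have carrier: "carrier (deRham_cohomology Y) = deRham_class Y ` closed_forms Y" for Y :: "'a set"
    by (auto simp: deRham_cohomology_def Let_def FactRing_def A_RCOSETS_def' deRham_class_def form_algebra_def)
  have class_mem: "x \<in> deRham_class Y \<omega> \<longleftrightarrow> (\<exists>h\<in>exact_forms Y. x = (\<lambda>p vs. h p vs + \<omega> p vs))" for Y :: "'a set" and x \<omega>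
    by (simp add: deRham_class_def a_r_coset_def' form_algebra_def)
  have "deRham_class N (restrict_form N b) \<in> inclusion_pullback N ` carrier (deRham_cohomology M)"
    unfolding surj carrier[of N] using restrict_closed[OF b(1)] by blast
  then obtain a0 where a0: "a0 \<in> closed_forms M"
    "deRham_class N (restrict_form N b) = inclusion_pullback N (deRham_class M a0)"
    unfolding carrier[of M] by blast
  have "restrict_form N b \<in> deRham_class N (restrict_form N b)"
    unfolding class_mem using zero_exact by (intro bexI[of _ "\<lambda>_ _. 0"]) simp_all
  \<comment> \<open>The image class is a union over representatives, so the restricted form
    \<open>b\<close> itself lies in the class of one restricted representative
    \<open>\<omega>\<close>.\<close>
  then obtain \<omega> where \<omega>: "\<omega> \<in> deRham_class M a0" "restrict_form N b \<in> deRham_class N (restrict_form N \<omega>)"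
    unfolding a0(2) inclusion_pullback_def by blast
  obtain h where h: "h \<in> exact_forms M" "\<omega> = (\<lambda>p vs. h p vs + a0 p vs)" using \<omega>(1) class_mem by blast
  have "\<omega> \<in> closed_forms M" unfolding h(2) using M.closed_add[OF _ a0(1)] h(1) M.exact_closed by blast
  then have \<omega>M: "closed_on M \<omega>" by (simp add: M.closed_iff)
  obtain \<beta> where \<beta>: "\<beta> \<in> smooth_forms N" "restrict_form N b = (\<lambda>p vs. exterior_deriv N \<beta> p vs + restrict_form N \<omega> p vs)"
    using \<omega>(2) unfolding class_mem exact_forms_def by blast
  have "cohomologous P b (pullback r \<omega>)"
  proof (rule cohomologousI[OF ambient_form_pullback_smooth[OF \<beta>(1)]])
    fix z vs assume z: "z \<in> P"
    have "b z vs = pullback r (restrict_form N b) z vs" using b(2)[OF z] pullback_restrict[OF z] by simp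
    also have "\<dots> = pullback r (exterior_deriv N \<beta>) z vs + pullback r (restrict_form N \<omega>) z vs"
      unfolding \<beta>(2) by (simp add: pullback_def)
    also have "\<dots> = pullback r \<omega> z vs + ambient_deriv (pullback r \<beta>) z vs"
      using pullback_restrict[OF z] ambient_deriv_pullback_smooth[OF \<beta>(1) z] by simp
    finally show "b z vs = pullback r \<omega> z vs + ambient_deriv (pullback r \<beta>) z vs" .
  qed
  with \<omega>M show thesis by (rule that)
qed

end

section \<open>Characters, one-parameter subgroups and logarithmic forms\<close>

section \<open>Characters and the torus\<close>

lemma open_torus: "open (torus :: (complex^'l) set)"
proof -
  have "torus = (\<Inter>i\<in>UNIV. (\<lambda>z::complex^'l. z $ i) -` (- {0}))" by (auto simp: torus_def)
  moreover have "open \<dots>" by (intro open_INT ballI open_vimage continuous_intros) auto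
  ultimately show ?thesis by simp
qed

lemma smooth_on_coord: "open U \<Longrightarrow> smooth_on U (\<lambda>z::complex^'l. z $ i)"
  by (intro smooth_on_vec_nth smooth_on_ident)

lemma smooth_on_character: "smooth_on torus (character n)"
  unfolding character_def[abs_def]
  by (intro smooth_on_prod smooth_on_powi smooth_on_coord open_torus) (simp add: torus_def)

lemma character_nonzero: "z \<in> torus \<Longrightarrow> character n z \<noteq> 0"
  by (simp add: character_def torus_def)

lemma character_add: "z \<in> torus \<Longrightarrow> character (n + m) z = character n z * character m z"
  by (simp add: character_def torus_def power_int_add prod.distrib)

lemma character_uminus: "z \<in> torus \<Longrightarrow> character (- n) z = inverse (character n z)"
  by (simp add: character_def torus_def power_int_minus prod_inversef[unfolded comp_def])

lemma character_zero [simp]: "character 0 z = 1"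
  by (simp add: character_def)

lemma complement_subset: "complement \<A> \<subseteq> torus"
  by (auto simp: complement_def)

lemma complement_iff: "z \<in> complement \<A> \<longleftrightarrow> z \<in> torus \<and> (\<forall>K\<in>\<A>. character (fst K) z \<noteq> snd K)"
  by (auto simp: complement_def hypersurface_def split: prod.splits)

lemma complement_mono: "\<A> \<subseteq> \<B> \<Longrightarrow> complement \<B> \<subseteq> complement \<A>"
  by (auto simp: complement_iff subset_iff)

lemma open_complement:
  assumes "finite \<A>"
  shows "open (complement \<A>)"
proof -
  have "complement \<A> = torus \<inter> (\<Inter>K\<in>\<A>. torus \<inter> (\<lambda>z. character (fst K) z - snd K) -` (- {0}))"
    by (auto simp: complement_iff) (metis fst_conv snd_conv)
  moreover have "open (torus \<inter> (\<lambda>z. character (fst K) z - snd K) -` (- {0}))" for K :: "(int^'a) \<times> complex"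
    by (rule continuous_open_preimage[OF smooth_on_imp_continuous_on[OF smooth_on_diff[OF open_torus
        smooth_on_character smooth_on_const[OF open_torus]]] open_torus]) auto
  ultimately show ?thesis
    using assms open_torus by (metis (no_types, lifting) open_INT open_Int)
qed

definition pairing :: "int^'l \<Rightarrow> int^'l \<Rightarrow> int" where
  "pairing n m = (\<Sum>i\<in>UNIV. n $ i * m $ i)"

text \<open>The one-parameter subgroup with exponent vector \<open>m\<close>, acting on points by
  multiplication.\<close>

definition act :: "int^'l \<Rightarrow> complex \<Rightarrow> complex^'l \<Rightarrow> complex^'l" where
  "act m s z = (\<chi> i. s powi (m $ i) * z $ i)"

lemma act_torus: "s \<noteq> 0 \<Longrightarrow> z \<in> torus \<Longrightarrow> act m s z \<in> torus"
  by (simp add: act_def torus_def)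

lemma act_act: "act m s (act m s' z) = act m (s * s') z"
  by (simp add: act_def vec_eq_iff power_int_mult_distrib)

lemma act_1 [simp]: "act m 1 z = z"
  by (simp add: act_def vec_eq_iff)

lemma character_act:
  assumes "s \<noteq> 0"
  shows "character n (act m s z) = s powi (pairing n m) * character n z"
proof -
  have "s powi (\<Sum>i\<in>I. n $ i * m $ i) = (\<Prod>i\<in>I. s powi (m $ i * n $ i))" for I :: "'a set"
    using assms by (induction I rule: infinite_finite_induct) (simp_all add: power_int_add mult.commute)
  then have "(\<Prod>i\<in>UNIV. (s powi m $ i) powi n $ i) = s powi (pairing n m)"
    by (simp add: pairing_def power_int_mult)
  then show ?thesis
    by (simp add: character_def act_def power_int_mult_distrib prod.distrib)
qed

text \<open>Bezout in several variables: the values of the pairing with \<open>n\<close> form an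
  ideal of the integers, whose least positive element divides every entry of
  \<open>n\<close>.\<close>

lemma primitive_dual:
  assumes "primitive n"
  obtains m where "pairing n m = 1"
proof -
  define I where "I = range (pairing n)"
  have I0: "0 \<in> I" unfolding I_def by (rule image_eqI[of _ _ 0]) (simp_all add: pairing_def)
  have Iadd: "x + y * k \<in> I" if "x \<in> I" "y \<in> I" for x y k
  proof -
    obtain a b where ab: "x = pairing n a" "y = pairing n b" using \<open>x \<in> I\<close> \<open>y \<in> I\<close> unfolding I_def by blast
    have "x + y * k = pairing n (\<chi> i. a $ i + b $ i * k)"
      by (simp add: ab pairing_def sum.distrib sum_distrib_left algebra_simps)
    then show ?thesis by (simp add: I_def)
  qed
  have In: "n $ j \<in> I" for j
  proof -
    have "n $ j = pairing n (\<chi> i. if i = j then 1 else 0)"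
      by (simp add: pairing_def if_distrib cong: if_cong)
    then show ?thesis by (simp add: I_def)
  qed
  have "\<exists>g. g \<in> I \<and> g > 0"
  proof (rule ccontr)
    assume neg: "\<nexists>g. g \<in> I \<and> g > 0"
    have "n $ j = 0" for j
      using neg In[of j] Iadd[OF I0 In[of j], of "-1"] by (metis add_0 linorder_neqE_linordered_idom mult_minus1_right neg_0_less_iff_less)
    then have "range (\<lambda>i. n $ i) = {0}" by auto
    then show False using assms by (simp add: primitive_def)
  qed
  then obtain g0 where g0: "g0 \<in> I" "g0 > 0" by blast
  define g where "g = (LEAST k. int k \<in> I \<and> k > 0)"
  have g: "int g \<in> I" "g > 0"
    using LeastI[of "\<lambda>k. int k \<in> I \<and> k > 0" "nat g0"] g0 by (simp_all add: g_def)
  have gmin: "k \<ge> g" if "int k \<in> I" "k > 0" for k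
    unfolding g_def using that by (intro Least_le) simp
  have "int g dvd x" if "x \<in> I" for x
  proof -
    have "x mod int g = x + int g * (- (x div int g))" by (simp add: minus_div_mult_eq_mod[symmetric] algebra_simps)
    then have "x mod int g \<in> I" using Iadd[OF that g(1)] by metis
    moreover have "0 \<le> x mod int g" "x mod int g < int g" using g(2) by simp_all
    ultimately have "x mod int g = 0" using gmin[of "nat (x mod int g)"] by (cases "x mod int g = 0") auto
    then show ?thesis by auto
  qed
  then have "int g dvd Gcd (range (\<lambda>i. n $ i))" using In by (intro Gcd_greatest) auto
  then have "int g dvd 1" using assms unfolding primitive_def by (simp only:)
  then have "int g = 1" using g(2) by simp
  then show thesis using g(1) that by (auto simp: I_def)
qed

section \<open>The algebra of logarithmic forms\<close>

text \<open>The unit is not cut off outside a complement, so one and the same logarithmic form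
  serves on the complements of all subarrangements and in the elimination of coordinates.\<close>

inductive_set form_span_algebra :: "'a form set \<Rightarrow> 'a form set" for G where
  one: "(\<lambda>p. const0 1) \<in> form_span_algebra G"
| gen: "x \<in> G \<Longrightarrow> x \<in> form_span_algebra G"
| add: "x \<in> form_span_algebra G \<Longrightarrow> y \<in> form_span_algebra G \<Longrightarrow> (\<lambda>p vs. x p vs + y p vs) \<in> form_span_algebra G"
| mult: "x \<in> form_span_algebra G \<Longrightarrow> y \<in> form_span_algebra G \<Longrightarrow> (\<lambda>p. wdg (x p) (y p)) \<in> form_span_algebra G"
| smult: "x \<in> form_span_algebra G \<Longrightarrow> (\<lambda>p vs. c * x p vs) \<in> form_span_algebra G"

lemma form_span_algebra_mono: "G \<subseteq> H \<Longrightarrow> form_span_algebra G \<subseteq> form_span_algebra H"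
proof
  fix x assume GH: "G \<subseteq> H" and "x \<in> form_span_algebra G"
  from this(2) show "x \<in> form_span_algebra H"
    by induction (use GH in \<open>auto intro: form_span_algebra.intros\<close>)
qed

lemma form_span_algebra_closed:
  assumes X: "open X" and G: "\<And>g. g \<in> G \<Longrightarrow> closed_on X g" and x: "x \<in> form_span_algebra G"
  shows "closed_on X x"
  using x
proof induction
  case one
  show ?case
    unfolding closed_on_def using ambient_form_const0[OF X smooth_on_const[OF X, of 1]]
    by (auto simp: ambient_deriv_const0[of "\<lambda>_. 1"] one_form_def)
qed (auto intro: G closed_on_add[OF X] closed_on_wdg[OF X] closed_on_cmult[OF X])

definition xi0 :: "'l::finite \<Rightarrow> (complex^'l) form" where
  "xi0 i = log_deriv (\<lambda>z. z $ i)"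

definition psi0 :: "(int^'l) \<times> complex \<Rightarrow> (complex^'l) form" where
  "psi0 K = log_deriv (\<lambda>z. character (fst K) z - snd K)"

definition log_forms :: "((int^'l) \<times> complex) set \<Rightarrow> (complex^'l) form set" where
  "log_forms \<A> = form_span_algebra (range xi0 \<union> psi0 ` \<A>)"

lemma closed_xi0: "open X \<Longrightarrow> X \<subseteq> torus \<Longrightarrow> closed_on X (xi0 i)"
  unfolding xi0_def by (rule closed_log_deriv) (auto intro: smooth_on_coord simp: torus_def)

lemma closed_psi0:
  assumes "open X" "X \<subseteq> torus" "\<And>z. z \<in> X \<Longrightarrow> character (fst K) z \<noteq> snd K"
  shows "closed_on X (psi0 K)"
  unfolding psi0_def
proof (rule closed_log_deriv[OF assms(1)])
  show "smooth_on X (\<lambda>z. character (fst K) z - snd K)"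
    by (rule smooth_on_diff[OF assms(1) smooth_on_subset[OF smooth_on_character assms(2)] smooth_on_const[OF assms(1)]])
qed (use assms(3) in auto)

lemma closed_log_forms:
  assumes "finite \<A>" "x \<in> log_forms \<A>"
  shows "closed_on (complement \<A>) x"
proof (rule form_span_algebra_closed[OF open_complement[OF assms(1)] _ assms(2)[unfolded log_forms_def]])
  fix g assume "g \<in> range xi0 \<union> psi0 ` \<A>"
  then show "closed_on (complement \<A>) g"
  proof
    assume "g \<in> range xi0"
    then show ?thesis using closed_xi0[OF open_complement[OF assms(1)] complement_subset] by auto
  next
    assume "g \<in> psi0 ` \<A>"
    then obtain K where "K \<in> \<A>" "g = psi0 K" by blast
    then show ?thesis
      by (auto intro!: closed_psi0 open_complement assms(1) complement_subset simp: complement_iff)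
  qed
qed

lemma log_forms_mono: "\<A> \<subseteq> \<B> \<Longrightarrow> log_forms \<A> \<subseteq> log_forms \<B>"
  unfolding log_forms_def by (rule form_span_algebra_mono) auto

definition logarithmic_cohomology :: "((int^'l) \<times> complex) set \<Rightarrow> bool" where
  "logarithmic_cohomology \<A> \<longleftrightarrow>
     (\<forall>\<omega>. closed_on (complement \<A>) \<omega> \<longrightarrow> (\<exists>\<rho>\<in>log_forms \<A>. cohomologous (complement \<A>) \<omega> \<rho>))"

section \<open>Surjectivity: every class on the complement is logarithmic\<close>

section \<open>The cohomology of the torus\<close>

definition put :: "'l \<Rightarrow> complex \<Rightarrow> complex^'l \<Rightarrow> complex^'l" where
  "put j u z = (\<chi> i. if i = j then u else z $ i)"

lemma put_nth: "put j u z $ i = (if i = j then u else z $ i)"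
  by (simp add: put_def)

lemma put_commute: "k \<noteq> j \<Longrightarrow> put j u (put k v z) = put k v (put j u z)"
  by (simp add: put_def vec_eq_iff)

lemma put_torus: "u \<noteq> 0 \<Longrightarrow> z \<in> torus \<Longrightarrow> put j u z \<in> torus"
  by (simp add: torus_def put_nth)

lemma smooth_on_put:
  assumes "open U" "smooth_on U f" "smooth_on U g"
  shows "smooth_on U (\<lambda>x. put j (f x) (g x))"
  unfolding put_def
proof (rule smooth_on_vec_lambda[OF assms(1)])
  show "smooth_on U (\<lambda>x. if i = j then f x else g x $ i)" for i
    using assms(2) smooth_on_vec_nth[OF assms(1,3), of i] by (cases "i = j") simp_all
qed

text \<open>The maps \<open>put j 1\<close> compose to a constant map. A form that is its own
  pullback along a constant map has no part of positive degree, and its part of degree zero is a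
  constant.\<close>

lemma torus_basic_constant:
  fixes \<omega> :: "(complex^'l) form"
  assumes \<omega>: "ambient_form torus \<omega>" and basic: "\<And>j p. p \<in> torus \<Longrightarrow> pullback (put j 1) \<omega> p = \<omega> p"
    and p: "p \<in> torus"
  shows "\<omega> p vs = const0 (\<omega> (\<chi> i. 1) []) vs"
proof -
  define puts where "puts S z = (\<chi> i. if i \<in> S then 1 else z $ i)" for S and z :: "complex^'l"
  have puts_torus: "puts S z \<in> torus" if "z \<in> torus" for S z
    using that by (simp add: puts_def torus_def)
  have sm: "smooth_on torus (puts S)" for S
    unfolding puts_def
  proof (rule smooth_on_vec_lambda[OF open_torus])
    show "smooth_on torus (\<lambda>z. if i \<in> S then 1 else z $ i)" for i :: 'l
      using smooth_on_const[OF open_torus] smooth_on_coord[OF open_torus] by (cases "i \<in> S") simp_all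
  qed
  have all: "pullback (puts S) \<omega> p = \<omega> p" if "finite S" "p \<in> torus" for S p
    using that
  proof (induction S arbitrary: p rule: finite_induct)
    case empty
    have "puts {} q = q" for q by (simp add: puts_def vec_eq_iff)
    then show ?case by (rule pullback_id[OF _ open_torus empty])
  next
    case (insert j S)
    have "puts (insert j S) q = put j 1 (puts S q)" for q by (simp add: puts_def put_def vec_eq_iff)
    then have "pullback (puts (insert j S)) \<omega> p = pullback (\<lambda>q. put j 1 (puts S q)) \<omega> p"
      by (intro pullback_cong[OF open_torus insert.prems])
    also have "\<dots> = pullback (puts S) (pullback (put j 1) \<omega>) p"
    proof (rule pullback_compose[symmetric])
      show "puts S differentiable at p" by (rule smooth_on_imp_differentiable[OF sm insert.prems])
      show "put j 1 differentiable at (puts S p)"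
        by (rule smooth_on_imp_differentiable[OF smooth_on_put[OF open_torus smooth_on_const[OF open_torus]
          smooth_on_ident[OF open_torus]] puts_torus[OF insert.prems]])
    qed
    also have "\<dots> = pullback (puts S) \<omega> p"
      by (rule ext) (simp add: pullback_def[of "puts S"] basic[OF puts_torus[OF insert.prems]])
    also have "\<dots> = \<omega> p" by (rule insert.IH[OF insert.prems])
    finally show ?case .
  qed
  have const: "puts UNIV = (\<lambda>z. (\<chi> i. 1))" by (simp add: puts_def fun_eq_iff)
  have "\<omega> p vs = pullback (puts UNIV) \<omega> p vs" using all[OF finite[of UNIV] p] by simp
  also have "\<dots> = \<omega> (\<chi> i. 1) (map (\<lambda>v. 0) vs)"
    unfolding pullback_def const by (simp add: frechet_derivative_eqI[OF has_derivative_const])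
  also have "\<dots> = const0 (\<omega> (\<chi> i. 1) []) vs"
  proof (cases vs)
    case (Cons v us)
    have "(\<chi> i. 1) \<in> (torus :: (complex^'l) set)" by (simp add: torus_def)
    from multilinear_zero[OF alternating_multilin[OF ambient_form_alternating[OF \<omega> this]], of "[]"]
    show ?thesis by (simp add: Cons const0_def)
  qed (simp add: const0_def)
  finally show ?thesis .
qed

text \<open>\<open>circle_decomposition\<close> is applied to one factor of the torus at a time,
  with \<open>t\<close> the corresponding coordinate and constant radius \<open>1\<close>.\<close>

lemma logarithmic_cohomology_torus: "logarithmic_cohomology ({} :: ((int^'l) \<times> complex) set)"
proof -
  have T: "complement {} = (torus :: (complex^'l) set)" by (simp add: complement_def)
  \<comment> \<open>\<open>R\<close> holds the coordinates whose circles have not yet been averaged;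
    being its own pullback along \<open>put j 1\<close> means that the form is basic with respect to
    coordinate \<open>j\<close>.\<close>
  have main: "\<exists>\<rho>\<in>log_forms {}. cohomologous torus \<omega> \<rho>"
    if "finite R" "closed_on torus \<omega>" "\<And>j p. j \<notin> R \<Longrightarrow> p \<in> torus \<Longrightarrow> pullback (put j 1) \<omega> p = \<omega> p"
    for R and \<omega> :: "(complex^'l) form"
    using that
  proof (induction R arbitrary: \<omega> rule: finite_induct)
    case empty
    have "cohomologous torus \<omega> (\<lambda>p vs. \<omega> (\<chi> i. 1) [] * const0 1 vs)"
    proof (rule cohomologous_refl[OF open_torus])
      fix p vs assume "p \<in> (torus :: (complex^'l) set)"
      from torus_basic_constant[OF closed_onD(1)[OF empty(1)] empty(2) this, of vs]
      show "\<omega> p vs = \<omega> (\<chi> i. 1) [] * const0 1 vs" by (simp add: const0_def)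
    qed
    moreover have "(\<lambda>p vs. \<omega> (\<chi> i. 1) [] * const0 1 vs) \<in> log_forms {}"
      unfolding log_forms_def by (rule form_span_algebra.smult, rule form_span_algebra.one)
    ultimately show ?case by blast
  next
    case (insert j R)
    let ?D = "{u::complex. u \<noteq> 0} \<times> (torus :: (complex^'l) set)"
    have D: "open ?D"
    proof (rule open_Times[OF _ open_torus])
      have "{u::complex. u \<noteq> 0} = - {0}" by auto
      then show "open {u::complex. u \<noteq> 0}" by (simp add: open_Compl)
    qed
    have smJ: "smooth_on ?D (\<lambda>x. put j (fst x) (snd x))"
      by (rule smooth_on_put[OF D smooth_on_fst[OF D smooth_on_ident[OF D]] smooth_on_snd[OF D smooth_on_ident[OF D]]])
    have JD: "(\<lambda>x. put j (fst x) (snd x)) ` ?D \<subseteq> torus" by (auto intro: put_torus)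
    have nz: "z $ j \<noteq> 0" if "z \<in> torus" for z :: "complex^'l" using that by (simp add: torus_def)
    have sput: "smooth_on torus (put k (1::complex))" "put k 1 ` torus \<subseteq> torus" for k
      using smooth_on_put[OF open_torus smooth_on_const[OF open_torus] smooth_on_ident[OF open_torus], of k 1]
        put_torus[of 1 _ k] by auto
    obtain \<alpha> \<beta> where \<alpha>: "closed_on torus \<alpha>" and \<beta>: "closed_on torus \<beta>"
      and coh: "cohomologous torus \<omega> (\<lambda>p vs. \<alpha> p vs + wdg (\<lambda>us. - \<i> * log_deriv (\<lambda>z. z $ j) p us) (\<beta> p) vs)"
      and basic: "\<And>\<pi> \<theta>. smooth_on torus \<pi> \<Longrightarrow> \<pi> ` torus \<subseteq> torus \<Longrightarrow> smooth_on torus \<theta> \<Longrightarrow> \<theta> ` torus \<subseteq> torus \<Longrightarrow>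
       (\<And>z. z \<in> torus \<Longrightarrow> (1::real) = 1) \<Longrightarrow>
       (\<And>z u. z \<in> torus \<Longrightarrow> norm u = 1 \<Longrightarrow> put j (fst (u, \<pi> z)) (snd (u, \<pi> z)) = \<theta> (put j (fst (u, z)) (snd (u, z)))) \<Longrightarrow>
       (\<And>p. p \<in> torus \<Longrightarrow> pullback \<theta> \<omega> p = \<omega> p) \<Longrightarrow>
       \<forall>p\<in>torus. pullback \<pi> \<alpha> p = \<alpha> p \<and> pullback \<pi> \<beta> p = \<beta> p"
    proof (rule circle_decomposition[OF D open_torus open_torus subset_refl smJ JD insert.prems(1) smooth_on_coord[OF open_torus] nz,
          where r = "\<lambda>_. 1"])
      show "smooth_on torus (\<lambda>_. 1 :: real)" by (rule smooth_on_const[OF open_torus])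
      show "(u, z) \<in> ?D" if "z \<in> torus" "norm u = 1" for z u using that by auto
      show "(of_real (1 - x + x * (1 / norm (z $ j))) * z $ j, z) \<in> ?D"
        if z: "z \<in> torus" and x: "0 \<le> x" "x \<le> 1" for z x
      proof -
        have "1 - x + x * (1 / norm (z $ j)) > 0"
        proof (cases "x = 1")
          case False
          then have "1 - x > 0" using x by simp
          then show ?thesis using x by (intro add_pos_nonneg) auto
        qed (use nz[OF z] in simp)
        then have "of_real (1 - x + x * (1 / norm (z $ j))) \<noteq> (0::complex)" by (metis less_irrefl of_real_eq_0_iff)
        then show ?thesis using nz[OF z] z by simp
      qed
      show "put j (fst (z $ j, z)) (snd (z $ j, z)) = z" for z by (simp add: put_def vec_eq_iff)
    qed auto
    \<comment> \<open>The new forms become independent of coordinate \<open>j\<close>, and keep the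
      independence already reached because \<open>put k\<close> commutes with
      \<open>put j\<close>.\<close>
    have b: "pullback (put k 1) \<alpha> p = \<alpha> p \<and> pullback (put k 1) \<beta> p = \<beta> p" if k: "k \<notin> R" and p: "p \<in> torus" for k p
    proof (cases "k = j")
      case True
      have "\<forall>p\<in>torus. pullback (put j 1) \<alpha> p = \<alpha> p \<and> pullback (put j 1) \<beta> p = \<beta> p"
        by (rule basic[OF sput smooth_on_ident[OF open_torus]])
          (auto simp: put_def vec_eq_iff intro: pullback_id[OF _ open_torus])
      then show ?thesis using p True by blast
    next
      case False
      have "\<forall>p\<in>torus. pullback (put k 1) \<alpha> p = \<alpha> p \<and> pullback (put k 1) \<beta> p = \<beta> p"
        by (rule basic[OF sput sput]) (use insert.prems(2)[of k] k False in \<open>simp_all add: put_commute[of k j]\<close>)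
      then show ?thesis using p by blast
    qed
    obtain \<rho>1 where \<rho>1: "\<rho>1 \<in> log_forms {}" "cohomologous torus \<alpha> \<rho>1"
      using insert.IH[OF \<alpha>] b by blast
    obtain \<rho>2 where \<rho>2: "\<rho>2 \<in> log_forms {}" "cohomologous torus \<beta> \<rho>2"
      using insert.IH[OF \<beta>] b by blast
    have xi: "closed_on torus (\<lambda>p us. - \<i> * log_deriv (\<lambda>z. z $ j) p us)"
      using closed_on_cmult[OF open_torus closed_xi0[OF open_torus subset_refl, of j], of "- \<i>"] by (simp add: xi0_def)
    have "cohomologous torus \<omega> (\<lambda>p vs. \<rho>1 p vs + wdg (\<lambda>us. - \<i> * log_deriv (\<lambda>z. z $ j) p us) (\<rho>2 p) vs)"
      by (rule cohomologous_trans[OF open_torus coh cohomologous_add[OF open_torus \<rho>1(2) cohomologous_wdg[OF open_torus xi \<rho>2(2)]]])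
    moreover have "(\<lambda>p us. - \<i> * log_deriv (\<lambda>z. z $ j) p us) \<in> log_forms {}"
      unfolding log_forms_def xi0_def[symmetric] by (intro form_span_algebra.smult form_span_algebra.gen) simp
    then have "(\<lambda>p vs. \<rho>1 p vs + wdg (\<lambda>us. - \<i> * log_deriv (\<lambda>z. z $ j) p us) (\<rho>2 p) vs) \<in> log_forms {}"
      using form_span_algebra.add form_span_algebra.mult \<rho>1(1) \<rho>2(1) unfolding log_forms_def by blast
    ultimately show ?case by blast
  qed
  show ?thesis
    unfolding logarithmic_cohomology_def T using main[OF finite[of UNIV]] by blast
qed

section \<open>Deleting a hypersurface\<close>

lemma closed_on_Un:
  assumes "open X" "open Y" "closed_on X \<omega>" "closed_on Y \<omega>"
  shows "closed_on (X \<union> Y) \<omega>"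
proof -
  have "smooth_on (X \<union> Y) (\<lambda>q. \<omega> q vs)" for vs
  proof (rule smooth_on_local)
    fix x assume "x \<in> X \<union> Y"
    then show "\<exists>V. open V \<and> x \<in> V \<and> smooth_on V (\<lambda>q. \<omega> q vs)"
    proof
      assume "x \<in> X"
      then show ?thesis
        using assms(1) smooth_coeffsD[OF ambient_form_smooth[OF closed_onD(1)[OF assms(3)]]] by blast
    next
      assume "x \<in> Y"
      then show ?thesis
        using assms(2) smooth_coeffsD[OF ambient_form_smooth[OF closed_onD(1)[OF assms(4)]]] by blast
    qed
  qed
  then show ?thesis
    using assms(3,4) unfolding closed_on_def ambient_form_def by blast
qed

lemma ambient_form_Un:
  assumes "open X" "open Y" "ambient_form X \<omega>" "ambient_form Y \<omega>"
  shows "ambient_form (X \<union> Y) \<omega>"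
proof -
  have "smooth_on (X \<union> Y) (\<lambda>q. \<omega> q vs)" for vs
  proof (rule smooth_on_local)
    fix x assume "x \<in> X \<union> Y"
    then show "\<exists>V. open V \<and> x \<in> V \<and> smooth_on V (\<lambda>q. \<omega> q vs)"
    proof
      assume "x \<in> X"
      then show ?thesis using assms(1) smooth_coeffsD[OF ambient_form_smooth[OF assms(3)]] by blast
    next
      assume "x \<in> Y"
      then show ?thesis using assms(2) smooth_coeffsD[OF ambient_form_smooth[OF assms(4)]] by blast
    qed
  qed
  then show ?thesis
    using assms(3,4) unfolding ambient_form_def by blast
qed

text \<open>Near \<open>0\<close> the difference quotient of \<open>(1 + t) powi k\<close> is
  bounded by the modulus of \<open>k\<close> plus \<open>1\<close>. One constant
  \<open>\<delta>\<close> serves as radius and as inverse Lipschitz constant;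
  \<open>\<delta> \<le> 1/2\<close> keeps \<open>1 + t\<close> away from \<open>0\<close>.\<close>

lemma powi_near_one:
  "\<exists>\<delta>>0. \<delta> \<le> 1/2 \<and> (\<forall>t::complex. norm t < \<delta> \<longrightarrow> norm ((1 + t) powi k - 1) \<le> norm t / \<delta>)"
proof -
  have "((\<lambda>t::complex. (1 + t) powi k) has_field_derivative (of_int k * (1 + 0) powi (k - 1) * 1)) (at 0)"
    by (auto intro!: derivative_eq_intros)
  then have "((\<lambda>t::complex. (1 + t) powi k) has_derivative (\<lambda>t. of_int k * t)) (at 0)"
    by (simp add: has_field_derivative_def)
  then have "\<forall>e>0. \<exists>d>0. \<forall>y::complex. norm (y - 0) < d \<longrightarrow>
      norm ((1 + y) powi k - (1 + 0) powi k - of_int k * (y - 0)) \<le> e * norm (y - 0)"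
    unfolding has_derivative_at_alt by blast
  then obtain d where d: "d > 0" "\<And>y::complex. norm y < d \<Longrightarrow> norm ((1 + y) powi k - 1 - of_int k * y) \<le> norm y"
    by (metis diff_zero add_0_right power_int_1_left mult_1 zero_less_one)
  define C where "C = \<bar>real_of_int k\<bar> + 1"
  define \<delta> where "\<delta> = min d (min (1/2) (1 / C))"
  have C: "C > 0" by (simp add: C_def)
  have \<delta>: "\<delta> > 0" "\<delta> \<le> 1/2" "\<delta> \<le> d" "\<delta> \<le> 1 / C" using d(1) C by (simp_all add: \<delta>_def)
  have "norm ((1 + t) powi k - 1) \<le> norm t / \<delta>" if "norm t < \<delta>" for t :: complex
  proof -
    have "norm ((1 + t) powi k - 1) \<le> norm ((1 + t) powi k - 1 - of_int k * t) + norm (of_int k * t)"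
      by (metis diff_add_cancel norm_triangle_ineq)
    also have "\<dots> \<le> norm t + \<bar>real_of_int k\<bar> * norm t"
      using d(2)[of t] that \<delta>(3) by (simp add: norm_mult)
    also have "\<dots> = C * norm t" by (simp add: C_def algebra_simps)
    also have "\<dots> \<le> 1 / \<delta> * norm t"
    proof (rule mult_right_mono)
      have "C * \<delta> \<le> 1" using \<delta>(4) C by (simp add: pos_le_divide_eq mult.commute)
      then show "C \<le> 1 / \<delta>" using \<delta>(1) by (simp add: pos_le_divide_eq)
    qed simp
    finally show ?thesis by simp
  qed
  with \<delta> show ?thesis by blast
qed

lemma powi_near_one_finite:
  assumes "finite S"
  shows "\<exists>\<delta>>0. \<delta> \<le> 1/2 \<and> (\<forall>k\<in>S. \<forall>t::complex. norm t < \<delta> \<longrightarrow> norm ((1 + t) powi k - 1) \<le> norm t / \<delta>)"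
  using assms
proof induction
  case empty
  show ?case by (intro exI[of _ "1/2"]) simp
next
  case (insert k S)
  then obtain \<delta>1 where \<delta>1: "\<delta>1 > 0" "\<delta>1 \<le> 1/2"
    "\<And>k t. k \<in> S \<Longrightarrow> norm (t::complex) < \<delta>1 \<Longrightarrow> norm ((1 + t) powi k - 1) \<le> norm t / \<delta>1" by blast
  obtain \<delta>2 where \<delta>2: "\<delta>2 > 0" "\<delta>2 \<le> 1/2"
    "\<And>t. norm (t::complex) < \<delta>2 \<Longrightarrow> norm ((1 + t) powi k - 1) \<le> norm t / \<delta>2" using powi_near_one[of k] by blast
  let ?d = "min \<delta>1 \<delta>2"
  have "norm t / \<delta>1 \<le> norm t / ?d" "norm t / \<delta>2 \<le> norm t / ?d" for t :: complex
    using \<delta>1(1) \<delta>2(1) by (intro divide_left_mono; simp)+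
  then have "norm ((1 + t) powi j - 1) \<le> norm t / ?d" if "j \<in> insert k S" "norm t < ?d" for j and t :: complex
    using order_trans[OF \<delta>1(3)[of j t]] order_trans[OF \<delta>2(3)[of t]] that by (cases "j = k") simp_all
  then show ?case using \<delta>1 \<delta>2 by (intro exI[of _ ?d]) auto
qed

text \<open>A smooth substitute for the smaller of \<open>1\<close> and half the modulus: it is
  bounded by both and vanishes only at \<open>0\<close>, so products of gaps give smooth positive
  radii.\<close>

definition gap :: "complex \<Rightarrow> real" where
  "gap w = (norm w)\<^sup>2 / (1 + (norm w)\<^sup>2)"

lemma one_add_norm_sq: "1 + (norm w)\<^sup>2 > 0"
  by (simp add: add_pos_nonneg)

lemma gap_bounds: "0 \<le> gap w" "gap w \<le> 1" "gap w \<le> norm w / 2" "gap w = 0 \<longleftrightarrow> w = 0" "w \<noteq> 0 \<Longrightarrow> gap w > 0"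
proof -
  note p = one_add_norm_sq[of w]
  show "0 \<le> gap w" "gap w \<le> 1" using p by (simp_all add: gap_def)
  show 0: "gap w = 0 \<longleftrightarrow> w = 0" using p by (auto simp: gap_def)
  show "w \<noteq> 0 \<Longrightarrow> gap w > 0" using p by (simp add: gap_def)
  have "2 * norm w \<le> 1 + (norm w)\<^sup>2" using zero_le_power2[of "norm w - 1"] by (simp add: power2_eq_square algebra_simps)
  then have "norm w * (2 * norm w) \<le> norm w * (1 + (norm w)\<^sup>2)" by (rule mult_left_mono) simp
  then show "gap w \<le> norm w / 2" using p by (simp add: gap_def divide_simps power2_eq_square algebra_simps)
qed

lemma smooth_on_gap:
  fixes f :: "'a::real_normed_vector \<Rightarrow> complex"
  assumes "open U" "smooth_on U f"
  shows "smooth_on U (\<lambda>x. gap (f x))"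
proof -
  have eq: "gap (f x) = Re (f x * cnj (f x)) / (1 + Re (f x * cnj (f x)))" for x
    by (simp only: gap_def complex_mult_cnj cmod_power2 Re_complex_of_real)
  have pos: "1 + Re (f x * cnj (f x)) \<noteq> 0" for x
    using one_add_norm_sq[of "f x"] by (simp only: complex_mult_cnj cmod_power2 Re_complex_of_real)
  show ?thesis
    unfolding eq
    by (intro smooth_on_divide smooth_on_add smooth_on_const smooth_on_Re smooth_on_mult smooth_on_cnj assms pos)
qed

lemma gap_prod_le:
  assumes "finite I" "i \<in> I"
  shows "(\<Prod>i\<in>I. gap (f i)) \<le> gap (f i)" "0 \<le> (\<Prod>i\<in>I. gap (f i))"
proof -
  show "0 \<le> (\<Prod>i\<in>I. gap (f i))" by (intro prod_nonneg gap_bounds)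
  have "(\<Prod>i\<in>I. gap (f i)) = gap (f i) * (\<Prod>i\<in>I - {i}. gap (f i))"
    by (rule prod.remove[OF assms])
  also have "\<dots> \<le> gap (f i) * 1"
    by (intro mult_left_mono prod_le_1 gap_bounds conjI)
  finally show "(\<Prod>i\<in>I. gap (f i)) \<le> gap (f i)" by simp
qed

text \<open>Since the pairing is \<open>1\<close>, the character \<open>n\<close> maps each orbit of
  the subgroup \<open>m\<close> bijectively onto the nonzero complex numbers. Every orbit meets the
  hypersurface in one point, which gives global product coordinates; \<open>tt\<close> is normalised
  so that the hypersurface is \<open>tt = 0\<close> and the only excluded value is
  \<open>-1\<close>.\<close>

locale deletion =
  fixes \<A> :: "((int^'l) \<times> complex) set" and n m :: "int^'l" and c :: complex
  assumes fin: "finite \<A>" and dual: "pairing n m = 1" and c: "c \<noteq> 0"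
begin

text \<open>\<open>J u z\<close> is the point of the orbit of \<open>z\<close> under the one-parameter subgroup \<open>m\<close> at which \<open>tt = u\<close>.\<close>

definition "tt z = character n z / c - 1"
definition "J u z = act m ((1 + u) * c / character n z) z"
definition "pr z = J 0 z"

lemma one_tt: "z \<in> torus \<Longrightarrow> 1 + tt z \<noteq> 0"
  using c by (simp add: tt_def character_nonzero)

lemma tt_0: "z \<in> torus \<Longrightarrow> tt z = 0 \<longleftrightarrow> character n z = c"
  using c by (simp add: tt_def)

context
  fixes z :: "complex^'l"
  assumes z: "z \<in> torus"
begin

lemma scale_nonzero: "1 + u \<noteq> 0 \<Longrightarrow> (1 + u) * c / character n z \<noteq> 0"
  using c character_nonzero[OF z] by simp

lemma J_torus: "1 + u \<noteq> 0 \<Longrightarrow> J u z \<in> torus"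
  unfolding J_def by (intro act_torus scale_nonzero z)

lemma character_J: "1 + u \<noteq> 0 \<Longrightarrow> character n (J u z) = (1 + u) * c"
  using character_nonzero[OF z, of n] unfolding J_def character_act[OF scale_nonzero] dual by simp

lemma tt_J: "1 + u \<noteq> 0 \<Longrightarrow> tt (J u z) = u"
  using c by (simp add: tt_def character_J)

lemma J_J: "1 + v \<noteq> 0 \<Longrightarrow> J u (J v z) = J u z"
proof -
  assume v: "1 + v \<noteq> 0"
  have "(1 + u) * c / (s * c) * (s * c / ch) = (1 + u) * c / ch" if "s \<noteq> 0" for s ch
    using c that by simp
  from this[OF v] show ?thesis
    unfolding J_def[of u "J v z"] character_J[OF v] by (simp only: J_def act_act)
qed

lemma J_tt: "J (tt z) z = z"
  using c character_nonzero[OF z, of n] by (simp add: J_def tt_def)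

lemma pr_torus: "pr z \<in> torus"
  unfolding pr_def by (rule J_torus) simp

lemma tt_pr: "tt (pr z) = 0"
  unfolding pr_def by (rule tt_J) simp

lemma pr_J: "1 + u \<noteq> 0 \<Longrightarrow> pr (J u z) = pr z"
  unfolding pr_def by (rule J_J)

lemma J_pr: "J u (pr z) = J u z"
  unfolding pr_def by (rule J_J) simp

text \<open>Moving from \<open>pr z\<close> to \<open>z\<close> is the action of
  \<open>1 + tt z\<close>. Thus all other characters are controlled along an orbit, which is where
  the estimate for powers near one enters.\<close>

lemma character_via_pr: "character k z = (1 + tt z) powi (pairing k m) * character k (pr z)"
proof -
  have "act m (1 + tt z) (pr z) = z"
    using c character_nonzero[OF z, of n] by (simp add: pr_def J_def act_act tt_def)
  then have "character k z = character k (act m (1 + tt z) (pr z))" by simp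
  also have "\<dots> = (1 + tt z) powi (pairing k m) * character k (pr z)"
    by (rule character_act[OF one_tt[OF z]])
  finally show ?thesis .
qed

end

lemma smooth_tt: "smooth_on torus tt"
  unfolding tt_def[abs_def]
  by (intro smooth_on_diff smooth_on_divide smooth_on_character smooth_on_const open_torus c)

definition DJ :: "(complex \<times> (complex^'l)) set" where
  "DJ = {u. 1 + u \<noteq> 0} \<times> torus"

lemma open_DJ: "open DJ"
proof -
  have "{u::complex. 1 + u \<noteq> 0} = - {-1}" by (auto simp: add_eq_0_iff)
  then show ?thesis unfolding DJ_def by (intro open_Times open_torus) (simp add: open_Compl)
qed

lemma smooth_J: "smooth_on DJ (\<lambda>x. J (fst x) (snd x))"
proof -
  have snd: "smooth_on DJ snd" by (rule smooth_on_snd[OF open_DJ smooth_on_ident[OF open_DJ]])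
  have ch: "smooth_on DJ (\<lambda>x. character n (snd x))"
    by (rule smooth_on_compose[OF open_DJ open_torus smooth_on_character _ snd]) (auto simp: DJ_def)
  have s: "smooth_on DJ (\<lambda>x. (1 + fst x) * c / character n (snd x))"
    by (intro smooth_on_divide smooth_on_mult smooth_on_add smooth_on_const smooth_on_fst smooth_on_ident open_DJ ch)
      (auto simp: DJ_def character_nonzero)
  show ?thesis
    unfolding J_def act_def
    by (intro smooth_on_vec_lambda smooth_on_mult smooth_on_powi smooth_on_vec_nth open_DJ snd s)
      (use scale_nonzero in \<open>auto simp: DJ_def\<close>)
qed

lemma smooth_pr: "smooth_on torus pr"
proof -
  have "smooth_on torus (\<lambda>z. (0::complex, z))"
    by (intro smooth_on_Pair smooth_on_const smooth_on_ident open_torus)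
  from smooth_on_compose[OF open_torus open_DJ smooth_J _ this]
  show ?thesis by (simp add: pr_def[abs_def] DJ_def image_subset_iff)
qed

definition "M = complement \<A>"
definition "N = M \<inter> hypersurface (n, c)"
definition "M' = complement (insert (n, c) \<A>)"
text \<open>The union of the orbits through \<open>N\<close>. It need not lie in \<open>M\<close>,
  since an orbit can meet other hypersurfaces away from \<open>N\<close>, but it retracts onto
  \<open>N\<close>.\<close>

definition "P = torus \<inter> pr -` M"

lemma open_M: "open M" unfolding M_def by (rule open_complement[OF fin])
lemma open_M': "open M'" unfolding M'_def using fin by (intro open_complement) simp

lemma open_P: "open P"
  unfolding P_def by (rule continuous_open_preimage[OF smooth_on_imp_continuous_on[OF smooth_pr] open_torus open_M])

lemma M_torus: "M \<subseteq> torus" unfolding M_def by (rule complement_subset)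
lemma P_torus: "P \<subseteq> torus" by (auto simp: P_def)

lemma M'_iff: "z \<in> M' \<longleftrightarrow> z \<in> M \<and> tt z \<noteq> 0"
  using tt_0[of z] by (auto simp: M'_def M_def complement_iff)

lemma N_iff: "z \<in> N \<longleftrightarrow> z \<in> M \<and> tt z = 0"
  using tt_0[of z] M_torus by (auto simp: N_def hypersurface_def)

lemma pr_fix: "z \<in> torus \<Longrightarrow> tt z = 0 \<Longrightarrow> pr z = z"
  using J_tt[of z] by (simp add: pr_def)

lemma retraction_pr: "retraction P N pr"
proof
  show "open P" by (rule open_P)
  show "N \<subseteq> P" using pr_fix M_torus by (auto simp: N_iff P_def)
  show "smooth_on P pr" by (rule smooth_on_subset[OF smooth_pr P_torus])
  show "pr ` P \<subseteq> N" using tt_pr by (auto simp: N_iff P_def)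
  show "pr z = z" if "z \<in> N" for z using that pr_fix M_torus by (auto simp: N_iff)
qed

text \<open>One constant for the finitely many exponents with which the characters of
  \<open>\<A>\<close> vary along orbits.\<close>

definition "\<delta> = (SOME \<delta>. \<delta> > 0 \<and> \<delta> \<le> 1/2 \<and>
  (\<forall>k\<in>(\<lambda>K. pairing (fst K) m) ` \<A>. \<forall>t::complex. norm t < \<delta> \<longrightarrow> norm ((1 + t) powi k - 1) \<le> norm t / \<delta>))"

lemma \<delta>: "\<delta> > 0" "\<delta> \<le> 1/2"
  "K \<in> \<A> \<Longrightarrow> norm (t::complex) < \<delta> \<Longrightarrow> norm ((1 + t) powi (pairing (fst K) m) - 1) \<le> norm t / \<delta>"
proof -
  have "\<delta> > 0 \<and> \<delta> \<le> 1/2 \<and> (\<forall>k\<in>(\<lambda>K. pairing (fst K) m) ` \<A>. \<forall>t::complex. norm t < \<delta> \<longrightarrow> norm ((1 + t) powi k - 1) \<le> norm t / \<delta>)"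
    unfolding \<delta>_def by (rule someI_ex) (use powi_near_one_finite[OF finite_imageI[OF fin]] in blast)
  then show "\<delta> > 0" "\<delta> \<le> 1/2"
    "K \<in> \<A> \<Longrightarrow> norm (t::complex) < \<delta> \<Longrightarrow> norm ((1 + t) powi (pairing (fst K) m) - 1) \<le> norm t / \<delta>" by auto
qed

text \<open>On the orbit of \<open>z\<close>, the hypersurface \<open>K\<close> is met where
  \<open>(1 + tt) powi (pairing (fst K) m)\<close> equals \<open>1 - offset K z\<close>; a nonzero
  offset keeps it away from \<open>tt = 0\<close>.\<close>

definition "offset K z = 1 - snd K / character (fst K) (pr z)"

text \<open>Radius of a tube around the hypersurface inside \<open>M\<close>; it vanishes off \<open>P\<close>.\<close>

definition "\<rho> z = \<delta> * (\<Prod>K\<in>\<A>. gap (offset K z))"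

lemma offset_0: "z \<in> torus \<Longrightarrow> offset K z = 0 \<longleftrightarrow> character (fst K) (pr z) = snd K"
  using character_nonzero[OF pr_torus, of z "fst K"] by (auto simp: offset_def)

lemma smooth_\<rho>: "smooth_on torus \<rho>"
proof -
  have ch: "smooth_on torus (\<lambda>z. character (fst K) (pr z))" for K :: "(int^'l) \<times> complex"
    by (rule smooth_on_compose[OF open_torus open_torus smooth_on_character _ smooth_pr]) (use pr_torus in auto)
  have "smooth_on torus (offset K)" for K
    unfolding offset_def[abs_def]
    by (intro smooth_on_diff smooth_on_divide smooth_on_const open_torus ch) (rule character_nonzero[OF pr_torus])
  then show ?thesis
    unfolding \<rho>_def[abs_def] by (intro smooth_on_mult smooth_on_const smooth_on_prod smooth_on_gap open_torus)
qed

lemma \<rho>_le: "\<rho> z \<le> \<delta>" "0 \<le> \<rho> z" "K \<in> \<A> \<Longrightarrow> \<rho> z \<le> \<delta> * gap (offset K z)"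
proof -
  have "(\<Prod>K\<in>\<A>. gap (offset K z)) \<le> 1" by (intro prod_le_1 gap_bounds conjI)
  then show "\<rho> z \<le> \<delta>" unfolding \<rho>_def using \<delta>(1) mult_left_mono[of _ 1 \<delta>] by simp
  show "0 \<le> \<rho> z" unfolding \<rho>_def using \<delta>(1) by (intro mult_nonneg_nonneg prod_nonneg gap_bounds) simp
  show "K \<in> \<A> \<Longrightarrow> \<rho> z \<le> \<delta> * gap (offset K z)"
    unfolding \<rho>_def using \<delta>(1) by (intro mult_left_mono gap_prod_le(1)[OF fin]) simp_all
qed

lemma \<rho>_pos_iff: "z \<in> torus \<Longrightarrow> \<rho> z > 0 \<longleftrightarrow> z \<in> P"
proof -
  assume z: "z \<in> torus"
  have "\<rho> z = 0 \<longleftrightarrow> (\<exists>K\<in>\<A>. offset K z = 0)"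
    unfolding \<rho>_def using \<delta>(1) fin by (simp add: gap_bounds(4))
  also have "\<dots> \<longleftrightarrow> z \<notin> P"
    using offset_0[OF z] z pr_torus[OF z] by (auto simp: P_def M_def complement_iff)
  finally show ?thesis using \<rho>_le(2)[of z] by (metis less_eq_real_def less_irrefl)
qed

lemma \<rho>_J: "z \<in> torus \<Longrightarrow> 1 + u \<noteq> 0 \<Longrightarrow> \<rho> (J u z) = \<rho> z"
  by (simp add: \<rho>_def offset_def pr_J)

text \<open>If \<open>z\<close> lay on \<open>K\<close>, the offset would have modulus at most
  \<open>norm (tt z) / \<delta>\<close>, hence by the choice of \<open>\<rho>\<close> at most the
  gap of the offset, hence at most half its own modulus, and it would be zero.\<close>

lemma tube_subset:
  assumes "z \<in> torus" "norm (tt z) < \<rho> z"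
  shows "z \<in> M"
  unfolding M_def complement_iff
proof (intro conjI ballI assms(1) notI)
  fix K assume K: "K \<in> \<A>" and eq: "character (fst K) z = snd K"
  let ?t = "tt z" and ?x = "offset K z"
  have pos: "\<rho> z > 0" using assms(2) norm_ge_zero[of ?t] by linarith
  then have "z \<in> P" using \<rho>_pos_iff[OF assms(1)] by simp
  then have x0: "?x \<noteq> 0"
    using offset_0[OF assms(1), of K] K pr_torus[OF assms(1)] by (auto simp: P_def M_def complement_iff)
  have "?x = 1 - (1 + ?t) powi (pairing (fst K) m)"
    using character_via_pr[OF assms(1), of "fst K"] character_nonzero[OF pr_torus[OF assms(1)], of "fst K"] eq
    by (simp add: offset_def)
  then have "norm ?x = norm ((1 + ?t) powi (pairing (fst K) m) - 1)" by (simp add: norm_minus_commute)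
  also have "\<dots> \<le> norm ?t / \<delta>" using \<delta>(3)[OF K, of ?t] assms(2) \<rho>_le(1)[of z] by linarith
  also have "\<dots> \<le> gap ?x"
    using \<rho>_le(3)[OF K, of z] assms(2) \<delta>(1) by (simp add: pos_divide_le_eq mult.commute)
  also have "\<dots> \<le> norm ?x / 2" by (rule gap_bounds)
  finally show False using x0 by simp
qed

text \<open>An open tube around \<open>N\<close> inside \<open>M\<close>, and below the same tube
  punctured along the hypersurface; both are empty over points where \<open>\<rho>\<close>
  vanishes.\<close>

definition "W = {z\<in>torus. norm (tt z) < \<rho> z}"
definition "W' = {z\<in>torus. norm (tt z) < \<rho> z \<and> tt z \<noteq> 0}"

lemma open_W: "open W"
proof -
  have "W = torus \<inter> (\<lambda>z. \<rho> z - norm (tt z)) -` {0<..}" by (auto simp: W_def)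
  also have "open \<dots>"
    by (rule continuous_open_preimage[OF _ open_torus open_greaterThan])
      (intro continuous_on_diff continuous_on_norm smooth_on_imp_continuous_on smooth_\<rho> smooth_tt)
  finally show ?thesis .
qed

lemma open_W': "open W'"
proof -
  have "W' = W \<inter> (torus \<inter> tt -` (- {0}))" by (auto simp: W_def W'_def)
  also have "open \<dots>"
    by (intro open_Int open_W continuous_open_preimage[OF smooth_on_imp_continuous_on[OF smooth_tt] open_torus]) auto
  finally show ?thesis .
qed

lemma W_M: "W \<subseteq> M" using tube_subset by (auto simp: W_def)
lemma W'_M': "W' \<subseteq> M'" using tube_subset by (auto simp: W'_def M'_iff)
lemma W_P: "W \<subseteq> P" using \<rho>_pos_iff norm_ge_zero by (auto simp: W_def) (metis le_less_trans norm_ge_zero)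
lemma W'_W: "W' \<subseteq> W" by (auto simp: W_def W'_def)

lemma small_nonzero: "norm (u::complex) < \<rho> z \<Longrightarrow> 1 + u \<noteq> 0"
proof
  assume "norm u < \<rho> z" "1 + u = 0"
  then have "u = -1" by (simp add: add_eq_0_iff)
  then show False using \<open>norm u < \<rho> z\<close> \<rho>_le(1)[of z] \<delta>(2) by simp
qed

lemma J_W: "z \<in> torus \<Longrightarrow> norm u < \<rho> z \<Longrightarrow> J u z \<in> W"
  using small_nonzero[of u z] by (simp add: W_def J_torus tt_J \<rho>_J)

text \<open>The tube is star-shaped along the orbits: scaling \<open>tt\<close> down to
  \<open>0\<close> is a homotopy from the identity to \<open>pr\<close> inside
  \<open>W\<close>.\<close>

lemma tube_retract:
  assumes a: "closed_on M a"
  shows "cohomologous W a (pullback pr a)"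
proof -
  define \<Phi> where "\<Phi> = (\<lambda>x::real \<times> (complex^'l). J (of_real (fst x) * tt (snd x)) (snd x))"
  let ?T = "(UNIV :: real set) \<times> (torus :: (complex^'l) set)"
  have T: "open ?T" by (intro open_Times open_torus) simp
  have snd: "smooth_on ?T snd" by (rule smooth_on_snd[OF T smooth_on_ident[OF T]])
  have tts: "smooth_on ?T (\<lambda>x. tt (snd x))" and \<rho>s: "smooth_on ?T (\<lambda>x. \<rho> (snd x))"
    by (rule smooth_on_compose[OF T open_torus smooth_tt _ snd] smooth_on_compose[OF T open_torus smooth_\<rho> _ snd]; auto)+
  have k: "smooth_on ?T (\<lambda>x. of_real (fst x) * tt (snd x))"
    by (intro smooth_on_mult smooth_on_of_real smooth_on_fst smooth_on_ident T tts)
  define \<Omega> where "\<Omega> = {x\<in>?T. norm (of_real (fst x) * tt (snd x)) < \<rho> (snd x)}"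
  have \<Omega>: "open \<Omega>"
  proof -
    have "\<Omega> = ?T \<inter> (\<lambda>x. \<rho> (snd x) - norm (of_real (fst x) * tt (snd x))) -` {0<..}" by (auto simp: \<Omega>_def)
    also have "open \<dots>"
      by (rule continuous_open_preimage[OF _ T open_greaterThan])
        (intro continuous_on_diff continuous_on_norm smooth_on_imp_continuous_on \<rho>s k)
    finally show ?thesis .
  qed
  have sub: "{0..1} \<times> W \<subseteq> \<Omega>"
  proof
    fix x :: "real \<times> (complex^'l)" assume x: "x \<in> {0..1} \<times> W"
    have "norm (of_real (fst x) * tt (snd x)) \<le> 1 * norm (tt (snd x))"
      unfolding norm_mult using x by (intro mult_right_mono) auto
    then show "x \<in> \<Omega>" using x by (auto simp: \<Omega>_def W_def)
  qed
  have \<Phi>: "smooth_on \<Omega> \<Phi>"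
  proof -
    have kk: "smooth_on \<Omega> (\<lambda>x. (of_real (fst x) * tt (snd x), snd x))"
      by (intro smooth_on_Pair \<Omega> smooth_on_subset[OF k] smooth_on_subset[OF snd]) (auto simp: \<Omega>_def)
    have "(\<lambda>x. (of_real (fst x) * tt (snd x), snd x)) ` \<Omega> \<subseteq> DJ"
      using small_nonzero by (auto simp: \<Omega>_def DJ_def)
    from smooth_on_compose[OF \<Omega> open_DJ smooth_J this kk] show ?thesis by (simp add: \<Phi>_def)
  qed
  have im: "\<Phi> ` \<Omega> \<subseteq> W" using J_W by (auto simp: \<Phi>_def \<Omega>_def)
  have h: "cohomologous W (pullback (\<lambda>p. \<Phi> (1, p)) a) (pullback (\<lambda>p. \<Phi> (0, p)) a)"
    by (rule homotopy_cohomologous[OF open_W open_W \<Omega> sub \<Phi> im closed_on_subset[OF a W_M]])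
  show ?thesis
  proof (rule cohomologous_cong[OF _ _ h])
    fix p vs assume p: "p \<in> W"
    have "pullback (\<lambda>p. \<Phi> (1, p)) a p = a p"
      by (rule pullback_id[OF _ open_W p]) (simp add: \<Phi>_def J_tt W_def)
    then show "pullback (\<lambda>p. \<Phi> (1, p)) a p vs = a p vs" by simp
    show "pullback (\<lambda>p. \<Phi> (0, p)) a p vs = pullback pr a p vs" by (simp add: \<Phi>_def pr_def[abs_def])
  qed
qed

text \<open>The circle over \<open>z\<close> has radius \<open>\<rho> z / 2\<close> and depends only
  on the orbit of \<open>z\<close>. Hence the averages are defined on all of \<open>P\<close>,
  including the hypersurface, although \<open>\<omega>\<close> is given only off it.\<close>

lemma tube_decomposition:
  assumes \<omega>: "closed_on M' \<omega>"
  obtains \<alpha> \<beta> where "closed_on P \<alpha>" "closed_on P \<beta>" "\<And>p. p \<in> P \<Longrightarrow> pullback pr \<beta> p = \<beta> p"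
    "cohomologous W' \<omega> (\<lambda>p vs. \<alpha> p vs + wdg (\<lambda>us. - \<i> * psi0 (n, c) p us) (\<beta> p) vs)"
proof -
  define D where "D = {x\<in>DJ. fst x \<noteq> 0 \<and> norm (fst x) < \<rho> (snd x)}"
  have snd: "smooth_on DJ snd" by (rule smooth_on_snd[OF open_DJ smooth_on_ident[OF open_DJ]])
  have fst: "smooth_on DJ fst" by (rule smooth_on_fst[OF open_DJ smooth_on_ident[OF open_DJ]])
  have \<rho>s: "smooth_on DJ (\<lambda>x. \<rho> (snd x))"
    by (rule smooth_on_compose[OF open_DJ open_torus smooth_\<rho> _ snd]) (auto simp: DJ_def)
  have D: "open D"
  proof -
    have "D = (DJ \<inter> (\<lambda>x. \<rho> (snd x) - norm (fst x)) -` {0<..}) \<inter> (DJ \<inter> fst -` (- {0}))" by (auto simp: D_def)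
    also have "open \<dots>"
      by (intro open_Int continuous_open_preimage[OF _ open_DJ] open_greaterThan open_Compl closed_singleton
        continuous_on_diff continuous_on_norm smooth_on_imp_continuous_on \<rho>s fst)
    finally show ?thesis .
  qed
  have D_iff: "(u, z) \<in> D \<longleftrightarrow> z \<in> torus \<and> u \<noteq> 0 \<and> norm u < \<rho> z" for u z
    using small_nonzero[of u z] by (auto simp: D_def DJ_def)
  have JD: "(\<lambda>x. J (fst x) (snd x)) ` D \<subseteq> W'"
  proof -
    have "J u z \<in> W'" if "(u, z) \<in> D" for u z
      using J_W[of z u] tt_J[of z u] small_nonzero[of u z] that unfolding D_iff by (simp add: W_def W'_def)
    then show ?thesis by auto
  qed
  have smJ: "smooth_on D (\<lambda>x. J (fst x) (snd x))" by (rule smooth_on_subset[OF smooth_J]) (auto simp: D_def)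
  have smt: "smooth_on W' tt" by (rule smooth_on_subset[OF smooth_tt]) (auto simp: W'_def)
  have smr: "smooth_on P (\<lambda>z. \<rho> z / 2)"
    by (intro smooth_on_divide smooth_on_const smooth_on_subset[OF smooth_\<rho> P_torus] open_P) simp
  have W'P: "W' \<subseteq> P" using W'_W W_P by blast
  obtain \<alpha> \<beta> where \<alpha>: "closed_on P \<alpha>" and \<beta>: "closed_on P \<beta>"
    and coh: "cohomologous W' \<omega> (\<lambda>p vs. \<alpha> p vs + wdg (\<lambda>us. - \<i> * log_deriv tt p us) (\<beta> p) vs)"
    and basic: "\<And>\<pi> \<theta>. smooth_on P \<pi> \<Longrightarrow> \<pi> ` P \<subseteq> P \<Longrightarrow> smooth_on W' \<theta> \<Longrightarrow> \<theta> ` W' \<subseteq> W' \<Longrightarrow>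
       (\<And>z. z \<in> P \<Longrightarrow> \<rho> (\<pi> z) / 2 = \<rho> z / 2) \<Longrightarrow>
       (\<And>z u. z \<in> P \<Longrightarrow> norm u = \<rho> z / 2 \<Longrightarrow> J (fst (u, \<pi> z)) (snd (u, \<pi> z)) = \<theta> (J (fst (u, z)) (snd (u, z)))) \<Longrightarrow>
       (\<And>p. p \<in> W' \<Longrightarrow> pullback \<theta> \<omega> p = \<omega> p) \<Longrightarrow>
       \<forall>p\<in>P. pullback \<pi> \<alpha> p = \<alpha> p \<and> pullback \<pi> \<beta> p = \<beta> p"
  proof (rule circle_decomposition[OF D open_P open_W' W'P smJ JD closed_on_subset[OF \<omega> W'_M'] smt _ smr])
    show "tt z \<noteq> 0" if "z \<in> W'" for z using that by (simp add: W'_def)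
    show "0 < \<rho> z / 2" if "z \<in> P" for z using that \<rho>_pos_iff P_torus by auto
    show "(u, z) \<in> D" if "z \<in> P" "norm u = \<rho> z / 2" for z u
    proof -
      have "\<rho> z > 0" "z \<in> torus" using that(1) \<rho>_pos_iff P_torus by auto
      then show ?thesis using that(2) unfolding D_iff by auto
    qed
    show "J (fst (tt z, z)) (snd (tt z, z)) = z" if "z \<in> W'" for z using that J_tt by (simp add: W'_def)
    show "(of_real (1 - x + x * (\<rho> z / 2 / norm (tt z))) * tt z, z) \<in> D"
      if z: "z \<in> W'" and x: "0 \<le> x" "x \<le> 1" for z x
    proof -
      have t: "tt z \<noteq> 0" "norm (tt z) < \<rho> z" "z \<in> torus" using z by (simp_all add: W'_def)
      \<comment> \<open>\<open>s\<close> moves \<open>tt z\<close> radially towards modulus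
        \<open>\<rho> z / 2\<close>; on the way the point stays nonzero and its modulus below
        \<open>\<rho> z\<close>.\<close>
      define s where "s = 1 - x + x * (\<rho> z / 2 / norm (tt z))"
      have pos: "\<rho> z / 2 / norm (tt z) > 0" using t by (intro divide_pos_pos) (auto intro: le_less_trans[OF norm_ge_zero])
      have s: "s > 0"
      proof (cases "x = 1")
        case False
        then have "1 - x > 0" using x by simp
        then show ?thesis unfolding s_def by (intro add_pos_nonneg mult_nonneg_nonneg x(1) less_imp_le[OF pos])
      qed (use pos in \<open>simp add: s_def\<close>)
      have "s * norm (tt z) = (1 - x) * norm (tt z) + x * (\<rho> z / 2)" using t(1) by (simp add: s_def algebra_simps)
      also have "\<dots> < \<rho> z"
      proof (cases "x = 1")
        case True
        then show ?thesis using t(2) norm_ge_zero[of "tt z"] by (simp del: norm_ge_zero)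
      next
        case False
        have "(1 - x) * norm (tt z) < (1 - x) * \<rho> z" using False x t(2) by simp
        moreover have "x * (\<rho> z / 2) \<le> x * \<rho> z" using x \<rho>_le(2)[of z] by (intro mult_left_mono) auto
        ultimately show ?thesis by (simp add: algebra_simps)
      qed
      finally have "norm (of_real s * tt z) < \<rho> z" using s by (simp add: norm_mult)
      then show ?thesis using s t unfolding D_iff s_def[symmetric] by simp
    qed
  qed auto
  have pr: "smooth_on P pr" "pr ` P \<subseteq> P"
    using retraction.smooth_r[OF retraction_pr] retraction.r_P[OF retraction_pr] retraction.N_P[OF retraction_pr] by auto
  \<comment> \<open>\<open>J u\<close> is constant on orbits, so \<open>pr\<close> on the base is
    covered by the identity of the punctured tube.\<close>
  have "\<forall>p\<in>P. pullback pr \<alpha> p = \<alpha> p \<and> pullback pr \<beta> p = \<beta> p"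
  proof (rule basic[OF pr smooth_on_ident[OF open_W']])
    show "\<rho> (pr z) / 2 = \<rho> z / 2" if "z \<in> P" for z
      using \<rho>_J[of z 0] that P_torus by (auto simp: pr_def)
    show "J (fst (u, pr z)) (snd (u, pr z)) = J (fst (u, z)) (snd (u, z))" if "z \<in> P" for z u
      using J_pr[of z u] that P_torus by auto
    show "pullback (\<lambda>x. x) \<omega> p = \<omega> p" if "p \<in> W'" for p
      by (rule pullback_id[OF _ open_W' that]) simp
  qed simp
  then have b: "pullback pr \<beta> p = \<beta> p" if "p \<in> P" for p using that by blast
  \<comment> \<open>\<open>tt\<close> and \<open>character n z - c\<close> differ by the constant
    factor \<open>c\<close>, which logarithmic differentiation removes.\<close>
  have ld: "log_deriv tt p us = psi0 (n, c) p us" if p: "p \<in> W'" for p us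
  proof -
    have pT: "p \<in> torus" and t0: "tt p \<noteq> 0" using p by (simp_all add: W'_def)
    have d: "(character n has_derivative frechet_derivative (character n) (at p)) (at p)"
      by (rule smooth_on_has_derivative[OF smooth_on_character pT])
    have 1: "frechet_derivative tt (at p) v = frechet_derivative (character n) (at p) v / c" for v
    proof -
      have "(tt has_derivative (\<lambda>v. frechet_derivative (character n) (at p) v / c)) (at p)"
        unfolding tt_def[abs_def] using has_derivative_diff[OF has_derivative_divide[OF d has_derivative_const c] has_derivative_const] c
        by (simp add: divide_inverse)
      then show ?thesis by (simp add: frechet_derivative_eqI)
    qed
    have 2: "frechet_derivative (\<lambda>z. character n z - c) (at p) v = frechet_derivative (character n) (at p) v" for v
      using frechet_derivative_eqI[OF has_derivative_diff[OF d has_derivative_const]] by simp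
    have "tt p = (character n p - c) / c" using c by (simp add: tt_def field_simps)
    then show ?thesis using c by (simp add: psi0_def log_deriv_def one_form_def 1 2)
  qed
  have "cohomologous W' \<omega> (\<lambda>p vs. \<alpha> p vs + wdg (\<lambda>us. - \<i> * psi0 (n, c) p us) (\<beta> p) vs)"
  proof (rule cohomologous_cong[OF _ _ coh])
    fix p vs assume "p \<in> W'"
    then have "log_deriv tt p = psi0 (n, c) p" using ld by blast
    then show "\<alpha> p vs + wdg (\<lambda>us. - \<i> * log_deriv tt p us) (\<beta> p) vs = \<alpha> p vs + wdg (\<lambda>us. - \<i> * psi0 (n, c) p us) (\<beta> p) vs"
      by simp
  qed simp
  with \<alpha> \<beta> b show thesis by (rule that)
qed

end

context deletion
begin

lemma logarithmic_cohomology_insert: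
  assumes surj: "inclusion_pullback N ` carrier (deRham_cohomology M) = carrier (deRham_cohomology N)"
    and IH: "logarithmic_cohomology \<A>"
  shows "logarithmic_cohomology (insert (n, c) \<A>)"
  unfolding logarithmic_cohomology_def M'_def[symmetric]
proof (intro allI impI)
  fix \<omega> assume \<omega>: "closed_on M' \<omega>"
  let ?\<psi> = "\<lambda>p us. - \<i> * psi0 (n, c) p us"
  obtain \<alpha> \<beta> where \<alpha>: "closed_on P \<alpha>" and \<beta>: "closed_on P \<beta>" and basic: "\<And>p. p \<in> P \<Longrightarrow> pullback pr \<beta> p = \<beta> p"
    and dec: "cohomologous W' \<omega> (\<lambda>p vs. \<alpha> p vs + wdg (?\<psi> p) (\<beta> p) vs)"
    using tube_decomposition[OF \<omega>] by blast
  obtain a where a: "closed_on M a" "cohomologous P \<beta> (pullback pr a)"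
    using retraction.surjective_restriction_lift[OF retraction_pr open_M surj \<beta> basic] by blast
  have W'P: "W' \<subseteq> P" using W'_W W_P by blast
  have W'torus: "W' \<subseteq> torus" by (auto simp: W'_def)
  have M'torus: "M' \<subseteq> torus" unfolding M'_def by (rule complement_subset)
  \<comment> \<open>On the punctured tube the residue may be replaced by a form that is closed on
    all of \<open>M\<close>.\<close>
  have ba: "cohomologous W' \<beta> a"
    by (rule cohomologous_trans[OF open_W' cohomologous_subset[OF a(2) W'P]
        cohomologous_sym[OF open_W' cohomologous_subset[OF tube_retract[OF a(1)] W'_W]]])
  have \<psi>M': "closed_on M' ?\<psi>"
    by (rule closed_on_cmult[OF open_M' closed_psi0[OF open_M' M'torus]])
      (use M'_iff tt_0 M'torus in auto)
  have \<psi>W': "closed_on W' ?\<psi>" by (rule closed_on_subset[OF \<psi>M' W'_M'])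
  have "cohomologous W' \<omega> (\<lambda>p vs. \<alpha> p vs + wdg (?\<psi> p) (a p) vs)"
    by (rule cohomologous_trans[OF open_W' dec cohomologous_add[OF open_W' cohomologous_refl[OF open_W' refl]
        cohomologous_wdg[OF open_W' \<psi>W' ba]]])
  then obtain \<eta> where \<eta>: "ambient_form W' \<eta>"
    "\<And>p vs. p \<in> W' \<Longrightarrow> \<omega> p vs = \<alpha> p vs + wdg (?\<psi> p) (a p) vs + ambient_deriv \<eta> p vs"
    by (rule cohomologousE) blast
  obtain \<phi> :: "real \<Rightarrow> real" where \<phi>: "smooth_on UNIV \<phi>" "\<And>x. x \<le> 1/4 \<Longrightarrow> \<phi> x = 1" "\<And>x. x \<ge> 1/2 \<Longrightarrow> \<phi> x = 0"
    using smooth_cutoff by blast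
  \<comment> \<open>Squared relative distance to the hypersurface. The primitive
    \<open>\<eta>\<close> exists only on the punctured tube; multiplied by
    \<open>\<phi> (q z)\<close> it extends by zero to \<open>M'\<close> and is unchanged near the
    hypersurface.\<close>
  define q where "q z = (norm (tt z))\<^sup>2 / (\<rho> z)\<^sup>2" for z
  have \<rho>0: "\<rho> z \<noteq> 0" if "z \<in> P" for z using \<rho>_pos_iff[of z] P_torus that by auto
  have q: "smooth_on W' q"
  proof -
    have eq: "q z = Re (tt z * cnj (tt z)) / (\<rho> z)\<^sup>2" for z
      by (simp only: q_def complex_mult_cnj cmod_power2 Re_complex_of_real)
    show ?thesis
      unfolding eq[abs_def]
      by (intro smooth_on_divide smooth_on_Re smooth_on_mult smooth_on_cnj smooth_on_power open_W'
          smooth_on_subset[OF smooth_tt W'torus] smooth_on_subset[OF smooth_\<rho> W'torus])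
        (use \<rho>0 W'P in auto)
  qed
  have \<phi>q: "smooth_on W' (\<lambda>z. complex_of_real (\<phi> (q z)))"
    by (rule smooth_on_of_real[OF open_W' smooth_on_compose[OF open_W' open_UNIV \<phi>(1) _ q]]) simp
  define \<eta>' where "\<eta>' z vs = (if z \<in> W' then of_real (\<phi> (q z)) * \<eta> z vs else 0)" for z vs
  \<comment> \<open>Inside the tube this is the region \<open>q > 1/2\<close>; it is written without
    division because \<open>\<rho>\<close> may vanish outside the tube.\<close>
  define V where "V = M' \<inter> (torus \<inter> (\<lambda>z. 2 * (norm (tt z))\<^sup>2 - (\<rho> z)\<^sup>2) -` {0<..})"
  have V: "open V"
    unfolding V_def
    by (intro open_Int open_M' continuous_open_preimage[OF _ open_torus open_greaterThan]
        continuous_on_diff continuous_on_mult continuous_on_const continuous_on_power continuous_on_norm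
        smooth_on_imp_continuous_on smooth_\<rho> smooth_tt)
  have M'_cover: "M' = W' \<union> V"
  proof
    show "M' \<subseteq> W' \<union> V"
    proof
      fix z assume z: "z \<in> M'"
      then have zT: "z \<in> torus" and t0: "tt z \<noteq> 0" using M'_iff M'torus by auto
      show "z \<in> W' \<union> V"
      proof (cases "norm (tt z) < \<rho> z")
        case True
        then show ?thesis using zT t0 by (simp add: W'_def)
      next
        case False
        then have "(\<rho> z)\<^sup>2 \<le> (norm (tt z))\<^sup>2" using \<rho>_le(2)[of z] by (intro power_mono) auto
        moreover have "(norm (tt z))\<^sup>2 > 0" using t0 by simp
        ultimately have "2 * (norm (tt z))\<^sup>2 - (\<rho> z)\<^sup>2 > 0" by linarith
        then show ?thesis using z zT by (simp add: V_def)
      qed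
    qed
  qed (use W'_M' in \<open>auto simp: V_def\<close>)
  have V0: "\<eta>' z vs = 0" if "z \<in> V" for z vs
  proof (cases "z \<in> W'")
    case True
    then have "(\<rho> z)\<^sup>2 > 0" using \<rho>0 W'P by auto
    moreover have "2 * (norm (tt z))\<^sup>2 - (\<rho> z)\<^sup>2 > 0" using that by (simp add: V_def)
    ultimately have "q z \<ge> 1/2" unfolding q_def by (simp add: pos_le_divide_eq)
    then show ?thesis by (simp add: \<eta>'_def \<phi>(3))
  qed (simp add: \<eta>'_def)
  have \<eta>': "ambient_form M' \<eta>'"
    unfolding M'_cover
  proof (rule ambient_form_Un[OF open_W' V])
    show "ambient_form W' \<eta>'"
      by (rule ambient_form_cong[OF open_W' _ ambient_form_fmult[OF open_W' \<phi>q \<eta>(1)]]) (simp add: \<eta>'_def)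
    show "ambient_form V \<eta>'"
      by (rule ambient_form_cong[OF V _ ambient_form_zero[OF V]]) (simp add: V0)
  qed
  \<comment> \<open>A neighbourhood of \<open>N\<close> on which \<open>q < 1/4\<close> and the
    cutoff is \<open>1\<close>; together with \<open>M'\<close> it covers \<open>M\<close>.\<close>
  define Y where "Y = W \<inter> (torus \<inter> (\<lambda>z. (\<rho> z)\<^sup>2 - 4 * (norm (tt z))\<^sup>2) -` {0<..})"
  have Y: "open Y"
    unfolding Y_def
    by (intro open_Int open_W continuous_open_preimage[OF _ open_torus open_greaterThan]
        continuous_on_diff continuous_on_mult continuous_on_const continuous_on_power continuous_on_norm
        smooth_on_imp_continuous_on smooth_\<rho> smooth_tt)
  have YW': "open (Y \<inter> W')" by (rule open_Int[OF Y open_W'])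
  have Y1: "\<eta>' z vs = \<eta> z vs" if "z \<in> Y \<inter> W'" for z vs
  proof -
    have "(\<rho> z)\<^sup>2 > 0" using \<rho>0 W'P that by auto
    moreover have "(\<rho> z)\<^sup>2 - 4 * (norm (tt z))\<^sup>2 > 0" using that by (simp add: Y_def)
    ultimately have "q z \<le> 1/4" unfolding q_def by (simp add: pos_divide_le_eq)
    then show ?thesis using that by (simp add: \<eta>'_def \<phi>(2))
  qed
  \<comment> \<open>On \<open>Y \<inter> W'\<close> this difference equals \<open>\<alpha>\<close>,
    which is closed across the hypersurface, so \<open>\<omega>2\<close> glues the two to a closed
    form on \<open>M\<close>.\<close>
  define \<omega>1 where "\<omega>1 p vs = \<omega> p vs + (-1) * (wdg (?\<psi> p) (a p) vs + ambient_deriv \<eta>' p vs)" for p vs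
  have M'M: "M' \<subseteq> M" using M'_iff by auto
  note aM' = closed_on_subset[OF a(1) M'M]
  have \<omega>1: "closed_on M' \<omega>1"
    unfolding \<omega>1_def[abs_def]
    by (intro closed_on_add closed_on_cmult open_M' \<omega> closed_on_wdg \<psi>M' aM' closed_on_deriv \<eta>')
  have \<omega>1Y: "\<omega>1 p vs = \<alpha> p vs" if p: "p \<in> Y \<inter> W'" for p vs
  proof -
    have "ambient_deriv \<eta>' p vs = ambient_deriv \<eta> p vs"
      by (rule ambient_deriv_cong[OF YW' p Y1])
    then show ?thesis using \<eta>(2)[of p vs] p by (simp add: \<omega>1_def)
  qed
  define \<omega>2 where "\<omega>2 p vs = (if p \<in> M' then \<omega>1 p vs else \<alpha> p vs)" for p vs
  have Y_M': "Y \<inter> M' \<subseteq> W'" using M'_iff by (auto simp: Y_def W_def W'_def)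
  have M_cover: "M = M' \<union> Y"
  proof
    show "M \<subseteq> M' \<union> Y"
    proof
      fix z assume z: "z \<in> M"
      show "z \<in> M' \<union> Y"
      proof (cases "tt z = 0")
        case True
        have zT: "z \<in> torus" using z M_torus by blast
        then have "z \<in> P" using z pr_fix[OF zT True] by (simp add: P_def)
        then have "\<rho> z > 0" using \<rho>_pos_iff[OF zT] by simp
        then show ?thesis using True zT by (simp add: Y_def W_def)
      qed (use z M'_iff in simp)
    qed
    show "M' \<union> Y \<subseteq> M" using M'M W_M by (auto simp: Y_def)
  qed
  have \<omega>2: "closed_on M \<omega>2"
    unfolding M_cover
  proof (rule closed_on_Un[OF open_M' Y])
    show "closed_on M' \<omega>2"
      by (rule closed_on_cong[OF open_M' _ \<omega>1]) (simp add: \<omega>2_def)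
    have "Y \<subseteq> P" using W_P by (auto simp: Y_def)
    from closed_on_subset[OF \<alpha> this] show "closed_on Y \<omega>2"
      by (rule closed_on_cong[OF Y, rotated]) (use \<omega>1Y Y_M' in \<open>auto simp: \<omega>2_def\<close>)
  qed
  obtain \<rho>2 where \<rho>2: "\<rho>2 \<in> log_forms \<A>" "cohomologous M \<omega>2 \<rho>2"
    using IH \<omega>2 unfolding logarithmic_cohomology_def M_def[symmetric] by blast
  obtain \<rho>1 where \<rho>1: "\<rho>1 \<in> log_forms \<A>" "cohomologous M a \<rho>1"
    using IH a(1) unfolding logarithmic_cohomology_def M_def[symmetric] by blast
  have "cohomologous M' \<omega> (\<lambda>p vs. wdg (?\<psi> p) (a p) vs + \<omega>2 p vs)"
    by (rule cohomologousI[OF \<eta>']) (simp add: \<omega>2_def \<omega>1_def)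
  then have coh: "cohomologous M' \<omega> (\<lambda>p vs. wdg (?\<psi> p) (\<rho>1 p) vs + \<rho>2 p vs)"
    by (rule cohomologous_trans[OF open_M' _ cohomologous_add[OF open_M'
        cohomologous_wdg[OF open_M' \<psi>M' cohomologous_subset[OF \<rho>1(2) M'M]]
        cohomologous_subset[OF \<rho>2(2) M'M]]])
  have "log_forms \<A> \<subseteq> log_forms (insert (n, c) \<A>)" by (rule log_forms_mono) blast
  then have r: "\<rho>1 \<in> log_forms (insert (n, c) \<A>)" "\<rho>2 \<in> log_forms (insert (n, c) \<A>)" using \<rho>1(1) \<rho>2(1) by blast+
  have "?\<psi> \<in> log_forms (insert (n, c) \<A>)"
    unfolding log_forms_def by (rule form_span_algebra.smult, rule form_span_algebra.gen) simp
  then have "(\<lambda>p vs. wdg (?\<psi> p) (\<rho>1 p) vs + \<rho>2 p vs) \<in> log_forms (insert (n, c) \<A>)"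
    using r unfolding log_forms_def by (intro form_span_algebra.add form_span_algebra.mult)
  with coh show "\<exists>\<rho>\<in>log_forms (insert (n, c) \<A>). cohomologous M' \<omega> \<rho>" by blast
qed

end

theorem logarithmic_cohomology_deletion_restriction:
  fixes \<A> :: "((int^'l) \<times> complex) set"
  assumes "toric_arrangement \<A>" "deletion_restriction_type \<A>"
  shows "logarithmic_cohomology \<A>"
proof -
  obtain Ks where Ks: "distinct Ks" "set Ks = \<A>"
    and surj: "\<And>i. i < length Ks \<Longrightarrow>
      inclusion_pullback (complement (set (take i Ks)) \<inter> hypersurface (Ks ! i)) `
        carrier (deRham_cohomology (complement (set (take i Ks))))
      = carrier (deRham_cohomology (complement (set (take i Ks)) \<inter> hypersurface (Ks ! i)))"
    using assms(2) unfolding deletion_restriction_type_def Let_def by blast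
  have "logarithmic_cohomology (set (take i Ks))" if "i \<le> length Ks" for i
    using that
  proof (induction i)
    case 0
    show ?case using logarithmic_cohomology_torus by simp
  next
    case (Suc i)
    then have i: "i < length Ks" by simp
    obtain n c where K: "Ks ! i = (n, c)" by (cases "Ks ! i")
    have "(n, c) \<in> \<A>" using i K Ks(2) nth_mem by metis
    then have nc: "primitive n" "c \<noteq> 0" using assms(1) unfolding toric_arrangement_def by auto
    \<comment> \<open>Primitivity supplies the one-parameter subgroup transversal to the
      hypersurface.\<close>
    obtain m where m: "pairing n m = 1" using primitive_dual[OF nc(1)] .
    interpret deletion "set (take i Ks)" n m c
      by standard (use m nc(2) in simp_all)
    have "logarithmic_cohomology (insert (n, c) (set (take i Ks)))"
    proof (rule logarithmic_cohomology_insert)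
      show "inclusion_pullback N ` carrier (deRham_cohomology M) = carrier (deRham_cohomology N)"
        unfolding N_def M_def using surj[OF i] unfolding K .
      show "logarithmic_cohomology (set (take i Ks))" using Suc by simp
    qed
    then show ?case using i K by (simp add: take_Suc_conv_app_nth)
  qed
  from this[of "length Ks"] show ?thesis using Ks(2) by simp
qed

section \<open>Injectivity: exact logarithmic forms vanish\<close>

section \<open>Relations between logarithmic forms\<close>

lemma wdg_one_form_commute:
  "wdg (one_form L p) b vs = wdg (\<lambda>us. (-1) ^ length us * b us) (one_form L p) vs"
proof (induction vs arbitrary: b)
  case (Cons v vs)
  have 1: "(\<lambda>us. (-1) ^ length (v # us) * b (v # us)) = (\<lambda>us. - ((-1) ^ length us * b (v # us)))" by simp
  have 2: "(\<lambda>us. one_form L p (v # us)) = const0 (L p v)" by (auto simp: one_form_def const0_def)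
  show ?case
    unfolding wdg_one_form_Cons wdg.simps(2)[of "\<lambda>us. (-1) ^ length us * b us"] 1 2 wdg_const_right sign_sign
      wdg_minus_left Cons.IH by simp
qed simp

lemma wdg_one_one:
  "wdg (one_form L p) (one_form M p) vs
    = (if length vs = 2 then L p (vs ! 0) * M p (vs ! 1) - L p (vs ! 1) * M p (vs ! 0) else 0)"
proof -
  consider "vs = []" | v where "vs = [v]" | v w where "vs = [v, w]" | v w u us where "vs = v # w # u # us"
    by (metis list.exhaust)
  then show ?thesis
    by cases (auto simp: wdg_one_form_Cons one_form_def wdg_zero_right simp del: wdg.simps(2))
qed

text \<open>Arnold's relation, solved for the product. It is used for \<open>F\<close> and
  \<open>G\<close> linear in one coordinate with the same leading term, where \<open>F - G\<close>
  is free of that coordinate.\<close>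

lemma log_deriv_relation:
  fixes F G :: "'a::euclidean_space \<Rightarrow> complex"
  assumes "F differentiable at p" "G differentiable at p" "F p \<noteq> 0" "G p \<noteq> 0" "F p \<noteq> G p"
  shows "wdg (log_deriv F p) (log_deriv G p) vs
    = wdg (log_deriv (\<lambda>z. F z - G z) p) (\<lambda>us. log_deriv G p us - log_deriv F p us) vs"
proof -
  have D: "frechet_derivative (\<lambda>z. F z - G z) (at p) v = frechet_derivative F (at p) v - frechet_derivative G (at p) v" for v
    using assms(1,2) unfolding frechet_derivative_works
    by (subst frechet_derivative_eqI[OF has_derivative_diff]) auto
  \<comment> \<open>The relation evaluated on two vectors, as a rational identity in values and
    derivatives.\<close>
  have alg: "f1 / x * (g2 / y) - f2 / x * (g1 / y)
      = (f1 - g1) / (x - y) * (g2 / y - f2 / x) - (f2 - g2) / (x - y) * (g1 / y - f1 / x)"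
    if "x \<noteq> 0" "y \<noteq> 0" "x \<noteq> y" for x y f1 f2 g1 g2 :: complex
  proof -
    have "x - y \<noteq> 0" using that by simp
    then have "(f1 - g1) / (x - y) * (g2 / y - f2 / x) - (f2 - g2) / (x - y) * (g1 / y - f1 / x)
       = ((f1 - g1) * (g2 * x - f2 * y) - (f2 - g2) * (g1 * x - f1 * y)) / ((x - y) * (x * y))"
    proof -
      have "g2 / y - f2 / x = (g2 * x - f2 * y) / (x * y)" "g1 / y - f1 / x = (g1 * x - f1 * y) / (x * y)"
        using that by (simp_all only: diff_frac_eq[OF that(2,1)] mult.commute[of y x])
      then show ?thesis by (simp only: times_divide_times_eq diff_divide_distrib[symmetric])
    qed
    also have "(f1 - g1) * (g2 * x - f2 * y) - (f2 - g2) * (g1 * x - f1 * y) = (x - y) * (f1 * g2 - f2 * g1)"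
      by (simp add: algebra_simps)
    also have "(x - y) * (f1 * g2 - f2 * g1) / ((x - y) * (x * y)) = (f1 * g2 - f2 * g1) / (x * y)"
      using \<open>x - y \<noteq> 0\<close> by (rule nonzero_mult_divide_mult_cancel_left)
    also have "\<dots> = f1 / x * (g2 / y) - f2 / x * (g1 / y)" by (simp add: diff_divide_distrib)
    finally show ?thesis by simp
  qed
  have diff: "(\<lambda>us. log_deriv G p us - log_deriv F p us)
     = one_form (\<lambda>p v. frechet_derivative G (at p) v / G p - frechet_derivative F (at p) v / F p) p"
    by (rule ext) (simp add: log_deriv_def one_form_def)
  show ?thesis
    unfolding diff unfolding log_deriv_def wdg_one_one D using alg[OF assms(3-5)] by simp
qed

lemma log_deriv_cong:
  assumes "open U" "p \<in> U" "\<And>q. q \<in> U \<Longrightarrow> f q = g q"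
  shows "log_deriv f p vs = log_deriv g p vs"
  using frechet_cong[OF assms] assms(3)[OF assms(2)] by (simp add: log_deriv_def one_form_def)

lemma log_deriv_mult:
  fixes f g :: "'a::euclidean_space \<Rightarrow> complex"
  assumes "f differentiable at p" "g differentiable at p" "f p \<noteq> 0" "g p \<noteq> 0"
  shows "log_deriv (\<lambda>z. f z * g z) p vs = log_deriv f p vs + log_deriv g p vs"
proof -
  have "frechet_derivative (\<lambda>z. f z * g z) (at p) v
      = f p * frechet_derivative g (at p) v + frechet_derivative f (at p) v * g p" for v
    using assms(1,2) unfolding frechet_derivative_works
    by (subst frechet_derivative_eqI[OF has_derivative_mult]) auto
  then show ?thesis
    using assms(3,4) by (simp add: log_deriv_def one_form_def field_simps)
qed

lemma log_deriv_const: "log_deriv (\<lambda>z. c) p vs = 0"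
  by (simp add: log_deriv_def one_form_def)

lemma log_deriv_prod:
  fixes f :: "'i \<Rightarrow> 'a::euclidean_space \<Rightarrow> complex"
  assumes "finite I" "open U" "p \<in> U" "\<And>i. i \<in> I \<Longrightarrow> smooth_on U (f i)" "\<And>i. i \<in> I \<Longrightarrow> f i p \<noteq> 0"
  shows "log_deriv (\<lambda>z. \<Prod>i\<in>I. f i z) p vs = (\<Sum>i\<in>I. log_deriv (f i) p vs)"
  using assms(1,4,5)
proof induction
  case empty
  show ?case by (simp add: log_deriv_const)
next
  case (insert i I)
  have "log_deriv (\<lambda>z. f i z * (\<Prod>i\<in>I. f i z)) p vs = log_deriv (f i) p vs + log_deriv (\<lambda>z. \<Prod>i\<in>I. f i z) p vs"
  proof (rule log_deriv_mult)
    show "f i differentiable at p"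
      by (rule smooth_on_imp_differentiable[OF insert.prems(1) assms(3)]) simp
    show "(\<lambda>z. \<Prod>i\<in>I. f i z) differentiable at p"
      by (rule smooth_on_imp_differentiable[OF smooth_on_prod[OF assms(2)] assms(3)]) (use insert.prems in simp)
  qed (use insert in auto)
  then show ?case using insert by simp
qed

lemma log_deriv_power_int:
  fixes f :: "'a::euclidean_space \<Rightarrow> complex"
  assumes "f differentiable at p" "f p \<noteq> 0"
  shows "log_deriv (\<lambda>z. f z powi k) p vs = of_int k * log_deriv f p vs"
proof -
  have d: "(f has_derivative frechet_derivative f (at p)) (at p)" using assms(1) by (simp add: frechet_derivative_works)
  have "((\<lambda>x. x powi k) has_field_derivative (of_int k * f p powi (k - 1) * 1)) (at (f p))"
    by (rule DERIV_power_int[OF DERIV_ident]) (use assms(2) in simp)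
  from has_derivative_compose[OF d this[unfolded has_field_derivative_def]]
  have "frechet_derivative (\<lambda>z. f z powi k) (at p) v = of_int k * f p powi (k - 1) * frechet_derivative f (at p) v" for v
    by (simp add: frechet_derivative_eqI)
  moreover have "f p powi (k - 1) = f p powi k / f p" using assms(2) by (simp add: power_int_diff)
  ultimately show ?thesis using assms(2) by (simp add: log_deriv_def one_form_def)
qed

lemma log_deriv_character:
  assumes "p \<in> torus"
  shows "log_deriv (character n) p vs = (\<Sum>i\<in>UNIV. of_int (n $ i) * xi0 i p vs)"
proof -
  have nz: "p $ i \<noteq> 0" for i using assms by (simp add: torus_def)
  have "log_deriv (character n) p vs = log_deriv (\<lambda>z. \<Prod>i\<in>UNIV. z $ i powi n $ i) p vs"
    by (simp add: character_def[abs_def])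
  also have "\<dots> = (\<Sum>i\<in>UNIV. log_deriv (\<lambda>z. z $ i powi n $ i) p vs)"
    by (rule log_deriv_prod[OF _ open_torus assms smooth_on_powi[OF open_torus smooth_on_coord[OF open_torus]]])
      (use nz in \<open>auto simp: torus_def\<close>)
  also have "\<dots> = (\<Sum>i\<in>UNIV. of_int (n $ i) * xi0 i p vs)"
    unfolding xi0_def
    by (intro sum.cong refl log_deriv_power_int smooth_on_imp_differentiable[OF smooth_on_coord[OF open_torus] assms] nz)
  finally show ?thesis .
qed

lemma frechet_coord: "frechet_derivative (\<lambda>z::complex^'l. z $ i) (at p) v = v $ i"
  by (simp add: frechet_derivative_eqI[OF bounded_linear.has_derivative[OF bounded_linear_vec_nth has_derivative_ident]])

lemma xi0_eq: "xi0 i = one_form (\<lambda>p v. v $ i / p $ i)"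
  by (simp add: xi0_def log_deriv_def frechet_coord)

lemma frechet_character:
  assumes "p \<in> torus"
  shows "frechet_derivative (character n) (at p) v = character n p * (\<Sum>i\<in>UNIV. of_int (n $ i) * (v $ i / p $ i))"
  using log_deriv_character[OF assms, of n "[v]"] character_nonzero[OF assms, of n]
  by (simp add: log_deriv_def one_form_def xi0_eq field_simps)

lemma psi0_eq:
  assumes "p \<in> torus"
  shows "psi0 K p vs = one_form (\<lambda>p v. character (fst K) p * (\<Sum>i\<in>UNIV. of_int (fst K $ i) * (v $ i / p $ i))
      / (character (fst K) p - snd K)) p vs"
proof -
  have "frechet_derivative (\<lambda>z. character (fst K) z - snd K) (at p) v = frechet_derivative (character (fst K)) (at p) v" for v
    using frechet_derivative_eqI[OF has_derivative_diff[OF smooth_on_has_derivative[OF smooth_on_character assms] has_derivative_const]]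
    by simp
  then show ?thesis by (simp add: psi0_def log_deriv_def one_form_def frechet_character[OF assms])
qed

lemma pullback_log_deriv:
  fixes f :: "'a::euclidean_space \<Rightarrow> 'b::euclidean_space" and g :: "'b \<Rightarrow> complex"
  assumes "f differentiable at p" "g differentiable at (f p)"
  shows "pullback f (log_deriv g) p vs = log_deriv (\<lambda>z. g (f z)) p vs"
proof -
  have "frechet_derivative (\<lambda>x. g (f x)) (at p) = (\<lambda>v. frechet_derivative g (at (f p)) (frechet_derivative f (at p) v))"
    using assms unfolding frechet_derivative_works
    by (intro frechet_derivative_eqI has_derivative_compose[of f _ p UNIV g])
  then show ?thesis
    by (cases vs) (simp_all add: pullback_def log_deriv_def one_form_def)
qed

text \<open>For \<open>w = 1\<close> both sides are monic of degree \<open>n\<close> in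
  \<open>x\<close> and vanish at the \<open>n\<close> roots of unity; the general case follows by
  homogenising with \<open>w\<close>.\<close>

lemma prod_minus_roots_unity:
  assumes "n > 0"
  shows "(\<Prod>\<zeta>\<in>{\<zeta>::complex. \<zeta> ^ n = 1}. x - \<zeta> * w) = x ^ n - w ^ n"
proof -
  let ?A = "{\<zeta>::complex. \<zeta> ^ n = 1}"
  have fin: "finite ?A" and card: "card ?A = n"
    using finite_roots_unity[of n] card_roots_unity_eq[OF assms] assms by auto
  let ?p = "\<Prod>\<zeta>\<in>?A. [:-\<zeta>, 1:]"
  have deg: "degree ?p = n"
    using card by (subst degree_prod_eq_sum_degree) (auto simp: card)
  have lc: "lead_coeff ?p = 1" by (simp add: lead_coeff_prod)
  have "?p = monom 1 n - 1"
  proof (rule poly_eqI_degree_lead_coeff[of _ n _ ?A])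
    show "poly.coeff ?p n = poly.coeff (monom 1 n - 1) n"
      using lc assms unfolding deg by (simp add: coeff_pCons split: nat.splits)
    show "degree (monom 1 n - 1 :: complex poly) \<le> n"
      by (rule degree_diff_le) (simp_all add: degree_monom_le)
    show "poly ?p z = poly (monom 1 n - 1) z" if "z \<in> ?A" for z
    proof -
      have "poly ?p z = 0" using that fin by (auto simp: poly_prod prod_zero_iff)
      then show ?thesis using that by (simp add: poly_monom)
    qed
  qed (use card deg in auto)
  then have "poly ?p y = poly (monom 1 n - 1) y" for y by simp
  then have 1: "(\<Prod>\<zeta>\<in>?A. y - \<zeta>) = y ^ n - 1" for y by (simp add: poly_prod poly_monom)
  show ?thesis
  proof (cases "w = 0")
    case True
    then show ?thesis using assms card by (simp add: power_0_left)
  next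
    case False
    have "(\<Prod>\<zeta>\<in>?A. x - \<zeta> * w) = (\<Prod>\<zeta>\<in>?A. w * (x / w - \<zeta>))"
      using False by (intro prod.cong) (auto simp: field_simps)
    also have "\<dots> = w ^ n * ((x / w) ^ n - 1)" using 1 card by (simp add: prod.distrib)
    also have "\<dots> = x ^ n - w ^ n" using False by (simp add: power_divide field_simps)
    finally show ?thesis .
  qed
qed

text \<open>A point on the new hypersurface is moved by scaling a coordinate of nonzero exponent by
  a real \<open>s > 1\<close> close to \<open>1\<close>; this multiplies the character by a power of
  \<open>s\<close> different from \<open>1\<close>.\<close>

lemma complement_dense:
  fixes \<A> :: "((int^'l) \<times> complex) set"
  assumes "finite \<A>" "\<And>K. K \<in> \<A> \<Longrightarrow> fst K \<noteq> 0" "open U" "U \<inter> torus \<noteq> {}"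
  shows "U \<inter> complement \<A> \<noteq> {}"
  using assms(1,2)
proof induction
  case empty
  show ?case using assms(4) by (simp add: complement_def)
next
  case (insert K \<A>)
  obtain n c where K: "K = (n, c)" by (cases K)
  have "n \<noteq> 0" using insert.prems[of K] K by simp
  then obtain i where i: "n $ i \<noteq> 0" by (auto simp: vec_eq_iff)
  obtain z where z: "z \<in> U" "z \<in> complement \<A>" using insert by auto
  have zT: "z \<in> torus" using z(2) complement_subset by blast
  define e :: "int^'l" where "e = (\<chi> k. if k = i then 1 else 0)"
  have pair: "pairing n e = n $ i"
    by (simp add: pairing_def e_def if_distrib cong: if_cong)
  define g where "g s = act e (of_real s) z" for s :: real
  have g1: "g 1 = z" by (simp add: g_def)
  have chg: "character n (g s) = of_real (s powi (n $ i)) * character n z" if "s > 0" for s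
    using that character_act[of "of_real s" n e z] by (simp add: g_def pair)
  show ?case
  proof (cases "character n z = c")
    case False
    then show ?thesis using z K by (auto simp: complement_iff)
  next
    case True
    have op: "open (U \<inter> complement \<A>)" by (intro open_Int assms(3) open_complement insert.hyps)
    have gdef: "g = (\<lambda>s. \<chi> k. (if k = i then complex_of_real s else 1) * z $ k)"
      by (auto simp: g_def act_def e_def vec_eq_iff fun_eq_iff)
    have "continuous_on UNIV g"
      unfolding gdef
    proof (intro continuous_on_vec_lambda continuous_on_mult continuous_on_const)
      show "continuous_on UNIV (\<lambda>s::real. if k = i then complex_of_real s else 1)" for k
        by (cases "k = i") (simp_all add: continuous_on_of_real continuous_on_id)
    qed
    then have "open (g -` (U \<inter> complement \<A>))" using op by (rule open_vimage[rotated])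
    moreover have "1 \<in> g -` (U \<inter> complement \<A>)" using g1 z by simp
    ultimately obtain r where r: "r > 0" "ball 1 r \<subseteq> g -` (U \<inter> complement \<A>)" using openE by blast
    define s where "s = 1 + r / 2"
    have s: "s > 1" "s \<in> ball 1 r" using r(1) by (simp_all add: s_def dist_real_def)
    have "s powi (n $ i) \<noteq> 1"
    proof
      assume "s powi (n $ i) = 1"
      then have "s ^ nat \<bar>n $ i\<bar> = 1"
        by (cases "n $ i \<ge> 0") (simp_all add: power_int_def power_inverse)
      moreover have "s ^ nat \<bar>n $ i\<bar> > 1" using s(1) i by (intro one_less_power) auto
      ultimately show False by simp
    qed
    then have "character n (g s) \<noteq> c"
      using chg[of s] s(1) character_nonzero[OF zT, of n] True by (simp del: of_real_power_int)
    moreover have "g s \<in> U \<inter> complement \<A>" using r(2) s(2) by blast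
    ultimately have "g s \<in> U \<inter> complement (insert K \<A>)" using K by (auto simp: complement_iff)
    then show ?thesis by blast
  qed
qed

section \<open>Elimination of a coordinate\<close>

lemma form_span_algebra_sum:
  assumes "finite I" "\<And>i. i \<in> I \<Longrightarrow> x i \<in> form_span_algebra G"
  shows "(\<lambda>p vs. \<Sum>i\<in>I. x i p vs) \<in> form_span_algebra G"
  using assms
proof induction
  case empty
  have "(\<lambda>p vs. 0 * const0 1 vs) \<in> form_span_algebra G"
    by (rule form_span_algebra.smult, rule form_span_algebra.one)
  then show ?case by simp
next
  case (insert i I)
  have "(\<lambda>p vs. x i p vs + (\<Sum>i\<in>I. x i p vs)) \<in> form_span_algebra G"
    using insert by (intro form_span_algebra.add) auto
  then show ?case using insert by simp
qed

text \<open>The degree involution is multiplicative and only changes the sign of the generators,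
  which are one-forms.\<close>

lemma form_span_algebra_sign:
  fixes G :: "'a form set"
  assumes G: "\<And>g. g \<in> G \<Longrightarrow> \<exists>L. g = one_form L" and x: "x \<in> form_span_algebra G"
  shows "(\<lambda>p vs. (-1) ^ length vs * x p vs) \<in> form_span_algebra G"
  using x
proof induction
  case one
  have "(\<lambda>(p::'a) (vs::'a list). (-1) ^ length vs * const0 1 vs) = (\<lambda>p. const0 1)" by (auto simp: const0_def fun_eq_iff)
  then show ?case using form_span_algebra.one by simp
next
  case (gen g)
  then obtain L where L: "g = one_form L" using G by blast
  have "(\<lambda>p vs. (-1) ^ length vs * g p vs) = (\<lambda>p vs. (-1) * g p vs)"
    by (auto simp: L one_form_def fun_eq_iff)
  then show ?case using form_span_algebra.smult[OF form_span_algebra.gen[OF gen], of "-1"] by simp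
next
  case (add x y)
  show ?case using form_span_algebra.add[OF add.IH] by (simp add: algebra_simps)
next
  case (mult x y)
  have "(\<lambda>p vs. (-1) ^ length vs * wdg (x p) (y p) vs)
      = (\<lambda>p. wdg (\<lambda>us. (-1) ^ length us * x p us) (\<lambda>us. (-1) ^ length us * y p us))"
    by (simp add: fun_eq_iff wdg_sign)
  then show ?case using form_span_algebra.mult[OF mult.IH] by simp
next
  case (smult x c)
  show ?case using form_span_algebra.smult[OF smult.IH, of c] by (simp add: mult.left_commute)
qed

text \<open>Relational naturality: it compares wedge products at two points on two lists of vectors,
  as is required for forms that ignore some coordinates.\<close>

lemma wdg_rel:
  assumes "list_all2 R vs vs'" "\<And>us us'. list_all2 R us us' \<Longrightarrow> a us = a' us' \<and> b us = b' us'"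
  shows "wdg a b vs = wdg a' b' vs'"
  using assms
proof (induction arbitrary: a a' b b' rule: list_all2_induct)
  case Nil
  show ?case using Nil[of "[]" "[]"] by simp
next
  case (Cons v vs v' vs')
  have 1: "wdg (\<lambda>us. a (v # us)) b vs = wdg (\<lambda>us. a' (v' # us)) b' vs'"
    by (rule Cons.IH) (use Cons.prems Cons.hyps(1) in simp)
  have 2: "wdg (\<lambda>us. (-1) ^ length us * a us) (\<lambda>us. b (v # us)) vs
      = wdg (\<lambda>us. (-1) ^ length us * a' us) (\<lambda>us. b' (v' # us)) vs'"
    by (rule Cons.IH) (use Cons.prems Cons.hyps(1) in \<open>auto dest: list_all2_lengthD\<close>)
  show ?case using 1 2 by simp
qed

lemma one_form_rel:
  assumes "list_all2 R vs vs'" "\<And>v v'. R v v' \<Longrightarrow> M p v = N p' v'"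
  shows "one_form M p vs = one_form N p' vs'"
  using assms by (cases vs; cases vs') (auto simp: one_form_def dest: list_all2_lengthD)

text \<open>The integral of d log of \<open>c + \<delta> cis x\<close>. If
  \<open>norm c > \<delta>\<close>, then \<open>1 + \<delta> cis x / c\<close> stays in the right
  half plane, where the principal logarithm gives a periodic primitive.\<close>

lemma integral_log_circle:
  fixes c :: complex and \<delta> :: real
  assumes "\<delta> > 0" "c = 0 \<or> norm c > \<delta>"
  shows "integral {0..2*pi} (\<lambda>x. \<i> * of_real \<delta> * cis x / (c + of_real \<delta> * cis x)) = (if c = 0 then 2 * pi * \<i> else 0)"
proof (cases "c = 0")
  case True
  then show ?thesis using assms(1) by (simp add: cis_neq_zero scaleR_conv_of_real)
next
  case False
  then have c: "norm c > \<delta>" using assms(2) by simp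
  define h where "h x = 1 + of_real \<delta> * cis x / c" for x
  have pos: "h x \<notin> \<real>\<^sub>\<le>\<^sub>0" for x
  proof -
    have "norm (of_real \<delta> * cis x / c) < 1" using c assms(1) by (simp add: norm_divide norm_mult divide_less_eq_1)
    then have "\<bar>Re (of_real \<delta> * cis x / c)\<bar> < 1" using abs_Re_le_cmod order_le_less_trans by blast
    then have "Re (h x) > 0" by (simp add: h_def)
    then show ?thesis by (auto simp: complex_nonpos_Reals_iff)
  qed
  have "((\<lambda>x. \<i> * of_real \<delta> * cis x / (c + of_real \<delta> * cis x)) has_integral (Ln (h (2*pi)) - Ln (h 0))) {0..2*pi}"
  proof (rule fundamental_theorem_of_calculus)
    fix x :: real
    have "(cis has_vector_derivative (\<i> * cis x)) (at x)"
      using has_derivative_cis[OF has_derivative_ident, of x UNIV]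
      by (simp add: has_vector_derivative_def scaleR_conv_of_real mult.assoc mult.left_commute)
    then have hd: "(h has_vector_derivative (of_real \<delta> * (\<i> * cis x) / c)) (at x)"
      unfolding h_def[abs_def]
      using has_vector_derivative_const[of 1 "at x"] has_vector_derivative_divide[OF has_vector_derivative_mult_right]
      by (auto intro!: derivative_eq_intros simp: False)
    have "(Ln has_field_derivative inverse (h x)) (at (h x))" by (rule has_field_derivative_Ln[OF pos])
    from field_vector_diff_chain_at[OF hd this]
    have "((\<lambda>x. Ln (h x)) has_vector_derivative (of_real \<delta> * (\<i> * cis x) / c * inverse (h x))) (at x)"
      by (simp add: comp_def)
    moreover have "of_real \<delta> * (\<i> * cis x) / c * inverse (h x) = \<i> * of_real \<delta> * cis x / (c + of_real \<delta> * cis x)"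
    proof -
      have "c * h x = c + of_real \<delta> * cis x" using False by (simp add: h_def field_simps)
      then show ?thesis by (simp add: divide_inverse[symmetric] divide_divide_eq_left mult.assoc mult.commute[of c] mult.left_commute)
    qed
    ultimately show "((\<lambda>x. Ln (h x)) has_vector_derivative \<i> * of_real \<delta> * cis x / (c + of_real \<delta> * cis x)) (at x within {0..2*pi})"
      by (simp add: has_vector_derivative_at_within)
  qed simp
  moreover have "h (2*pi) = h 0" by (simp add: h_def)
  ultimately show ?thesis using False by (simp add: integral_unique)
qed

lemma frechet_slice:
  fixes h :: "real \<times> 'a::euclidean_space \<Rightarrow> 'b::euclidean_space"
  assumes "h differentiable at (x, z)" "((\<lambda>x. h (x, z)) has_vector_derivative d) (at x)"
  shows "frechet_derivative h (at (x, z)) (1, 0) = d"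
proof -
  have "((\<lambda>x. h (x, z)) has_derivative (\<lambda>t. frechet_derivative h (at (x, z)) (t, 0))) (at x)"
    by (rule has_derivative_compose[of "\<lambda>x. (x, z)" _ x UNIV h, OF has_derivative_Pair[OF has_derivative_ident has_derivative_const]])
      (use assms(1) in \<open>simp add: frechet_derivative_works\<close>)
  from has_derivative_unique[OF this assms(2)[unfolded has_vector_derivative_def]]
  show ?thesis by (metis scaleR_one)
qed

text \<open>A pair \<open>(\<alpha>, q)\<close> encodes the monomial \<open>\<alpha> \<chi>\<^sub>q\<close> in the coordinates \<open>L\<close>, which is a possible value of the
  coordinate \<open>j\<close> to be avoided. The equations in \<open>E_diff\<close> keep these monomials distinct, because
  \<open>\<alpha> \<chi>\<^sub>q - \<beta> \<chi>\<^sub>q\<^sub>' = \<alpha> \<chi>\<^sub>q\<^sub>' (\<chi>\<^sub>q\<^sub>-\<^sub>q\<^sub>' - \<beta> / \<alpha>)\<close>.\<close>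

locale elimination =
  fixes j :: "'l::finite" and L :: "'l set" and roots :: "(complex \<times> (int^'l)) set"
    and E :: "((int^'l) \<times> complex) set"
  assumes j_notin: "j \<notin> L"
    and finite_roots: "finite roots" and zero_root: "(0, 0) \<in> roots"
    and roots_support: "(\<alpha>, q) \<in> roots \<Longrightarrow> i \<notin> L \<Longrightarrow> q $ i = 0"
    and roots_zero: "(0, q) \<in> roots \<Longrightarrow> q = 0"
    and finite_E: "finite E" and E_support: "(n, c) \<in> E \<Longrightarrow> i \<notin> L \<Longrightarrow> n $ i = 0"
    and E_diff: "(\<alpha>, q) \<in> roots \<Longrightarrow> (\<beta>, q') \<in> roots \<Longrightarrow> \<alpha> \<noteq> 0 \<Longrightarrow> \<beta> \<noteq> 0 \<Longrightarrow> q \<noteq> q' \<Longrightarrow> (q - q', \<beta> / \<alpha>) \<in> E"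
begin

definition root :: "complex \<times> (int^'l) \<Rightarrow> complex^'l \<Rightarrow> complex" where
  "root a z = fst a * character (snd a) z"

definition base_forms :: "(complex^'l) form set" where
  "base_forms = form_span_algebra (xi0 ` L \<union> psi0 ` E)"

text \<open>A fibration over \<open>complement E\<close> whose fibres are planes without the roots.
  The base stays in the same space: coordinate \<open>j\<close> is a dummy variable there, since
  neither \<open>E\<close> nor the base forms depend on it.\<close>

definition total :: "(complex^'l) set" where
  "total = {z \<in> complement E. \<forall>a\<in>roots. z $ j \<noteq> root a z}"

definition root_form :: "complex \<times> (int^'l) \<Rightarrow> (complex^'l) form" where
  "root_form a = log_deriv (\<lambda>z. z $ j - root a z)"

lemma smooth_root: "smooth_on torus (root a)"
  unfolding root_def[abs_def]
  by (rule smooth_on_mult[OF open_torus smooth_on_const[OF open_torus] smooth_on_character])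

lemma base_torus: "complement E \<subseteq> torus"
  by (rule complement_subset)

lemma open_base: "open (complement E)"
  by (rule open_complement[OF finite_E])

lemma smooth_linear_root: "smooth_on torus (\<lambda>z. z $ j - root a z)"
  by (rule smooth_on_diff[OF open_torus smooth_on_coord[OF open_torus] smooth_root])

lemma open_total: "open total"
proof -
  have "total = complement E \<inter> (\<Inter>a\<in>roots. torus \<inter> (\<lambda>z. z $ j - root a z) -` (- {0}))"
    using base_torus by (auto simp: total_def)
  moreover have "open (torus \<inter> (\<lambda>z. z $ j - root a z) -` (- {0}))" for a
    by (rule continuous_open_preimage[OF smooth_on_imp_continuous_on[OF smooth_linear_root] open_torus]) auto
  ultimately show ?thesis using finite_roots open_base by (metis (no_types, lifting) open_INT open_Int)
qed

lemma generators_one_form: "g \<in> xi0 ` L \<union> psi0 ` E \<Longrightarrow> \<exists>M. g = one_form M"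
  by (auto simp: xi0_def psi0_def log_deriv_def)

lemma base_forms_sign: "B \<in> base_forms \<Longrightarrow> (\<lambda>p vs. (-1) ^ length vs * B p vs) \<in> base_forms"
  unfolding base_forms_def by (rule form_span_algebra_sign[OF generators_one_form])

lemma base_forms_closed: "B \<in> base_forms \<Longrightarrow> closed_on (complement E) B"
  unfolding base_forms_def
proof (rule form_span_algebra_closed[OF open_base])
  fix g assume "g \<in> xi0 ` L \<union> psi0 ` E"
  then consider i where "g = xi0 i" | K where "K \<in> E" "g = psi0 K" by blast
  then show "closed_on (complement E) g"
  proof cases
    case 1
    then show ?thesis using closed_xi0[OF open_base base_torus] by simp
  next
    case 2
    have "character (fst K) z \<noteq> snd K" if "z \<in> complement E" for z
      using that 2(1) by (simp add: complement_iff)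
    then show ?thesis using 2(2) closed_psi0[OF open_base base_torus] by simp
  qed
qed

lemmas base_forms_intros = form_span_algebra.one[where G = "xi0 ` L \<union> psi0 ` E", folded base_forms_def]
  form_span_algebra.gen[where G = "xi0 ` L \<union> psi0 ` E", folded base_forms_def]
  form_span_algebra.add[where G = "xi0 ` L \<union> psi0 ` E", folded base_forms_def]
  form_span_algebra.mult[where G = "xi0 ` L \<union> psi0 ` E", folded base_forms_def]
  form_span_algebra.smult[where G = "xi0 ` L \<union> psi0 ` E", folded base_forms_def]
  form_span_algebra_sum[where G = "xi0 ` L \<union> psi0 ` E", folded base_forms_def]

lemma base_forms_zero: "(\<lambda>p vs. 0) \<in> base_forms"
  using base_forms_intros(6)[of "{}"] by simp

lemma log_deriv_monomial:
  assumes "c \<noteq> 0" "\<And>i. i \<notin> L \<Longrightarrow> m $ i = 0"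
  shows "\<exists>\<rho>\<in>base_forms. \<forall>p\<in>torus. \<forall>vs. log_deriv (\<lambda>z. c * character m z) p vs = \<rho> p vs"
proof (rule bexI[of _ "\<lambda>p vs. \<Sum>i\<in>L. of_int (m $ i) * xi0 i p vs"], intro ballI allI)
  show "(\<lambda>p vs. \<Sum>i\<in>L. of_int (m $ i) * xi0 i p vs) \<in> base_forms"
    by (intro base_forms_intros) auto
  fix p vs assume p: "p \<in> (torus :: (complex^'l) set)"
  have "log_deriv (\<lambda>z. c * character m z) p vs = log_deriv (\<lambda>z. c) p vs + log_deriv (character m) p vs"
    by (rule log_deriv_mult) (use assms(1) p in \<open>auto intro: smooth_on_imp_differentiable[OF smooth_on_character] simp: character_nonzero\<close>)
  also have "\<dots> = (\<Sum>i\<in>UNIV. of_int (m $ i) * xi0 i p vs)" by (simp add: log_deriv_const log_deriv_character[OF p])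
  also have "\<dots> = (\<Sum>i\<in>L. of_int (m $ i) * xi0 i p vs)"
    by (rule sum.mono_neutral_right) (use assms(2) in auto)
  finally show "log_deriv (\<lambda>z. c * character m z) p vs = (\<Sum>i\<in>L. of_int (m $ i) * xi0 i p vs)" .
qed

text \<open>The difference is a monomial when one root is zero or the exponents agree, and otherwise
  a monomial times a factor whose equation lies in \<open>E\<close>. In each case it has no zeros on
  the base and its logarithmic derivative is a base form.\<close>

lemma root_diff:
  assumes a: "a \<in> roots" and b: "b \<in> roots" and ab: "a \<noteq> b"
  shows "\<exists>\<rho>\<in>base_forms. \<forall>p\<in>complement E. (\<forall>vs. log_deriv (\<lambda>z. root a z - root b z) p vs = \<rho> p vs) \<and> root a p \<noteq> root b p"
proof -
  obtain \<alpha> q \<beta> q' where ab': "a = (\<alpha>, q)" "b = (\<beta>, q')" by (cases a, cases b) blast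
  have sq: "q $ i = 0" "q' $ i = 0" if "i \<notin> L" for i using roots_support a b that unfolding ab' by blast+
  have mono: ?thesis
    if c: "c \<noteq> 0" and m: "\<And>i. i \<notin> L \<Longrightarrow> m $ i = 0" and eq: "\<And>z. z \<in> torus \<Longrightarrow> root a z - root b z = c * character m z" for c m
  proof -
    obtain \<rho> where \<rho>: "\<rho> \<in> base_forms" "\<And>p vs. p \<in> torus \<Longrightarrow> log_deriv (\<lambda>z. c * character m z) p vs = \<rho> p vs"
      using log_deriv_monomial[OF c m] by blast
    have "log_deriv (\<lambda>z. root a z - root b z) p vs = \<rho> p vs \<and> root a p \<noteq> root b p" if "p \<in> complement E" for p vs
    proof -
      have p: "p \<in> torus" using that base_torus by blast
      have "root a p - root b p \<noteq> 0" using c eq[OF p] character_nonzero[OF p] by simp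
      moreover have "log_deriv (\<lambda>z. root a z - root b z) p vs = \<rho> p vs"
        unfolding \<rho>(2)[OF p, symmetric]
        by (rule log_deriv_cong[OF open_torus p]) (rule eq)
      ultimately show ?thesis by simp
    qed
    then show ?thesis using \<rho>(1) by blast
  qed
  consider "\<alpha> = 0" | "\<alpha> \<noteq> 0" "\<beta> = 0" | "\<alpha> \<noteq> 0" "\<beta> \<noteq> 0" "q = q'" | "\<alpha> \<noteq> 0" "\<beta> \<noteq> 0" "q \<noteq> q'" by blast
  then show ?thesis
  proof cases
    case 1
    then have "\<beta> \<noteq> 0" using ab a b roots_zero unfolding ab' by blast
    then show ?thesis using 1 by (intro mono[of "- \<beta>" q'] sq) (auto simp: ab' root_def)
  next
    case 2
    then show ?thesis by (intro mono[of \<alpha> q] sq) (auto simp: ab' root_def)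
  next
    case 3
    then show ?thesis using ab by (intro mono[of "\<alpha> - \<beta>" q] sq) (auto simp: ab' root_def algebra_simps)
  next
    case 4
    let ?K = "(q - q', \<beta> / \<alpha>)"
    have K: "?K \<in> E" using E_diff a b 4 unfolding ab' by blast
    have fact: "root a z - root b z = \<alpha> * character q' z * (character (q - q') z - \<beta> / \<alpha>)" if "z \<in> torus" for z
      using 4 that character_add[OF that, of "q - q'" q'] by (simp add: ab' root_def field_simps)
    obtain \<rho> where \<rho>: "\<rho> \<in> base_forms" "\<And>p vs. p \<in> torus \<Longrightarrow> log_deriv (\<lambda>z. \<alpha> * character q' z) p vs = \<rho> p vs"
      using log_deriv_monomial[of \<alpha> q'] 4 sq by blast
    have "log_deriv (\<lambda>z. root a z - root b z) p vs = \<rho> p vs + psi0 ?K p vs \<and> root a p \<noteq> root b p"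
      if "p \<in> complement E" for p vs
    proof -
      have p: "p \<in> torus" using that base_torus by blast
      have nz: "character (q - q') p - \<beta> / \<alpha> \<noteq> 0" using that K by (auto simp: complement_iff)
      have "log_deriv (\<lambda>z. root a z - root b z) p vs = log_deriv (\<lambda>z. (\<alpha> * character q' z) * (character (q - q') z - \<beta> / \<alpha>)) p vs"
        by (rule log_deriv_cong[OF open_torus p]) (rule fact)
      also have "\<dots> = log_deriv (\<lambda>z. \<alpha> * character q' z) p vs + log_deriv (\<lambda>z. character (q - q') z - \<beta> / \<alpha>) p vs"
      proof (rule log_deriv_mult)
        show "(\<lambda>z. \<alpha> * character q' z) differentiable at p"
          by (rule smooth_on_imp_differentiable[OF smooth_on_mult[OF open_torus smooth_on_const[OF open_torus] smooth_on_character] p])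
        show "(\<lambda>z. character (q - q') z - \<beta> / \<alpha>) differentiable at p"
          by (rule smooth_on_imp_differentiable[OF smooth_on_diff[OF open_torus smooth_on_character smooth_on_const[OF open_torus]] p])
      qed (use nz 4 character_nonzero[OF p] in auto)
      finally show ?thesis using fact[OF p] nz 4(1) character_nonzero[OF p, of q'] \<rho>(2)[OF p] by (auto simp: psi0_def)
    qed
    moreover have "(\<lambda>p vs. \<rho> p vs + psi0 ?K p vs) \<in> base_forms" using base_forms_intros(3)[OF \<rho>(1) base_forms_intros(2)] K by blast
    ultimately show ?thesis by (intro bexI[of _ "\<lambda>p vs. \<rho> p vs + psi0 ?K p vs"]) blast+
  qed
qed

lemma root_distinct: "a \<in> roots \<Longrightarrow> b \<in> roots \<Longrightarrow> a \<noteq> b \<Longrightarrow> p \<in> complement E \<Longrightarrow> root a p \<noteq> root b p"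
  using root_diff by blast

section \<open>Normal forms, linear in the root forms\<close>

definition normal_form :: "(complex^'l) form \<Rightarrow> bool" where
  "normal_form \<omega> \<longleftrightarrow> (\<exists>B0\<in>base_forms. \<exists>B. (\<forall>a\<in>roots. B a \<in> base_forms) \<and>
     (\<forall>p\<in>total. \<forall>vs. \<omega> p vs = B0 p vs + (\<Sum>a\<in>roots. wdg (B a p) (root_form a p) vs)))"

lemma normal_form_cong: "normal_form \<omega> \<Longrightarrow> (\<And>p vs. p \<in> total \<Longrightarrow> \<omega>' p vs = \<omega> p vs) \<Longrightarrow> normal_form \<omega>'"
  unfolding normal_form_def by simp

lemma normal_form_base: "B0 \<in> base_forms \<Longrightarrow> normal_form B0"
  unfolding normal_form_def
  by (intro bexI[of _ B0] exI[of _ "\<lambda>a p vs. 0"]) (auto intro: base_forms_zero simp: wdg_zero_left)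

lemma normal_form_single:
  assumes "B \<in> base_forms" "a \<in> roots"
  shows "normal_form (\<lambda>p. wdg (B p) (root_form a p))"
  unfolding normal_form_def
proof (intro bexI[of _ "\<lambda>p vs. 0"] exI[of _ "\<lambda>b. if b = a then B else (\<lambda>p vs. 0)"] conjI ballI allI)
  fix p vs
  have "(\<Sum>b\<in>roots. wdg ((if b = a then B else (\<lambda>p vs. 0)) p) (root_form b p) vs)
      = (\<Sum>b\<in>roots. if b = a then wdg (B p) (root_form b p) vs else 0)"
    by (intro sum.cong) (auto simp: wdg_zero_left)
  then show "wdg (B p) (root_form a p) vs = 0 + (\<Sum>b\<in>roots. wdg ((if b = a then B else (\<lambda>p vs. 0)) p) (root_form b p) vs)"
    using assms(2) finite_roots by simp
qed (use assms(1) base_forms_zero in auto)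

lemma normal_form_add:
  assumes "normal_form \<omega>" "normal_form \<omega>'"
  shows "normal_form (\<lambda>p vs. \<omega> p vs + \<omega>' p vs)"
proof -
  obtain B0 B where B: "B0 \<in> base_forms" "\<And>a. a \<in> roots \<Longrightarrow> B a \<in> base_forms"
      "\<And>p vs. p \<in> total \<Longrightarrow> \<omega> p vs = B0 p vs + (\<Sum>a\<in>roots. wdg (B a p) (root_form a p) vs)"
    using assms(1) unfolding normal_form_def by blast
  obtain C0 C where C: "C0 \<in> base_forms" "\<And>a. a \<in> roots \<Longrightarrow> C a \<in> base_forms"
      "\<And>p vs. p \<in> total \<Longrightarrow> \<omega>' p vs = C0 p vs + (\<Sum>a\<in>roots. wdg (C a p) (root_form a p) vs)"
    using assms(2) unfolding normal_form_def by blast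
  show ?thesis
    unfolding normal_form_def
    by (intro bexI[of _ "\<lambda>p vs. B0 p vs + C0 p vs"] exI[of _ "\<lambda>a p vs. B a p vs + C a p vs"] conjI ballI allI)
      (use B C in \<open>auto intro: base_forms_intros(3) simp: wdg_add_left sum.distrib\<close>)
qed

lemma normal_form_sum:
  assumes "finite I" "\<And>i. i \<in> I \<Longrightarrow> normal_form (\<omega> i)"
  shows "normal_form (\<lambda>p vs. \<Sum>i\<in>I. \<omega> i p vs)"
  using assms
proof induction
  case empty
  show ?case using normal_form_base[OF base_forms_zero] by simp
next
  case (insert i I)
  have "normal_form (\<lambda>p vs. \<omega> i p vs + (\<Sum>i\<in>I. \<omega> i p vs))" using insert by (intro normal_form_add) auto
  then show ?case using insert by simp
qed

lemma normal_form_wdg_base: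
  assumes "\<sigma> \<in> base_forms" "normal_form \<omega>"
  shows "normal_form (\<lambda>p. wdg (\<sigma> p) (\<omega> p))"
proof -
  obtain B0 B where B: "B0 \<in> base_forms" "\<And>a. a \<in> roots \<Longrightarrow> B a \<in> base_forms"
      "\<And>p vs. p \<in> total \<Longrightarrow> \<omega> p vs = B0 p vs + (\<Sum>a\<in>roots. wdg (B a p) (root_form a p) vs)"
    using assms(2) unfolding normal_form_def by blast
  show ?thesis
    unfolding normal_form_def
  proof (intro bexI[of _ "\<lambda>p. wdg (\<sigma> p) (B0 p)"] exI[of _ "\<lambda>a p. wdg (\<sigma> p) (B a p)"] conjI ballI allI)
    fix p vs assume "p \<in> total"
    then have "\<omega> p = (\<lambda>vs. B0 p vs + (\<Sum>a\<in>roots. wdg (B a p) (root_form a p) vs))" using B(3) by blast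
    then show "wdg (\<sigma> p) (\<omega> p) vs = wdg (\<sigma> p) (B0 p) vs + (\<Sum>a\<in>roots. wdg (wdg (\<sigma> p) (B a p)) (root_form a p) vs)"
      by (simp add: wdg_add_right wdg_sum_right wdg_assoc)
  qed (use B assms(1) in \<open>auto intro: base_forms_intros(4)\<close>)
qed

lemma normal_form_cmult: "normal_form \<omega> \<Longrightarrow> normal_form (\<lambda>p vs. c * \<omega> p vs)"
  by (rule normal_form_cong[OF normal_form_wdg_base[OF base_forms_intros(5)[OF base_forms_intros(1)], of \<omega> c]])
    (simp_all add: wdg_cmult_left wdg_const_left)

text \<open>For two distinct roots Arnold's relation replaces the product of root forms by a base
  form times their difference, so products never become quadratic. A repeated root form gives zero
  once it is moved past the coefficient.\<close>

lemma normal_form_wdg_root: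
  assumes s: "s \<in> roots" and "normal_form \<omega>"
  shows "normal_form (\<lambda>p. wdg (root_form s p) (\<omega> p))"
proof -
  obtain B0 B where B: "B0 \<in> base_forms" "\<And>a. a \<in> roots \<Longrightarrow> B a \<in> base_forms"
      "\<And>p vs. p \<in> total \<Longrightarrow> \<omega> p vs = B0 p vs + (\<Sum>a\<in>roots. wdg (B a p) (root_form a p) vs)"
    using assms(2) unfolding normal_form_def by blast
  let ?sg = "\<lambda>B p us. (-1) ^ length us * B p us"
  have swap: "wdg (root_form s p) b = wdg (\<lambda>us. (-1) ^ length us * b us) (root_form s p)" for b p
    unfolding root_form_def log_deriv_def by (rule ext) (rule wdg_one_form_commute)
  have piece: "normal_form (\<lambda>p. wdg (root_form s p) (wdg (B a p) (root_form a p)))" if a: "a \<in> roots" for a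
  proof (cases "a = s")
    case True
    have "wdg (root_form s p) (root_form s p) = (\<lambda>us. 0)" for p
      unfolding root_form_def log_deriv_def by (rule ext, rule wdg_one_one_proportional[of _ _ 1]) simp
    then have "wdg (root_form s p) (wdg (B a p) (root_form a p)) vs = 0" for p vs
      by (simp add: True wdg_assoc[symmetric] swap[of p "B s p"]) (simp add: wdg_assoc wdg_zero_right)
    then show ?thesis using normal_form_cong[OF normal_form_base[OF base_forms_zero]] by simp
  next
    case False
    obtain \<rho> where \<rho>: "\<rho> \<in> base_forms" "\<And>p vs. p \<in> complement E \<Longrightarrow> log_deriv (\<lambda>z. root a z - root s z) p vs = \<rho> p vs"
      using root_diff[OF a s False] by blast
    have "normal_form (\<lambda>p vs. wdg (wdg (?sg (B a) p) (\<rho> p)) (root_form a p) vs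
        + (-1) * wdg (wdg (?sg (B a) p) (\<rho> p)) (root_form s p) vs)"
      by (intro normal_form_add normal_form_cmult normal_form_single base_forms_intros base_forms_sign \<rho>(1) B(2) a s)
    then show ?thesis
    proof (rule normal_form_cong)
      fix p vs assume p: "p \<in> total"
      then have pP: "p \<in> complement E" and pT: "p \<in> torus" using base_torus by (auto simp: total_def)
      have diff: "(\<lambda>z. z $ j - root t z) differentiable at p" for t
        by (rule smooth_on_imp_differentiable[OF smooth_linear_root pT])
      have "wdg (root_form s p) (root_form a p) us = wdg (\<rho> p) (\<lambda>us. root_form a p us - root_form s p us) us" for us
      proof -
        have "wdg (root_form s p) (root_form a p) us
           = wdg (log_deriv (\<lambda>z. (z $ j - root s z) - (z $ j - root a z)) p) (\<lambda>us. root_form a p us - root_form s p us) us"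
          unfolding root_form_def
          by (rule log_deriv_relation[OF diff diff]) (use p a s root_distinct[OF a s False pP] in \<open>auto simp: total_def\<close>)
        also have "log_deriv (\<lambda>z. (z $ j - root s z) - (z $ j - root a z)) p = \<rho> p"
          using \<rho>(2)[OF pP] by (simp add: fun_eq_iff)
        finally show ?thesis .
      qed
      then have rel: "wdg (root_form s p) (root_form a p) = wdg (\<rho> p) (\<lambda>us. root_form a p us - root_form s p us)"
        by (rule ext)
      have "wdg (root_form s p) (wdg (B a p) (root_form a p)) vs
          = wdg (?sg (B a) p) (wdg (root_form s p) (root_form a p)) vs"
        unfolding wdg_assoc[symmetric] swap[of p "B a p"] ..
      also have "\<dots> = wdg (wdg (?sg (B a) p) (\<rho> p)) (\<lambda>us. root_form a p us - root_form s p us) vs"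
        unfolding rel wdg_assoc ..
      finally show "wdg (root_form s p) (wdg (B a p) (root_form a p)) vs
         = wdg (wdg (?sg (B a) p) (\<rho> p)) (root_form a p) vs + (-1) * wdg (wdg (?sg (B a) p) (\<rho> p)) (root_form s p) vs"
        by (simp add: wdg_diff_right)
    qed
  qed
  have "normal_form (\<lambda>p vs. wdg (?sg B0 p) (root_form s p) vs
      + (\<Sum>a\<in>roots. wdg (root_form s p) (wdg (B a p) (root_form a p)) vs))"
    by (intro normal_form_add normal_form_single normal_form_sum piece base_forms_sign B(1) s finite_roots)
  then show ?thesis
  proof (rule normal_form_cong)
    fix p vs assume "p \<in> total"
    then have "\<omega> p = (\<lambda>vs. B0 p vs + (\<Sum>a\<in>roots. wdg (B a p) (root_form a p) vs))" using B(3) by blast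
    then show "wdg (root_form s p) (\<omega> p) vs = wdg (?sg B0 p) (root_form s p) vs
      + (\<Sum>a\<in>roots. wdg (root_form s p) (wdg (B a p) (root_form a p)) vs)"
      by (simp add: wdg_add_right wdg_sum_right swap[of p "B0 p"])
  qed
qed

lemma character_off:
  assumes "\<And>i. i \<in> L \<Longrightarrow> p $ i = p' $ i" "\<And>i. i \<notin> L \<Longrightarrow> n $ i = 0"
  shows "character n p = character n p'"
  unfolding character_def
proof (rule prod.cong[OF refl])
  show "p $ i powi n $ i = p' $ i powi n $ i" for i using assms by (cases "i \<in> L") simp_all
qed

lemma root_off:
  assumes "a \<in> roots" "\<And>i. i \<in> L \<Longrightarrow> p $ i = p' $ i"
  shows "root a p = root a p'"
proof -
  have "snd a $ i = 0" if "i \<notin> L" for i using roots_support[of "fst a" "snd a"] assms(1) that by simp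
  then show ?thesis unfolding root_def by (simp add: character_off[of p p' "snd a"] assms(2))
qed

text \<open>The exponents in every generator are supported in \<open>L\<close>, and wedge products
  preserve this kind of dependence by \<open>wdg_rel\<close>. In other words, base forms are basic
  for the projection that forgets the remaining coordinates.\<close>

lemma base_forms_basic:
  assumes B: "B \<in> base_forms" and p: "p \<in> torus" "p' \<in> torus" "\<And>i. i \<in> L \<Longrightarrow> p $ i = p' $ i"
    and vs: "list_all2 (\<lambda>v v'. \<forall>i\<in>L. v $ i = v' $ i) vs vs'"
  shows "B p vs = B p' vs'"
  using B[unfolded base_forms_def] vs
proof (induction arbitrary: vs vs')
  case one
  then show ?case by (auto simp: const0_def)
next
  case (gen g)
  then consider i where "i \<in> L" "g = xi0 i" | K where "K \<in> E" "g = psi0 K" by blast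
  then show ?case
  proof cases
    case 1
    then show ?thesis unfolding 1(2) xi0_eq by (intro one_form_rel[OF gen.prems]) (use p(3) in simp)
  next
    case 2
    have K: "fst K $ i = 0" if "i \<notin> L" for i using E_support[of "fst K" "snd K"] 2(1) that by simp
    have "(\<Sum>i\<in>UNIV. of_int (fst K $ i) * (v $ i / p $ i)) = (\<Sum>i\<in>UNIV. of_int (fst K $ i) * (v' $ i / p' $ i))"
      if "\<forall>i\<in>L. v $ i = v' $ i" for v v'
    proof (rule sum.cong[OF refl])
      show "of_int (fst K $ i) * (v $ i / p $ i) = of_int (fst K $ i) * (v' $ i / p' $ i)" for i
        using that p(3) K by (cases "i \<in> L") simp_all
    qed
    moreover have "character (fst K) p = character (fst K) p'" by (rule character_off[OF p(3) K])
    ultimately show ?thesis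
      unfolding 2(2) psi0_eq[OF p(1)] psi0_eq[OF p(2)] by (intro one_form_rel[OF gen.prems]) simp
  qed
next
  case (mult x y)
  show ?case
    by (rule wdg_rel[OF mult.prems]) (use mult.IH in blast)
qed simp_all

section \<open>Residues along the roots\<close>

definition radius :: "complex \<times> (int^'l) \<Rightarrow> complex^'l \<Rightarrow> real" where
  "radius r z = (\<Prod>s\<in>roots - {r}. gap (root r z - root s z)) / 2"

lemma radius_pos: "r \<in> roots \<Longrightarrow> z \<in> complement E \<Longrightarrow> radius r z > 0"
  unfolding radius_def by (intro divide_pos_pos prod_pos gap_bounds(5)) (use root_distinct[of r] in force)+

text \<open>One factor of the product is the gap to root \<open>s\<close> and the others are at most
  \<open>1\<close>. Hence the circle around root \<open>r\<close> encloses no other root.\<close>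

lemma radius_less:
  assumes "r \<in> roots" "s \<in> roots" "s \<noteq> r" "z \<in> complement E"
  shows "radius r z < norm (root r z - root s z)"
proof -
  have "radius r z \<le> gap (root r z - root s z) / 2"
    unfolding radius_def using gap_prod_le(1)[of "roots - {r}" s] finite_roots assms(2,3) by simp
  moreover have "gap (root r z - root s z) \<le> norm (root r z - root s z) / 2" by (rule gap_bounds(3))
  moreover have "norm (root r z - root s z) > 0" using root_distinct[OF assms(1,2) _ assms(4)] assms(3) by simp
  ultimately show ?thesis by linarith
qed

lemma smooth_radius: "smooth_on torus (radius r)"
  unfolding radius_def[abs_def]
  by (intro smooth_on_divide smooth_on_prod smooth_on_gap smooth_on_diff smooth_root smooth_on_const open_torus) simp

definition circle :: "complex \<times> (int^'l) \<Rightarrow> real \<times> (complex^'l) \<Rightarrow> complex^'l" where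
  "circle r w = put j (root r (snd w) + of_real (radius r (snd w)) * cis (fst w)) (snd w)"

lemma open_cylinder: "open (UNIV \<times> complement E :: (real \<times> (complex^'l)) set)"
  by (rule open_Times[OF open_UNIV open_base])

lemma smooth_snd_compose:
  fixes f :: "complex^'l \<Rightarrow> 'b::euclidean_space"
  assumes "smooth_on torus f"
  shows "smooth_on (UNIV \<times> complement E) (\<lambda>w::real \<times> (complex^'l). f (snd w))"
  by (rule smooth_on_compose[OF open_cylinder open_base smooth_on_subset[OF assms base_torus] _
      smooth_on_snd[OF open_cylinder smooth_on_ident[OF open_cylinder]]]) auto

lemma smooth_circle: "smooth_on (UNIV \<times> complement E) (circle r)"
  unfolding circle_def[abs_def]
  by (intro smooth_on_put smooth_on_add smooth_on_mult smooth_on_of_real smooth_on_cis smooth_on_fst smooth_on_snd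
    smooth_on_ident open_cylinder smooth_snd_compose smooth_root smooth_radius)

lemma put_base: "u \<noteq> 0 \<Longrightarrow> z \<in> complement E \<Longrightarrow> put j u z \<in> complement E"
proof -
  assume u: "u \<noteq> 0" and z: "z \<in> complement E"
  have "character (fst K) (put j u z) = character (fst K) z" if "K \<in> E" for K
    by (rule character_off) (use j_notin E_support[of "fst K" "snd K"] that in \<open>auto simp: put_nth\<close>)
  then show "put j u z \<in> complement E" using z put_torus[OF u, of z] by (simp add: complement_iff)
qed

text \<open>The root \<open>0\<close> is among those avoided, which is why the circle stays in the
  torus.\<close>

lemma circle_total:
  assumes r: "r \<in> roots" and z: "z \<in> complement E"
  shows "circle r (x, z) \<in> total"
proof -
  let ?u = "root r z + of_real (radius r z) * cis x"
  have ne: "?u \<noteq> root s z" if s: "s \<in> roots" for s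
  proof (cases "s = r")
    case True
    then show ?thesis using radius_pos[OF r z] by (simp add: cis_neq_zero)
  next
    case False
    have "norm (of_real (radius r z) * cis x) = radius r z" using radius_pos[OF r z] by (simp add: norm_mult)
    then have "of_real (radius r z) * cis x \<noteq> - (root r z - root s z)"
      using radius_less[OF r s False z] by (metis less_irrefl norm_minus_cancel)
    then show ?thesis by (metis add_diff_cancel_left' minus_diff_eq)
  qed
  have "?u \<noteq> 0" using ne[OF zero_root] by (simp add: root_def)
  moreover have "root s (put j ?u z) = root s z" if "s \<in> roots" for s
    by (rule root_off[OF that]) (use j_notin in \<open>auto simp: put_nth\<close>)
  ultimately show ?thesis using put_base[OF _ z] ne by (simp add: total_def circle_def put_nth)
qed

lemma circle_image:
  assumes "r \<in> roots"
  shows "circle r ` (UNIV \<times> complement E) \<subseteq> total"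
  using circle_total[OF assms] by auto

lemma frechet_circle:
  assumes "w \<in> UNIV \<times> complement E" "i \<noteq> j"
  shows "frechet_derivative (circle r) (at w) v $ i = snd v $ i"
proof -
  have "((\<lambda>w. circle r w $ i) has_derivative (\<lambda>v. frechet_derivative (circle r) (at w) v $ i)) (at w)"
    by (rule bounded_linear.has_derivative[OF bounded_linear_vec_nth smooth_on_has_derivative[OF smooth_circle assms(1)]])
  moreover have "(\<lambda>w. circle r w $ i) = (\<lambda>w. snd w $ i)" using assms(2) by (simp add: circle_def put_nth)
  moreover have "((\<lambda>w::real \<times> (complex^'l). snd w $ i) has_derivative (\<lambda>v. snd v $ i)) (at w)"
    by (intro bounded_linear.has_derivative[OF bounded_linear_vec_nth] bounded_linear.has_derivative[OF bounded_linear_snd] has_derivative_ident)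
  ultimately show ?thesis using has_derivative_unique by metis
qed

lemma total_torus: "total \<subseteq> torus"
  using base_torus by (auto simp: total_def)

text \<open>Only coordinate \<open>j\<close> moves along the circle: vectors of the base keep their
  components in \<open>L\<close>, and the angular vector has none, so base forms are reproduced on
  the former and vanish when contracted with the latter.\<close>

lemma pullback_circle_base:
  assumes r: "r \<in> roots" and z: "z \<in> complement E" and B: "B \<in> base_forms"
  shows "pullback (circle r) B (x, z) (map (Pair 0) vs) = B z vs"
    and "pullback (circle r) B (x, z) ((1, 0) # map (Pair 0) vs) = 0"
proof -
  have w: "(x, z) \<in> UNIV \<times> complement E" using z by simp
  have T: "circle r (x, z) \<in> torus" "z \<in> torus" using circle_total[OF r z] total_torus z base_torus by blast+
  have off: "circle r (x, z) $ i = z $ i" if "i \<in> L" for i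
    using that j_notin by (auto simp: circle_def put_nth)
  have D: "frechet_derivative (circle r) (at (x, z)) v $ i = snd v $ i" if "i \<in> L" for i v
    using frechet_circle[OF w] that j_notin by metis
  show "pullback (circle r) B (x, z) (map (Pair 0) vs) = B z vs"
    unfolding pullback_def
    by (rule base_forms_basic[OF B T off]) (simp_all add: list_all2_conv_all_nth D)
  have "pullback (circle r) B (x, z) ((1, 0) # map (Pair 0) vs) = B z (0 # vs)"
    unfolding pullback_def
    by (rule base_forms_basic[OF B T off]) (simp_all add: list_all2_map1 list.rel_refl D)
  also have "\<dots> = 0"
    using multilinear_zero[OF alternating_multilin[OF ambient_form_alternating[OF closed_onD(1)[OF base_forms_closed[OF B]] z]], of "[]" vs]
    by simp
  finally show "pullback (circle r) B (x, z) ((1, 0) # map (Pair 0) vs) = 0" .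
qed

lemma pullback_circle_root:
  assumes r: "r \<in> roots" and a: "a \<in> roots" and z: "z \<in> complement E"
  shows "pullback (circle r) (root_form a) (x, z) ((1, 0) # us)
     = const0 (\<i> * of_real (radius r z) * cis x / ((root r z - root a z) + of_real (radius r z) * cis x)) us"
proof -
  have w: "(x, z) \<in> UNIV \<times> complement E" using z by simp
  let ?h = "\<lambda>w. circle r w $ j - root a (circle r w)"
  have T: "circle r (x, z) \<in> torus" using circle_total[OF r z] total_torus by blast
  have h: "?h (x, z) = (root r z - root a z) + of_real (radius r z) * cis x" for x z
    by (subst root_off[OF a, of _ z]) (use j_notin in \<open>auto simp: circle_def put_nth\<close>)
  have "((\<lambda>x. ?h (x, z)) has_vector_derivative (of_real (radius r z) * (\<i> * cis x))) (at x)"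
  proof -
    have "(cis has_vector_derivative (\<i> * cis x)) (at x)"
      using has_derivative_cis[OF has_derivative_ident, of x UNIV]
      by (simp add: has_vector_derivative_def scaleR_conv_of_real mult.assoc mult.left_commute)
    from has_vector_derivative_add[OF has_vector_derivative_const has_vector_derivative_mult_right[OF this]]
    show ?thesis unfolding h by simp
  qed
  moreover have "?h differentiable at (x, z)"
  proof (rule smooth_on_imp_differentiable[OF _ w])
    have sub: "circle r ` (UNIV \<times> complement E) \<subseteq> torus" using circle_image[OF r] total_torus by blast
    show "smooth_on (UNIV \<times> complement E) ?h"
      by (rule smooth_on_compose[OF open_cylinder open_torus smooth_linear_root sub smooth_circle])
  qed
  ultimately have "frechet_derivative ?h (at (x, z)) (1, 0) = of_real (radius r z) * (\<i> * cis x)"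
    by (intro frechet_slice)
  moreover have "pullback (circle r) (root_form a) (x, z) ((1, 0) # us) = log_deriv ?h (x, z) ((1, 0) # us)"
    unfolding root_form_def
    by (rule pullback_log_deriv) (use smooth_on_imp_differentiable[OF smooth_circle w] smooth_on_imp_differentiable[OF smooth_linear_root T] in auto)
  ultimately show ?thesis by (simp add: log_deriv_def one_form_def const0_def h mult.assoc mult.left_commute)
qed

text \<open>Contraction with the angular vector kills the base forms and turns each root form into a
  logarithmic integrand, whose integral is nonzero only for the encircled root. The sign comes from
  moving the contraction past the coefficient.\<close>

lemma residue:
  assumes r: "r \<in> roots" and z: "z \<in> complement E" and B0: "B0 \<in> base_forms" and B: "\<And>a. a \<in> roots \<Longrightarrow> B a \<in> base_forms"
    and \<omega>: "\<And>p vs. p \<in> total \<Longrightarrow> \<omega> p vs = B0 p vs + (\<Sum>a\<in>roots. wdg (B a p) (root_form a p) vs)"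
  shows "fibre_integral 0 (2*pi) (pullback (circle r) \<omega>) z vs = 2 * pi * \<i> * ((-1) ^ length vs * B r z vs)"
proof -
  let ?f = "\<lambda>a x. \<i> * of_real (radius r z) * cis x / ((root r z - root a z) + of_real (radius r z) * cis x)"
  have integrand: "pullback (circle r) \<omega> (x, z) ((1, 0) # map (Pair 0) vs) = (\<Sum>a\<in>roots. ?f a x * ((-1) ^ length vs * B a z vs))" for x
  proof -
    have "pullback (circle r) \<omega> (x, z) ((1, 0) # map (Pair 0) vs)
       = pullback (circle r) B0 (x, z) ((1, 0) # map (Pair 0) vs)
         + (\<Sum>a\<in>roots. pullback (circle r) (\<lambda>p. wdg (B a p) (root_form a p)) (x, z) ((1, 0) # map (Pair 0) vs))"
      unfolding pullback_def by (rule \<omega>[OF circle_total[OF r z]])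
    also have "\<dots> = (\<Sum>a\<in>roots. pullback (circle r) (\<lambda>p. wdg (B a p) (root_form a p)) (x, z) ((1, 0) # map (Pair 0) vs))"
      using pullback_circle_base(2)[OF r z B0] by simp
    also have "\<dots> = (\<Sum>a\<in>roots. ?f a x * ((-1) ^ length vs * B a z vs))"
    proof (rule sum.cong[OF refl])
      fix a assume a: "a \<in> roots"
      have 1: "wdg (\<lambda>us. pullback (circle r) (B a) (x, z) ((1, 0) # us)) (pullback (circle r) (root_form a) (x, z)) (map (Pair 0) vs) = 0"
        unfolding wdg_map pullback_circle_base(2)[OF r z B[OF a]] by (rule wdg_zero_left)
      have 2: "wdg (\<lambda>us. (-1) ^ length us * pullback (circle r) (B a) (x, z) us) (\<lambda>us. pullback (circle r) (root_form a) (x, z) ((1, 0) # us)) (map (Pair 0) vs)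
         = ?f a x * ((-1) ^ length vs * B a z vs)"
        unfolding pullback_circle_root[OF r a z] wdg_const_right using pullback_circle_base(1)[OF r z B[OF a]] by simp
      show "pullback (circle r) (\<lambda>p. wdg (B a p) (root_form a p)) (x, z) ((1, 0) # map (Pair 0) vs) = ?f a x * ((-1) ^ length vs * B a z vs)"
        unfolding pullback_wdg wdg.simps(2) 1 2 by simp
    qed
    finally show ?thesis .
  qed
  have int: "?f a integrable_on {0..2*pi}" if a: "a \<in> roots" for a
  proof (rule integrable_continuous_real)
    have "(root r z - root a z) + of_real (radius r z) * cis x \<noteq> 0" for x
    proof -
      have "circle r (x, z) $ j \<noteq> root a (circle r (x, z))" using circle_total[OF r z] a by (simp add: total_def)
      also have "root a (circle r (x, z)) = root a z"
        by (rule root_off[OF a]) (use j_notin in \<open>auto simp: circle_def put_nth\<close>)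
      finally show ?thesis by (simp add: circle_def put_nth algebra_simps)
    qed
    then show "continuous_on {0..2*pi} (?f a)" by (intro continuous_intros continuous_on_cis) auto
  qed
  have val: "integral {0..2*pi} (?f a) = (if a = r then 2 * pi * \<i> else 0)" if a: "a \<in> roots" for a
    using integral_log_circle[OF radius_pos[OF r z], of "root r z - root a z"] root_distinct[OF r a _ z] radius_less[OF r a _ z]
    by auto
  have "fibre_integral 0 (2*pi) (pullback (circle r) \<omega>) z vs
      = integral {0..2*pi} (\<lambda>x. \<Sum>a\<in>roots. ?f a x * ((-1) ^ length vs * B a z vs))"
    unfolding fibre_integral_def interval_integral_form_def integrand ..
  also have "\<dots> = (\<Sum>a\<in>roots. integral {0..2*pi} (?f a) * ((-1) ^ length vs * B a z vs))"
  proof (subst integral_sum[OF finite_roots])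
    show "(\<lambda>x. ?f a x * ((-1) ^ length vs * B a z vs)) integrable_on {0..2*pi}" if "a \<in> roots" for a
      by (rule integrable_on_mult_left[OF int[OF that]])
    show "(\<Sum>a\<in>roots. integral {0..2*pi} (\<lambda>x. ?f a x * ((-1) ^ length vs * B a z vs)))
       = (\<Sum>a\<in>roots. integral {0..2*pi} (?f a) * ((-1) ^ length vs * B a z vs))"
      by (intro sum.cong refl integral_mult_left)
  qed
  also have "\<dots> = (\<Sum>a\<in>roots. if a = r then 2 * pi * \<i> * ((-1) ^ length vs * B r z vs) else 0)"
    by (intro sum.cong) (auto simp: val)
  also have "\<dots> = 2 * pi * \<i> * ((-1) ^ length vs * B r z vs)" using r finite_roots by simp
  finally show ?thesis .
qed

theorem normal_form_exact_zero:
  assumes IH: "\<And>B p vs. B \<in> base_forms \<Longrightarrow> cohomologous (complement E) B (\<lambda>p vs. 0) \<Longrightarrow> p \<in> complement E \<Longrightarrow> B p vs = 0"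
    and nf: "normal_form \<omega>" and exact: "cohomologous total \<omega> (\<lambda>p vs. 0)" and p: "p \<in> total"
  shows "\<omega> p vs = 0"
proof -
  obtain B0 B where B0: "B0 \<in> base_forms" and B: "\<And>a. a \<in> roots \<Longrightarrow> B a \<in> base_forms"
    and \<omega>: "\<And>p vs. p \<in> total \<Longrightarrow> \<omega> p vs = B0 p vs + (\<Sum>a\<in>roots. wdg (B a p) (root_form a p) vs)"
    using nf unfolding normal_form_def by blast
  obtain \<eta> where \<eta>: "ambient_form total \<eta>" "\<And>p vs. p \<in> total \<Longrightarrow> \<omega> p vs = 0 + ambient_deriv \<eta> p vs"
    using cohomologousE[OF exact] by blast
  \<comment> \<open>The circles are closed, so the boundary terms cancel and the residue of
    \<open>d \<eta>\<close> is minus the derivative of the fibre integral of \<open>\<eta>\<close>.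
    Thus the degree involution of \<open>B r\<close>, up to a scalar, is an exact base form.\<close>
  have Bzero: "B r z vs = 0" if r: "r \<in> roots" and z: "z \<in> complement E" for r z vs
  proof -
    let ?\<Theta> = "pullback (circle r) \<eta>"
    let ?\<rho> = "\<lambda>p vs. 2 * pi * \<i> * ((-1) ^ length vs * B r p vs)"
    have \<Theta>: "ambient_form (UNIV \<times> complement E) ?\<Theta>"
      by (rule ambient_form_pullback[OF open_cylinder open_total smooth_circle circle_image[OF r] \<eta>(1)])
    have sub: "{0..2*pi} \<times> complement E \<subseteq> UNIV \<times> complement E" by auto
    have fib: "ambient_form (complement E) (fibre_integral 0 (2*pi) ?\<Theta>)"
      by (rule ambient_form_fibre_integral[OF open_base open_cylinder sub \<Theta>])
    have "cohomologous (complement E) ?\<rho> (\<lambda>p vs. 0)"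
    proof (rule cohomologousI[OF ambient_form_minus[OF open_base fib]])
      fix p vs assume p: "p \<in> complement E"
      have "pullback (circle r) \<omega> (x, p) us = ambient_deriv ?\<Theta> (x, p) us" for x us
      proof -
        have "pullback (circle r) \<omega> (x, p) us = pullback (circle r) (ambient_deriv \<eta>) (x, p) us"
          unfolding pullback_def using \<eta>(2)[OF circle_total[OF r p]] by simp
        also have "\<dots> = ambient_deriv ?\<Theta> (x, p) us"
          by (rule ambient_deriv_pullback[symmetric, OF open_cylinder open_total smooth_circle circle_image[OF r] \<eta>(1)]) (use p in simp)
        finally show ?thesis .
      qed
      then have "fibre_integral 0 (2*pi) (pullback (circle r) \<omega>) p vs = fibre_integral 0 (2*pi) (ambient_deriv ?\<Theta>) p vs"
        by (simp add: fibre_integral_def interval_integral_form_def)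
      moreover have "?\<Theta> (2*pi, p) (map (Pair 0) vs) = ?\<Theta> (0, p) (map (Pair 0) vs)"
      proof -
        have "(\<lambda>p. circle r (2*pi, p)) = (\<lambda>p. circle r (0, p))" by (simp add: circle_def)
        then show ?thesis
          using slice_pullback[OF smooth_circle, of "2*pi" p r \<eta> vs] slice_pullback[OF smooth_circle, of 0 p r \<eta> vs] p by simp
      qed
      ultimately have "?\<rho> p vs = - ambient_deriv (fibre_integral 0 (2*pi) ?\<Theta>) p vs"
        using cartan_fibre_integral[OF open_base p sub open_cylinder ambient_form_smooth[OF \<Theta>], of vs]
          residue[OF r p B0 B \<omega>, of vs] by simp
      also have "\<dots> = ambient_deriv (\<lambda>p vs. - fibre_integral 0 (2*pi) ?\<Theta> p vs) p vs"
        by (rule ambient_deriv_minus[symmetric, OF ambient_form_smooth[OF fib] p])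
      finally show "?\<rho> p vs = 0 + ambient_deriv (\<lambda>p vs. - fibre_integral 0 (2*pi) ?\<Theta> p vs) p vs" by simp
    qed
    from IH[OF base_forms_intros(5)[OF base_forms_sign[OF B[OF r]]] this z, of vs]
    show ?thesis by simp
  qed
  have total_base: "z \<in> complement E" if "z \<in> total" for z using that by (simp add: total_def)
  have \<omega>B0: "\<omega> q us = B0 q us" if "q \<in> total" for q us
  proof -
    have "B a q = (\<lambda>us. 0)" if "a \<in> roots" for a using Bzero[OF that total_base[OF \<open>q \<in> total\<close>]] by blast
    then show ?thesis using \<omega>[OF that] by (simp add: wdg_zero_left)
  qed
  \<comment> \<open>A section of the fibration: angle \<open>0\<close> on the circle around the root
    \<open>0\<close>. It recovers \<open>B0\<close>, because base forms do not see what is put into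
    coordinate \<open>j\<close>.\<close>
  let ?\<sigma> = "\<lambda>z. circle (0, 0) (0, z)"
  have pair: "smooth_on (complement E) (\<lambda>z. (0::real, z))"
    by (intro smooth_on_Pair smooth_on_const smooth_on_ident open_base)
  have \<sigma>: "smooth_on (complement E) ?\<sigma>"
    by (rule smooth_on_compose[OF open_base open_cylinder smooth_circle _ pair]) auto
  have "?\<sigma> ` complement E \<subseteq> total" using circle_total[OF zero_root] by blast
  from cohomologous_pullback[OF open_base open_total \<sigma> this exact]
  have "cohomologous (complement E) B0 (\<lambda>p vs. 0)"
  proof (rule cohomologous_cong[rotated -1])
    fix z vs assume z: "z \<in> complement E"
    have "pullback ?\<sigma> \<omega> z vs = pullback ?\<sigma> B0 z vs"
      unfolding pullback_def by (rule \<omega>B0[OF circle_total[OF zero_root z]])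
    also have "\<dots> = pullback (circle (0, 0)) B0 (0, z) (map (Pair 0) vs)"
      by (rule slice_pullback[symmetric, OF smooth_circle]) (use z in simp)
    also have "\<dots> = B0 z vs" by (rule pullback_circle_base(1)[OF zero_root z B0])
    finally show "pullback ?\<sigma> \<omega> z vs = B0 z vs" .
    show "pullback ?\<sigma> (\<lambda>p vs. 0) z vs = 0" by (simp add: pullback_def)
  qed
  then have "B0 p vs = 0" by (rule IH[OF B0 _ total_base[OF p]])
  then show ?thesis using \<omega>B0[OF p] by simp
qed

end

section \<open>Exact logarithmic forms vanish\<close>

text \<open>Pulled back along this isogeny, with \<open>n $ j\<close> dividing \<open>D\<close>, the function \<open>\<chi>\<^sub>n - c\<close> splits into
  factors linear in the coordinate \<open>j\<close> whose roots are monomials in the other coordinates.\<close>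

definition power_off :: "'l \<Rightarrow> nat \<Rightarrow> complex^'l \<Rightarrow> complex^'l" where
  "power_off j D z = (\<chi> i. if i = j then z $ i else z $ i ^ D)"

definition scale_off :: "'l \<Rightarrow> nat \<Rightarrow> int^'l \<Rightarrow> int^'l" where
  "scale_off j D n = (\<chi> i. if i = j then n $ i else int D * n $ i)"

lemma character_power_off: "character n (power_off j D z) = character (scale_off j D n) z"
  unfolding character_def power_off_def scale_off_def
  by (intro prod.cong) (auto simp: power_int_mult)

lemma scale_off_uminus: "scale_off j D (- n) = - scale_off j D n"
  by (simp add: scale_off_def vec_eq_iff)

lemma scale_off_eq_0_iff: "D > 0 \<Longrightarrow> scale_off j D n = 0 \<longleftrightarrow> n = 0"
  by (auto simp: scale_off_def vec_eq_iff split: if_splits)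

lemma power_off_torus: "z \<in> torus \<Longrightarrow> power_off j D z \<in> torus"
  by (simp add: power_off_def torus_def)

lemma power_off_surj:
  assumes "D > 0" "p \<in> torus"
  obtains z where "z \<in> torus" "power_off j D z = p"
proof -
  have "\<exists>w. w \<noteq> 0 \<and> p $ i = w ^ D" for i
    using exists_complex_root_nonzero[of "p $ i" D] assms by (auto simp: torus_def)
  then obtain w where w: "\<And>i. w i \<noteq> 0 \<and> p $ i = w i ^ D" by metis
  show thesis
    by (rule that[of "\<chi> i. if i = j then p $ i else w i"])
      (use w assms(2) in \<open>auto simp: torus_def power_off_def vec_eq_iff\<close>)
qed

lemma smooth_power_off:
  assumes "open U"
  shows "smooth_on U (power_off j D)"
  unfolding power_off_def[abs_def]
proof (rule smooth_on_vec_lambda[OF assms])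
  show "smooth_on U (\<lambda>z. if i = j then z $ i else z $ i ^ D)" for i
    using smooth_on_coord[OF assms] smooth_on_power[OF assms smooth_on_coord[OF assms]] by (cases "i = j") simp_all
qed

lemma frechet_power_off:
  fixes z :: "complex^'l"
  shows
  "frechet_derivative (power_off j D) (at z) v $ i = (if i = j then v $ i else of_nat D * z $ i ^ (D - 1) * v $ i)"
proof -
  have coord: "((\<lambda>z::complex^'l. z $ i) has_derivative (\<lambda>v. v $ i)) (at z)"
    by (rule bounded_linear.has_derivative[OF bounded_linear_vec_nth has_derivative_ident])
  have 1: "((\<lambda>z. power_off j D z $ i) has_derivative (\<lambda>v. frechet_derivative (power_off j D) (at z) v $ i)) (at z)"
    by (rule bounded_linear.has_derivative[OF bounded_linear_vec_nth smooth_on_has_derivative[OF smooth_power_off[OF open_UNIV]]]) simp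
  have 2: "((\<lambda>z. power_off j D z $ i) has_derivative (\<lambda>v. if i = j then v $ i else of_nat D * z $ i ^ (D - 1) * v $ i)) (at z)"
  proof (cases "i = j")
    case True
    then show ?thesis using coord by (simp add: power_off_def)
  next
    case False
    then show ?thesis using has_derivative_power[OF coord, of D] by (simp add: power_off_def mult.assoc mult.left_commute mult.commute)
  qed
  show ?thesis using has_derivative_unique[OF 1 2] by metis
qed

lemma character_single: "character (\<chi> i. if i = j then a else 0) z = z $ j powi a"
proof -
  have "character (\<chi> i. if i = j then a else 0) z = (\<Prod>i\<in>UNIV. if i = j then z $ j powi a else 1)"
    unfolding character_def by (intro prod.cong) auto
  then show ?thesis by simp
qed

lemma character_power: "character (\<chi> i. int e * q $ i) z = character q z ^ e"
  unfolding character_def prod_power_distrib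
  by (intro prod.cong) (simp_all add: power_int_mult mult.commute[of "int e"])

text \<open>With \<open>e = m $ j\<close> and \<open>D = e * e'\<close>, the rescaled character is
  the \<open>e\<close>-th power of a monomial linear in \<open>z $ j\<close>. Writing
  \<open>d\<close> as an \<open>e\<close>-th power too, the difference splits over the
  \<open>e\<close>-th roots of unity.\<close>

lemma character_minus_factor_pos:
  fixes m :: "int^'l"
  assumes j: "j \<notin> L" and D: "D > 0" and d: "d \<noteq> 0" and m: "m $ j > 0" "nat (m $ j) dvd D"
    and supp: "\<And>i. i \<noteq> j \<Longrightarrow> i \<notin> L \<Longrightarrow> m $ i = 0"
  obtains R k where "finite R" "\<And>a. a \<in> R \<Longrightarrow> fst a \<noteq> 0" "\<And>a i. a \<in> R \<Longrightarrow> i \<notin> L \<Longrightarrow> snd a $ i = 0"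
    "\<And>i. i \<noteq> j \<Longrightarrow> i \<notin> L \<Longrightarrow> k $ i = 0"
    "\<And>z. z \<in> torus \<Longrightarrow> character (scale_off j D m) z - d = character k z * (\<Prod>a\<in>R. z $ j - fst a * character (snd a) z)"
proof -
  define e where "e = nat (m $ j)"
  have e: "e > 0" "int e = m $ j" using m(1) by (simp_all add: e_def)
  obtain e' where e': "D = e * e'" using m(2) by (auto simp: e_def)
  define q where "q = (\<chi> i. if i = j then 0 else int e' * m $ i)"
  define k where "k = (\<chi> i. int e * q $ i)"
  obtain d' where d': "d = d' ^ e" "d' \<noteq> 0" using exists_complex_root_nonzero[of d e] d e(1) by auto
  have fin: "finite {\<zeta>::complex. \<zeta> ^ e = 1}" using finite_roots_unity[of e] e(1) by simp
  show thesis
  proof (rule that[of "(\<lambda>\<zeta>. (\<zeta> * d', - q)) ` {\<zeta>. \<zeta> ^ e = 1}" k])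
    show "finite ((\<lambda>\<zeta>. (\<zeta> * d', - q)) ` {\<zeta>. \<zeta> ^ e = 1})" using fin by simp
    show "fst a \<noteq> 0" if "a \<in> (\<lambda>\<zeta>. (\<zeta> * d', - q)) ` {\<zeta>. \<zeta> ^ e = 1}" for a
      using that d'(2) e(1) by (auto simp: power_0_left)
    show "snd a $ i = 0" if "a \<in> (\<lambda>\<zeta>. (\<zeta> * d', - q)) ` {\<zeta>. \<zeta> ^ e = 1}" "i \<notin> L" for a i
      using that supp[of i] by (auto simp: q_def)
    show "k $ i = 0" if "i \<noteq> j" "i \<notin> L" for i using supp[OF that] by (simp add: k_def q_def)
    fix z assume z: "z \<in> (torus :: (complex^'l) set)"
    have "scale_off j D m = k + (\<chi> i. if i = j then int e else 0)"
      using e(2) by (auto simp: scale_off_def k_def q_def vec_eq_iff e')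
    then have 1: "character (scale_off j D m) z = character k z * z $ j ^ e"
      by (simp add: character_add[OF z] character_single)
    have k: "character k z = character q z ^ e" unfolding k_def by (rule character_power)
    have "(\<Prod>a\<in>(\<lambda>\<zeta>. (\<zeta> * d', - q)) ` {\<zeta>. \<zeta> ^ e = 1}. z $ j - fst a * character (snd a) z)
        = (\<Prod>\<zeta>\<in>{\<zeta>. \<zeta> ^ e = 1}. z $ j - \<zeta> * (d' * character (- q) z))"
      using d'(2) by (subst prod.reindex) (auto simp: inj_on_def mult.assoc)
    also have "\<dots> = z $ j ^ e - (d' * character (- q) z) ^ e" by (rule prod_minus_roots_unity[OF e(1)])
    also have "\<dots> = z $ j ^ e - d / character k z"
      by (simp add: k d'(1) character_uminus[OF z] power_mult_distrib power_inverse divide_inverse)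
    finally show "character (scale_off j D m) z - d
        = character k z * (\<Prod>a\<in>(\<lambda>\<zeta>. (\<zeta> * d', - q)) ` {\<zeta>. \<zeta> ^ e = 1}. z $ j - fst a * character (snd a) z)"
      using character_nonzero[OF z, of k] by (simp add: 1 right_diff_distrib)
  qed
qed

text \<open>A negative exponent is reduced to a positive one by \<chi> - c = -c \<chi> (1/\<chi> -
  1/c); the factor in front is absorbed into the monomial.\<close>

lemma character_minus_factor:
  fixes n :: "int^'l"
  assumes j: "j \<notin> L" and D: "D > 0" and c: "c \<noteq> 0" and n: "n $ j \<noteq> 0" "nat \<bar>n $ j\<bar> dvd D"
    and supp: "\<And>i. i \<noteq> j \<Longrightarrow> i \<notin> L \<Longrightarrow> n $ i = 0"
  shows "\<exists>R k b. finite R \<and> (\<forall>a\<in>R. fst a \<noteq> 0 \<and> (\<forall>i. i \<notin> L \<longrightarrow> snd a $ i = 0)) \<and>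
    (\<forall>i. i \<noteq> j \<longrightarrow> i \<notin> L \<longrightarrow> k $ i = 0) \<and> b \<noteq> 0 \<and>
    (\<forall>z\<in>torus. character (scale_off j D n) z - c = b * character k z * (\<Prod>a\<in>R. z $ j - fst a * character (snd a) z))"
proof (cases "n $ j > 0")
  case True
  then have "nat (n $ j) dvd D" using n(2) by simp
  from character_minus_factor_pos[OF j D c True this supp]
  obtain R k where "finite R" "\<And>a. a \<in> R \<Longrightarrow> fst a \<noteq> 0" "\<And>a i. a \<in> R \<Longrightarrow> i \<notin> L \<Longrightarrow> snd a $ i = 0"
    "\<And>i. i \<noteq> j \<Longrightarrow> i \<notin> L \<Longrightarrow> k $ i = 0"
    "\<And>z. z \<in> torus \<Longrightarrow> character (scale_off j D n) z - c = character k z * (\<Prod>a\<in>R. z $ j - fst a * character (snd a) z)"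
    by blast
  then show ?thesis by (intro exI[of _ R] exI[of _ k] exI[of _ 1]) simp
next
  case False
  then have neg: "(- n) $ j > 0" "nat ((- n) $ j) dvd D" using n by simp_all
  have c': "1 / c \<noteq> 0" using c by simp
  have supp': "(- n) $ i = 0" if "i \<noteq> j" "i \<notin> L" for i using supp[OF that] by simp
  from character_minus_factor_pos[OF j D c' neg supp']
  obtain R k where R: "finite R" "\<And>a. a \<in> R \<Longrightarrow> fst a \<noteq> 0" "\<And>a i. a \<in> R \<Longrightarrow> i \<notin> L \<Longrightarrow> snd a $ i = 0"
    "\<And>i. i \<noteq> j \<Longrightarrow> i \<notin> L \<Longrightarrow> k $ i = 0"
    "\<And>z. z \<in> torus \<Longrightarrow> character (scale_off j D (- n)) z - 1 / c = character k z * (\<Prod>a\<in>R. z $ j - fst a * character (snd a) z)"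
    by blast
  have "character (scale_off j D n) z - c
      = - c * character (scale_off j D n + k) z * (\<Prod>a\<in>R. z $ j - fst a * character (snd a) z)" if z: "z \<in> torus" for z
  proof -
    let ?x = "character (scale_off j D n) z"
    have "?x - c = - c * ?x * (inverse ?x - 1 / c)"
      using c character_nonzero[OF z, of "scale_off j D n"] by (simp add: field_simps)
    also have "inverse ?x - 1 / c = character k z * (\<Prod>a\<in>R. z $ j - fst a * character (snd a) z)"
      using R(5)[OF z] by (simp add: scale_off_uminus character_uminus[OF z])
    finally show ?thesis by (simp add: character_add[OF z] mult.assoc)
  qed
  moreover have "(scale_off j D n + k) $ i = 0" if "i \<noteq> j" "i \<notin> L" for i
    using R(4)[OF that] supp[OF that] that by (simp add: scale_off_def)
  ultimately show ?thesis
    using R(1-3) c by (intro exI[of _ R] exI[of _ "scale_off j D n + k"] exI[of _ "- c"]) auto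
qed

context elimination
begin

text \<open>Closure of normal forms under products is not visible, but the forms that preserve them
  under left multiplication constitute an algebra. It suffices to place the generators in it and to
  apply the result to the unit.\<close>

definition preserves_normal :: "(complex^'l) form \<Rightarrow> bool" where
  "preserves_normal x \<longleftrightarrow> (\<forall>\<nu>. normal_form \<nu> \<longrightarrow> normal_form (\<lambda>p. wdg (x p) (\<nu> p)))"

lemma preserves_normalD: "preserves_normal x \<Longrightarrow> normal_form \<nu> \<Longrightarrow> normal_form (\<lambda>p. wdg (x p) (\<nu> p))"
  by (simp add: preserves_normal_def)

lemma preserves_normal_cong:
  assumes "preserves_normal x" "\<And>p vs. p \<in> total \<Longrightarrow> x' p vs = x p vs"
  shows "preserves_normal x'"
  unfolding preserves_normal_def
proof (intro allI impI)
  fix \<nu> assume "normal_form \<nu>"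
  from preserves_normalD[OF assms(1) this] show "normal_form (\<lambda>p. wdg (x' p) (\<nu> p))"
  proof (rule normal_form_cong)
    fix p vs assume "p \<in> total"
    then have "x' p = x p" using assms(2) by (simp add: fun_eq_iff)
    then show "wdg (x' p) (\<nu> p) vs = wdg (x p) (\<nu> p) vs" by simp
  qed
qed

lemma preserves_normal_base: "B \<in> base_forms \<Longrightarrow> preserves_normal B"
  by (simp add: preserves_normal_def normal_form_wdg_base)

lemma preserves_normal_root: "a \<in> roots \<Longrightarrow> preserves_normal (root_form a)"
  by (simp add: preserves_normal_def normal_form_wdg_root)

lemma preserves_normal_add:
  assumes "preserves_normal x" "preserves_normal y"
  shows "preserves_normal (\<lambda>p vs. x p vs + y p vs)"
  unfolding preserves_normal_def
proof (intro allI impI)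
  fix \<nu> assume \<nu>: "normal_form \<nu>"
  show "normal_form (\<lambda>p. wdg (\<lambda>vs. x p vs + y p vs) (\<nu> p))"
    by (rule normal_form_cong[OF normal_form_add[OF preserves_normalD[OF assms(1) \<nu>] preserves_normalD[OF assms(2) \<nu>]]])
      (rule wdg_add_left)
qed

lemma preserves_normal_cmult:
  assumes "preserves_normal x"
  shows "preserves_normal (\<lambda>p vs. c * x p vs)"
  unfolding preserves_normal_def
proof (intro allI impI)
  fix \<nu> assume \<nu>: "normal_form \<nu>"
  show "normal_form (\<lambda>p. wdg (\<lambda>vs. c * x p vs) (\<nu> p))"
    by (rule normal_form_cong[OF normal_form_cmult[OF preserves_normalD[OF assms \<nu>]]]) (rule wdg_cmult_left)
qed

lemma preserves_normal_wdg:
  assumes "preserves_normal x" "preserves_normal y"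
  shows "preserves_normal (\<lambda>p. wdg (x p) (y p))"
  unfolding preserves_normal_def
proof (intro allI impI)
  fix \<nu> assume \<nu>: "normal_form \<nu>"
  show "normal_form (\<lambda>p. wdg (wdg (x p) (y p)) (\<nu> p))"
    by (rule normal_form_cong[OF preserves_normalD[OF assms(1) preserves_normalD[OF assms(2) \<nu>]]]) (rule wdg_assoc)
qed

lemma preserves_normal_sum:
  assumes "finite I" "\<And>i. i \<in> I \<Longrightarrow> preserves_normal (x i)"
  shows "preserves_normal (\<lambda>p vs. \<Sum>i\<in>I. x i p vs)"
  using assms
proof induction
  case empty
  show ?case using preserves_normal_base[OF base_forms_zero] by simp
next
  case (insert i I)
  have "preserves_normal (\<lambda>p vs. x i p vs + (\<Sum>i\<in>I. x i p vs))" using insert by (intro preserves_normal_add) auto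
  then show ?case using insert by simp
qed

lemma preserves_normal_imp: "preserves_normal x \<Longrightarrow> normal_form x"
  using normal_form_cong[OF preserves_normalD[OF _ normal_form_base[OF base_forms_intros(1)]]]
  by (simp add: wdg_const_right)

lemma root_form_zero: "root_form (0, 0) = xi0 j"
  by (simp add: root_form_def xi0_def root_def)

lemma preserves_normal_character:
  assumes "\<And>i. i \<noteq> j \<Longrightarrow> i \<notin> L \<Longrightarrow> m $ i = 0"
  shows "preserves_normal (log_deriv (character m))"
proof -
  have "preserves_normal (\<lambda>p vs. \<Sum>i\<in>insert j L. of_int (m $ i) * xi0 i p vs)"
  proof (rule preserves_normal_sum)
    show "preserves_normal (\<lambda>p vs. of_int (m $ i) * xi0 i p vs)" if "i \<in> insert j L" for i
      using that preserves_normal_root[OF zero_root] preserves_normal_base[OF base_forms_intros(2), of "xi0 i"]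
      by (intro preserves_normal_cmult) (auto simp: root_form_zero)
  qed simp
  then show ?thesis
  proof (rule preserves_normal_cong)
    fix p vs assume "p \<in> total"
    then have "p \<in> torus" using total_torus by blast
    then have "log_deriv (character m) p vs = (\<Sum>i\<in>UNIV. of_int (m $ i) * xi0 i p vs)" by (rule log_deriv_character)
    also have "\<dots> = (\<Sum>i\<in>insert j L. of_int (m $ i) * xi0 i p vs)"
      by (rule sum.mono_neutral_right) (use assms in auto)
    finally show "log_deriv (character m) p vs = (\<Sum>i\<in>insert j L. of_int (m $ i) * xi0 i p vs)" .
  qed
qed

lemma preserves_normal_factored:
  assumes R: "R \<subseteq> roots" and b: "b \<noteq> 0" and k: "\<And>i. i \<noteq> j \<Longrightarrow> i \<notin> L \<Longrightarrow> k $ i = 0"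
    and g: "\<And>z. z \<in> torus \<Longrightarrow> g z = b * character k z * (\<Prod>a\<in>R. z $ j - root a z)"
  shows "preserves_normal (log_deriv g)"
proof -
  have fin: "finite R" using R finite_roots finite_subset by blast
  have "preserves_normal (\<lambda>p vs. log_deriv (character k) p vs + (\<Sum>a\<in>R. root_form a p vs))"
    by (intro preserves_normal_add preserves_normal_character preserves_normal_sum fin preserves_normal_root k) (use R in auto)
  then show ?thesis
  proof (rule preserves_normal_cong)
    fix p vs assume "p \<in> total"
    then have p: "p \<in> torus" and nz: "\<And>a. a \<in> R \<Longrightarrow> p $ j - root a p \<noteq> 0"
      using total_torus R by (auto simp: total_def)
    have d1: "(\<lambda>z. b) differentiable at p" "character k differentiable at p"
      using smooth_on_imp_differentiable[OF smooth_on_character p] by simp_all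
    have d2: "(\<lambda>z. b * character k z) differentiable at p"
      by (rule smooth_on_imp_differentiable[OF smooth_on_mult[OF open_torus smooth_on_const[OF open_torus] smooth_on_character] p])
    have d3: "(\<lambda>z. \<Prod>a\<in>R. z $ j - root a z) differentiable at p"
      by (rule smooth_on_imp_differentiable[OF smooth_on_prod[OF open_torus smooth_linear_root] p])
    have "log_deriv g p vs = log_deriv (\<lambda>z. (b * character k z) * (\<Prod>a\<in>R. z $ j - root a z)) p vs"
      by (rule log_deriv_cong[OF open_torus p g])
    also have "\<dots> = log_deriv (\<lambda>z. b * character k z) p vs + log_deriv (\<lambda>z. \<Prod>a\<in>R. z $ j - root a z) p vs"
      by (rule log_deriv_mult[OF d2 d3]) (use b nz fin character_nonzero[OF p] in auto)
    also have "log_deriv (\<lambda>z. b * character k z) p vs = log_deriv (\<lambda>z. b) p vs + log_deriv (character k) p vs"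
      by (rule log_deriv_mult[OF d1]) (use b character_nonzero[OF p] in auto)
    also have "log_deriv (\<lambda>z. \<Prod>a\<in>R. z $ j - root a z) p vs = (\<Sum>a\<in>R. root_form a p vs)"
      unfolding root_form_def by (rule log_deriv_prod[OF fin open_torus p smooth_linear_root nz])
    finally show "log_deriv g p vs = log_deriv (character k) p vs + (\<Sum>a\<in>R. root_form a p vs)"
      by (simp add: log_deriv_const)
  qed
qed

end

text \<open>Induction over the coordinates that the equations and generators involve. The set
  \<open>E\<close>, the form and the point are generalised because elimination produces a new
  arrangement over the base.\<close>

theorem log_form_exact_zero:
  fixes L :: "'l::finite set" and E :: "((int^'l) \<times> complex) set"
  assumes "finite E" "\<And>K. K \<in> E \<Longrightarrow> fst K \<noteq> 0 \<and> snd K \<noteq> 0 \<and> (\<forall>i. i \<notin> L \<longrightarrow> fst K $ i = 0)"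
    and "\<omega> \<in> form_span_algebra (xi0 ` L \<union> psi0 ` E)" "cohomologous (complement E) \<omega> (\<lambda>p vs. 0)"
    and "p \<in> complement E"
  shows "\<omega> p vs = 0"
  using finite[of L] assms
proof (induction L arbitrary: E \<omega> p vs rule: finite_induct)
  case (empty E)
  \<comment> \<open>No coordinate is left, so an equation would have exponent zero. The algebra
    reduces to constants, and an exact form has no part of degree zero.\<close>
  have "E = {}" using empty.prems(2) by (fastforce simp: vec_eq_iff)
  have const: "\<exists>c. \<forall>p vs. \<omega> p vs = const0 c vs"
    using empty.prems(3)[unfolded \<open>E = {}\<close>]
  proof induction
    case one
    show ?case by blast
  next
    case (gen x)
    then show ?case by simp
  next
    case (add x y)
    then obtain a b where "\<forall>p vs. x p vs = const0 a vs" "\<forall>p vs. y p vs = const0 b vs" by blast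
    then have "\<forall>p vs. x p vs + y p vs = const0 (a + b) vs" by (simp add: const0_def)
    then show ?case by blast
  next
    case (mult x y)
    then obtain a b where "\<And>p. x p = const0 a" "\<And>p. y p = const0 b" by (metis ext)
    then have "\<forall>p vs. wdg (x p) (y p) vs = const0 (a * b) vs" by (simp add: wdg_const_left) (simp add: const0_def)
    then show ?case by blast
  next
    case (smult x c)
    then obtain a where "\<forall>p vs. x p vs = const0 a vs" by blast
    then have "\<forall>p vs. c * x p vs = const0 (c * a) vs" by (simp add: const0_def)
    then show ?case by blast
  qed
  then obtain c where c: "\<And>p vs. \<omega> p vs = const0 c vs" by blast
  obtain \<eta> where "\<And>p vs. p \<in> complement E \<Longrightarrow> \<omega> p vs = 0 + ambient_deriv \<eta> p vs"
    using cohomologousE[OF empty.prems(4)] by blast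
  from this[OF empty.prems(5), of "[]"] have "c = 0" by (simp add: c const0_def)
  then show ?case by (simp add: c const0_def)
next
  case (insert j L E)
  \<comment> \<open>The equations that involve coordinate \<open>j\<close>. Their exponents in
    \<open>j\<close> all divide \<open>D\<close>, so a single isogeny splits all of them.\<close>
  define E1 where "E1 = {K\<in>E. fst K $ j \<noteq> 0}"
  have finE1: "finite E1" using insert.prems(1) by (simp add: E1_def)
  define D where "D = (\<Prod>K\<in>E1. nat \<bar>fst K $ j\<bar>)"
  have D: "D > 0" unfolding D_def by (rule prod_pos) (auto simp: E1_def)
  have Ddvd: "nat \<bar>fst K $ j\<bar> dvd D" if "K \<in> E1" for K
    unfolding D_def by (rule dvd_prodI[OF finE1 that])
  have supp: "fst K $ i = 0" if "K \<in> E" "i \<noteq> j" "i \<notin> L" for K i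
    using insert.prems(2)[OF that(1)] that by simp
  let ?sc = "scale_off j D" and ?f = "power_off j D"
  have "\<forall>K\<in>E1. \<exists>R k b. finite R \<and> (\<forall>a\<in>R. fst a \<noteq> 0 \<and> (\<forall>i. i \<notin> L \<longrightarrow> snd a $ i = 0)) \<and>
    (\<forall>i. i \<noteq> j \<longrightarrow> i \<notin> L \<longrightarrow> k $ i = 0) \<and> b \<noteq> 0 \<and>
    (\<forall>z\<in>torus. character (?sc (fst K)) z - snd K = b * character k z * (\<Prod>a\<in>R. z $ j - fst a * character (snd a) z))"
  proof
    fix K assume K: "K \<in> E1"
    then have KE: "K \<in> E" "fst K $ j \<noteq> 0" by (simp_all add: E1_def)
    have "snd K \<noteq> 0" using insert.prems(2)[OF KE(1)] by simp
    from character_minus_factor[OF insert.hyps(2) D this KE(2) Ddvd[OF K] supp[OF KE(1)]]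
    show "\<exists>R k b. finite R \<and> (\<forall>a\<in>R. fst a \<noteq> 0 \<and> (\<forall>i. i \<notin> L \<longrightarrow> snd a $ i = 0)) \<and>
      (\<forall>i. i \<noteq> j \<longrightarrow> i \<notin> L \<longrightarrow> k $ i = 0) \<and> b \<noteq> 0 \<and>
      (\<forall>z\<in>torus. character (?sc (fst K)) z - snd K = b * character k z * (\<Prod>a\<in>R. z $ j - fst a * character (snd a) z))" .
  qed
  then obtain R where R: "\<forall>K\<in>E1. \<exists>k b. finite (R K) \<and> (\<forall>a\<in>R K. fst a \<noteq> 0 \<and> (\<forall>i. i \<notin> L \<longrightarrow> snd a $ i = 0)) \<and>
    (\<forall>i. i \<noteq> j \<longrightarrow> i \<notin> L \<longrightarrow> k $ i = 0) \<and> b \<noteq> 0 \<and>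
    (\<forall>z\<in>torus. character (?sc (fst K)) z - snd K = b * character k z * (\<Prod>a\<in>R K. z $ j - fst a * character (snd a) z))"
    by (rule bchoice[THEN exE])
  define roots where "roots = insert (0, 0) (\<Union>K\<in>E1. R K)"
  \<comment> \<open>The base arrangement: the rescaled equations free of coordinate
    \<open>j\<close>, together with those that keep distinct roots apart.\<close>
  define Ew where "Ew = (\<lambda>K. (?sc (fst K), snd K)) ` (E - E1)
     \<union> (\<lambda>(a, b). (snd a - snd b, fst b / fst a)) ` {(a, b) \<in> roots \<times> roots. fst a \<noteq> 0 \<and> fst b \<noteq> 0 \<and> snd a \<noteq> snd b}"
  have fin_roots: "finite roots" using R finE1 by (auto simp: roots_def)
  have roots_supp: "snd a $ i = 0" if "a \<in> roots" "i \<notin> L" for a i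
    using that R by (auto simp: roots_def)
  have roots_nz: "a = (0, 0)" if "a \<in> roots" "fst a = 0" for a using that R by (auto simp: roots_def)
  have finEw: "finite Ew"
  proof -
    have "finite {(a, b) \<in> roots \<times> roots. fst a \<noteq> 0 \<and> fst b \<noteq> 0 \<and> snd a \<noteq> snd b}"
      by (rule finite_subset[of _ "roots \<times> roots"]) (use fin_roots in auto)
    then show ?thesis using insert.prems(1) by (simp add: Ew_def)
  qed
  have Ew: "fst K \<noteq> 0 \<and> snd K \<noteq> 0 \<and> (\<forall>i. i \<notin> L \<longrightarrow> fst K $ i = 0)" if "K \<in> Ew" for K
    using that[unfolded Ew_def]
  proof
    assume "K \<in> (\<lambda>K. (?sc (fst K), snd K)) ` (E - E1)"
    then obtain K' where K': "K' \<in> E" "fst K' $ j = 0" "K = (?sc (fst K'), snd K')" by (auto simp: E1_def)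
    have "?sc (fst K') $ i = 0" if "i \<notin> L" for i
      using supp[OF K'(1), of i] that K'(2) by (auto simp: scale_off_def)
    then show ?thesis using insert.prems(2)[OF K'(1)] K'(3) D by (simp add: scale_off_eq_0_iff)
  next
    assume "K \<in> (\<lambda>(a, b). (snd a - snd b, fst b / fst a)) ` {(a, b) \<in> roots \<times> roots. fst a \<noteq> 0 \<and> fst b \<noteq> 0 \<and> snd a \<noteq> snd b}"
    then obtain a b where "a \<in> roots" "b \<in> roots" "fst a \<noteq> 0" "fst b \<noteq> 0" "snd a \<noteq> snd b" "K = (snd a - snd b, fst b / fst a)" by auto
    then show ?thesis using roots_supp by simp
  qed
  interpret elimination j L roots Ew
  proof
    show "j \<notin> L" by (rule insert.hyps(2))
    show "finite roots" by (rule fin_roots)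
    show "(0, 0) \<in> roots" by (simp add: roots_def)
    show "q $ i = 0" if "(\<alpha>, q) \<in> roots" "i \<notin> L" for \<alpha> q i using roots_supp[OF that] by simp
    show "q = 0" if "(0, q) \<in> roots" for q using roots_nz[OF that] by simp
    show "finite Ew" by (rule finEw)
    show "n $ i = 0" if "(n, c) \<in> Ew" "i \<notin> L" for n c i using Ew[OF that(1)] that(2) by simp
    show "(q - q', \<beta> / \<alpha>) \<in> Ew" if "(\<alpha>, q) \<in> roots" "(\<beta>, q') \<in> roots" "\<alpha> \<noteq> 0" "\<beta> \<noteq> 0" "q \<noteq> q'" for \<alpha> q \<beta> q'
      unfolding Ew_def by (rule UnI2, rule image_eqI[of _ _ "((\<alpha>, q), (\<beta>, q'))"]) (use that in auto)
  qed
  have IH: "B p vs = 0" if "B \<in> base_forms" "cohomologous (complement Ew) B (\<lambda>p vs. 0)" "p \<in> complement Ew" for B p vs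
    by (rule insert.IH[OF finEw Ew that(1)[unfolded base_forms_def] that(2,3)])
  have fac: "\<exists>k b. (\<forall>i. i \<noteq> j \<longrightarrow> i \<notin> L \<longrightarrow> k $ i = 0) \<and> b \<noteq> 0 \<and> R K \<subseteq> roots \<and>
     (\<forall>z\<in>torus. character (?sc (fst K)) z - snd K = b * character k z * (\<Prod>a\<in>R K. z $ j - root a z))"
    if "K \<in> E1" for K
    using bspec[OF R that] that unfolding root_def roots_def by blast
  have fT: "?f z \<in> torus" if "z \<in> total" for z using that total_torus power_off_torus by blast
  \<comment> \<open>The image of \<open>total\<close> may be smaller than
    \<open>complement E\<close>, because points where roots collide have been removed too; density
    makes up for this below.\<close>
  have f_total: "?f ` total \<subseteq> complement E"
  proof
    fix y assume "y \<in> ?f ` total"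
    then obtain z where z: "z \<in> total" "y = ?f z" by blast
    then have zT: "z \<in> torus" and zE: "z \<in> complement Ew" using total_torus by (auto simp: total_def)
    have "character (?sc (fst K)) z \<noteq> snd K" if K: "K \<in> E" for K
    proof (cases "K \<in> E1")
      case True
      from fac[OF this] obtain k b where kb: "b \<noteq> 0" "R K \<subseteq> roots"
        "\<And>z. z \<in> torus \<Longrightarrow> character (?sc (fst K)) z - snd K = b * character k z * (\<Prod>a\<in>R K. z $ j - root a z)" by blast
      have "(\<Prod>a\<in>R K. z $ j - root a z) \<noteq> 0"
        using z(1) kb(2) finite_subset[OF kb(2) fin_roots] by (auto simp: total_def prod_zero_iff)
      then show ?thesis using kb(1) kb(3)[OF zT] character_nonzero[OF zT, of k] by force
    next
      case False
      then have "(?sc (fst K), snd K) \<in> Ew" using K unfolding Ew_def by blast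
      then show ?thesis using zE by (force simp: complement_iff)
    qed
    then show "y \<in> complement E" using fT[OF z(1)] by (simp add: z(2) complement_iff character_power_off)
  qed
  have opE: "open (complement E)" by (rule open_complement[OF insert.prems(1)])
  have nf: "preserves_normal (pullback ?f \<omega>)"
    using insert.prems(3)
  proof induction
    case one
    show ?case by (rule preserves_normal_cong[OF preserves_normal_base[OF base_forms_intros(1)]]) (simp add: pullback_def const0_def)
  next
    case (gen g)
    then consider i where "i = j \<or> i \<in> L" "g = log_deriv (\<lambda>z. z $ i)" | K where "K \<in> E" "g = log_deriv (\<lambda>z. character (fst K) z - snd K)"
      by (auto simp: xi0_def psi0_def)
    then show ?case
    proof cases
      case 1
      define m :: "int^'l" where "m = (\<chi> k. if k = i then 1 else 0)"
      have "preserves_normal (log_deriv (character (?sc m)))"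
        by (rule preserves_normal_character) (use 1(1) in \<open>auto simp: scale_off_def m_def\<close>)
      then show ?thesis
      proof (rule preserves_normal_cong)
        fix p vs assume p: "p \<in> total"
        have "pullback ?f g p vs = log_deriv (\<lambda>z. ?f z $ i) p vs"
          unfolding 1(2)
          by (rule pullback_log_deriv[OF smooth_on_imp_differentiable[OF smooth_power_off[OF open_total] p]
            smooth_on_imp_differentiable[OF smooth_on_coord[OF open_torus] fT[OF p]]])
        also have "(\<lambda>z. ?f z $ i) = character (?sc m)"
          by (rule ext) (simp add: character_power_off[symmetric], simp add: m_def character_single)
        finally show "pullback ?f g p vs = log_deriv (character (?sc m)) p vs" .
      qed
    next
      case 2
      have "preserves_normal (log_deriv (\<lambda>z. character (?sc (fst K)) z - snd K))"
      proof (cases "K \<in> E1")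
        case True
        from fac[OF this] obtain k b where "\<And>i. i \<noteq> j \<Longrightarrow> i \<notin> L \<Longrightarrow> k $ i = 0" "b \<noteq> 0" "R K \<subseteq> roots"
          "\<And>z. z \<in> torus \<Longrightarrow> character (?sc (fst K)) z - snd K = b * character k z * (\<Prod>a\<in>R K. z $ j - root a z)" by blast
        from preserves_normal_factored[OF this(3,2,1,4)] show ?thesis by blast
      next
        case False
        then have "psi0 (?sc (fst K), snd K) \<in> psi0 ` Ew" using 2(1) unfolding Ew_def by blast
        from preserves_normal_base[OF base_forms_intros(2)[OF UnI2[OF this]]]
        show ?thesis by (simp add: psi0_def)
      qed
      then show ?thesis
      proof (rule preserves_normal_cong)
        fix p vs assume p: "p \<in> total"
        have "pullback ?f g p vs = log_deriv (\<lambda>z. character (fst K) (?f z) - snd K) p vs"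
          unfolding 2(2)
          by (rule pullback_log_deriv[OF smooth_on_imp_differentiable[OF smooth_power_off[OF open_total] p]
            smooth_on_imp_differentiable[OF smooth_on_diff[OF open_torus smooth_on_character smooth_on_const[OF open_torus]] fT[OF p]]])
        then show "pullback ?f g p vs = log_deriv (\<lambda>z. character (?sc (fst K)) z - snd K) p vs"
          by (simp add: character_power_off)
      qed
    qed
  next
    case (add x y)
    then show ?case using preserves_normal_add[OF add.IH] by (simp add: pullback_def)
  next
    case (mult x y)
    then show ?case using preserves_normal_wdg[OF mult.IH] by (simp add: pullback_wdg[abs_def])
  next
    case (smult x c)
    then show ?case using preserves_normal_cmult[OF smult.IH] by (simp add: pullback_def)
  qed
  have "cohomologous total (pullback ?f \<omega>) (pullback ?f (\<lambda>p vs. 0))"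
    by (rule cohomologous_pullback[OF open_total opE smooth_power_off[OF open_total] f_total insert.prems(4)])
  then have coh: "cohomologous total (pullback ?f \<omega>) (\<lambda>p vs. 0)" by (simp add: pullback_def)
  have zero_total: "pullback ?f \<omega> z vs = 0" if "z \<in> total" for z vs
    by (rule normal_form_exact_zero[OF _ preserves_normal_imp[OF nf] coh that]) (rule IH)
  \<comment> \<open>An arrangement whose complement lies in \<open>total\<close>: the conditions on
    \<open>z $ j\<close> and the roots are rewritten with characters, so that
    \<open>complement_dense\<close> applies.\<close>
  define A where "A = Ew \<union> (\<lambda>a. ((\<chi> i. if i = j then 1 else 0) - snd a, fst a)) ` (roots - {(0, 0)})"
  have finA: "finite A" using finEw fin_roots by (simp add: A_def)
  have A0: "fst K \<noteq> 0" if "K \<in> A" for K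
  proof (cases "K \<in> Ew")
    case True
    then show ?thesis using Ew by blast
  next
    case False
    then obtain a where a: "a \<in> roots" "K = ((\<chi> i. if i = j then 1 else 0) - snd a, fst a)"
      using \<open>K \<in> A\<close> unfolding A_def by blast
    then have "fst K $ j = 1" using roots_supp[OF a(1) insert.hyps(2)] by simp
    then show ?thesis by auto
  qed
  have A_total: "complement A \<subseteq> total"
  proof
    fix z assume z: "z \<in> complement A"
    then have zT: "z \<in> torus" using complement_subset by blast
    have "z $ j \<noteq> root a z" if a: "a \<in> roots" for a
    proof (cases "a = (0, 0)")
      case True
      then show ?thesis using zT by (simp add: torus_def root_def)
    next
      case False
      then have "((\<chi> i. if i = j then 1 else 0) - snd a, fst a) \<in> A" using a by (auto simp: A_def)
      then have "character ((\<chi> i. if i = j then 1 else 0) - snd a) z \<noteq> fst a" using z by (force simp: complement_iff)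
      moreover have "character ((\<chi> i. if i = j then 1 else 0) - snd a) z = z $ j / character (snd a) z"
        using character_add[OF zT, of _ "- snd a"] by (simp add: character_single character_uminus[OF zT] divide_inverse)
      ultimately show ?thesis using character_nonzero[OF zT, of "snd a"] by (auto simp: root_def)
    qed
    moreover have "z \<in> complement Ew" using z complement_mono[of Ew A] by (auto simp: A_def)
    ultimately show "z \<in> total" by (simp add: total_def)
  qed
  obtain z where z: "z \<in> torus" "?f z = p"
    using power_off_surj[OF D] insert.prems(5) complement_subset by (metis subsetD)
  define V where "V = torus \<inter> ?f -` complement E"
  have V: "open V"
    unfolding V_def
    by (rule continuous_open_preimage[OF smooth_on_imp_continuous_on[OF smooth_power_off[OF open_torus]] open_torus opE])
  have zV: "z \<in> V" using z insert.prems(5) by (simp add: V_def)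
  have "\<omega> \<in> log_forms E"
    using insert.prems(3) form_span_algebra_mono[of "xi0 ` insert j L \<union> psi0 ` E" "range xi0 \<union> psi0 ` E"]
    unfolding log_forms_def by blast
  then have "closed_on (complement E) \<omega>" by (rule closed_log_forms[OF insert.prems(1)])
  then have fV: "ambient_form V (pullback ?f \<omega>)"
    by (intro ambient_form_pullback[OF V opE smooth_power_off[OF V] _ closed_onD(1)]) (auto simp: V_def)
  \<comment> \<open>By continuity and density, vanishing on \<open>total\<close> carries over to the
    chosen preimage \<open>z\<close>, where roots may collide.\<close>
  have zero: "pullback ?f \<omega> z us = 0" for us
  proof (rule ccontr)
    assume nz: "pullback ?f \<omega> z us \<noteq> 0"
    have "open (V \<inter> (\<lambda>z. pullback ?f \<omega> z us) -` (- {0}))"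
      by (rule continuous_open_preimage[OF smooth_on_imp_continuous_on[OF smooth_coeffsD[OF ambient_form_smooth[OF fV]]] V]) auto
    moreover have "z \<in> (V \<inter> (\<lambda>z. pullback ?f \<omega> z us) -` (- {0})) \<inter> torus" using nz zV z by simp
    ultimately have "V \<inter> (\<lambda>z. pullback ?f \<omega> z us) -` (- {0}) \<inter> complement A \<noteq> {}"
      by (intro complement_dense[OF finA A0]) blast+
    then show False using zero_total A_total by blast
  qed
  \<comment> \<open>A right inverse of the derivative of the isogeny at \<open>z\<close>: every list
    of vectors at \<open>p\<close> is a pushforward, so vanishing of the pullback gives vanishing of
    the form.\<close>
  define g where "g w = (\<chi> i. if i = j then w $ i else w $ i / (of_nat D * z $ i ^ (D - 1)))" for w :: "complex^'l"
  have "frechet_derivative ?f (at z) (g w) = w" for w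
    using z(1) D by (simp add: vec_eq_iff frechet_power_off g_def torus_def)
  then have "map (frechet_derivative ?f (at z)) (map g vs) = vs" by (simp add: comp_def)
  then show ?case using zero[of "map g vs"] z(2) by (simp add: pullback_def)
qed

section \<open>Algebraic forms and the graded isomorphism\<close>

section \<open>Algebraic forms\<close>

lemma dlog_eq: "dlog M f = restrict_form M (log_deriv f)"
proof -
  have "function_form f = (\<lambda>p. const0 (f p))" by (rule ext) (rule function_form_eq)
  then have "ambient_deriv (function_form f) p vs / f p = log_deriv f p vs" for p vs
    by (simp add: ambient_deriv_const0 log_deriv_def one_form_def)
  then show ?thesis by (simp add: dlog_def)
qed

lemma xi_eq: "xi \<A> i = restrict_form (complement \<A>) (xi0 i)"
  by (simp add: xi_def xi0_def dlog_eq)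

lemma psi_eq: "psi \<A> K = restrict_form (complement \<A>) (psi0 K)"
  by (simp add: psi_def psi0_def dlog_eq split: prod.splits)

lemma coordinate_ring_prod:
  assumes "\<And>i. i \<in> I \<Longrightarrow> f i \<in> coordinate_ring \<A>"
  shows "(\<lambda>z. \<Prod>i\<in>I. f i z) \<in> coordinate_ring \<A>"
  using assms
proof (induction I rule: infinite_finite_induct)
  case (insert i I)
  then have "(\<lambda>z. f i z * (\<Prod>i\<in>I. f i z)) \<in> coordinate_ring \<A>" by (intro coordinate_ring.mult) auto
  then show ?case using insert by simp
qed (simp_all add: coordinate_ring.const)

lemma coordinate_ring_power: "f \<in> coordinate_ring \<A> \<Longrightarrow> (\<lambda>z. f z ^ n) \<in> coordinate_ring \<A>"
  using coordinate_ring_prod[of "{..<n}" "\<lambda>_. f"] by simp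

lemma coordinate_ring_character: "character n \<in> coordinate_ring \<A>"
  unfolding character_def[abs_def]
proof (rule coordinate_ring_prod)
  fix i
  have "(\<lambda>z. z $ i ^ k) \<in> coordinate_ring \<A>" "(\<lambda>z. inverse (z $ i) ^ k) \<in> coordinate_ring \<A>" for k
    by (intro coordinate_ring_power coordinate_ring.coord coordinate_ring.coord_inverse)+
  then show "(\<lambda>z. z $ i powi n $ i) \<in> coordinate_ring \<A>"
    by (cases "n $ i \<ge> 0") (simp_all add: power_int_def)
qed

lemma length_nths_compl: "length (nths vs I) + length (nths vs (- I)) = length vs"
proof -
  have "{i. i < length vs} = {i. i < length vs \<and> i \<in> I} \<union> {i. i < length vs \<and> i \<in> - I}" by auto
  then have "length vs = card ({i. i < length vs \<and> i \<in> I} \<union> {i. i < length vs \<and> i \<in> - I})"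
    by (metis card_Collect_less_nat)
  also have "\<dots> = card {i. i < length vs \<and> i \<in> I} + card {i. i < length vs \<and> i \<in> - I}"
    by (rule card_Un_disjoint) auto
  finally show ?thesis by (simp add: length_nths)
qed

text \<open>In degree \<open>k\<close> each shuffle contributes to exactly one summand, the one
  indexed by the number of vectors fed to \<open>x\<close>.\<close>

lemma component_wedge: "component k (wedge x y) = (\<lambda>p vs. \<Sum>i\<le>k. wedge (component i x) (component (k - i) y) p vs)"
proof (intro ext)
  fix p vs
  have split: "(\<Sum>i\<le>k. component i x p (nths vs I) * component (k - i) y p (nths vs (- I)))
     = (if length vs = k then x p (nths vs I) * y p (nths vs (- I)) else 0)" for I
  proof -
    note len = length_nths_compl[of vs I]
    have "(\<Sum>i\<le>k. component i x p (nths vs I) * component (k - i) y p (nths vs (- I)))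
       = (\<Sum>i\<le>k. if i = length (nths vs I) then (if length vs = k then x p (nths vs I) * y p (nths vs (- I)) else 0) else 0)"
      by (rule sum.cong) (use len in \<open>auto simp: component_def\<close>)
    also have "\<dots> = (if length vs = k then x p (nths vs I) * y p (nths vs (- I)) else 0)"
      using len by auto
    finally show ?thesis .
  qed
  let ?sg = "\<lambda>I. (-1) ^ card {(i, j). i \<in> I \<and> j \<in> {..<length vs} - I \<and> j < i} :: complex"
  have "(\<Sum>i\<le>k. wedge (component i x) (component (k - i) y) p vs)
     = (\<Sum>I\<in>Pow {..<length vs}. ?sg I * (\<Sum>i\<le>k. component i x p (nths vs I) * component (k - i) y p (nths vs (- I))))"
    unfolding wedge_def sum_distrib_left mult.assoc by (rule sum.swap)
  also have "\<dots> = component k (wedge x y) p vs"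
    unfolding split by (simp add: component_def wedge_def mult.assoc)
  finally show "component k (wedge x y) p vs = (\<Sum>i\<le>k. wedge (component i x) (component (k - i) y) p vs)" ..
qed

lemma component_homogeneous: "homogeneous k x \<Longrightarrow> component i x = (if i = k then x else (\<lambda>p vs. 0))"
  by (auto simp: homogeneous_def component_def fun_eq_iff)

locale finite_arrangement =
  fixes \<A> :: "((int^'l) \<times> complex) set"
  assumes finite_arr: "finite \<A>"
begin

abbreviation X :: "(complex^'l) set" where
  "X \<equiv> complement \<A>"

lemma open_X: "open X"
  by (rule open_complement[OF finite_arr])

sublocale open_set X
  by unfold_locales (rule open_X)

lemma restrict_X: "restrict_form X \<omega> = (\<lambda>p vs. if p \<in> X then \<omega> p vs else 0)"
  by (rule restrict_form_open[OF open_X])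

definition monomial_form :: "'l list \<Rightarrow> (complex^'l) form" where
  "monomial_form s = foldr wedge (map (xi \<A>) s) unit_form"

lemma xi_off: "p \<notin> X \<Longrightarrow> xi \<A> i p = (\<lambda>vs. 0)"
  by (simp add: xi_eq restrict_X)

lemma unit_wedge:
  assumes "\<And>p. p \<notin> X \<Longrightarrow> x p = (\<lambda>vs. 0)"
  shows "wedge unit_form x = x" "wedge x unit_form = x"
  unfolding wedge_fun unit_form_at
  by (intro ext; use assms in \<open>simp add: wdg_const_left wdg_const_right wdg_zero_left wdg_zero_right\<close>)+

lemma monomial_form_off: "p \<notin> X \<Longrightarrow> monomial_form s p = (\<lambda>vs. 0)"
  by (cases s) (auto simp: monomial_form_def unit_form_at wedge_fun xi_off wdg_zero_left)

lemma monomial_form_append: "wedge (monomial_form s) (monomial_form t) = monomial_form (s @ t)"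
proof (induction s)
  case Nil
  show ?case using unit_wedge(1)[of "monomial_form t"] monomial_form_off by (simp add: monomial_form_def)
next
  case (Cons i s)
  have "wedge (monomial_form (i # s)) (monomial_form t) = wedge (xi \<A> i) (wedge (monomial_form s) (monomial_form t))"
    by (simp add: monomial_form_def wedge_fun fun_eq_iff wdg_assoc)
  then show ?case by (simp add: Cons) (simp add: monomial_form_def)
qed

lemma homogeneous_xi: "homogeneous 1 (xi \<A> i)"
  by (simp add: homogeneous_def xi_eq restrict_X xi0_def log_deriv_def one_form_def)

lemma homogeneous_psi: "homogeneous 1 (psi \<A> K)"
  by (simp add: homogeneous_def psi_eq restrict_X psi0_def log_deriv_def one_form_def)

lemma homogeneous_unit: "homogeneous 0 unit_form"
  by (auto simp: homogeneous_def unit_form_at const0_def)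

lemma homogeneous_monomial: "homogeneous (length s) (monomial_form s)"
proof (induction s)
  case Nil
  show ?case using homogeneous_unit by (simp add: monomial_form_def)
next
  case (Cons i s)
  show ?case
    unfolding homogeneous_def
  proof (intro allI impI)
    fix p and vs :: "(complex^'l) list" assume "length vs \<noteq> length (i # s)"
    then have "wdg (xi \<A> i p) (monomial_form s p) vs = 0"
      using homogeneous_xi[of i] Cons by (intro wdg_homogeneous[of 1 _ "length s"]) (auto simp: homogeneous_def)
    then show "monomial_form (i # s) p vs = 0" by (simp add: monomial_form_def wedge_fun)
  qed
qed

lemma algebraic_forms_eq:
  "algebraic_forms \<A> k = {\<lambda>z vs. \<Sum>s | length s = k. f s z * monomial_form s z vs | f. \<forall>s. f s \<in> coordinate_ring \<A>}"
  unfolding algebraic_forms_def monomial_form_def unit_form_def ..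

lemma algebraic_formsI:
  "(\<And>s. f s \<in> coordinate_ring \<A>) \<Longrightarrow> (\<lambda>z vs. \<Sum>s | length s = k. f s z * monomial_form s z vs) \<in> algebraic_forms \<A> k"
  unfolding algebraic_forms_eq by blast

lemma algebraic_formsE:
  assumes "x \<in> algebraic_forms \<A> k"
  obtains f where "\<And>s. f s \<in> coordinate_ring \<A>" "x = (\<lambda>z vs. \<Sum>s | length s = k. f s z * monomial_form s z vs)"
  using assms unfolding algebraic_forms_eq by blast

lemma finite_lists: "finite {s :: 'l list. length s = k}"
  using finite_lists_length_eq[of "UNIV :: 'l set" k] by simp

lemma algebraic_forms_homogeneous:
  assumes "x \<in> algebraic_forms \<A> k"
  shows "homogeneous k x"
proof -
  obtain f where "x = (\<lambda>z vs. \<Sum>s | length s = k. f s z * monomial_form s z vs)" using algebraic_formsE[OF assms] by blast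
  then show ?thesis using homogeneous_monomial by (auto simp: homogeneous_def intro!: sum.neutral)
qed

lemma algebraic_forms_add:
  assumes "x \<in> algebraic_forms \<A> k" "y \<in> algebraic_forms \<A> k"
  shows "(\<lambda>z vs. x z vs + y z vs) \<in> algebraic_forms \<A> k"
proof -
  obtain f where f: "\<And>s. f s \<in> coordinate_ring \<A>" "x = (\<lambda>z vs. \<Sum>s | length s = k. f s z * monomial_form s z vs)"
    using algebraic_formsE[OF assms(1)] by blast
  obtain g where g: "\<And>s. g s \<in> coordinate_ring \<A>" "y = (\<lambda>z vs. \<Sum>s | length s = k. g s z * monomial_form s z vs)"
    using algebraic_formsE[OF assms(2)] by blast
  have "(\<lambda>z vs. \<Sum>s | length s = k. (f s z + g s z) * monomial_form s z vs) \<in> algebraic_forms \<A> k"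
    by (rule algebraic_formsI) (intro coordinate_ring.add f g)
  then show ?thesis by (simp add: f(2) g(2) sum.distrib distrib_right)
qed

lemma algebraic_forms_fmult:
  assumes "x \<in> algebraic_forms \<A> k" "h \<in> coordinate_ring \<A>"
  shows "(\<lambda>z vs. h z * x z vs) \<in> algebraic_forms \<A> k"
proof -
  obtain f where f: "\<And>s. f s \<in> coordinate_ring \<A>" "x = (\<lambda>z vs. \<Sum>s | length s = k. f s z * monomial_form s z vs)"
    using algebraic_formsE[OF assms(1)] by blast
  have "(\<lambda>z vs. \<Sum>s | length s = k. (h z * f s z) * monomial_form s z vs) \<in> algebraic_forms \<A> k"
    by (rule algebraic_formsI) (intro coordinate_ring.mult f assms(2))
  then show ?thesis by (simp add: f(2) sum_distrib_left mult.assoc)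
qed

lemma algebraic_forms_zero: "(\<lambda>z vs. 0) \<in> algebraic_forms \<A> k"
  using algebraic_formsI[OF coordinate_ring.const[of 0], of k] by simp

lemma algebraic_forms_sum:
  assumes "finite I" "\<And>i. i \<in> I \<Longrightarrow> x i \<in> algebraic_forms \<A> k"
  shows "(\<lambda>z vs. \<Sum>i\<in>I. x i z vs) \<in> algebraic_forms \<A> k"
  using assms
proof induction
  case empty
  show ?case using algebraic_forms_zero by simp
next
  case (insert i I)
  have "(\<lambda>z vs. x i z vs + (\<Sum>i\<in>I. x i z vs)) \<in> algebraic_forms \<A> k" using insert by (intro algebraic_forms_add) auto
  then show ?case using insert by simp
qed

lemma algebraic_forms_monomial: "monomial_form s \<in> algebraic_forms \<A> (length s)"
proof -
  have "(\<lambda>z vs. \<Sum>t | length t = length s. (if t = s then 1 else 0) * monomial_form t z vs) \<in> algebraic_forms \<A> (length s)"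
    by (rule algebraic_formsI) (rule coordinate_ring.const)
  moreover have "(\<Sum>t | length t = length s. (if t = s then 1 else 0) * monomial_form t z vs) = monomial_form s z vs" for z vs
  proof -
    have "(\<Sum>t | length t = length s. (if t = s then 1 else 0) * monomial_form t z vs)
       = (\<Sum>t | length t = length s. if t = s then monomial_form t z vs else 0)" by (intro sum.cong) auto
    then show ?thesis using finite_lists[of "length s"] by simp
  qed
  ultimately show ?thesis by simp
qed

lemma algebraic_forms_unit: "unit_form \<in> algebraic_forms \<A> 0"
  using algebraic_forms_monomial[of "[]"] by (simp add: monomial_form_def)

lemma algebraic_forms_xi: "xi \<A> i \<in> algebraic_forms \<A> 1"
  using algebraic_forms_monomial[of "[i]"] unit_wedge(2)[of "xi \<A> i"] by (simp add: monomial_form_def xi_off)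

text \<open>The inverse of a single factor \<chi> - c is not a generator of the coordinate ring; it
  arises from the inverse of the full product by multiplying with the other factors. The form is
  then d\<chi>, expanded in the \<open>xi\<close>, times this function.\<close>

lemma algebraic_forms_psi:
  assumes K: "K \<in> \<A>"
  shows "psi \<A> K \<in> algebraic_forms \<A> 1"
proof -
  let ?n = "fst K" and ?g = "\<lambda>K z. character (fst K) z - snd K"
  define h where "h z = (1 / (\<Prod>(n, c)\<in>\<A>. character n z - c)) * (\<Prod>K\<in>\<A> - {K}. ?g K z)" for z
  have "(\<lambda>z. ?g K z) \<in> coordinate_ring \<A>" for K
    using coordinate_ring.add[OF coordinate_ring_character coordinate_ring.const[of "- snd K"], of "fst K"] by simp
  then have "h \<in> coordinate_ring \<A>"
    unfolding h_def by (intro coordinate_ring.mult coordinate_ring.localise coordinate_ring_prod)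
  then have "(\<lambda>z vs. \<Sum>i\<in>UNIV. (of_int (?n $ i) * (character ?n z * h z)) * xi \<A> i z vs) \<in> algebraic_forms \<A> 1"
    by (intro algebraic_forms_sum algebraic_forms_fmult algebraic_forms_xi coordinate_ring.mult coordinate_ring.const coordinate_ring_character) simp_all
  also have "(\<lambda>z vs. \<Sum>i\<in>UNIV. (of_int (?n $ i) * (character ?n z * h z)) * xi \<A> i z vs) = psi \<A> K"
  proof (intro ext)
    fix z vs
    show "(\<Sum>i\<in>UNIV. (of_int (?n $ i) * (character ?n z * h z)) * xi \<A> i z vs) = psi \<A> K z vs"
    proof (cases "z \<in> X")
      case False
      then show ?thesis by (simp add: xi_eq psi_eq restrict_X)
    next
      case True
      then have zT: "z \<in> torus" and nz: "\<And>K. K \<in> \<A> \<Longrightarrow> ?g K z \<noteq> 0"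
        by (auto simp: complement_iff simp del: split_paired_All)
      have "(\<Prod>(n, c)\<in>\<A>. character n z - c) = (\<Prod>K\<in>\<A>. ?g K z)" by (simp add: case_prod_beta)
      also have "\<dots> = ?g K z * (\<Prod>K\<in>\<A> - {K}. ?g K z)" by (rule prod.remove[OF finite_arr K])
      finally have prod: "(\<Prod>(n, c)\<in>\<A>. character n z - c) = ?g K z * (\<Prod>K\<in>\<A> - {K}. ?g K z)" .
      have "(\<Prod>K\<in>\<A> - {K}. ?g K z) \<noteq> 0"
        using nz finite_arr by (simp add: prod_zero_iff del: split_paired_All)
      then have hz: "h z = 1 / ?g K z"
        unfolding h_def prod by simp
      show ?thesis
        using True by (cases "length vs = 1")
          (simp_all add: xi_eq psi_eq restrict_X xi0_eq psi0_eq[OF zT] one_form_def hz sum_distrib_left sum_divide_distrib mult_ac)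
    qed
  qed
  finally show ?thesis .
qed

text \<open>A word of length \<open>k + m\<close> splits uniquely into words of lengths
  \<open>k\<close> and \<open>m\<close>; as all words are allowed as indices, products are
  concatenations without reordering or signs.\<close>

lemma algebraic_forms_wedge:
  assumes "x \<in> algebraic_forms \<A> k" "y \<in> algebraic_forms \<A> m"
  shows "wedge x y \<in> algebraic_forms \<A> (k + m)"
proof -
  obtain f where f: "\<And>s. f s \<in> coordinate_ring \<A>" "x = (\<lambda>z vs. \<Sum>s | length s = k. f s z * monomial_form s z vs)"
    using algebraic_formsE[OF assms(1)] by blast
  obtain g where g: "\<And>s. g s \<in> coordinate_ring \<A>" "y = (\<lambda>z vs. \<Sum>s | length s = m. g s z * monomial_form s z vs)"
    using algebraic_formsE[OF assms(2)] by blast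
  have "wedge x y = (\<lambda>z vs. \<Sum>u | length u = k + m. (f (take k u) z * g (drop k u) z) * monomial_form u z vs)"
  proof (intro ext)
    fix z vs
    have "wedge x y z vs = (\<Sum>s | length s = k. \<Sum>t | length t = m. f s z * (g t z * wdg (monomial_form s z) (monomial_form t z) vs))"
      unfolding wedge_fun f(2) g(2) wdg_sum_left wdg_cmult_left wdg_sum_right wdg_cmult_right sum_distrib_left ..
    also have "\<dots> = (\<Sum>s | length s = k. \<Sum>t | length t = m. (f s z * g t z) * monomial_form (s @ t) z vs)"
      by (simp add: monomial_form_append[symmetric] wedge_fun mult.assoc)
    also have "\<dots> = (\<Sum>(s, t)\<in>{s. length s = k} \<times> {t. length t = m}. (f s z * g t z) * monomial_form (s @ t) z vs)"
      by (rule sum.cartesian_product)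
    also have "\<dots> = (\<Sum>u | length u = k + m. (f (take k u) z * g (drop k u) z) * monomial_form u z vs)"
      by (rule sum.reindex_bij_witness[of _ "\<lambda>u. (take k u, drop k u)" "\<lambda>(s, t). s @ t"]) auto
    finally show "wedge x y z vs = (\<Sum>u | length u = k + m. (f (take k u) z * g (drop k u) z) * monomial_form u z vs)" .
  qed
  then show ?thesis by (simp only:) (intro algebraic_formsI coordinate_ring.mult f(1) g(1))
qed

section \<open>The isomorphism\<close>

definition R :: "(complex^'l) form set" where
  "R = generated_subalgebra (algebraic_deRham_complex \<A>) (range (xi \<A>) \<union> psi \<A> ` \<A>)"

lemma complex_simps:
  "one (algebraic_deRham_complex \<A>) = unit_form"
  "mult (algebraic_deRham_complex \<A>) = wedge"
  "add (algebraic_deRham_complex \<A>) = (\<lambda>\<alpha> \<beta> p vs. \<alpha> p vs + \<beta> p vs)"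
  "smult (algebraic_deRham_complex \<A>) = (\<lambda>c \<alpha> p vs. c * \<alpha> p vs)"
  "homog (algebraic_deRham_complex \<A>) = algebraic_forms \<A>"
  by (simp_all add: algebraic_deRham_complex_def form_algebra_def unit_form_def)

lemmas R_intros = generated_subalgebra.intros[where R = "algebraic_deRham_complex \<A>"
    and G = "range (xi \<A>) \<union> psi \<A> ` \<A>", folded R_def, unfolded complex_simps]

lemma R_zero: "(\<lambda>p vs. 0) \<in> R"
  using R_intros(5)[OF R_intros(1), of 0] by simp

lemma R_sum:
  assumes "finite I" "\<And>i. i \<in> I \<Longrightarrow> x i \<in> R"
  shows "(\<lambda>p vs. \<Sum>i\<in>I. x i p vs) \<in> R"
  using assms
proof induction
  case empty
  show ?case using R_zero by simp
next
  case (insert i I)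
  have "(\<lambda>p vs. x i p vs + (\<Sum>i\<in>I. x i p vs)) \<in> R" using insert by (intro R_intros(3)) auto
  then show ?case using insert by simp
qed

text \<open>The generators are homogeneous algebraic forms, so the subalgebra contains the
  components of its elements. This makes intersection with the algebraic forms of each degree a
  genuine grading of \<open>R\<close>.\<close>

lemma R_component:
  assumes "x \<in> R"
  shows "component k x \<in> R \<inter> algebraic_forms \<A> k"
  using assms[unfolded R_def]
proof (induction arbitrary: k rule: generated_subalgebra.induct)
  case one
  show ?case
    unfolding complex_simps component_homogeneous[OF homogeneous_unit]
    using R_intros(1) algebraic_forms_unit R_zero algebraic_forms_zero by simp
next
  case (gen x)
  then have "homogeneous 1 x" "x \<in> algebraic_forms \<A> 1"
    using homogeneous_xi homogeneous_psi algebraic_forms_xi algebraic_forms_psi by auto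
  then show ?case
    using R_intros(2)[OF gen] R_zero algebraic_forms_zero by (simp add: component_homogeneous)
next
  case (add x y)
  have "component k (\<lambda>p vs. x p vs + y p vs) = (\<lambda>p vs. component k x p vs + component k y p vs)"
    by (auto simp: component_def fun_eq_iff)
  then show ?case using R_intros(3) algebraic_forms_add add.IH[of k] by (simp add: complex_simps)
next
  case (mult x y)
  have "wedge (component i x) (component (k - i) y) \<in> R \<inter> algebraic_forms \<A> k" if "i \<le> k" for i
    using R_intros(4) algebraic_forms_wedge[of _ i _ "k - i"] mult.IH(1)[of i] mult.IH(2)[of "k - i"] that by simp
  then show ?case
    unfolding complex_simps component_wedge
    using R_sum[of "{..k}"] algebraic_forms_sum[of "{..k}"] by simp
next
  case (smult x c)
  have "component k (\<lambda>p vs. c * x p vs) = (\<lambda>p vs. c * component k x p vs)"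
    by (auto simp: component_def fun_eq_iff)
  then show ?case
    using R_intros(5) algebraic_forms_fmult[OF _ coordinate_ring.const] smult.IH[of k] by (simp add: complex_simps)
qed

text \<open>Bridge between the forms cut off outside the complement, as in the statement, and the
  uncut ones of the preceding arguments: cutting off is compatible with all algebra
  operations.\<close>

lemma R_eq: "R = restrict_form X ` log_forms \<A>"
proof
  show "R \<subseteq> restrict_form X ` log_forms \<A>"
  proof
    fix x assume "x \<in> R"
    then show "x \<in> restrict_form X ` log_forms \<A>"
      unfolding R_def log_forms_def
    proof (induction rule: generated_subalgebra.induct)
      case one
      show ?case
        unfolding complex_simps
        by (rule image_eqI[OF _ form_span_algebra.one]) (auto simp: fun_eq_iff unit_form_at restrict_X)
    next
      case (gen x)
      then show ?case by (auto simp: xi_eq psi_eq intro!: imageI form_span_algebra.gen)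
    next
      case (add x y)
      then obtain a b where "a \<in> form_span_algebra (range xi0 \<union> psi0 ` \<A>)" "b \<in> form_span_algebra (range xi0 \<union> psi0 ` \<A>)"
        "x = restrict_form X a" "y = restrict_form X b" by blast
      then show ?case
        unfolding complex_simps
        by (intro image_eqI[OF _ form_span_algebra.add[of a _ b]]) (auto simp: fun_eq_iff restrict_X)
    next
      case (mult x y)
      then obtain a b where "a \<in> form_span_algebra (range xi0 \<union> psi0 ` \<A>)" "b \<in> form_span_algebra (range xi0 \<union> psi0 ` \<A>)"
        "x = restrict_form X a" "y = restrict_form X b" by blast
      then show ?case
        unfolding complex_simps
        by (intro image_eqI[OF _ form_span_algebra.mult[of a _ b]] ext) (simp_all add: restrict_X wedge_fun wdg_zero_left)
    next
      case (smult x c)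
      then obtain a where "a \<in> form_span_algebra (range xi0 \<union> psi0 ` \<A>)" "x = restrict_form X a" by blast
      then show ?case
        unfolding complex_simps
        by (intro image_eqI[OF _ form_span_algebra.smult[of a _ c]]) (auto simp: fun_eq_iff restrict_X)
    qed
  qed
  have "restrict_form X x \<in> R" if "x \<in> log_forms \<A>" for x
    using that unfolding log_forms_def
  proof induction
    case one
    have "restrict_form X (\<lambda>p. const0 1) = unit_form" by (auto simp: fun_eq_iff unit_form_at restrict_X)
    then show ?case using R_intros(1) by simp
  next
    case (gen x)
    then show ?case by (auto simp: xi_eq[symmetric] psi_eq[symmetric] intro!: R_intros(2))
  next
    case (add x y)
    have "restrict_form X (\<lambda>p vs. x p vs + y p vs) = (\<lambda>p vs. restrict_form X x p vs + restrict_form X y p vs)"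
      by (auto simp: fun_eq_iff restrict_X)
    then show ?case using R_intros(3)[OF add.IH] by simp
  next
    case (mult x y)
    have "restrict_form X (\<lambda>p. wdg (x p) (y p)) = wedge (restrict_form X x) (restrict_form X y)"
      by (auto simp: fun_eq_iff restrict_X wedge_fun wdg_zero_left)
    then show ?case using R_intros(4)[OF mult.IH] by simp
  next
    case (smult x c)
    have "restrict_form X (\<lambda>p vs. c * x p vs) = (\<lambda>p vs. c * restrict_form X x p vs)"
      by (auto simp: fun_eq_iff restrict_X)
    then show ?case using R_intros(5)[OF smult.IH] by simp
  qed
  then show "restrict_form X ` log_forms \<A> \<subseteq> R" by blast
qed

lemma R_closed: "R \<subseteq> closed_forms X"
proof
  fix x assume "x \<in> R"
  then obtain \<rho> where \<rho>: "\<rho> \<in> log_forms \<A>" "x = restrict_form X \<rho>" unfolding R_eq by blast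
  have "closed_on X x"
    by (rule closed_on_cong[OF open_X _ closed_log_forms[OF finite_arr \<rho>(1)]]) (simp add: \<rho>(2) restrict_X)
  then show "x \<in> closed_forms X" unfolding closed_iff by (simp add: \<rho>(2) restrict_X)
qed

lemma log_form_algebra_simps:
  "carrier (log_form_algebra \<A>) = R" "mult (log_form_algebra \<A>) = wedge"
  "add (log_form_algebra \<A>) = (\<lambda>\<alpha> \<beta> p vs. \<alpha> p vs + \<beta> p vs)"
  "one (log_form_algebra \<A>) = restrict_form X (function_form (\<lambda>_. 1))"
  "smult (log_form_algebra \<A>) = (\<lambda>c \<alpha> p vs. c * \<alpha> p vs)"
  "homog (log_form_algebra \<A>) = (\<lambda>k. R \<inter> algebraic_forms \<A> k)"
  by (simp_all add: log_form_algebra_def R_def Let_def complex_simps unit_form_def)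

lemma log_form_algebra_isomorphic:
  assumes exponents: "\<And>K. K \<in> \<A> \<Longrightarrow> fst K \<noteq> 0 \<and> snd K \<noteq> 0" and surj: "logarithmic_cohomology \<A>"
  shows "graded_algebra_isomorphic (log_form_algebra \<A>) (deRham_cohomology X)"
proof (rule graded_iso_criterion[OF log_form_algebra_simps R_closed R_intros(5) R_intros(3)])
  fix x assume x: "x \<in> R" "cohomologous X x (\<lambda>p vs. 0)"
  then obtain \<rho> where \<rho>: "\<rho> \<in> log_forms \<A>" "x = restrict_form X \<rho>" unfolding R_eq by blast
  have coh: "cohomologous X \<rho> (\<lambda>p vs. 0)"
    by (rule cohomologous_cong[OF _ _ x(2)]) (simp_all add: \<rho>(2) restrict_X)
  have "\<rho> p vs = 0" if "p \<in> X" for p vs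
    by (rule log_form_exact_zero[OF finite_arr _ \<rho>(1)[unfolded log_forms_def] coh that]) (use exponents in simp)
  then show "x = (\<lambda>p vs. 0)" by (auto simp: \<rho>(2) restrict_X fun_eq_iff)
next
  fix \<omega> assume "\<omega> \<in> closed_forms X"
  then have "closed_on X \<omega>" by (simp add: closed_iff)
  then obtain \<rho> where \<rho>: "\<rho> \<in> log_forms \<A>" "cohomologous X \<omega> \<rho>" using surj unfolding logarithmic_cohomology_def by blast
  have "cohomologous X \<omega> (restrict_form X \<rho>)"
    by (rule cohomologous_cong[OF _ _ \<rho>(2)]) (simp_all add: restrict_X)
  then show "\<exists>x\<in>R. cohomologous X \<omega> x" using \<rho>(1) unfolding R_eq by blast
qed (use algebraic_forms_homogeneous R_component in auto)

end

theorem theorem4p7: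
  fixes \<A> :: "((int^'l) \<times> complex) set"
  assumes "toric_arrangement \<A>"
    and "deletion_restriction_type \<A>"
  shows "graded_algebra_isomorphic (log_form_algebra \<A>) (deRham_cohomology (complement \<A>))"
proof -
  interpret finite_arrangement \<A>
    by unfold_locales (use assms(1) in \<open>simp add: toric_arrangement_def\<close>)
  show ?thesis
  proof (rule log_form_algebra_isomorphic)
    fix K assume "K \<in> \<A>"
    then have "primitive (fst K)" "snd K \<noteq> 0" using assms(1) by (auto simp: toric_arrangement_def)
    \<comment> \<open>The greatest common divisor of the zero vector is \<open>0\<close>, so
      primitive exponents are nonzero, as the vanishing argument requires.\<close>
    moreover have "\<not> primitive (0 :: int^'l)" by (simp add: primitive_def)
    ultimately show "fst K \<noteq> 0 \<and> snd K \<noteq> 0" by metis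
  qed (rule logarithmic_cohomology_deletion_restriction[OF assms])
qed

end
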